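(* Assume $$\mathbb E^{\mathbf P^0}\big[e^{2\eta e^{rT}J_T}\big]<+\infty,\qquad \mathbb E^{\mathbf P^0}\Big[e^{4\int_0^T\lambda^0_s\,ds}\Big]<+\infty,\qquad \mathbb E^{\mathbf P^0}\Big[\int_0^T(\lambda^0_t)^2\,dt\Big]<+\infty .$$ Let $(R,\Theta^R,M)\in\mathcal L^{(2)}\times\widehat{\mathcal L}\times\mathcal L^{\perp}$ be a solution to the BSDE under $\mathbf P^0$ $$R_t=\Xi-\int_t^T\int_0^{+\infty}\Theta^R(s,z)\,\widetilde m^0(ds,dz)-\int_t^T\operatorname*{ess\,sup}_{\mathbf u\in\mathcal U}f\big(s,R_{s^-},\Theta^R(s,\cdot),u^{(1)}_s,u^{(2)}_s\big)\,ds+M_T-M_t,\quad t\in[0,T],$$ with terminal condition $\Xi=e^{-\eta Y^{\mathbf 0}_T}=\exp\big(\eta e^{rT}\int_0^T\int_0^{+\infty}e^{-rt}z\,m(dt,dz)\big)$, where $$\begin{aligned}f\big(t,R_{t^-},\Theta^R(t,\cdot),u^{(1)}_t,u^{(2)}_t\big)=&-R_{t^-}\eta e^{r(T-t)}\big(c_1(u^{(1)}_t)+c_2(u^{(2)}_t)\big)+\int_0^{+\infty}\Theta^R(t,z)\lambda^0_tF(dz)\\&-\gamma^{(1)}(u^{(1)}_t)\lambda^0_t\int_0^{+\infty}\Big[(\Theta^R(t,z)+R_{t^-})\big(e^{-\eta e^{r(T-t)}z(1-\gamma^{(2)}(u^{(2)}_t))}-1\big)+\Theta^R(t,z)\Big]F(dz).\end{aligned}$$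 Then $R_t=W^{\mathbf 0}_t$ $\mathbf P^0$-a.s. for each $t\in[0,T]$, and any process $\mathbf u^*=(u^{(1),*},u^{(2),*})\in\mathcal U$ which satisfies, for any $t\in[0,T]$, $$f\big(t,R_{t^-},\Theta^R(t,\cdot),u^{(1),*}_t,u^{(2),*}_t\big)=\operatorname*{ess\,sup}_{\mathbf u\in\mathcal U}f\big(t,R_{t^-},\Theta^R(t,\cdot),u^{(1)}_t,u^{(2)}_t\big)\quad\mathbf P^0\text{-a.s.}$$ is an optimal effort, i.e. attains the infimum in $v=\inf_{\mathbf u\in\mathcal U}\mathbb E^{\mathbf P^{\mathbf u}}[e^{-\eta X^{\mathbf u}_T}]$.
   Context: $T>0$ is fixed and $(\Omega,\mathcal F,\mathbf P^0;\mathbb F)$ is a filtered probability space with $\mathbb F=\{\mathcal F_t\}_{t\in[0,T]}$ satisfying the usual hypotheses (no further structure on $\mathbb F$). $r,\eta,x_0,\zeta_1,\zeta_2>0$ are constants and $U=[0,\zeta_1]\times[0,\zeta_2]$. For $i=1,2$ the cost function $c_i$ is continuous and increasing on $[0,\zeta_i]$ with $c_i(0)=0$. $\gamma^{(1)}:[0,\zeta_1]\to(0,1]$ and $\gamma^{(2)}:[0,\zeta_2]\to[0,1]$ are continuous and non-increasing with $\gamma^{(1)}(0)=\gamma^{(2)}(0)=1$. Losses: $N_t=\sum_{i\ge1}\mathbf 1_{\{T_i\le t\}}$ is the claim counting process with claim times $T_i$; the claim sizes $\{Z_i\}_{i\ge1}$ are i.i.d. with cumulative distribution function $F$ on $(0,+\infty)$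 and $\mathbb E^{\mathbf P^0}[Z^2]<+\infty$ ($Z$ a generic claim size); $J_t=\sum_{i=1}^{N_t}Z_i$ and $m(dt,dz)=\sum_{i\ge1}\delta_{(T_i,Z_i)}(dt,dz)\mathbf 1_{\{T_i<+\infty\}}$ is its jump measure. $\{\lambda^0_t\}$ is a strictly positive $\mathbb F$-predictable process, and under $\mathbf P^0$ the ($\mathbb F$-)dual predictable projection of $m$ is $\nu^0(dt,dz)=\lambda^0_tF(dz)\,dt$; $\widetilde m^0=m-\nu^0$. For a $U$-valued $\mathbb F$-predictable $\mathbf u=(u^{(1)},u^{(2)})$, the process $$L^{\mathbf u}_t=\exp\Big(-\int_0^t(\gamma^{(1)}(u^{(1)}_s)-1)\lambda^0_s\,ds+\int_0^t\int_0^{+\infty}\log(\gamma^{(1)}(u^{(1)}_s))\,m(ds,dz)\Big)$$ is (under the assumed integrability of $\lambda^0$) an $(\mathbb F,\mathbf P^0)$-martingale, and $\mathbf P^{\mathbf u}$ is the probability measure on $\mathcal F_T$ with $d\mathbf P^{\mathbf u}/d\mathbf P^0=L^{\mathbf u}_T$. Put $$Y^{\mathbf u}_t=-\int_0^t\int_0^{+\infty}\gamma^{(2)}(u^{(2)}_s)e^{r(t-s)}z\,m(ds,dz)-\int_0^te^{r(t-s)}\big(c_1(u^{(1)}_s)+c_2(u^{(2)}_s)\big)ds$$ and $X^{\mathbf u}_t=x_0e^{rt}+Y^{\mathbf u}_t$ (the wealth). $\mathcal U$ is the class of admissible efforts: $U$-valued $\mathbb F$-predictable $\mathbf u$ with $\mathbb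 E^{\mathbf P^{\mathbf u}}[e^{-\eta X^{\mathbf u}_T}]<+\infty$. With $\mathbf 0$ the null effort and $\mathcal U(t,\mathbf 0)=\{\bar{\mathbf u}\in\mathcal U:\bar{\mathbf u}_s=\mathbf 0\text{ a.s. for all }s\le t\}$, the Snell envelope associated with the null effort is $$W^{\mathbf 0}_t=\operatorname*{ess\,inf}_{\bar{\mathbf u}\in\mathcal U(t,\mathbf 0)}\mathbb E^{\mathbf P^{\bar{\mathbf u}}}\big[e^{-\eta Y^{\bar{\mathbf u}}_T}\big|\mathcal F_t\big],\quad t\in[0,T].$$ All essential infima/suprema are with respect to $\mathbf P^0$. Spaces: $\mathcal L^{(2)}$ is the set of càdlàg $\mathbb F$-adapted $R$ with $\mathbb E^{\mathbf P^0}[\int_0^T|R_t|^2dt]<+\infty$; $\widehat{\mathcal L}$ is the set of $\mathbb F$-predictable random fields $\Theta=\{\Theta(t,z),\ t\in[0,T],\ z\in[0,+\infty)\}$ with $\mathbb E^{\mathbf P^0}[\int_0^T\int_0^{+\infty}|\Theta(t,z)|^2\lambda^0_tF(dz)dt]<+\infty$; $\mathcal L^{\perp}$ is the set of square-integrable $(\mathbb F,\mathbf P^0)$-martingales $M$ orthogonal to $\widetilde m^0$, i.e. orthogonal to $\int_0^\cdot\int_0^{+\infty}\Theta(s,z)\widetilde m^0(ds,dz)$ for every $\Theta\in\widehat{\mathcal L}$. *)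

theory Defs
  imports "HOL-Probability.Probability"
begin

section \<open>Stochastic processes on a finite horizon\<close>

text \<open>A filtration is a library filtration indexed by all reals; only its members with index in
  \<open>[0,T]\<close> are ever referred to.\<close>

definition usual_hypotheses :: "'a measure \<Rightarrow> (real \<Rightarrow> 'a measure) \<Rightarrow> real \<Rightarrow> bool" where
  "usual_hypotheses M F T \<longleftrightarrow>
     complete_measure M \<and> null_sets M \<subseteq> sets (F 0) \<and>
     (\<forall>t\<in>{0..<T}. sets (F t) = (\<Inter>s\<in>{t<..T}. sets (F s)))"

definition predictable_sigma :: "(real \<Rightarrow> 'a measure) \<Rightarrow> real \<Rightarrow> (real \<times> 'a) measure" where
  "predictable_sigma F T =
     sigma ({0..T} \<times> space (F 0))
       ({{0} \<times> A |A. A \<in> sets (F 0)} \<union>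
        {{s<..t} \<times> A |s t A. 0 \<le> s \<and> s \<le> t \<and> t \<le> T \<and> A \<in> sets (F s)})"

definition predictable ::
  "(real \<Rightarrow> 'a measure) \<Rightarrow> real \<Rightarrow> (real \<Rightarrow> 'a \<Rightarrow> 'b::topological_space) \<Rightarrow> bool" where
  "predictable F T X \<longleftrightarrow> (\<lambda>(t, \<omega>). X t \<omega>) \<in> predictable_sigma F T \<rightarrow>\<^sub>M borel"

definition predictable_field ::
  "(real \<Rightarrow> 'a measure) \<Rightarrow> real \<Rightarrow> (real \<Rightarrow> real \<Rightarrow> 'a \<Rightarrow> 'b::topological_space) \<Rightarrow> bool" where
  "predictable_field F T H \<longleftrightarrow>
     (\<lambda>((t, \<omega>), z). H t z \<omega>) \<in> predictable_sigma F T \<Otimes>\<^sub>M restrict_space borel {0..} \<rightarrow>\<^sub>M borel"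

definition adapted :: "(real \<Rightarrow> 'a measure) \<Rightarrow> real \<Rightarrow> (real \<Rightarrow> 'a \<Rightarrow> real) \<Rightarrow> bool" where
  "adapted F T X \<longleftrightarrow> (\<forall>t\<in>{0..T}. X t \<in> borel_measurable (F t))"

definition cadlag :: "'a measure \<Rightarrow> real \<Rightarrow> (real \<Rightarrow> 'a \<Rightarrow> real) \<Rightarrow> bool" where
  "cadlag M T X \<longleftrightarrow> (\<forall>\<omega>\<in>space M.
     (\<forall>t\<in>{0..<T}. ((\<lambda>s. X s \<omega>) \<longlongrightarrow> X t \<omega>) (at_right t)) \<and>
     (\<forall>t\<in>{0<..T}. \<exists>l. ((\<lambda>s. X s \<omega>) \<longlongrightarrow> l) (at_left t)))"

text \<open>Convention \<open>X\<^sub>0\<^sub>- = X\<^sub>0\<close>.\<close>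

definition left_limit :: "(real \<Rightarrow> 'a \<Rightarrow> real) \<Rightarrow> real \<Rightarrow> 'a \<Rightarrow> real" where
  "left_limit X t \<omega> = (if t \<le> 0 then X 0 \<omega> else Lim (at_left t) (\<lambda>s. X s \<omega>))"

definition martingale ::
  "'a measure \<Rightarrow> (real \<Rightarrow> 'a measure) \<Rightarrow> real \<Rightarrow> (real \<Rightarrow> 'a \<Rightarrow> real) \<Rightarrow> bool" where
  "martingale M F T X \<longleftrightarrow>
     adapted F T X \<and> (\<forall>t\<in>{0..T}. integrable M (X t)) \<and>
     (\<forall>s t. 0 \<le> s \<longrightarrow> s \<le> t \<longrightarrow> t \<le> T \<longrightarrow>
        (AE \<omega> in M. real_cond_exp M (F s) (X t) \<omega> = X s \<omega>))"

text \<open>A random measure \<open>\<nu>\<close> on \<open>(0,T] \<times> (0,\<infinity>)\<close> is the dual predictable projection of \<open>\<mu>\<close> if it is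
  predictable and agrees with \<open>\<mu>\<close> in mean on all nonnegative predictable random fields.\<close>

definition dual_predictable_projection ::
  "'a measure \<Rightarrow> (real \<Rightarrow> 'a measure) \<Rightarrow> real \<Rightarrow>
   ('a \<Rightarrow> (real \<times> real) measure) \<Rightarrow> ('a \<Rightarrow> (real \<times> real) measure) \<Rightarrow> bool" where
  "dual_predictable_projection M F T \<mu> \<nu> \<longleftrightarrow>
     (\<forall>H :: real \<Rightarrow> real \<Rightarrow> 'a \<Rightarrow> ennreal. predictable_field F T H \<longrightarrow>
        predictable F T (\<lambda>t \<omega>. \<integral>\<^sup>+p\<in>{0<..t} \<times> {0<..}. H (fst p) (snd p) \<omega> \<partial>\<nu> \<omega>) \<and>
        (\<integral>\<^sup>+\<omega>. (\<integral>\<^sup>+p\<in>{0<..T} \<times> {0<..}. H (fst p) (snd p) \<omega> \<partial>\<mu> \<omega>) \<partial>M) =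
        (\<integral>\<^sup>+\<omega>. (\<integral>\<^sup>+p\<in>{0<..T} \<times> {0<..}. H (fst p) (snd p) \<omega> \<partial>\<nu> \<omega>) \<partial>M))"

section \<open>Essential supremum and infimum of a family of random variables\<close>

text \<open>The library's \<open>esssup\<close> is the number attached to one function. Here the essential supremum of
  a family is a random variable, the least almost sure upper bound. On a probability space it
  exists and is unique up to almost sure equality (proved below); \<open>ess_Sup\<close> and \<open>ess_Inf\<close>
  pick a version, so they are only meaningful inside almost sure statements.\<close>

definition is_ess_Sup :: "'a measure \<Rightarrow> ('a \<Rightarrow> ereal) set \<Rightarrow> ('a \<Rightarrow> ereal) \<Rightarrow> bool" where
  "is_ess_Sup M S g \<longleftrightarrow>
     g \<in> borel_measurable M \<and> (\<forall>X\<in>S. AE \<omega> in M. X \<omega> \<le> g \<omega>) \<and>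
     (\<forall>h\<in>borel_measurable M. (\<forall>X\<in>S. AE \<omega> in M. X \<omega> \<le> h \<omega>) \<longrightarrow> (AE \<omega> in M. g \<omega> \<le> h \<omega>))"

definition ess_Sup :: "'a measure \<Rightarrow> ('a \<Rightarrow> ereal) set \<Rightarrow> 'a \<Rightarrow> ereal" where
  "ess_Sup M S = (SOME g. is_ess_Sup M S g)"

definition is_ess_Inf :: "'a measure \<Rightarrow> ('a \<Rightarrow> ereal) set \<Rightarrow> ('a \<Rightarrow> ereal) \<Rightarrow> bool" where
  "is_ess_Inf M S g \<longleftrightarrow>
     g \<in> borel_measurable M \<and> (\<forall>X\<in>S. AE \<omega> in M. g \<omega> \<le> X \<omega>) \<and>
     (\<forall>h\<in>borel_measurable M. (\<forall>X\<in>S. AE \<omega> in M. h \<omega> \<le> X \<omega>) \<longrightarrow> (AE \<omega> in M. h \<omega> \<le> g \<omega>))"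

definition ess_Inf :: "'a measure \<Rightarrow> ('a \<Rightarrow> ereal) set \<Rightarrow> 'a \<Rightarrow> ereal" where
  "ess_Inf M S = (SOME g. is_ess_Inf M S g)"

lemma is_ess_Sup_ex:
  fixes M :: "'a measure" and S :: "('a \<Rightarrow> ereal) set"
  assumes "finite_measure M" and S: "S \<subseteq> borel_measurable M"
  shows "\<exists>g. is_ess_Sup M S g"
proof -
  interpret finite_measure M by fact
  define \<phi> :: "ereal \<Rightarrow> real" where
    "\<phi> x = (if x = \<infinity> then 2 else if x = -\<infinity> then -2 else arctan (real_of_ereal x))" for x
  have at: "\<bar>arctan x\<bar> < 2" for x
    using arctan_bounded[of x] pi_less_4 by auto
  have \<phi>_mono: "\<phi> x < \<phi> y" if "x < y" for x y
    using that at by (cases x; cases y) (auto simp: \<phi>_def arctan_less_iff abs_less_iff minus_less_iff)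
  have \<phi>_bd: "norm (\<phi> x) \<le> 2" for x using at[of "real_of_ereal x"] by (auto simp: \<phi>_def)
  have \<phi>_meas[measurable]: "\<phi> \<in> borel_measurable borel"
    unfolding \<phi>_def by measurable
  define I where "I C = (\<integral>\<omega>. \<phi> (SUP X\<in>C. X \<omega>) \<partial>M)" for C :: "('a \<Rightarrow> ereal) set"
  have Cm: "(\<lambda>\<omega>. SUP X\<in>C. X \<omega>) \<in> borel_measurable M" if "countable C" "C \<subseteq> S" for C
    using that S by (intro borel_measurable_SUP) auto
  have int: "integrable M (\<lambda>\<omega>. \<phi> (SUP X\<in>C. X \<omega>))" if "countable C" "C \<subseteq> S" for C
    using Cm[OF that] \<phi>_bd by (intro integrable_const_bound[where B=2]) auto
  have I_mono: "I C \<le> I C'" if "C \<subseteq> C'" "countable C'" "C' \<subseteq> S" for C C'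
    unfolding I_def
  proof (rule integral_mono)
    show "\<phi> (SUP X\<in>C. X \<omega>) \<le> \<phi> (SUP X\<in>C'. X \<omega>)" for \<omega>
      using SUP_subset_mono[OF that(1), of "\<lambda>X. X \<omega>" "\<lambda>X. X \<omega>"] \<phi>_mono
      by (metis less_eq_real_def order_le_less order_refl)
  qed (use that in \<open>blast intro: int countable_subset\<close>)+
  define K where "K = {C. countable C \<and> C \<subseteq> S}"
  have bdd: "bdd_above (I ` K)"
  proof (rule bdd_aboveI2)
    fix C assume "C \<in> K"
    then have "I C \<le> (\<integral>\<omega>. 2 \<partial>M)"
      unfolding I_def K_def using \<phi>_bd by (intro integral_mono int) (auto simp: abs_le_iff)
    then show "I C \<le> 2 * measure M (space M)" by simp
  qed
  have ne: "K \<noteq> {}" by (auto simp: K_def)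
  have "\<exists>C\<in>K. (SUP C\<in>K. I C) - 1 / Suc n < I C" for n
    using less_cSUP_iff[OF ne bdd, of "(SUP C\<in>K. I C) - 1 / Suc n"] by auto
  then obtain c where c: "\<And>n. c n \<in> K" "\<And>n. (SUP C\<in>K. I C) - 1 / Suc n < I (c n)" by metis
  define C where "C = (\<Union>n. c n)"
  have C: "countable C" "C \<subseteq> S" using c(1) by (auto simp: C_def K_def)
  have CI: "(SUP C\<in>K. I C) - 1 / Suc n < I C" for n
    using c(2)[of n] I_mono[of "c n" C] C by (force simp: C_def)
  have top: "(SUP C\<in>K. I C) \<le> I C"
  proof (rule ccontr)
    assume "\<not> ?thesis"
    then obtain n where "1 / Suc n < (SUP C\<in>K. I C) - I C"
      using nat_approx_posE[of "(SUP C\<in>K. I C) - I C"] by auto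
    with CI[of n] show False by simp
  qed
  define g where "g \<omega> = (SUP X\<in>C. X \<omega>)" for \<omega>
  have ub: "AE \<omega> in M. X \<omega> \<le> g \<omega>" if "X \<in> S" for X
  proof -
    let ?C = "insert X C"
    have C': "countable ?C" "?C \<subseteq> S" using C that by auto
    have "I ?C \<le> (SUP C\<in>K. I C)" by (rule cSUP_upper[OF _ bdd]) (use C' in \<open>auto simp: K_def\<close>)
    with top I_mono[of C ?C] C' have eq: "I ?C = I C" by (simp add: subset_insertI)
    have le: "\<phi> (SUP X\<in>C. X \<omega>) \<le> \<phi> (SUP X\<in>?C. X \<omega>)" for \<omega>
      using SUP_subset_mono[of C ?C "\<lambda>X. X \<omega>" "\<lambda>X. X \<omega>"] \<phi>_mono
      by (metis less_eq_real_def order_le_less order_refl subset_insertI)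
    have "AE \<omega> in M. \<phi> (SUP X\<in>?C. X \<omega>) - \<phi> (SUP X\<in>C. X \<omega>) = 0"
    proof (subst integral_nonneg_eq_0_iff_AE[symmetric])
      show "integrable M (\<lambda>\<omega>. \<phi> (SUP X\<in>?C. X \<omega>) - \<phi> (SUP X\<in>C. X \<omega>))"
        using int[OF C'] int[OF C] by (rule Bochner_Integration.integrable_diff)
      show "(\<integral>\<omega>. \<phi> (SUP X\<in>?C. X \<omega>) - \<phi> (SUP X\<in>C. X \<omega>) \<partial>M) = 0"
        using eq Bochner_Integration.integral_diff[OF int[OF C'] int[OF C]] by (simp add: I_def)
    qed (use le in auto)
    then show ?thesis
    proof eventually_elim
      case (elim \<omega>)
      then have "\<not> (SUP X\<in>C. X \<omega>) < (SUP X\<in>?C. X \<omega>)" using \<phi>_mono by fastforce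
      then have "(SUP X\<in>?C. X \<omega>) \<le> (SUP X\<in>C. X \<omega>)" by (simp only: not_less)
      then show ?case by (simp add: g_def del: max_less_iff_conj)
    qed
  qed
  have "is_ess_Sup M S g"
    unfolding is_ess_Sup_def
  proof (intro conjI ballI impI ub)
    show "g \<in> borel_measurable M" unfolding g_def using Cm[OF C] .
    fix h assume "\<forall>X\<in>S. AE \<omega> in M. X \<omega> \<le> h \<omega>"
    then have "AE \<omega> in M. \<forall>X\<in>C. X \<omega> \<le> h \<omega>"
      using C by (subst AE_ball_countable) auto
    then show "AE \<omega> in M. g \<omega> \<le> h \<omega>"
      by eventually_elim (auto simp: g_def intro: SUP_least)
  qed
  then show ?thesis by blast
qed

lemma is_ess_Sup_uminus:
  fixes M :: "'a measure" and S :: "('a \<Rightarrow> ereal) set"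
  shows "is_ess_Sup M ((\<lambda>X \<omega>. - X \<omega>) ` S) g \<Longrightarrow> is_ess_Inf M S (\<lambda>\<omega>. - g \<omega>)"
  unfolding is_ess_Sup_def is_ess_Inf_def
proof (elim conjE, intro conjI ballI impI)
  fix h :: "'a \<Rightarrow> ereal" assume h: "h \<in> borel_measurable M" "\<forall>X\<in>S. AE \<omega> in M. h \<omega> \<le> X \<omega>"
    and least: "\<forall>h\<in>borel_measurable M. (\<forall>X\<in>(\<lambda>X \<omega>. - X \<omega>) ` S. AE \<omega> in M. X \<omega> \<le> h \<omega>) \<longrightarrow>
      (AE \<omega> in M. g \<omega> \<le> h \<omega>)"
  have m: "(\<lambda>\<omega>. - h \<omega>) \<in> borel_measurable M" using h(1) by auto
  have ub: "\<forall>X\<in>(\<lambda>X \<omega>. - X \<omega>) ` S. AE \<omega> in M. X \<omega> \<le> - h \<omega>" using h(2) by auto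
  have "AE \<omega> in M. g \<omega> \<le> - h \<omega>"
    using bspec[OF least m] ub by (rule mp)
  then show "AE \<omega> in M. h \<omega> \<le> - g \<omega>" by eventually_elim (metis ereal_minus_le_minus ereal_uminus_uminus)
next
  fix X assume "\<forall>X\<in>(\<lambda>X \<omega>. - X \<omega>) ` S. AE \<omega> in M. X \<omega> \<le> g \<omega>" "X \<in> S"
  then have "AE \<omega> in M. - X \<omega> \<le> g \<omega>" by auto
  then show "AE \<omega> in M. - g \<omega> \<le> X \<omega>" by eventually_elim (metis ereal_minus_le_minus ereal_uminus_uminus)
qed auto

lemma is_ess_Inf_ex:
  assumes "finite_measure M" "S \<subseteq> borel_measurable M"
  shows "\<exists>g. is_ess_Inf M S g"
proof -
  have "(\<lambda>X \<omega>. - X \<omega>) ` S \<subseteq> borel_measurable M" using assms(2) by auto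
  from is_ess_Sup_ex[OF assms(1) this] is_ess_Sup_uminus[of M S] show ?thesis by blast
qed

lemma is_ess_Sup_unique:
  "is_ess_Sup M S g \<Longrightarrow> is_ess_Sup M S h \<Longrightarrow> AE \<omega> in M. g \<omega> = h \<omega>"
proof -
  assume "is_ess_Sup M S g" "is_ess_Sup M S h"
  then have "AE \<omega> in M. g \<omega> \<le> h \<omega>" "AE \<omega> in M. h \<omega> \<le> g \<omega>"
    unfolding is_ess_Sup_def by blast+
  then show ?thesis by eventually_elim simp
qed

lemma is_ess_Inf_unique:
  "is_ess_Inf M S g \<Longrightarrow> is_ess_Inf M S h \<Longrightarrow> AE \<omega> in M. g \<omega> = h \<omega>"
proof -
  assume "is_ess_Inf M S g" "is_ess_Inf M S h"
  then have "AE \<omega> in M. g \<omega> \<le> h \<omega>" "AE \<omega> in M. h \<omega> \<le> g \<omega>"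
    unfolding is_ess_Inf_def by blast+
  then show ?thesis by eventually_elim simp
qed

section \<open>The model\<close>

text \<open>Claims are numbered from \<open>0\<close>: \<open>claim_time D i\<close> and \<open>claim_size D i\<close> are \<open>T\<close> and \<open>Z\<close> with
  index \<open>i + 1\<close>. A claim that never occurs has claim time \<open>\<infinity>\<close>. \<open>claim_law\<close> is the measure \<open>F(dz)\<close>.\<close>

record 'a loss_data =
  P0 :: "'a measure"
  filt :: "real \<Rightarrow> 'a measure"
  horizon :: real
  rate :: real
  risk_av :: real
  wealth0 :: real
  \<zeta>1 :: real
  \<zeta>2 :: real
  cost1 :: "real \<Rightarrow> real"
  cost2 :: "real \<Rightarrow> real"
  \<gamma>1 :: "real \<Rightarrow> real"
  \<gamma>2 :: "real \<Rightarrow> real"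
  claim_time :: "nat \<Rightarrow> 'a \<Rightarrow> ereal"
  claim_size :: "nat \<Rightarrow> 'a \<Rightarrow> real"
  claim_law :: "real measure"
  intensity :: "real \<Rightarrow> 'a \<Rightarrow> real"

definition claim_count :: "'a loss_data \<Rightarrow> real \<Rightarrow> 'a \<Rightarrow> nat" where
  "claim_count D t \<omega> = card {i. claim_time D i \<omega> \<le> ereal t}"

definition loss :: "'a loss_data \<Rightarrow> real \<Rightarrow> 'a \<Rightarrow> real" where
  "loss D t \<omega> = (\<Sum>i<claim_count D t \<omega>. claim_size D i \<omega>)"

text \<open>The random measures \<open>m\<close> (a sum of Dirac masses) and \<open>\<nu>\<^sup>0(dt,dz) = \<lambda>\<^sup>0\<^sub>t F(dz) dt\<close>.\<close>

definition jump_measure :: "'a loss_data \<Rightarrow> 'a \<Rightarrow> (real \<times> real) measure" where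
  "jump_measure D \<omega> =
     distr (count_space {i. claim_time D i \<omega> < \<infinity>}) (borel \<Otimes>\<^sub>M borel)
       (\<lambda>i. (real_of_ereal (claim_time D i \<omega>), claim_size D i \<omega>))"

definition compensator :: "'a loss_data \<Rightarrow> 'a \<Rightarrow> (real \<times> real) measure" where
  "compensator D \<omega> =
     density (lborel \<Otimes>\<^sub>M claim_law D)
       (\<lambda>(t, z). ennreal (intensity D t \<omega>) * indicator {0..horizon D} t)"

locale loss_model = prob_space "P0 D" + filtration "space (P0 D)" "filt D"
  for D :: "'a loss_data" +
  assumes horizon_pos: "0 < horizon D"
    and subalg: "\<And>t. t \<in> {0..horizon D} \<Longrightarrow> subalgebra (P0 D) (filt D t)"
    and usual: "usual_hypotheses (P0 D) (filt D) (horizon D)"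
    and constants_pos:
      "0 < rate D" "0 < risk_av D" "0 < wealth0 D" "0 < \<zeta>1 D" "0 < \<zeta>2 D"
    and cost1: "continuous_on {0..\<zeta>1 D} (cost1 D)" "mono_on {0..\<zeta>1 D} (cost1 D)" "cost1 D 0 = 0"
    and cost2: "continuous_on {0..\<zeta>2 D} (cost2 D)" "mono_on {0..\<zeta>2 D} (cost2 D)" "cost2 D 0 = 0"
    and \<gamma>1: "\<gamma>1 D \<in> {0..\<zeta>1 D} \<rightarrow> {0<..1}" "continuous_on {0..\<zeta>1 D} (\<gamma>1 D)"
      "antimono_on {0..\<zeta>1 D} (\<gamma>1 D)" "\<gamma>1 D 0 = 1"
    and \<gamma>2: "\<gamma>2 D \<in> {0..\<zeta>2 D} \<rightarrow> {0..1}" "continuous_on {0..\<zeta>2 D} (\<gamma>2 D)"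
      "antimono_on {0..\<zeta>2 D} (\<gamma>2 D)" "\<gamma>2 D 0 = 1"
    and claim_time_meas: "\<And>i. claim_time D i \<in> borel_measurable (P0 D)"
    and claim_time_pos: "\<And>i \<omega>. \<omega> \<in> space (P0 D) \<Longrightarrow> 0 < claim_time D i \<omega>"
    and claim_time_incr: "\<And>i \<omega>. \<omega> \<in> space (P0 D) \<Longrightarrow> claim_time D i \<omega> \<le> claim_time D (Suc i) \<omega>"
      "\<And>i \<omega>. \<omega> \<in> space (P0 D) \<Longrightarrow> claim_time D i \<omega> < \<infinity> \<Longrightarrow>
        claim_time D i \<omega> < claim_time D (Suc i) \<omega>"
    and claims_adapted: "\<And>i t B. t \<in> {0..horizon D} \<Longrightarrow> B \<in> sets borel \<Longrightarrow>
      {\<omega> \<in> space (P0 D). claim_time D i \<omega> \<le> ereal t \<and> claim_size D i \<omega> \<in> B} \<in> sets (filt D t)"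
    and claim_size_indep: "indep_vars (\<lambda>_. borel) (claim_size D) UNIV"
    and claim_size_law: "\<And>i. distr (P0 D) borel (claim_size D i) = claim_law D"
    and claim_law_pos: "AE z in claim_law D. 0 < z"
    and claim_law_moment: "integrable (claim_law D) (\<lambda>z. z\<^sup>2)"
    and intensity_pos: "\<And>t \<omega>. t \<in> {0..horizon D} \<Longrightarrow> \<omega> \<in> space (P0 D) \<Longrightarrow> 0 < intensity D t \<omega>"
    and intensity_predictable: "predictable (filt D) (horizon D) (intensity D)"
    and compensator: "dual_predictable_projection (P0 D) (filt D) (horizon D)
      (jump_measure D) (compensator D)"

section \<open>Controlled wealth and the optimization problem\<close>

text \<open>\<open>\<integral>\<^sub>a\<^sup>b \<integral>\<^sub>0\<^sup>\<infinity> H(s,z) \<mu>(ds,dz)\<close>, the integral being over \<open>(a,b] \<times> (0,\<infinity>)\<close>.\<close>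

definition measure_int ::
  "(real \<times> real) measure \<Rightarrow> real \<Rightarrow> real \<Rightarrow> (real \<Rightarrow> real \<Rightarrow> real) \<Rightarrow> real" where
  "measure_int \<mu> a b H = set_lebesgue_integral \<mu> ({a<..b} \<times> {0<..}) (\<lambda>(s, z). H s z)"

definition density_process ::
  "'a loss_data \<Rightarrow> (real \<Rightarrow> 'a \<Rightarrow> real \<times> real) \<Rightarrow> real \<Rightarrow> 'a \<Rightarrow> real" where
  "density_process D u t \<omega> = exp (
     - (LINT s:{0..t}|lborel. (\<gamma>1 D (fst (u s \<omega>)) - 1) * intensity D s \<omega>)
     + measure_int (jump_measure D \<omega>) 0 t (\<lambda>s z. ln (\<gamma>1 D (fst (u s \<omega>)))))"

definition Pu :: "'a loss_data \<Rightarrow> (real \<Rightarrow> 'a \<Rightarrow> real \<times> real) \<Rightarrow> 'a measure" where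
  "Pu D u = density (restr_to_subalg (P0 D) (filt D (horizon D)))
     (\<lambda>\<omega>. ennreal (density_process D u (horizon D) \<omega>))"

definition Y :: "'a loss_data \<Rightarrow> (real \<Rightarrow> 'a \<Rightarrow> real \<times> real) \<Rightarrow> real \<Rightarrow> 'a \<Rightarrow> real" where
  "Y D u t \<omega> =
     - measure_int (jump_measure D \<omega>) 0 t
         (\<lambda>s z. \<gamma>2 D (snd (u s \<omega>)) * exp (rate D * (t - s)) * z)
     - (LINT s:{0..t}|lborel.
         exp (rate D * (t - s)) * (cost1 D (fst (u s \<omega>)) + cost2 D (snd (u s \<omega>))))"

definition wealth :: "'a loss_data \<Rightarrow> (real \<Rightarrow> 'a \<Rightarrow> real \<times> real) \<Rightarrow> real \<Rightarrow> 'a \<Rightarrow> real" where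
  "wealth D u t \<omega> = wealth0 D * exp (rate D * t) + Y D u t \<omega>"

definition admissible :: "'a loss_data \<Rightarrow> (real \<Rightarrow> 'a \<Rightarrow> real \<times> real) set" where
  "admissible D = {u.
     (\<forall>t\<in>{0..horizon D}. \<forall>\<omega>\<in>space (P0 D). u t \<omega> \<in> {0..\<zeta>1 D} \<times> {0..\<zeta>2 D}) \<and>
     predictable (filt D) (horizon D) u \<and>
     integrable (Pu D u) (\<lambda>\<omega>. exp (- risk_av D * wealth D u (horizon D) \<omega>))}"

definition objective :: "'a loss_data \<Rightarrow> (real \<Rightarrow> 'a \<Rightarrow> real \<times> real) \<Rightarrow> real" where
  "objective D u = (LINT \<omega>|Pu D u. exp (- risk_av D * wealth D u (horizon D) \<omega>))"

definition optimal_effort :: "'a loss_data \<Rightarrow> (real \<Rightarrow> 'a \<Rightarrow> real \<times> real) \<Rightarrow> bool" where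
  "optimal_effort D u \<longleftrightarrow> u \<in> admissible D \<and> objective D u = (INF v\<in>admissible D. objective D v)"

definition null_effort :: "real \<Rightarrow> 'a \<Rightarrow> real \<times> real" where
  "null_effort t \<omega> = (0, 0)"

definition admissible_null :: "'a loss_data \<Rightarrow> real \<Rightarrow> (real \<Rightarrow> 'a \<Rightarrow> real \<times> real) set" where
  "admissible_null D t =
     {u \<in> admissible D. \<forall>s\<in>{0..t}. AE \<omega> in P0 D. u s \<omega> = null_effort s \<omega>}"

definition snell_null :: "'a loss_data \<Rightarrow> real \<Rightarrow> 'a \<Rightarrow> ereal" where
  "snell_null D t = ess_Inf (P0 D)
     ((\<lambda>u \<omega>. ereal (real_cond_exp (Pu D u) (filt D t)
         (\<lambda>\<omega>'. exp (- risk_av D * Y D u (horizon D) \<omega>')) \<omega>)) ` admissible_null D t)"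

section \<open>The BSDE\<close>

text \<open>Integral over \<open>(a,b]\<close> against \<open>m - \<nu>\<^sup>0\<close>. For fields in \<open>L_hat\<close> the integrals against \<open>m\<close> and
  \<open>\<nu>\<^sup>0\<close> are both almost surely absolutely convergent as soon as \<open>\<lambda>\<^sup>0\<close> is integrable for \<open>P\<^sup>0 \<otimes> dt\<close>,
  so the stochastic integral is their pathwise difference.\<close>

definition compensated_int ::
  "'a loss_data \<Rightarrow> (real \<Rightarrow> real \<Rightarrow> 'a \<Rightarrow> real) \<Rightarrow> real \<Rightarrow> real \<Rightarrow> 'a \<Rightarrow> real" where
  "compensated_int D \<Theta> a b \<omega> =
     measure_int (jump_measure D \<omega>) a b (\<lambda>s z. \<Theta> s z \<omega>)
     - measure_int (compensator D \<omega>) a b (\<lambda>s z. \<Theta> s z \<omega>)"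

definition L_two :: "'a loss_data \<Rightarrow> (real \<Rightarrow> 'a \<Rightarrow> real) set" where
  "L_two D = {R. adapted (filt D) (horizon D) R \<and> cadlag (P0 D) (horizon D) R \<and>
     (\<integral>\<^sup>+\<omega>. (\<integral>\<^sup>+t\<in>{0..horizon D}. ennreal (\<bar>R t \<omega>\<bar>\<^sup>2) \<partial>lborel) \<partial>P0 D) < \<infinity>}"

definition L_hat :: "'a loss_data \<Rightarrow> (real \<Rightarrow> real \<Rightarrow> 'a \<Rightarrow> real) set" where
  "L_hat D = {\<Theta>. predictable_field (filt D) (horizon D) \<Theta> \<and>
     (\<integral>\<^sup>+\<omega>. (\<integral>\<^sup>+t\<in>{0..horizon D}. (\<integral>\<^sup>+z\<in>{0<..}.
         ennreal (\<bar>\<Theta> t z \<omega>\<bar>\<^sup>2 * intensity D t \<omega>) \<partial>claim_law D) \<partial>lborel) \<partial>P0 D) < \<infinity>}"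

text \<open>Two square-integrable martingales, one of them null at time 0, are orthogonal if their product
  is a martingale.\<close>

definition L_perp :: "'a loss_data \<Rightarrow> (real \<Rightarrow> 'a \<Rightarrow> real) set" where
  "L_perp D = {M. martingale (P0 D) (filt D) (horizon D) M \<and> cadlag (P0 D) (horizon D) M \<and>
     (\<forall>t\<in>{0..horizon D}. integrable (P0 D) (\<lambda>\<omega>. (M t \<omega>)\<^sup>2)) \<and>
     (\<forall>\<Theta>\<in>L_hat D. martingale (P0 D) (filt D) (horizon D)
        (\<lambda>t \<omega>. M t \<omega> * compensated_int D \<Theta> 0 t \<omega>))}"

text \<open>\<open>\<rho>\<close> stands for \<open>R\<^sub>t\<^sub>-\<close> and \<open>\<theta>\<close> for \<open>\<Theta>(t,\<cdot>)\<close>; the dependence on \<open>\<omega>\<close> comes from \<open>\<lambda>\<^sup>0\<^sub>t\<close>.\<close>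

definition driver ::
  "'a loss_data \<Rightarrow> real \<Rightarrow> 'a \<Rightarrow> real \<Rightarrow> (real \<Rightarrow> real) \<Rightarrow> real \<Rightarrow> real \<Rightarrow> real" where
  "driver D t \<omega> \<rho> \<theta> u1 u2 =
     - \<rho> * risk_av D * exp (rate D * (horizon D - t)) * (cost1 D u1 + cost2 D u2)
     + (LINT z:{0<..}|claim_law D. \<theta> z * intensity D t \<omega>)
     - \<gamma>1 D u1 * intensity D t \<omega> * (LINT z:{0<..}|claim_law D.
         (\<theta> z + \<rho>) *
           (exp (- risk_av D * exp (rate D * (horizon D - t)) * z * (1 - \<gamma>2 D u2)) - 1) + \<theta> z)"

definition driver_along :: "'a loss_data \<Rightarrow> (real \<Rightarrow> 'a \<Rightarrow> real) \<Rightarrow> (real \<Rightarrow> real \<Rightarrow> 'a \<Rightarrow> real) \<Rightarrow>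
  (real \<Rightarrow> 'a \<Rightarrow> real \<times> real) \<Rightarrow> real \<Rightarrow> 'a \<Rightarrow> real" where
  "driver_along D R \<Theta> u t \<omega> =
     driver D t \<omega> (left_limit R t \<omega>) (\<lambda>z. \<Theta> t z \<omega>) (fst (u t \<omega>)) (snd (u t \<omega>))"

definition driver_ess_Sup :: "'a loss_data \<Rightarrow> (real \<Rightarrow> 'a \<Rightarrow> real) \<Rightarrow>
  (real \<Rightarrow> real \<Rightarrow> 'a \<Rightarrow> real) \<Rightarrow> real \<Rightarrow> 'a \<Rightarrow> ereal" where
  "driver_ess_Sup D R \<Theta> t =
     ess_Sup (P0 D) ((\<lambda>u \<omega>. ereal (driver_along D R \<Theta> u t \<omega>)) ` admissible D)"

definition terminal :: "'a loss_data \<Rightarrow> 'a \<Rightarrow> real" where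
  "terminal D \<omega> = exp (- risk_av D * Y D null_effort (horizon D) \<omega>)"

lemma (in loss_model) terminal_eq:
  "terminal D \<omega> = exp (risk_av D * exp (rate D * horizon D) *
     measure_int (jump_measure D \<omega>) 0 (horizon D) (\<lambda>s z. exp (- rate D * s) * z))"
proof -
  have "(\<lambda>(s, z). exp (rate D * (horizon D - s)) * z) =
      (\<lambda>p. exp (rate D * horizon D) * (case p of (s, z) \<Rightarrow> exp (- rate D * s) * z))"
    by (auto simp: fun_eq_iff exp_add[symmetric] algebra_simps)
  then have "measure_int (jump_measure D \<omega>) 0 (horizon D) (\<lambda>s z. exp (rate D * (horizon D - s)) * z) =
      exp (rate D * horizon D) *
        measure_int (jump_measure D \<omega>) 0 (horizon D) (\<lambda>s z. exp (- rate D * s) * z)"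
    unfolding measure_int_def by simp
  then show ?thesis
    by (simp add: terminal_def Y_def null_effort_def \<gamma>2 cost1 cost2)
qed

text \<open>The essential supremum is a random variable determined, for each \<open>s\<close> separately, up to a null
  set. To integrate it in \<open>s\<close> one uses a jointly measurable version \<open>G\<close>; by Fubini the value
  of the integral does not depend, almost surely, on the version.\<close>

definition bsde_solution :: "'a loss_data \<Rightarrow>
  (real \<Rightarrow> 'a \<Rightarrow> real) \<Rightarrow> (real \<Rightarrow> real \<Rightarrow> 'a \<Rightarrow> real) \<Rightarrow> (real \<Rightarrow> 'a \<Rightarrow> real) \<Rightarrow> bool" where
  "bsde_solution D R \<Theta> M \<longleftrightarrow>
     R \<in> L_two D \<and> \<Theta> \<in> L_hat D \<and> M \<in> L_perp D \<and>
     (\<exists>G :: real \<Rightarrow> 'a \<Rightarrow> real.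
        (\<lambda>(s, \<omega>). G s \<omega>) \<in> borel_measurable (restrict_space borel {0..horizon D} \<Otimes>\<^sub>M P0 D) \<and>
        (AE s in lborel. s \<in> {0..horizon D} \<longrightarrow>
           (AE \<omega> in P0 D. ereal (G s \<omega>) = driver_ess_Sup D R \<Theta> s \<omega>)) \<and>
        (AE \<omega> in P0 D. set_integrable lborel {0..horizon D} (\<lambda>s. G s \<omega>)) \<and>
        (\<forall>t\<in>{0..horizon D}. AE \<omega> in P0 D.
           R t \<omega> = terminal D \<omega> - compensated_int D \<Theta> t (horizon D) \<omega>
             - (LINT s:{t..horizon D}|lborel. G s \<omega>) + M (horizon D) \<omega> - M t \<omega>))"

end

theory Submission
  imports Defs
begin

text \<open>
  Every effort \<open>u\<close> changes the cost in a multiplicative way. Let \<open>\<Xi>\<close> be the terminal value of the backward equation,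
  and let \<open>K\<close> be the exponential of \<open>\<integral> a ds - \<Sum> \<ell>(T\<^sub>i, Z\<^sub>i)\<close> with
  \<open>a = (1 - \<gamma>\<^sub>1(u\<^sub>1)) \<lambda> + \<eta> e\<^bsup>r(T-s)\<^esup> (c\<^sub>1(u\<^sub>1) + c\<^sub>2(u\<^sub>2))\<close> and
  \<open>\<ell> = - ln \<gamma>\<^sub>1(u\<^sub>1) + \<eta> e\<^bsup>r(T-s)\<^esup> z (1 - \<gamma>\<^sub>2(u\<^sub>2))\<close>. Then \<open>L\<^sub>T exp (- \<eta> Y\<^sub>T) = \<Xi> K\<^sub>T\<close> (\<open>density_wealth\<close>), so
  that the expected cost of \<open>u\<close> is \<open>E\<^sup>0 [\<Xi> K\<^sub>T]\<close>, and all the analysis takes place under \<open>P\<^sup>0\<close>.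

  The process \<open>R + M\<close> is of finite variation, and so is \<open>K\<close>: between the claims both are absolutely continuous, and
  they jump at the claims only. The pathwise product formula, the compensation of the sums over the claims and
  the orthogonality of \<open>M\<close> to the compensated claims therefore give (\<open>verification\<close>), for an effort that vanishes up to
  \<open>t\<close> and an event \<open>A\<close> of the past up to \<open>t\<close> on which \<open>R\<^sub>t\<close> and \<open>M\<^sub>t\<close> are bounded,
  \<open>E [1\<^sub>A \<Xi> K\<^sub>T] = E [1\<^sub>A R\<^sub>t] + E [1\<^sub>A \<integral>\<^sub>t\<^sup>T K\<^sub>s\<^sub>- (ess sup f - f(u\<^sub>s)) ds]\<close>.
  The shape of the driver is exactly the sum of the contributions of the drift of \<open>R\<close> and of \<open>K\<close>
  (\<open>drift_identity\<close>). The error term is nonnegative; it vanishes if \<open>u\<close> maximizes the driver, and it is at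
  most a constant times \<open>\<epsilon>\<close> if \<open>u\<close> maximizes it up to \<open>\<epsilon>\<close>. An \<open>\<epsilon>\<close>-optimal predictable effort exists because the driver
  is continuous in the effort, so the first good point of a countable dense set can be chosen. Bayes' rule
  (\<open>conditional_cost\<close>) turns the identity into a statement on conditional expectations under \<open>P\<^sup>u\<close>: \<open>R\<^sub>t\<close> is below all of
  them and is approached in mean, whence it is their essential infimum. With \<open>t = 0\<close> the same identity shows
  that a maximizer of the driver is optimal.

  Expectations of products with \<open>M\<close> are the delicate point. The square-integrable martingale \<open>M\<close> is
  orthogonal to the integrals of fields in \<open>L_hat\<close>, and \<open>K\<close> is of that form plus a drift part, whose product with \<open>M\<close> is handled by conditioning
  (\<open>orthogonal_martingale_expectation\<close>). Integrability comes throughout from \<open>K \<le> e\<^bsup>C T + \<Lambda>\<^esup>\<close> with \<open>\<Lambda> = \<integral>\<^sub>0\<^sup>T \<lambda> ds\<close>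
  and the assumed moments of \<open>\<Lambda>\<close> and of the loss.
\<close>

section \<open>Pathwise calculus of finite variation functions with finitely many jumps\<close>

locale diffuse_time = sigma_finite_measure \<mu> for \<mu> :: "real measure" +
  assumes time_measurable: "(\<lambda>s. s) \<in> borel_measurable \<mu>"
    and diffuse: "\<And>s. AE v in \<mu>. v \<noteq> s"
begin

definition cumul :: "(real \<Rightarrow> real) \<Rightarrow> real \<Rightarrow> real" where
  "cumul \<alpha> s = (\<integral>v. indicator {..s} v * \<alpha> v \<partial>\<mu>)"

lemma integrable_upto: "integrable \<mu> \<alpha> \<Longrightarrow> integrable \<mu> (\<lambda>v. indicator {..s} v * \<alpha> v)"
  for \<alpha> :: "real \<Rightarrow> real"
proof -
  assume "integrable \<mu> \<alpha>"
  note time_measurable[measurable] borel_measurable_integrable[OF this, measurable]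
  show ?thesis
    by (rule Bochner_Integration.integrable_bound[OF \<open>integrable \<mu> \<alpha>\<close>]) (measurable, auto split: split_indicator)
qed

lemma integrable_after: "integrable \<mu> \<alpha> \<Longrightarrow> integrable \<mu> (\<lambda>v. indicator {s<..} v * \<alpha> v)"
  for \<alpha> :: "real \<Rightarrow> real"
proof -
  assume "integrable \<mu> \<alpha>"
  note time_measurable[measurable] borel_measurable_integrable[OF this, measurable]
  show ?thesis
    by (rule Bochner_Integration.integrable_bound[OF \<open>integrable \<mu> \<alpha>\<close>]) (measurable, auto split: split_indicator)
qed

lemma cumul_measurable[measurable]:
  assumes [measurable]: "\<alpha> \<in> borel_measurable \<mu>"
  shows "cumul \<alpha> \<in> borel_measurable \<mu>"
proof -
  note time_measurable[measurable]
  have "(\<lambda>s. \<integral>v. indicator {..s} v * \<alpha> v \<partial>\<mu>) \<in> borel_measurable \<mu>"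
    unfolding indicator_def atMost_iff by measurable
  then show ?thesis by (simp add: cumul_def[abs_def])
qed

lemma cumul_bound:
  assumes "integrable \<mu> \<alpha>" shows "\<bar>cumul \<alpha> s\<bar> \<le> (\<integral>v. \<bar>\<alpha> v\<bar> \<partial>\<mu>)"
proof -
  have "\<bar>cumul \<alpha> s\<bar> \<le> (\<integral>v. \<bar>indicator {..s} v * \<alpha> v\<bar> \<partial>\<mu>)"
    unfolding cumul_def by (rule integral_abs_bound)
  also have "\<dots> \<le> (\<integral>v. \<bar>\<alpha> v\<bar> \<partial>\<mu>)"
    using integrable_upto[OF assms] assms
    by (intro integral_mono) (auto split: split_indicator)
  finally show ?thesis .
qed

lemma integrable_mult_bounded:
  assumes "integrable \<mu> \<alpha>" "f \<in> borel_measurable \<mu>" "\<And>s. \<bar>f s\<bar> \<le> (B::real)"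
  shows "integrable \<mu> (\<lambda>s. \<alpha> s * f s :: real)"
proof (rule Bochner_Integration.integrable_bound[of _ "\<lambda>s. B * \<alpha> s"])
  show "AE s in \<mu>. norm (\<alpha> s * f s) \<le> norm (B * \<alpha> s)"
  proof (rule AE_I2)
    fix s
    have "\<bar>f s\<bar> * \<bar>\<alpha> s\<bar> \<le> \<bar>B\<bar> * \<bar>\<alpha> s\<bar>"
      using assms(3)[of s] by (intro mult_right_mono) auto
    then show "norm (\<alpha> s * f s) \<le> norm (B * \<alpha> s)" by (simp add: abs_mult mult.commute)
  qed
qed (use assms in auto)

lemma product_of_integrals:
  assumes \<alpha>: "integrable \<mu> \<alpha>" and \<beta>: "integrable \<mu> \<beta>"
  shows "(\<integral>v. \<alpha> v \<partial>\<mu>) * (\<integral>v. \<beta> v \<partial>\<mu>) = (\<integral>s. \<alpha> s * cumul \<beta> s \<partial>\<mu>) + (\<integral>s. cumul \<alpha> s * \<beta> s \<partial>\<mu>)"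
proof -
  interpret pair_sigma_finite \<mu> \<mu> ..
  note [measurable] = time_measurable borel_measurable_integrable[OF \<alpha>] borel_measurable_integrable[OF \<beta>]
  have int: "integrable (\<mu> \<Otimes>\<^sub>M \<mu>) (\<lambda>(s, v). \<alpha> s * \<beta> v)"
    by (rule Fubini_integrable) (auto simp: abs_mult \<alpha> \<beta>)
  have int1: "integrable (\<mu> \<Otimes>\<^sub>M \<mu>) (\<lambda>(s, v). \<alpha> s * (indicator {..s} v * \<beta> v))"
    by (rule Bochner_Integration.integrable_bound[OF int])
      (auto simp: indicator_def split: split_indicator)
  have int2: "integrable (\<mu> \<Otimes>\<^sub>M \<mu>) (\<lambda>(s, v). indicator {..v} s * \<alpha> s * \<beta> v)"
    by (rule Bochner_Integration.integrable_bound[OF int])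
      (auto simp: indicator_def split: split_indicator)
  have "(\<integral>v. \<alpha> v \<partial>\<mu>) * (\<integral>v. \<beta> v \<partial>\<mu>) = (\<integral>s. (\<integral>v. \<alpha> s * \<beta> v \<partial>\<mu>) \<partial>\<mu>)"
    by simp
  also have "\<dots> = (\<integral>p. (\<lambda>(s, v). \<alpha> s * (indicator {..s} v * \<beta> v)) p
      + (\<lambda>(s, v). indicator {..v} s * \<alpha> s * \<beta> v) p \<partial>(\<mu> \<Otimes>\<^sub>M \<mu>))"
    unfolding integral_fst[OF int]
  proof (rule integral_cong_AE)
    show "AE p in \<mu> \<Otimes>\<^sub>M \<mu>. (case p of (s, v) \<Rightarrow> \<alpha> s * \<beta> v) =
        (\<lambda>(s, v). \<alpha> s * (indicator {..s} v * \<beta> v)) p + (\<lambda>(s, v). indicator {..v} s * \<alpha> s * \<beta> v) p"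
    proof (rule AE_pair_measure)
      have "(case (s, v) of (s, v) \<Rightarrow> \<alpha> s * \<beta> v) = (\<lambda>(s, v). \<alpha> s * (indicator {..s} v * \<beta> v)) (s, v)
          + (\<lambda>(s, v). indicator {..v} s * \<alpha> s * \<beta> v) (s, v)" if "v \<noteq> s" for s v
        using that by (auto split: split_indicator)
      then show "AE s in \<mu>. AE v in \<mu>. (case (s, v) of (s, v) \<Rightarrow> \<alpha> s * \<beta> v) =
          (\<lambda>(s, v). \<alpha> s * (indicator {..s} v * \<beta> v)) (s, v)
          + (\<lambda>(s, v). indicator {..v} s * \<alpha> s * \<beta> v) (s, v)"
        by (intro AE_I2 AE_mp[OF diffuse] impI)
    qed (simp add: indicator_def)
  qed (simp_all add: indicator_def)
  also have "\<dots> = (\<integral>s. (\<integral>v. \<alpha> s * (indicator {..s} v * \<beta> v) \<partial>\<mu>) \<partial>\<mu>)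
      + (\<integral>v. (\<integral>s. indicator {..v} s * \<alpha> s * \<beta> v \<partial>\<mu>) \<partial>\<mu>)"
    unfolding integral_fst[OF int1] integral_snd[OF int2]
    by (rule Bochner_Integration.integral_add[OF int1 int2])
  also have "\<dots> = (\<integral>s. \<alpha> s * cumul \<beta> s \<partial>\<mu>) + (\<integral>s. cumul \<alpha> s * \<beta> s \<partial>\<mu>)"
    by (simp add: cumul_def)
  finally show ?thesis .
qed

lemma product_of_integral_and_sum:
  assumes \<alpha>: "integrable \<mu> \<alpha>" and I: "finite I"
  shows "(\<integral>v. \<alpha> v \<partial>\<mu>) * (\<Sum>i\<in>I. \<xi> i) =
    (\<integral>s. \<alpha> s * (\<Sum>i\<in>{i\<in>I. \<tau> i < s}. \<xi> i) \<partial>\<mu>) + (\<Sum>i\<in>I. cumul \<alpha> (\<tau> i) * \<xi> i)"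
proof -
  note [measurable] = time_measurable borel_measurable_integrable[OF \<alpha>]
  have split: "(\<integral>v. \<alpha> v \<partial>\<mu>) = cumul \<alpha> s + (\<integral>v. indicator {s<..} v * \<alpha> v \<partial>\<mu>)" for s
    unfolding cumul_def
    by (subst Bochner_Integration.integral_add[symmetric])
      (auto intro!: integrable_upto integrable_after \<alpha> Bochner_Integration.integral_cong split: split_indicator)
  have "(\<integral>s. \<alpha> s * (\<Sum>i\<in>{i\<in>I. \<tau> i < s}. \<xi> i) \<partial>\<mu>) = (\<integral>s. (\<Sum>i\<in>I. indicator {\<tau> i<..} s * \<alpha> s * \<xi> i) \<partial>\<mu>)"
    using I by (intro Bochner_Integration.integral_cong)
      (auto simp: sum_distrib_left sum.inter_filter intro!: sum.cong split: split_indicator)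
  also have "\<dots> = (\<Sum>i\<in>I. (\<integral>s. indicator {\<tau> i<..} s * \<alpha> s \<partial>\<mu>) * \<xi> i)"
    using integrable_after[OF \<alpha>] by (subst Bochner_Integration.integral_sum) auto
  finally show ?thesis
    by (simp add: sum_distrib_left sum.distrib[symmetric] distrib_right[symmetric] split[symmetric] add.commute)
qed

lemma product_of_sums:
  fixes \<xi> \<upsilon> :: "'i \<Rightarrow> real" and \<tau> :: "'i \<Rightarrow> real"
  assumes I: "finite I" and inj: "inj_on \<tau> I"
  shows "(\<Sum>i\<in>I. \<xi> i) * (\<Sum>i\<in>I. \<upsilon> i) =
    (\<Sum>i\<in>I. \<xi> i * (\<Sum>j\<in>{j\<in>I. \<tau> j < \<tau> i}. \<upsilon> j) + (\<Sum>j\<in>{j\<in>I. \<tau> j < \<tau> i}. \<xi> j) * \<upsilon> i + \<xi> i * \<upsilon> i)"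
proof -
  have "(\<Sum>i\<in>I. \<xi> i) * (\<Sum>i\<in>I. \<upsilon> i) = (\<Sum>i\<in>I. \<Sum>j\<in>I. \<xi> i * \<upsilon> j)"
    by (simp add: sum_product)
  also have "\<dots> = (\<Sum>i\<in>I. \<Sum>j\<in>I. (if \<tau> j < \<tau> i then \<xi> i * \<upsilon> j else 0) + (if \<tau> i < \<tau> j then \<xi> i * \<upsilon> j else 0)
      + (if i = j then \<xi> i * \<upsilon> j else 0))"
    using inj by (intro sum.cong refl) (auto dest: inj_onD)
  also have "\<dots> = (\<Sum>i\<in>I. \<Sum>j\<in>I. (if \<tau> j < \<tau> i then \<xi> i * \<upsilon> j else 0))
      + (\<Sum>i\<in>I. \<Sum>j\<in>I. (if \<tau> i < \<tau> j then \<xi> i * \<upsilon> j else 0)) + (\<Sum>i\<in>I. \<xi> i * \<upsilon> i)"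
    using I by (simp add: sum.distrib)
  also have "(\<Sum>i\<in>I. \<Sum>j\<in>I. (if \<tau> i < \<tau> j then \<xi> i * \<upsilon> j else 0)) =
      (\<Sum>j\<in>I. \<Sum>i\<in>I. (if \<tau> i < \<tau> j then \<xi> i * \<upsilon> j else 0))"
    by (rule sum.swap)
  finally show ?thesis
    using I by (simp add: sum.distrib sum_distrib_left sum_distrib_right sum.inter_filter if_distrib
        if_distribR cong: if_cong)
qed

text \<open>Integration by parts. Both factors are accumulated from a density and from jumps at the
  distinct times \<open>\<tau> i\<close>; the last summand is the covariation of common jumps. Since \<open>\<mu>\<close> has no
  atoms, only the jumps see the difference between left limits and values.\<close>

lemma product_formula:
  fixes \<xi> \<upsilon> :: "'i \<Rightarrow> real" and \<tau> :: "'i \<Rightarrow> real"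
  assumes \<alpha>: "integrable \<mu> \<alpha>" and \<beta>: "integrable \<mu> \<beta>" and I: "finite I" and inj: "inj_on \<tau> I"
    and Xm: "\<And>s. Xm s = x0 + cumul \<alpha> s + (\<Sum>i\<in>{i\<in>I. \<tau> i < s}. \<xi> i)"
    and Ym: "\<And>s. Ym s = y0 + cumul \<beta> s + (\<Sum>i\<in>{i\<in>I. \<tau> i < s}. \<upsilon> i)"
  shows "(x0 + (\<integral>s. \<alpha> s \<partial>\<mu>) + (\<Sum>i\<in>I. \<xi> i)) * (y0 + (\<integral>s. \<beta> s \<partial>\<mu>) + (\<Sum>i\<in>I. \<upsilon> i)) =
    x0 * y0 + (\<integral>s. \<alpha> s * Ym s + Xm s * \<beta> s \<partial>\<mu>) + (\<Sum>i\<in>I. \<xi> i * Ym (\<tau> i) + Xm (\<tau> i) * \<upsilon> i + \<xi> i * \<upsilon> i)"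
proof -
  note [measurable] = time_measurable borel_measurable_integrable[OF \<alpha>] borel_measurable_integrable[OF \<beta>]
  have m: "(\<lambda>s. \<Sum>i\<in>{i\<in>I. \<tau> i < s}. f i) \<in> borel_measurable \<mu>" for f :: "'i \<Rightarrow> real"
    using I by (simp add: sum.inter_filter)
  have b: "\<bar>\<Sum>i\<in>{i\<in>I. \<tau> i < s}. f i\<bar> \<le> (\<Sum>i\<in>I. \<bar>f i\<bar>)" for f :: "'i \<Rightarrow> real" and s
    by (rule order_trans[OF sum_abs]) (use I in \<open>auto intro!: sum_mono2\<close>)
  note sm = integrable_mult_bounded[OF _ m b]
  have i1: "integrable \<mu> (\<lambda>s. \<alpha> s * cumul \<beta> s)"
    by (rule integrable_mult_bounded[OF \<alpha> _ cumul_bound[OF \<beta>]]) simp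
  have i2: "integrable \<mu> (\<lambda>s. \<beta> s * cumul \<alpha> s)"
    by (rule integrable_mult_bounded[OF \<beta> _ cumul_bound[OF \<alpha>]]) simp
  have "(\<integral>s. \<alpha> s * Ym s + Xm s * \<beta> s \<partial>\<mu>) =
      (\<integral>s. y0 * \<alpha> s + x0 * \<beta> s + \<alpha> s * cumul \<beta> s + \<beta> s * cumul \<alpha> s
        + \<alpha> s * (\<Sum>i\<in>{i\<in>I. \<tau> i < s}. \<upsilon> i) + \<beta> s * (\<Sum>i\<in>{i\<in>I. \<tau> i < s}. \<xi> i) \<partial>\<mu>)"
    unfolding Xm Ym by (intro Bochner_Integration.integral_cong refl) (simp add: algebra_simps)
  also have "\<dots> = y0 * (\<integral>s. \<alpha> s \<partial>\<mu>) + x0 * (\<integral>s. \<beta> s \<partial>\<mu>) + (\<integral>s. \<alpha> s * cumul \<beta> s \<partial>\<mu>)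
      + (\<integral>s. \<beta> s * cumul \<alpha> s \<partial>\<mu>) + (\<integral>s. \<alpha> s * (\<Sum>i\<in>{i\<in>I. \<tau> i < s}. \<upsilon> i) \<partial>\<mu>)
      + (\<integral>s. \<beta> s * (\<Sum>i\<in>{i\<in>I. \<tau> i < s}. \<xi> i) \<partial>\<mu>)"
    using \<alpha> \<beta> i1 i2 sm[OF \<alpha>] sm[OF \<beta>] by (simp add: Bochner_Integration.integral_add)
  finally show ?thesis
    unfolding Xm Ym
    using product_of_integrals[OF \<alpha> \<beta>] product_of_integral_and_sum[OF \<alpha> I, of \<upsilon> \<tau>]
      product_of_integral_and_sum[OF \<beta> I, of \<xi> \<tau>] product_of_sums[OF I inj, of \<xi> \<upsilon>]
    by (simp add: algebra_simps sum.distrib sum_distrib_left sum_distrib_right)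
qed

lemma cumul_upto: "cumul (\<lambda>v. indicator {..s} v * \<alpha> v) r = cumul \<alpha> (min r s)"
  unfolding cumul_def by (intro Bochner_Integration.integral_cong refl) (auto split: split_indicator)

lemma cumul_nonneg: "(\<And>v. v \<in> space \<mu> \<Longrightarrow> 0 \<le> \<alpha> v) \<Longrightarrow> 0 \<le> cumul \<alpha> s"
  unfolding cumul_def by (intro integral_nonneg_AE AE_I2) auto

lemma cumul_le_integral: "integrable \<mu> \<alpha> \<Longrightarrow> (\<And>v. v \<in> space \<mu> \<Longrightarrow> 0 \<le> \<alpha> v) \<Longrightarrow> cumul \<alpha> s \<le> (\<integral>v. \<alpha> v \<partial>\<mu>)"
  unfolding cumul_def by (intro integral_mono integrable_upto) (auto split: split_indicator)

lemma power_of_integral: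
  assumes a: "integrable \<mu> a"
  shows "(\<integral>v. a v \<partial>\<mu>) ^ Suc n = (\<integral>s. Suc n * (a s * cumul a s ^ n) \<partial>\<mu>)"
  using a
proof (induction n arbitrary: a)
  case (Suc n)
  note [measurable] = borel_measurable_integrable[OF Suc.prems]
  let ?b = "\<lambda>s. Suc n * (a s * cumul a s ^ n)"
  have bint: "integrable \<mu> (\<lambda>s. a s * cumul a s ^ k)" for k
    by (rule integrable_mult_bounded[OF Suc.prems, of _ "(\<integral>v. \<bar>a v\<bar> \<partial>\<mu>) ^ k"])
      (auto simp: power_abs intro!: power_mono cumul_bound Suc.prems)
  have cb: "cumul ?b s = cumul a s ^ Suc n" for s
  proof -
    have "cumul a s ^ Suc n = (\<integral>v. Suc n * (indicator {..s} v * a v * cumul (\<lambda>v. indicator {..s} v * a v) v ^ n) \<partial>\<mu>)"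
      unfolding cumul_def[of a s] by (rule Suc.IH[OF integrable_upto[OF Suc.prems]])
    also have "\<dots> = cumul ?b s"
      unfolding cumul_upto cumul_def[of ?b]
      by (intro Bochner_Integration.integral_cong refl) (auto split: split_indicator)
    finally show ?thesis ..
  qed
  have "(\<integral>v. a v \<partial>\<mu>) ^ Suc (Suc n) = (\<integral>v. a v \<partial>\<mu>) * (\<integral>v. ?b v \<partial>\<mu>)"
    by (simp only: Suc.IH[OF Suc.prems, symmetric] power_Suc)
  also have "\<dots> = (\<integral>s. a s * cumul ?b s \<partial>\<mu>) + (\<integral>s. cumul a s * ?b s \<partial>\<mu>)"
    by (rule product_of_integrals) (use Suc.prems bint in auto)
  also have "\<dots> = (\<integral>s. a s * cumul a s ^ Suc n \<partial>\<mu>) + (\<integral>s. Suc n * (a s * cumul a s ^ Suc n) \<partial>\<mu>)"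
    unfolding cb by (simp add: mult.left_commute)
  also have "\<dots> = Suc (Suc n) * (\<integral>s. a s * cumul a s ^ Suc n \<partial>\<mu>)"
    unfolding integral_mult_right_zero by (simp add: algebra_simps del: power_Suc)
  also have "\<dots> = (\<integral>s. Suc (Suc n) * (a s * cumul a s ^ Suc n) \<partial>\<mu>)"
    unfolding integral_mult_right_zero ..
  finally show ?case .
qed simp

text \<open>The chain rule for \<open>exp\<close> of an absolutely continuous function: the powers of an integral are
  handled by integration by parts, and summed up.\<close>

lemma exp_of_integral:
  assumes a: "integrable \<mu> a" and nn: "\<And>v. v \<in> space \<mu> \<Longrightarrow> 0 \<le> a v"
  shows "integrable \<mu> (\<lambda>s. a s * exp (cumul a s))"
    and "exp (\<integral>v. a v \<partial>\<mu>) = 1 + (\<integral>s. a s * exp (cumul a s) \<partial>\<mu>)"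
proof -
  note [measurable] = borel_measurable_integrable[OF a]
  let ?A = "\<integral>v. a v \<partial>\<mu>"
  have bint: "integrable \<mu> (\<lambda>s. a s * cumul a s ^ k)" for k
    by (rule integrable_mult_bounded[OF a, of _ "(\<integral>v. \<bar>a v\<bar> \<partial>\<mu>) ^ k"])
      (auto simp: power_abs intro!: power_mono cumul_bound a)
  let ?f = "\<lambda>n s. a s * cumul a s ^ n / fact n"
  have fint: "integrable \<mu> (?f n)" for n using bint[of n] by simp
  have f0: "0 \<le> ?f n s" if "s \<in> space \<mu>" for n s
    using nn[OF that] cumul_nonneg[of a s] nn by simp
  have val: "(\<integral>s. ?f n s \<partial>\<mu>) = ?A ^ Suc n / fact (Suc n)" for n
  proof -
    have "?A ^ Suc n / fact (Suc n) = Suc n * (\<integral>s. a s * cumul a s ^ n \<partial>\<mu>) / fact (Suc n)"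
      unfolding power_of_integral[OF a] by simp
    also have "\<dots> = (\<integral>s. ?f n s \<partial>\<mu>)" by (simp add: field_simps del: of_nat_Suc)
    finally show ?thesis ..
  qed
  have sums_s: "(\<lambda>n. ?f n s) sums (a s * exp (cumul a s))" for s
    using sums_mult[OF exp_converges[of "cumul a s"], of "a s"] by (simp add: field_simps)
  have sumsA: "(\<lambda>n. ?A ^ Suc n / fact (Suc n)) sums (exp ?A - 1)"
    using sums_split_initial_segment[OF exp_converges[of ?A], of 1] by (simp add: field_simps)
  have n_eq: "(\<integral>s. norm (?f n s) \<partial>\<mu>) = (\<integral>s. ?f n s \<partial>\<mu>)" for n
    using f0[of _ n] by (intro Bochner_Integration.integral_cong refl) (simp del: abs_divide abs_mult add: abs_of_nonneg)
  have ae: "AE s in \<mu>. summable (\<lambda>n. norm (?f n s))"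
  proof (rule AE_I2)
    fix s assume "s \<in> space \<mu>"
    from f0[OF this] have "(\<lambda>n. norm (?f n s)) = (\<lambda>n. ?f n s)"
      by (simp del: abs_divide abs_mult add: abs_of_nonneg)
    then show "summable (\<lambda>n. norm (?f n s))" using sums_summable[OF sums_s] by metis
  qed
  have sm: "summable (\<lambda>n. \<integral>s. norm (?f n s) \<partial>\<mu>)"
    unfolding n_eq val using sums_summable[OF sumsA] .
  note sums_eq = sums_unique[OF sums_s, symmetric]
  show "integrable \<mu> (\<lambda>s. a s * exp (cumul a s))"
    using integrable_suminf[OF fint ae sm] unfolding sums_eq .
  have "(\<lambda>n. \<integral>s. ?f n s \<partial>\<mu>) sums (\<integral>s. a s * exp (cumul a s) \<partial>\<mu>)"
    using sums_integral[OF fint ae sm] unfolding sums_eq .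
  with sumsA show "exp (\<integral>v. a v \<partial>\<mu>) = 1 + (\<integral>s. a s * exp (cumul a s) \<partial>\<mu>)"
    unfolding val using sums_unique2 by fastforce
qed

lemma prod_telescope:
  fixes \<kappa> :: "'i \<Rightarrow> real" and \<tau> :: "'i \<Rightarrow> real"
  assumes "finite I" and "inj_on \<tau> I"
  shows "(\<Prod>i\<in>I. \<kappa> i) = 1 + (\<Sum>i\<in>I. (\<Prod>j\<in>{j\<in>I. \<tau> j < \<tau> i}. \<kappa> j) * (\<kappa> i - 1))"
  using assms
proof (induction "card I" arbitrary: I)
  case (Suc n)
  then have "I \<noteq> {}" by auto
  define m where "m = arg_max_on \<tau> I"
  have m: "m \<in> I" "\<And>j. j \<in> I \<Longrightarrow> \<tau> j \<le> \<tau> m"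
  proof -
    have fin: "finite (\<tau> ` I)" "\<tau> ` I \<noteq> {}" using Suc.prems \<open>I \<noteq> {}\<close> by auto
    then obtain k where k: "k \<in> I" "\<tau> k = Max (\<tau> ` I)" using Max_in[OF fin] by fastforce
    then have "\<tau> j \<le> \<tau> k" if "j \<in> I" for j using that fin by simp
    then have "is_arg_max \<tau> (\<lambda>x. x \<in> I) k" using k by (auto simp: is_arg_max_linorder)
    then have "is_arg_max \<tau> (\<lambda>x. x \<in> I) m"
      unfolding m_def arg_max_on_def arg_max_def by (rule someI)
    then show "m \<in> I" "\<And>j. j \<in> I \<Longrightarrow> \<tau> j \<le> \<tau> m" by (auto simp: is_arg_max_linorder)
  qed
  let ?J = "I - {m}"
  have J: "finite ?J" "inj_on \<tau> ?J" "n = card ?J" using Suc m by (auto intro: inj_on_diff)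
  have before_m: "{j\<in>I. \<tau> j < \<tau> m} = ?J"
    using m Suc.prems(2) by (force simp: inj_on_def)
  have before: "{j\<in>I. \<tau> j < \<tau> i} = {j\<in>?J. \<tau> j < \<tau> i}" if "i \<in> ?J" for i
    using m that by fastforce
  have "(\<Sum>i\<in>I. (\<Prod>j\<in>{j\<in>I. \<tau> j < \<tau> i}. \<kappa> j) * (\<kappa> i - 1)) = (\<Prod>j\<in>?J. \<kappa> j) * (\<kappa> m - 1)
      + (\<Sum>i\<in>?J. (\<Prod>j\<in>{j\<in>I. \<tau> j < \<tau> i}. \<kappa> j) * (\<kappa> i - 1))"
    by (subst sum.remove[OF Suc.prems(1) m(1)]) (simp add: before_m)
  also have "(\<Sum>i\<in>?J. (\<Prod>j\<in>{j\<in>I. \<tau> j < \<tau> i}. \<kappa> j) * (\<kappa> i - 1)) = (\<Prod>j\<in>?J. \<kappa> j) - 1"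
    using Suc.hyps(1)[OF J(3,1,2)] before by simp
  finally show ?case
    by (subst prod.remove[OF Suc.prems(1) m(1)]) (simp add: algebra_simps)
qed simp

text \<open>The Doleans-Dade equation \<open>dK = K\<^sub>- (a ds + (\<kappa> - 1) dN)\<close>.\<close>

lemma doleans_dade:
  fixes \<kappa> :: "'i \<Rightarrow> real" and \<tau> :: "'i \<Rightarrow> real"
  assumes a: "integrable \<mu> a" and nn: "\<And>v. v \<in> space \<mu> \<Longrightarrow> 0 \<le> a v"
    and I: "finite I" "inj_on \<tau> I"
  defines "K \<equiv> \<lambda>s. exp (cumul a s) * (\<Prod>j\<in>{j\<in>I. \<tau> j < s}. \<kappa> j)"
  shows "exp (\<integral>v. a v \<partial>\<mu>) * (\<Prod>i\<in>I. \<kappa> i) =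
      1 + (\<integral>s. a s * K s \<partial>\<mu>) + (\<Sum>i\<in>I. K (\<tau> i) * (\<kappa> i - 1))"
    and "K s = 1 + cumul (\<lambda>v. a v * K v) s + (\<Sum>i\<in>{i\<in>I. \<tau> i < s}. K (\<tau> i) * (\<kappa> i - 1))"
proof -
  have *: "exp (\<integral>v. a v \<partial>\<mu>) * (\<Prod>i\<in>I. \<kappa> i) =
      1 + (\<integral>s. a s * (exp (cumul a s) * (\<Prod>j\<in>{j\<in>I. \<tau> j < s}. \<kappa> j)) \<partial>\<mu>)
       + (\<Sum>i\<in>I. exp (cumul a (\<tau> i)) * (\<Prod>j\<in>{j\<in>I. \<tau> j < \<tau> i}. \<kappa> j) * (\<kappa> i - 1))"
    if a: "integrable \<mu> a" and nn: "\<And>v. v \<in> space \<mu> \<Longrightarrow> 0 \<le> a v"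
      and I: "finite I" "inj_on \<tau> I" for a :: "real \<Rightarrow> real" and I
  proof -
    let ?\<alpha> = "\<lambda>s. a s * exp (cumul a s)"
    let ?\<upsilon> = "\<lambda>i. (\<Prod>j\<in>{j\<in>I. \<tau> j < \<tau> i}. \<kappa> j) * (\<kappa> i - 1)"
    have E: "exp (cumul a s) = 1 + cumul ?\<alpha> s + (\<Sum>i\<in>{i\<in>I. \<tau> i < s}. 0)" for s
    proof -
      have "exp (cumul a s) = 1 + (\<integral>v. indicator {..s} v * a v * exp (cumul (\<lambda>v. indicator {..s} v * a v) v) \<partial>\<mu>)"
        unfolding cumul_def[of a s]
        by (rule exp_of_integral) (use a nn in \<open>auto intro: integrable_upto\<close>)
      also have "\<dots> = 1 + cumul ?\<alpha> s"
        unfolding cumul_upto cumul_def[of ?\<alpha>]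
        by (intro arg_cong2[where f="(+)"] Bochner_Integration.integral_cong refl) (auto split: split_indicator)
      finally show ?thesis by simp
    qed
    have P: "(\<Prod>j\<in>{j\<in>I. \<tau> j < s}. \<kappa> j) = 1 + cumul (\<lambda>_. 0) s + (\<Sum>i\<in>{i\<in>I. \<tau> i < s}. ?\<upsilon> i)" for s
    proof -
      have eq: "{j \<in> {j \<in> I. \<tau> j < s}. \<tau> j < \<tau> i} = {j\<in>I. \<tau> j < \<tau> i}" if "i \<in> {j \<in> I. \<tau> j < s}" for i
        using that by auto
      have J: "finite {j\<in>I. \<tau> j < s}" "inj_on \<tau> {j\<in>I. \<tau> j < s}"
        using I by (auto intro: inj_on_subset)
      show ?thesis
        unfolding prod_telescope[OF J] by (simp add: cumul_def eq cong: sum.cong del: mem_Collect_eq)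
    qed
    have z: "integrable \<mu> (\<lambda>_. 0 :: real)" by simp
    have "exp (\<integral>v. a v \<partial>\<mu>) = 1 + (\<integral>s. ?\<alpha> s \<partial>\<mu>) + (\<Sum>i\<in>I. 0)"
      using exp_of_integral(2)[OF a nn] by simp
    moreover have "(\<Prod>i\<in>I. \<kappa> i) = 1 + (\<integral>s. (0::real) \<partial>\<mu>) + (\<Sum>i\<in>I. ?\<upsilon> i)"
      using prod_telescope[OF I] by simp
    ultimately show ?thesis
      using product_formula[OF exp_of_integral(1)[OF a nn] z I E P]
      by (simp add: mult.assoc)
  qed
  show "exp (\<integral>v. a v \<partial>\<mu>) * (\<Prod>i\<in>I. \<kappa> i) =
      1 + (\<integral>s. a s * K s \<partial>\<mu>) + (\<Sum>i\<in>I. K (\<tau> i) * (\<kappa> i - 1))"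
    unfolding K_def by (rule *[OF a nn I])
  let ?a = "\<lambda>v. indicator {..s} v * a v" and ?I = "{i\<in>I. \<tau> i < s}"
  have sub: "{j \<in> ?I. \<tau> j < r} = {j\<in>I. \<tau> j < r}" if "r \<le> s" for r using that by auto
  have "K s = exp (\<integral>v. ?a v \<partial>\<mu>) * (\<Prod>i\<in>?I. \<kappa> i)" by (simp add: K_def cumul_def)
  also have "\<dots> = 1 + (\<integral>r. ?a r * (exp (cumul ?a r) * (\<Prod>j\<in>{j\<in>?I. \<tau> j < r}. \<kappa> j)) \<partial>\<mu>)
       + (\<Sum>i\<in>?I. exp (cumul ?a (\<tau> i)) * (\<Prod>j\<in>{j\<in>?I. \<tau> j < \<tau> i}. \<kappa> j) * (\<kappa> i - 1))"
    by (rule *) (use a nn I in \<open>auto intro: integrable_upto inj_on_subset\<close>)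
  also have "(\<Sum>i\<in>?I. exp (cumul ?a (\<tau> i)) * (\<Prod>j\<in>{j\<in>?I. \<tau> j < \<tau> i}. \<kappa> j) * (\<kappa> i - 1)) =
      (\<Sum>i\<in>?I. K (\<tau> i) * (\<kappa> i - 1))"
    by (intro sum.cong refl, subst sub) (auto simp: K_def cumul_upto)
  also have "(\<integral>r. ?a r * (exp (cumul ?a r) * (\<Prod>j\<in>{j\<in>?I. \<tau> j < r}. \<kappa> j)) \<partial>\<mu>) = cumul (\<lambda>v. a v * K v) s"
    unfolding cumul_def[of "\<lambda>v. a v * K v"]
    by (intro Bochner_Integration.integral_cong refl)
      (auto simp: K_def cumul_upto sub[simplified] min_def split: split_indicator)
  finally show "K s = 1 + cumul (\<lambda>v. a v * K v) s + (\<Sum>i\<in>{i\<in>I. \<tau> i < s}. K (\<tau> i) * (\<kappa> i - 1))" .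
qed

end

text \<open>A function has left limits different from its values only countably often: the point of such a
  discontinuity is determined by a rational level between limit and value and a rational time
  shortly before it, and by the direction of the jump.\<close>

lemma countable_left_discontinuities:
  fixes f :: "real \<Rightarrow> real"
  assumes "\<And>s. s \<in> S \<Longrightarrow> (f \<longlongrightarrow> l s) (at_left s)"
  shows "countable {s\<in>S. l s \<noteq> f s}"
proof -
  have *: "countable {s\<in>S. l s < f s}" if lim: "\<And>s. s \<in> S \<Longrightarrow> (f \<longlongrightarrow> l s) (at_left s)" for f l :: "real \<Rightarrow> real"
  proof -
    let ?P = "\<lambda>s q. l s < real_of_rat (fst q) \<and> real_of_rat (fst q) < f s \<and> real_of_rat (snd q) < s \<and>
      (\<forall>r. real_of_rat (snd q) < r \<longrightarrow> r < s \<longrightarrow> f r < real_of_rat (fst q))"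
    have "\<exists>q. ?P s q" if s: "s \<in> {s\<in>S. l s < f s}" for s
    proof -
      obtain p where p: "l s < real_of_rat p" "real_of_rat p < f s" using s of_rat_dense by blast
      have "eventually (\<lambda>r. f r < real_of_rat p) (at_left s)"
        using lim[of s] s p by (intro order_tendstoD) auto
      then obtain b where b: "b < s" "\<And>r. b < r \<Longrightarrow> r < s \<Longrightarrow> f r < real_of_rat p"
        unfolding eventually_at_left_field by auto
      obtain a where "b < real_of_rat a" "real_of_rat a < s" using b of_rat_dense by blast
      with p b show ?thesis by (intro exI[of _ "(p, a)"]) auto
    qed
    then obtain q where q: "\<And>s. s \<in> {s\<in>S. l s < f s} \<Longrightarrow> ?P s (q s)" by metis
    have "inj_on q {s\<in>S. l s < f s}"
    proof (rule inj_onI, rule ccontr)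
      fix s r assume sr: "s \<in> {s\<in>S. l s < f s}" "r \<in> {s\<in>S. l s < f s}" "q s = q r" "s \<noteq> r"
      then show False using q[OF sr(1)] q[OF sr(2)] by (metis linorder_neq_iff order_less_asym)
    qed
    then show ?thesis by (rule countable_image_inj_on[rotated]) simp
  qed
  have "countable ({s\<in>S. l s < f s} \<union> {s\<in>S. - l s < - f s})"
    using assms by (intro countable_Un * tendsto_minus)
  then show ?thesis by (rule countable_subset[rotated]) auto
qed

section \<open>Predictable processes and random fields\<close>

context loss_model
begin

abbreviation "TT \<equiv> horizon D"
abbreviation "FF \<equiv> filt D"
abbreviation "PS \<equiv> predictable_sigma FF TT"
abbreviation "\<Omega> \<equiv> space (P0 D)"

definition Lb :: "real measure" where "Lb = restrict_space lborel {0<..TT}"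

lemma space_Lb[simp]: "space Lb = {0<..TT}"
  by (simp add: Lb_def space_restrict_space)

lemma Lb_id_measurable: "(\<lambda>s. s) \<in> borel_measurable Lb"
  unfolding Lb_def by (intro measurable_restrict_space1) simp

lemma AE_Lb_iff: "(AE s in Lb. P s) \<longleftrightarrow> (AE s in lborel. s \<in> {0<..TT} \<longrightarrow> P s)"
  unfolding Lb_def by (rule AE_restrict_space_iff) simp

lemma emeasure_Lb: "emeasure Lb (space Lb) = ennreal TT"
  unfolding space_Lb unfolding Lb_def using horizon_pos by (subst emeasure_restrict_space) auto

sublocale Lb: finite_measure Lb
  by standard (simp only: emeasure_Lb, simp)

sublocale Lb: diffuse_time Lb
proof
  show "(\<lambda>s. s) \<in> borel_measurable Lb" by (rule Lb_id_measurable)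
  show "AE v in Lb. v \<noteq> s" for s
    unfolding AE_Lb_iff using AE_lborel_singleton[of s] by eventually_elim simp
qed

lemma F_space[simp]: "space (FF s) = \<Omega>"
  by (rule space_F)

lemma PS_generators: "{{0} \<times> A |A. A \<in> sets (FF 0)} \<union>
    {{s<..t} \<times> A |s t A. 0 \<le> s \<and> s \<le> t \<and> t \<le> TT \<and> A \<in> sets (FF s)} \<subseteq> Pow ({0..TT} \<times> \<Omega>)"
proof -
  have "A \<subseteq> \<Omega>" if "A \<in> sets (FF s)" for A s using sets.sets_into_space[OF that] by simp
  then show ?thesis using horizon_pos by fastforce
qed

lemma space_PS: "space PS = {0..TT} \<times> \<Omega>"
  unfolding predictable_sigma_def F_space by (rule space_measure_of[OF PS_generators])

lemma sets_PS_rect: "0 \<le> s \<Longrightarrow> s \<le> t \<Longrightarrow> t \<le> TT \<Longrightarrow> A \<in> sets (FF s) \<Longrightarrow> {s<..t} \<times> A \<in> sets PS"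
  unfolding predictable_sigma_def F_space sets_measure_of[OF PS_generators] by auto

lemma sets_PS_zero: "A \<in> sets (FF 0) \<Longrightarrow> {0} \<times> A \<in> sets PS"
  unfolding predictable_sigma_def F_space sets_measure_of[OF PS_generators] by auto

lemma measurable_into_PS:
  assumes "\<And>x. x \<in> space N \<Longrightarrow> f x \<in> {0..TT} \<times> \<Omega>"
    and "\<And>A. A \<in> sets (FF 0) \<Longrightarrow> f -` ({0} \<times> A) \<inter> space N \<in> sets N"
    and "\<And>s t A. 0 \<le> s \<Longrightarrow> s \<le> t \<Longrightarrow> t \<le> TT \<Longrightarrow> A \<in> sets (FF s) \<Longrightarrow> f -` ({s<..t} \<times> A) \<inter> space N \<in> sets N"
  shows "f \<in> N \<rightarrow>\<^sub>M PS"
  unfolding predictable_sigma_def F_space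
  using PS_generators by (rule measurable_measure_of) (use assms in auto)

lemma subalg_sets: "s \<in> {0..TT} \<Longrightarrow> A \<in> sets (FF s) \<Longrightarrow> A \<in> sets (P0 D)"
  using subalg[of s] by (auto simp: subalgebra_def)

lemma from_F_measurable: "s \<in> {0..TT} \<Longrightarrow> f \<in> FF s \<rightarrow>\<^sub>M N \<Longrightarrow> f \<in> P0 D \<rightarrow>\<^sub>M N"
  using subalg[of s] by (rule measurable_from_subalg)

lemma PS_section_F: "s \<in> {0..TT} \<Longrightarrow> (\<lambda>\<omega>. (s, \<omega>)) \<in> FF s \<rightarrow>\<^sub>M PS"
proof (rule measurable_into_PS)
  fix r t A assume s: "s \<in> {0..TT}" and r: "0 \<le> r" "r \<le> t" "t \<le> TT" and A: "A \<in> sets (FF r)"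
  show "(\<lambda>\<omega>. (s, \<omega>)) -` ({r<..t} \<times> A) \<inter> space (FF s) \<in> sets (FF s)"
  proof (cases "r < s \<and> s \<le> t")
    case True
    with A have "A \<in> sets (FF s)" using sets_F_mono[of r s] by auto
    moreover have "(\<lambda>\<omega>. (s, \<omega>)) -` ({r<..t} \<times> A) \<inter> space (FF s) = A"
      using True sets.sets_into_space[OF A] by auto
    ultimately show ?thesis by simp
  next
    case False
    then have "(\<lambda>\<omega>. (s, \<omega>)) -` ({r<..t} \<times> A) \<inter> space (FF s) = {}" by auto
    then show ?thesis by simp
  qed
next
  fix A assume s: "s \<in> {0..TT}" and A: "A \<in> sets (FF 0)"
  then have "A \<in> sets (FF s)" using sets_F_mono[of 0 s] by auto
  moreover have "(\<lambda>\<omega>. (s, \<omega>)) -` ({0} \<times> A) \<inter> space (FF s) = (if s = 0 then A else {})"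
    using sets.sets_into_space[OF A] by auto
  ultimately show "(\<lambda>\<omega>. (s, \<omega>)) -` ({0} \<times> A) \<inter> space (FF s) \<in> sets (FF s)"
    by (cases "s = 0") simp_all
qed auto

lemma PS_section_P0: "s \<in> {0..TT} \<Longrightarrow> (\<lambda>\<omega>. (s, \<omega>)) \<in> P0 D \<rightarrow>\<^sub>M PS"
  by (rule from_F_measurable[OF _ PS_section_F])

lemma PS_joint: "(\<lambda>p. p) \<in> Lb \<Otimes>\<^sub>M P0 D \<rightarrow>\<^sub>M PS"
proof (rule measurable_into_PS)
  fix r t A assume r: "0 \<le> r" "r \<le> t" "t \<le> TT" and A: "A \<in> sets (FF r)"
  have "(\<lambda>p. p) -` ({r<..t} \<times> A) \<inter> space (Lb \<Otimes>\<^sub>M P0 D) = ({s \<in> space Lb. r < s \<and> s \<le> t} \<times> A)"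
    using r sets.sets_into_space[OF A] by (auto simp: space_pair_measure)
  moreover have "\<dots> \<in> sets (Lb \<Otimes>\<^sub>M P0 D)"
    using r subalg_sets[OF _ A] Lb_id_measurable by (intro pair_measureI) (measurable, auto)
  ultimately show "(\<lambda>p. p) -` ({r<..t} \<times> A) \<inter> space (Lb \<Otimes>\<^sub>M P0 D) \<in> sets (Lb \<Otimes>\<^sub>M P0 D)" by simp
next
  fix A
  have "(\<lambda>p. p) -` ({0} \<times> A) \<inter> space (Lb \<Otimes>\<^sub>M P0 D) = {}" by (auto simp: space_pair_measure)
  then show "(\<lambda>p. p) -` ({0} \<times> A) \<inter> space (Lb \<Otimes>\<^sub>M P0 D) \<in> sets (Lb \<Otimes>\<^sub>M P0 D)" by simp
qed (auto simp: space_pair_measure)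

lemma PS_Pair[measurable (raw)]:
  assumes "f \<in> N \<rightarrow>\<^sub>M Lb" "g \<in> N \<rightarrow>\<^sub>M P0 D"
  shows "(\<lambda>x. (f x, g x)) \<in> N \<rightarrow>\<^sub>M PS"
  using measurable_compose[OF measurable_Pair[OF assms] PS_joint] by simp

lemma PS_fst[measurable]: "fst \<in> borel_measurable PS"
proof (rule borel_measurableI_greater)
  fix a :: real
  have \<Omega>: "\<Omega> \<in> sets (FF r)" for r using sets.top[of "FF r"] by simp
  consider "a < 0" | "0 \<le> a" "a \<le> TT" | "TT < a" by linarith
  then show "{p \<in> space PS. a < fst p} \<in> sets PS"
  proof cases
    case 1
    then have "{p \<in> space PS. a < fst p} = space PS" by (auto simp: space_PS)
    then show ?thesis by simp
  next
    case 2
    then have "{p \<in> space PS. a < fst p} = {a<..TT} \<times> \<Omega>" by (auto simp: space_PS)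
    with 2 show ?thesis using sets_PS_rect[of a TT, OF _ _ _ \<Omega>] by simp
  next
    case 3
    then have e: "{p \<in> space PS. a < fst p} = {}" by (auto simp: space_PS)
    show ?thesis unfolding e by simp
  qed
qed

lemma PS_after:
  assumes q: "q \<in> {0..TT}" and g: "g \<in> FF q \<rightarrow>\<^sub>M N" and c: "c \<in> space N"
  shows "(\<lambda>p. if q < fst p then g (snd p) else c) \<in> PS \<rightarrow>\<^sub>M N"
proof (rule measurableI)
  fix B assume B: "B \<in> sets N"
  have 1: "{q<..TT} \<times> (g -` B \<inter> \<Omega>) \<in> sets PS"
    using q measurable_sets[OF g B] by (intro sets_PS_rect) auto
  have 2: "{p \<in> space PS. \<not> q < fst p \<and> c \<in> B} \<in> sets PS" by measurable
  have "(\<lambda>p. if q < fst p then g (snd p) else c) -` B \<inter> space PS =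
      {q<..TT} \<times> (g -` B \<inter> \<Omega>) \<union> {p \<in> space PS. \<not> q < fst p \<and> c \<in> B}"
    using q by (auto simp: space_PS split: if_splits)
  with 1 2 show "(\<lambda>p. if q < fst p then g (snd p) else c) -` B \<inter> space PS \<in> sets PS" by simp
next
  fix p assume "p \<in> space PS"
  then show "(if q < fst p then g (snd p) else c) \<in> space N"
    using measurable_space[OF g] c by (auto simp: space_PS)
qed

lemma PS_initial:
  assumes g: "g \<in> FF 0 \<rightarrow>\<^sub>M N" and c: "c \<in> space N"
  shows "(\<lambda>p. if fst p = 0 then g (snd p) else c) \<in> PS \<rightarrow>\<^sub>M N"
proof (rule measurableI)
  fix B assume B: "B \<in> sets N"
  have 1: "{0} \<times> (g -` B \<inter> \<Omega>) \<in> sets PS"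
    using measurable_sets[OF g B] by (intro sets_PS_zero) auto
  have 2: "{p \<in> space PS. fst p \<noteq> 0 \<and> c \<in> B} \<in> sets PS" by measurable
  have "(\<lambda>p. if fst p = 0 then g (snd p) else c) -` B \<inter> space PS =
      {0} \<times> (g -` B \<inter> \<Omega>) \<union> {p \<in> space PS. fst p \<noteq> 0 \<and> c \<in> B}"
    using horizon_pos by (auto simp: space_PS split: if_splits)
  with 1 2 show "(\<lambda>p. if fst p = 0 then g (snd p) else c) -` B \<inter> space PS \<in> sets PS" by simp
next
  fix p assume "p \<in> space PS"
  then show "(if fst p = 0 then g (snd p) else c) \<in> space N"
    using measurable_space[OF g] c by (auto simp: space_PS)
qed

text \<open>Grid points next to \<open>s\<close>, strictly to the left and weakly to the right.\<close>

definition grid_left :: "nat \<Rightarrow> real \<Rightarrow> nat" where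
  "grid_left n s = nat (\<lceil>s * Suc n / TT\<rceil> - 1)"

lemma grid_left:
  assumes "s \<in> {0<..TT}"
  shows "grid_left n s < Suc n" "TT * grid_left n s / Suc n < s" "s \<le> TT * (real (grid_left n s) + 1) / Suc n"
    and "k < Suc n \<Longrightarrow> TT * k / Suc n < s \<Longrightarrow> s \<le> TT * (real k + 1) / Suc n \<Longrightarrow> k = grid_left n s"
proof -
  let ?x = "s * Suc n / TT"
  have x: "0 < ?x" "?x \<le> Suc n" using assms horizon_pos by (auto simp: divide_le_eq mult.commute simp del: of_nat_Suc)
  then have c: "1 \<le> \<lceil>?x\<rceil>" "\<lceil>?x\<rceil> \<le> Suc n" by (auto simp: one_le_ceiling ceiling_le_iff)
  then have g: "real (grid_left n s) = \<lceil>?x\<rceil> - 1" unfolding grid_left_def by simp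
  have "real (grid_left n s) < ?x" "?x \<le> grid_left n s + 1" using g by linarith+
  then show "TT * grid_left n s / Suc n < s" "s \<le> TT * (real (grid_left n s) + 1) / Suc n"
    using horizon_pos by (auto simp: field_simps)
  show "grid_left n s < Suc n" using g c by linarith
  assume "TT * k / Suc n < s" "s \<le> TT * (real k + 1) / Suc n"
  then have "real k < ?x" "?x \<le> k + 1" using horizon_pos by (auto simp: field_simps)
  then have "\<lceil>?x\<rceil> = int k + 1" by (intro ceiling_unique) auto
  then show "k = grid_left n s" unfolding grid_left_def by simp
qed

lemma grid_left_tendsto:
  assumes s: "s \<in> {0<..TT}"
  shows "(\<lambda>n. TT * grid_left n s / Suc n) \<longlonglongrightarrow> s" "(\<lambda>n. TT * (real (grid_left n s) + 1) / Suc n) \<longlonglongrightarrow> s"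
proof -
  have z: "(\<lambda>n. TT / Suc n) \<longlonglongrightarrow> 0"
    using tendsto_mult[OF tendsto_const[of TT] LIMSEQ_inverse_real_of_nat] by (simp add: divide_inverse)
  have b: "s - TT / Suc n \<le> TT * grid_left n s / Suc n" for n
    using grid_left(3)[OF s, of n] by (simp add: distrib_left add_divide_distrib del: of_nat_Suc)
  have b2: "TT * (real (grid_left n s) + 1) / Suc n \<le> s + TT / Suc n" for n
    using grid_left(2)[OF s, of n] by (simp add: distrib_left add_divide_distrib del: of_nat_Suc)
  show "(\<lambda>n. TT * grid_left n s / Suc n) \<longlonglongrightarrow> s"
  proof (rule tendsto_sandwich[where f="\<lambda>n. s - TT / Suc n" and h="\<lambda>_. s"])
    show "(\<lambda>n. s - TT / Suc n) \<longlonglongrightarrow> s" using tendsto_diff[OF tendsto_const z] by simp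
  qed (use b grid_left(2)[OF s] in \<open>auto intro!: always_eventually less_imp_le\<close>)
  show "(\<lambda>n. TT * (real (grid_left n s) + 1) / Suc n) \<longlonglongrightarrow> s"
  proof (rule tendsto_sandwich[where f="\<lambda>_. s" and h="\<lambda>n. s + TT / Suc n"])
    show "(\<lambda>n. s + TT / Suc n) \<longlonglongrightarrow> s" using tendsto_add[OF tendsto_const z] by simp
  qed (use b2 grid_left(3)[OF s] in \<open>auto intro!: always_eventually\<close>)
qed

lemma sum_grid_left:
  fixes f :: "nat \<Rightarrow> real"
  assumes s: "s \<in> {0<..TT}"
  shows "(\<Sum>k<Suc n. if TT * k / Suc n < s \<and> s \<le> TT * (real k + 1) / Suc n then f k else 0) = f (grid_left n s)"
proof -
  have "(\<Sum>k<Suc n. if TT * k / Suc n < s \<and> s \<le> TT * (real k + 1) / Suc n then f k else 0) =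
      (\<Sum>k<Suc n. if k = grid_left n s then f k else 0)"
  proof (intro sum.cong refl if_cong)
    fix k assume "k \<in> {..<Suc n}"
    then show "(TT * k / Suc n < s \<and> s \<le> TT * (real k + 1) / Suc n) = (k = grid_left n s)"
      using grid_left(1-3)[OF s, of n] grid_left(4)[OF s, of k n] by blast
  qed
  then show ?thesis using grid_left(1)[OF s, of n] by simp
qed

lemma grid_point: "k \<le> Suc n \<Longrightarrow> TT * real k / Suc n \<in> {0..TT}"
  using horizon_pos by (auto simp: divide_le_eq simp del: of_nat_Suc)

lemma left_limit_tendsto:
  assumes "cadlag (P0 D) TT X" "\<omega> \<in> \<Omega>" "s \<in> {0<..TT}"
  shows "((\<lambda>s. X s \<omega>) \<longlongrightarrow> left_limit X s \<omega>) (at_left s)"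
  using assms tendsto_Lim[of "at_left s" "\<lambda>s. X s \<omega>"]
  unfolding cadlag_def left_limit_def by fastforce

lemma left_limit_predictable:
  assumes c: "cadlag (P0 D) TT X" and a: "adapted FF TT X"
  shows "(\<lambda>p. left_limit X (fst p) (snd p)) \<in> borel_measurable PS"
proof (rule borel_measurable_LIMSEQ_real)
  let ?X = "\<lambda>n p. (if fst p = 0 then X 0 (snd p) else 0) +
    (\<Sum>k<Suc n. if fst p \<le> TT * (real k + 1) / Suc n then
       (if TT * k / Suc n < fst p then X (TT * k / Suc n) (snd p) else 0) else 0)"
  show "?X n \<in> borel_measurable PS" for n
  proof -
    have "(\<lambda>p. if TT * k / Suc n < fst p then X (TT * k / Suc n) (snd p) else 0) \<in> borel_measurable PS"
      if "k < Suc n" for k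
      using grid_point[of k n] a that by (intro PS_after) (auto simp: adapted_def)
    moreover have "(\<lambda>p. if fst p = 0 then X 0 (snd p) else 0) \<in> borel_measurable PS"
      using a horizon_pos by (intro PS_initial) (auto simp: adapted_def)
    ultimately show ?thesis
      by (intro borel_measurable_add borel_measurable_sum measurable_If[where P="\<lambda>p. fst p \<le> _"])
        (simp_all del: of_nat_Suc)
  qed
  fix p assume p: "p \<in> space PS"
  then obtain s \<omega> where sw: "p = (s, \<omega>)" "s \<in> {0..TT}" "\<omega> \<in> \<Omega>" by (auto simp: space_PS)
  show "(\<lambda>n. ?X n p) \<longlonglongrightarrow> left_limit X (fst p) (snd p)"
  proof (cases "s = 0")
    case True
    have "\<not> TT * real k / Suc n < 0" for k n using horizon_pos by (simp add: not_less)
    with True sw show ?thesis by (simp add: left_limit_def)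
  next
    case False
    with sw have s: "s \<in> {0<..TT}" by auto
    have "(\<lambda>n. X (TT * grid_left n s / Suc n) \<omega>) \<longlonglongrightarrow> left_limit X s \<omega>"
    proof (rule filterlim_compose[OF left_limit_tendsto[OF c sw(3) s]])
      show "filterlim (\<lambda>n. TT * grid_left n s / Suc n) (at_left s) sequentially"
        unfolding filterlim_at using grid_left_tendsto(1)[OF s] grid_left(2)[OF s]
        by (auto intro!: always_eventually simp: less_imp_neq)
    qed
    moreover have "?X n p = X (TT * grid_left n s / Suc n) \<omega>" for n
    proof -
      have "?X n p = (\<Sum>k<Suc n. if TT * k / Suc n < s \<and> s \<le> TT * (real k + 1) / Suc n
          then X (TT * k / Suc n) \<omega> else 0)"
        using False unfolding sw fst_conv snd_conv if_distribR by (simp only: if_False add_0_left) (intro sum.cong, auto)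
      then show ?thesis using sum_grid_left[OF s, of n "\<lambda>k. X (TT * k / Suc n) \<omega>"] by (simp only:)
    qed
    ultimately show ?thesis by (simp add: sw del: sum.lessThan_Suc of_nat_Suc)
  qed
qed

lemma cadlag_jointly_measurable:
  assumes c: "cadlag (P0 D) TT X" and a: "\<And>s. s \<in> {0..TT} \<Longrightarrow> X s \<in> borel_measurable (P0 D)"
  shows "(\<lambda>p. X (fst p) (snd p)) \<in> borel_measurable (Lb \<Otimes>\<^sub>M P0 D)"
proof (rule borel_measurable_LIMSEQ_real)
  let ?X = "\<lambda>n p. \<Sum>k<Suc n. if TT * k / Suc n < fst p \<and> fst p \<le> TT * (real k + 1) / Suc n
    then X (TT * (real k + 1) / Suc n) (snd p) else 0"
  show "?X n \<in> borel_measurable (Lb \<Otimes>\<^sub>M P0 D)" for n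
  proof -
    have [measurable]: "X (TT * (real k + 1) / Suc n) \<in> borel_measurable (P0 D)" if "k < Suc n" for k :: nat
      using grid_point[of "Suc k" n] that by (intro a) (auto simp: add.commute)
    note measurable_compose[OF measurable_fst Lb_id_measurable, measurable]
    show ?thesis by (intro borel_measurable_sum) measurable
  qed
  fix p assume p: "p \<in> space (Lb \<Otimes>\<^sub>M P0 D)"
  then obtain s \<omega> where sw: "p = (s, \<omega>)" "s \<in> {0<..TT}" "\<omega> \<in> \<Omega>" by (auto simp: space_pair_measure)
  note s = sw(2)
  have eq: "?X n p = X (TT * (real (grid_left n s) + 1) / Suc n) \<omega>" for n
    using sum_grid_left[OF s, of n "\<lambda>k. X (TT * (real k + 1) / Suc n) \<omega>"] unfolding sw fst_conv snd_conv .
  have "((\<lambda>s. X s \<omega>) \<longlongrightarrow> X s \<omega>) (at s within {s..TT})"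
  proof (cases "s = TT")
    case False
    then have "((\<lambda>s. X s \<omega>) \<longlongrightarrow> X s \<omega>) (at_right s)" using c sw by (auto simp: cadlag_def)
    moreover have "at s within {s..TT} \<le> at_right s"
      unfolding at_within_def by (intro inf_mono) auto
    ultimately show ?thesis by (rule tendsto_mono[rotated])
  qed (simp add: at_within_def)
  then have cont: "continuous (at s within {s..TT}) (\<lambda>s. X s \<omega>)" by (simp add: continuous_within)
  have "(\<lambda>n. X (TT * (real (grid_left n s) + 1) / Suc n) \<omega>) \<longlonglongrightarrow> X s \<omega>"
    using cont[unfolded continuous_within_sequentially, rule_format, of "\<lambda>n. TT * (real (grid_left n s) + 1) / Suc n"]
      grid_left_tendsto(2)[OF s] grid_left(3)[OF s] grid_point[of "Suc (grid_left _ s)"] grid_left(1)[OF s]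
    by (auto simp: o_def Suc_le_eq add.commute)
  then show "(\<lambda>n. ?X n p) \<longlonglongrightarrow> X (fst p) (snd p)" unfolding eq by (simp add: sw)
qed

lemma left_limit_eq_AE:
  assumes "cadlag (P0 D) TT X" "\<omega> \<in> \<Omega>"
  shows "AE s in Lb. left_limit X s \<omega> = X s \<omega>"
proof -
  have "countable {s\<in>{0<..TT}. left_limit X s \<omega> \<noteq> X s \<omega>}"
    using left_limit_tendsto[OF assms] by (rule countable_left_discontinuities)
  then show ?thesis
    unfolding AE_Lb_iff by (intro AE_I'[OF countable_imp_null_set_lborel]) auto
qed

end

section \<open>The claims and their compensator\<close>

lemma real_integral_by_parts_of_sign:
  fixes f :: "'b \<Rightarrow> real"
  assumes "f \<in> borel_measurable M"
  shows "integral\<^sup>L M f = (if (\<integral>\<^sup>+x. ennreal \<bar>f x\<bar> \<partial>M) < \<infinity>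
    then enn2real (\<integral>\<^sup>+x. ennreal (f x) \<partial>M) - enn2real (\<integral>\<^sup>+x. ennreal (- f x) \<partial>M) else 0)"
proof (cases "integrable M f")
  case True
  then show ?thesis by (simp add: real_lebesgue_integral_def integrable_iff_bounded)
next
  case False
  then show ?thesis using assms by (auto simp: not_integrable_integral_eq integrable_iff_bounded)
qed

context loss_model
begin

definition tau :: "nat \<Rightarrow> 'a \<Rightarrow> real" where "tau i \<omega> = real_of_ereal (claim_time D i \<omega>)"

text \<open>The claims charged by the jump measure on \<open>(0,T] \<times> (0,\<infinity>)\<close>.\<close>

definition jumps :: "'a \<Rightarrow> nat set" where
  "jumps \<omega> = {i. claim_time D i \<omega> \<le> ereal TT \<and> 0 < claim_size D i \<omega>}"

definition mark :: "nat \<Rightarrow> 'a \<Rightarrow> (real \<times> 'a) \<times> real" where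
  "mark i \<omega> = ((tau i \<omega>, \<omega>), claim_size D i \<omega>)"

definition lam :: "real \<times> 'a \<Rightarrow> real" where "lam p = intensity D (fst p) (snd p)"

abbreviation "PF \<equiv> PS \<Otimes>\<^sub>M (borel :: real measure)"

lemma lam_predictable[measurable]: "lam \<in> borel_measurable PS"
  using intensity_predictable by (simp add: predictable_def lam_def[abs_def] split_beta')

lemma lam_pos: "s \<in> {0..TT} \<Longrightarrow> \<omega> \<in> \<Omega> \<Longrightarrow> 0 < lam (s, \<omega>)"
  using intensity_pos by (simp add: lam_def)

lemma tau: "\<omega> \<in> \<Omega> \<Longrightarrow> claim_time D i \<omega> \<le> ereal q \<Longrightarrow> claim_time D i \<omega> = ereal (tau i \<omega>)"
  "\<omega> \<in> \<Omega> \<Longrightarrow> claim_time D i \<omega> \<le> ereal q \<Longrightarrow> 0 < tau i \<omega> \<and> tau i \<omega> \<le> q"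
  using claim_time_pos[of \<omega> i] unfolding tau_def by (cases "claim_time D i \<omega>"; simp)+

lemma jumps_tau: "\<omega> \<in> \<Omega> \<Longrightarrow> i \<in> jumps \<omega> \<Longrightarrow> tau i \<omega> \<in> {0<..TT}"
  using tau(2)[of \<omega> i TT] by (simp add: jumps_def)

lemma claim_time_strict:
  assumes "\<omega> \<in> \<Omega>" "claim_time D j \<omega> < \<infinity>" "i < j"
  shows "claim_time D i \<omega> < claim_time D j \<omega>"
  using assms(2,3)
proof (induction j)
  case (Suc j)
  have j: "claim_time D j \<omega> < \<infinity>" using claim_time_incr(1)[OF assms(1), of j] Suc.prems by order
  then have *: "claim_time D j \<omega> < claim_time D (Suc j) \<omega>" using claim_time_incr(2)[OF assms(1)] by blast
  show ?case
  proof (cases "i = j")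
    case False
    then show ?thesis using Suc.IH[OF j] Suc.prems * by (simp add: less_Suc_eq)
  qed (use * in simp)
qed simp

lemma inj_tau: "\<omega> \<in> \<Omega> \<Longrightarrow> inj_on (\<lambda>i. tau i \<omega>) (jumps \<omega>)"
proof (rule linorder_inj_onI)
  fix i j assume *: "\<omega> \<in> \<Omega>" "i < j" "i \<in> jumps \<omega>" "j \<in> jumps \<omega>"
  then have "claim_time D i \<omega> < claim_time D j \<omega>"
    by (intro claim_time_strict) (auto simp: jumps_def)
  then show "tau i \<omega> \<noteq> tau j \<omega>" using * tau(1)[of \<omega> i TT] tau(1)[of \<omega> j TT]
    by (auto simp: jumps_def)
qed auto

text \<open>A predictable field evaluated at a claim is known once the claim has occurred.\<close>

lemma mark_adapted:
  assumes q: "q \<in> {0..TT}" and H: "H \<in> PF \<rightarrow>\<^sub>M N" and c: "c \<in> space N"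
  shows "(\<lambda>\<omega>. if claim_time D i \<omega> \<le> ereal q \<and> 0 < claim_size D i \<omega> then H (mark i \<omega>) else c) \<in> FF q \<rightarrow>\<^sub>M N"
proof -
  have known: "{\<omega>\<in>\<Omega>. claim_time D i \<omega> \<le> ereal r \<and> claim_size D i \<omega> \<in> B} \<in> sets (FF q)"
    if "r \<in> {0..q}" "B \<in> sets borel" for r B
    using claims_adapted[of r B i] that q sets_F_mono[of r q] by auto
  define E where "E = {\<omega>\<in>\<Omega>. claim_time D i \<omega> \<le> ereal q \<and> 0 < claim_size D i \<omega>}"
  define N' where "N' = restrict_space (FF q) E"
  have Es: "E \<in> sets (FF q)" using known[of q "{0<..}"] q by (simp add: E_def)
  have in_N': "B \<in> sets N'" if "B \<in> sets (FF q)" "B \<subseteq> E" for B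
    using that Es sets.Int_space_eq2[OF Es] unfolding N'_def
    by (subst sets_restrict_space_iff) (simp_all del: F_space)
  have spN': "space N' = E" by (auto simp: N'_def E_def space_restrict_space)
  have 1: "(\<lambda>\<omega>. (tau i \<omega>, \<omega>)) \<in> N' \<rightarrow>\<^sub>M PS"
  proof (rule measurable_into_PS)
    fix r t A assume r: "0 \<le> r" "r \<le> t" "t \<le> TT" and A: "A \<in> sets (FF r)"
    have A\<Omega>: "A \<subseteq> \<Omega>" using sets.sets_into_space[OF A] by simp
    let ?K = "\<lambda>r. {\<omega>\<in>\<Omega>. claim_time D i \<omega> \<le> ereal r \<and> claim_size D i \<omega> \<in> {0<..}}"
    have K: "\<omega> \<in> ?K r' \<longleftrightarrow> tau i \<omega> \<le> r'" if "\<omega> \<in> E" for \<omega> r'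
      using that tau(1)[of \<omega> i q] by (simp add: E_def)
    have KE: "?K (min t q) \<subseteq> E" by (auto simp: E_def intro: order_trans)
    have eq: "(\<lambda>\<omega>. (tau i \<omega>, \<omega>)) -` ({r<..t} \<times> A) \<inter> space N' = A \<inter> (?K (min t q) - ?K r)"
    proof (rule set_eqI)
      fix \<omega>
      show "\<omega> \<in> (\<lambda>\<omega>. (tau i \<omega>, \<omega>)) -` ({r<..t} \<times> A) \<inter> space N' \<longleftrightarrow> \<omega> \<in> A \<inter> (?K (min t q) - ?K r)"
      proof (cases "\<omega> \<in> E")
        case True
        then have "tau i \<omega> \<le> q" using tau(2)[of \<omega> i q] by (simp add: E_def)
        then show ?thesis unfolding spN' Int_iff Diff_iff K[OF True] using True by auto
      next
        case False
        then show ?thesis using KE unfolding spN' by blast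
      qed
    qed
    show "(\<lambda>\<omega>. (tau i \<omega>, \<omega>)) -` ({r<..t} \<times> A) \<inter> space N' \<in> sets N'"
    proof (cases "r \<le> q")
      case True
      then have "A \<in> sets (FF q)" using A sets_F_mono[OF True] by auto
      then show ?thesis
        unfolding eq using KE r q True
        by (intro in_N' sets.Int sets.Diff known) auto
    next
      case False
      then have "?K (min t q) \<subseteq> ?K r" by (auto intro: order_trans)
      then have "A \<inter> (?K (min t q) - ?K r) = {}" by blast
      then show ?thesis unfolding eq by (simp only: sets.empty_sets)
    qed
  next
    fix A
    have "(\<lambda>\<omega>. (tau i \<omega>, \<omega>)) -` ({0} \<times> A) \<inter> space N' = {}"
      using tau(2)[of _ i q] by (fastforce simp: spN' E_def)
    then show "(\<lambda>\<omega>. (tau i \<omega>, \<omega>)) -` ({0} \<times> A) \<inter> space N' \<in> sets N'" by simp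
  next
    fix \<omega> assume "\<omega> \<in> space N'"
    then show "(tau i \<omega>, \<omega>) \<in> {0..TT} \<times> \<Omega>" using tau(2)[of \<omega> i q] q by (auto simp: spN' E_def)
  qed
  have 2: "claim_size D i \<in> borel_measurable N'"
  proof (rule measurableI)
    fix B :: "real set" assume "B \<in> sets borel"
    then have "{\<omega>\<in>\<Omega>. claim_time D i \<omega> \<le> ereal q \<and> claim_size D i \<omega> \<in> B \<inter> {0<..}} \<in> sets (FF q)"
      using q by (intro known) auto
    moreover have "claim_size D i -` B \<inter> space N' =
        {\<omega>\<in>\<Omega>. claim_time D i \<omega> \<le> ereal q \<and> claim_size D i \<omega> \<in> B \<inter> {0<..}}" by (auto simp: spN' E_def)
    ultimately show "claim_size D i -` B \<inter> space N' \<in> sets N'" by (auto intro!: in_N' simp: E_def)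
  qed simp
  have "(\<lambda>\<omega>. H (mark i \<omega>)) \<in> N' \<rightarrow>\<^sub>M N"
    unfolding mark_def using measurable_Pair[OF 1 2] H by (rule measurable_compose)
  then have "(\<lambda>\<omega>. if \<omega> \<in> E then H (mark i \<omega>) else c) \<in> FF q \<rightarrow>\<^sub>M N"
    unfolding N'_def using Es c sets.Int_space_eq2[OF Es]
    by (subst (asm) measurable_restrict_space_iff) (simp_all del: F_space)
  then show ?thesis
    by (rule measurable_cong[THEN iffD1, rotated]) (auto simp: E_def)
qed

lemma nn_integral_jumps:
  "(\<integral>\<^sup>+i. f i \<partial>count_space (jumps \<omega>)) =
    (\<Sum>i. if claim_time D i \<omega> \<le> ereal TT \<and> 0 < claim_size D i \<omega> then f i else (0::ennreal))"
  by (subst nn_integral_count_space_indicator)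
    (auto simp: jumps_def nn_integral_count_space_nat intro!: suminf_cong)

lemma jump_sum_adapted:
  assumes "H \<in> borel_measurable PF"
  shows "(\<lambda>\<omega>. \<integral>\<^sup>+i. H (mark i \<omega>) \<partial>count_space (jumps \<omega>)) \<in> borel_measurable (FF TT)"
  unfolding nn_integral_jumps
  using horizon_pos by (intro borel_measurable_suminf_order mark_adapted assms) auto

text \<open>The sum over the claims before time \<open>s\<close> is predictable: it is the supremum over rational \<open>q < s\<close>
  of the sums over the claims up to \<open>q\<close>.\<close>

lemma jump_sum_before_predictable:
  fixes H :: "(real \<times> 'a) \<times> real \<Rightarrow> ennreal"
  assumes H: "H \<in> borel_measurable PF"
  shows "(\<lambda>p. \<integral>\<^sup>+i. (if tau i (snd p) < fst p then H (mark i (snd p)) else 0) \<partial>count_space (jumps (snd p)))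
    \<in> borel_measurable PS"
proof -
  let ?t = "\<lambda>i p. if claim_time D i (snd p) \<le> ereal TT \<and> 0 < claim_size D i (snd p)
    then (if tau i (snd p) < fst p then H (mark i (snd p)) else 0) else 0"
  let ?u = "\<lambda>i q p. if q < fst p then
    (if claim_time D i (snd p) \<le> ereal q \<and> 0 < claim_size D i (snd p) then H (mark i (snd p)) else 0) else 0"
  let ?Q = "{q \<in> \<rat>. 0 \<le> q \<and> q \<le> TT}"
  have cQ: "countable ?Q" using countable_rat by (rule countable_subset[rotated]) auto
  have ne: "?Q \<noteq> {}" using horizon_pos by (auto intro!: exI[of _ 0])
  have meas: "?u i q \<in> borel_measurable PS" if "q \<in> ?Q" for i q
    using that by (intro PS_after[where g="\<lambda>\<omega>. if claim_time D i \<omega> \<le> ereal q \<and> 0 < claim_size D i \<omega>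
        then H (mark i \<omega>) else 0"] mark_adapted H) auto
  have eq: "?t i p = (SUP q\<in>?Q. ?u i q p)" if p: "p \<in> space PS" for i p
  proof (rule antisym)
    have p': "0 \<le> fst p" "fst p \<le> TT" "snd p \<in> \<Omega>" using p by (auto simp: space_PS)
    show "?t i p \<le> (SUP q\<in>?Q. ?u i q p)"
    proof (cases "claim_time D i (snd p) \<le> ereal TT \<and> 0 < claim_size D i (snd p) \<and> tau i (snd p) < fst p")
      case True
      then obtain q where q: "q \<in> \<rat>" "tau i (snd p) < q" "q < fst p" using Rats_dense_in_real by blast
      then have "?t i p = ?u i q p"
        using True tau(1)[of "snd p" i TT] p' by auto
      moreover have "q \<in> ?Q" using q tau(2)[of "snd p" i TT] p' True by auto
      ultimately show ?thesis by (simp only:) (rule SUP_upper)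
    qed auto
    show "(SUP q\<in>?Q. ?u i q p) \<le> ?t i p"
    proof (rule SUP_least)
      fix q assume "q \<in> ?Q"
      then show "?u i q p \<le> ?t i p"
        using tau[of "snd p" i q] p' by auto
    qed
  qed
  have "?t i \<in> borel_measurable PS" for i
    by (subst measurable_cong[OF eq], assumption) (intro borel_measurable_SUP cQ meas)
  then show ?thesis
    unfolding nn_integral_jumps by (intro borel_measurable_suminf_order)
qed

lemma jump_sum_before_predictable_real:
  fixes H :: "(real \<times> 'a) \<times> real \<Rightarrow> real"
  assumes [measurable]: "H \<in> borel_measurable PF"
  shows "(\<lambda>p. \<integral>i. (if tau i (snd p) < fst p then H (mark i (snd p)) else 0) \<partial>count_space (jumps (snd p)))
    \<in> borel_measurable PS"
proof -
  have e: "ennreal \<bar>if c then x else 0\<bar> = (if c then ennreal \<bar>x\<bar> else 0)"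
    "ennreal (if c then x else 0) = (if c then ennreal x else 0)"
    "ennreal (- (if c then x else 0)) = (if c then ennreal (- x) else 0)" for c and x :: real
    by auto
  have [measurable]: "(\<lambda>p. \<integral>\<^sup>+i. (if tau i (snd p) < fst p then ennreal (f (H (mark i (snd p)))) else 0)
      \<partial>count_space (jumps (snd p))) \<in> borel_measurable PS" if [measurable]: "f \<in> borel_measurable borel" for f
    by (rule jump_sum_before_predictable[where H="\<lambda>x. ennreal (f (H x))"]) measurable
  note [measurable] = this[of abs] this[of "\<lambda>x. x"] this[of uminus]
  show ?thesis
    by (subst real_integral_by_parts_of_sign, simp) (unfold e, measurable)
qed

subsection \<open>The claim size law\<close>

lemma sets_claim_law[simp]: "sets (claim_law D) = sets borel"
  using claim_size_law[of 0] by (metis sets_distr)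

lemma claim_size_measurable[measurable]: "claim_size D i \<in> borel_measurable (P0 D)"
  using claim_size_indep by (simp add: indep_vars_def)

sublocale FL: prob_space "claim_law D"
  using prob_space_distr[OF claim_size_measurable[of 0]] unfolding claim_size_law .

lemma space_claim_law[simp]: "space (claim_law D) = UNIV"
  using sets_eq_imp_space_eq[OF sets_claim_law] by simp

lemma claim_law_id: "(\<lambda>z. z) \<in> claim_law D \<rightarrow>\<^sub>M borel"
  by (simp add: measurable_ident_sets)

lemma claim_size_pos_AE: "AE \<omega> in P0 D. \<forall>i. 0 < claim_size D i \<omega>"
proof -
  have "AE \<omega> in P0 D. 0 < claim_size D i \<omega>" for i
    using claim_law_pos unfolding claim_size_law[of i, symmetric]
    by (subst (asm) AE_distr_iff) auto
  then show ?thesis by (simp add: AE_all_countable)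
qed

subsection \<open>Integrals against the jump measure and the compensator\<close>

text \<open>Random fields are only defined on \<open>[0,T]\<close>; \<open>clip\<close> brings other times back into it.\<close>

definition clip :: "real \<Rightarrow> real" where "clip s = (if s \<in> {0<..TT} then s else TT)"

lemma clip_measurable[measurable]: "clip \<in> borel \<rightarrow>\<^sub>M Lb"
  unfolding Lb_def
proof (rule measurable_restrict_space2)
  show "clip \<in> space borel \<rightarrow> {0<..TT}" using horizon_pos by (auto simp: clip_def)
  have "clip \<in> borel_measurable borel" unfolding clip_def[abs_def] by measurable
  then show "clip \<in> borel \<rightarrow>\<^sub>M lborel" by simp
qed

lemma clip_eq: "s \<in> {0<..TT} \<Longrightarrow> clip s = s"
  by (simp add: clip_def)

lemma section_measurable:
  assumes "\<omega> \<in> \<Omega>" and [measurable]: "H \<in> PF \<rightarrow>\<^sub>M N"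
  shows "(\<lambda>p. H ((clip (fst p), \<omega>), snd p)) \<in> borel \<Otimes>\<^sub>M borel \<rightarrow>\<^sub>M N"
  using assms(1) by measurable

lemma predictable_fieldI:
  assumes "H \<in> PF \<rightarrow>\<^sub>M borel"
  shows "predictable_field FF TT (\<lambda>s z \<omega>. H ((s, \<omega>), z))"
proof -
  have "(\<lambda>z. z) \<in> restrict_space borel {0..} \<rightarrow>\<^sub>M (borel :: real measure)"
    by (intro measurable_restrict_space1) simp
  then have "(\<lambda>p. (fst p, snd p)) \<in> PS \<Otimes>\<^sub>M restrict_space borel {0..} \<rightarrow>\<^sub>M PF"
    by (intro measurable_Pair measurable_fst measurable_compose[OF measurable_snd])
  from measurable_compose[OF this assms]
  show ?thesis by (simp add: predictable_field_def split_beta')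
qed

lemma predictable_fieldD:
  fixes \<Theta> :: "real \<Rightarrow> real \<Rightarrow> 'a \<Rightarrow> real"
  assumes "predictable_field FF TT \<Theta>"
  shows "(\<lambda>x. if 0 < snd x then \<Theta> (fst (fst x)) (snd x) (snd (fst x)) else 0) \<in> borel_measurable PF"
proof -
  have c: "(\<lambda>x. max 0 (snd x)) \<in> PF \<rightarrow>\<^sub>M restrict_space borel {0::real..}"
    by (intro measurable_restrict_space2) auto
  have "(\<lambda>x. (fst x, max 0 (snd x))) \<in> PF \<rightarrow>\<^sub>M PS \<Otimes>\<^sub>M restrict_space borel {0..}"
    by (rule measurable_Pair[OF measurable_fst c])
  then have "(\<lambda>x. (\<lambda>((t, \<omega>), z). \<Theta> t z \<omega>) (fst x, max 0 (snd x))) \<in> borel_measurable PF"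
    by (rule measurable_compose) (rule assms[unfolded predictable_field_def])
  then have m: "(\<lambda>x. \<Theta> (fst (fst x)) (max 0 (snd x)) (snd (fst x))) \<in> borel_measurable PF"
    by (simp only: case_prod_beta fst_conv snd_conv)
  have "(\<lambda>x. if 0 < snd x then \<Theta> (fst (fst x)) (max 0 (snd x)) (snd (fst x)) else 0) \<in> borel_measurable PF"
    using m by (rule measurable_If) measurable
  also have "(\<lambda>x. if 0 < snd x then \<Theta> (fst (fst x)) (max 0 (snd x)) (snd (fst x)) else 0) =
      (\<lambda>x. if 0 < snd x then \<Theta> (fst (fst x)) (snd x) (snd (fst x)) else 0)"
    by (auto simp: fun_eq_iff max_def)
  finally show ?thesis .
qed

end

context loss_model
begin

lemma nn_integral_jump_measure:
  assumes \<omega>: "\<omega> \<in> \<Omega>" and H[measurable]: "H \<in> borel_measurable PF"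
  shows "(\<integral>\<^sup>+p\<in>{0<..TT} \<times> {0<..}. H ((fst p, \<omega>), snd p) \<partial>jump_measure D \<omega>) =
    (\<integral>\<^sup>+i. H (mark i \<omega>) \<partial>count_space (jumps \<omega>))"
proof -
  define f where "f p = H ((clip (fst p), \<omega>), snd p) * (indicator {0<..TT} (fst p) * indicator {0<..} (snd p))"
    for p :: "real \<times> real"
  let ?T = "\<lambda>i. (real_of_ereal (claim_time D i \<omega>), claim_size D i \<omega>)"
  let ?C = "{i. claim_time D i \<omega> < \<infinity>}"
  have T: "?T \<in> count_space ?C \<rightarrow>\<^sub>M borel \<Otimes>\<^sub>M borel"
    by (simp add: space_pair_measure)
  have "f \<in> borel_measurable (borel \<Otimes>\<^sub>M borel)"
    unfolding f_def[abs_def]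
    by (intro borel_measurable_times_ennreal section_measurable[OF \<omega> H]) measurable
  then have f: "f \<in> borel_measurable (distr (count_space ?C) (borel \<Otimes>\<^sub>M borel) ?T)"
    unfolding measurable_distr_eq1 .
  have cs: "(\<integral>\<^sup>+x. g x \<partial>count_space X) = (\<integral>\<^sup>+x. g x * indicator X x \<partial>count_space UNIV)"
    for g and X :: "nat set" by (simp add: nn_integral_restrict_space[symmetric] restrict_count_space)
  have "(\<integral>\<^sup>+p\<in>{0<..TT} \<times> {0<..}. H ((fst p, \<omega>), snd p) \<partial>jump_measure D \<omega>) = (\<integral>\<^sup>+p. f p \<partial>jump_measure D \<omega>)"
    by (rule nn_integral_cong) (auto simp: f_def clip_eq split: split_indicator)
  moreover have "(\<integral>\<^sup>+p. f p \<partial>jump_measure D \<omega>) = (\<integral>\<^sup>+i. f (?T i) \<partial>count_space ?C)"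
    unfolding jump_measure_def by (rule nn_integral_distr[OF T f])
  moreover
  have c1: "(\<integral>\<^sup>+i. f (?T i) \<partial>count_space ?C) = (\<integral>\<^sup>+i. f (?T i) * indicator ?C i \<partial>count_space UNIV)"
    by (rule cs)
  have c2: "(\<integral>\<^sup>+i. H (mark i \<omega>) \<partial>count_space (jumps \<omega>)) =
      (\<integral>\<^sup>+i. H (mark i \<omega>) * indicator (jumps \<omega>) i \<partial>count_space UNIV)"
    by (rule cs)
  have "(\<integral>\<^sup>+i. f (?T i) \<partial>count_space ?C) = (\<integral>\<^sup>+i. H (mark i \<omega>) \<partial>count_space (jumps \<omega>))"
    unfolding c1 c2
  proof (rule nn_integral_cong)
    fix i
    have "claim_time D i \<omega> < \<infinity> \<Longrightarrow> claim_time D i \<omega> = ereal (tau i \<omega>)"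
      using claim_time_pos[OF \<omega>, of i] by (cases "claim_time D i \<omega>") (auto simp: tau_def)
    then show "f (?T i) * indicator ?C i = H (mark i \<omega>) * indicator (jumps \<omega>) i"
      using tau[OF \<omega>, of i TT]
      by (auto simp: f_def jumps_def mark_def clip_eq tau_def[symmetric] split: split_indicator)
  qed
  ultimately show ?thesis by (simp only:)
qed

lemma compensator_density_measurable:
  assumes \<omega>: "\<omega> \<in> \<Omega>"
  shows "(\<lambda>p. (if fst p \<in> {0..TT} then intensity D (fst p) \<omega> else 0 :: real)) \<in> borel_measurable (borel \<Otimes>\<^sub>M borel :: (real \<times> real) measure)"
proof -
  have "(\<lambda>s. lam (clip s, \<omega>)) \<in> borel_measurable borel"
    using \<omega> by measurable
  then have "(\<lambda>s. if s \<in> {0<..TT} then lam (clip s, \<omega>) else if s = 0 then intensity D 0 \<omega> else 0) \<in> borel_measurable borel"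
    by measurable
  also have "(\<lambda>s. if s \<in> {0<..TT} then lam (clip s, \<omega>) else if s = 0 then intensity D 0 \<omega> else 0) =
      (\<lambda>s. if s \<in> {0..TT} then intensity D s \<omega> else 0)"
    using horizon_pos by (auto simp: fun_eq_iff clip_eq lam_def)
  finally show ?thesis by (rule measurable_compose[OF measurable_fst])
qed

lemma compensator_eq:
  "compensator D \<omega> = density (lborel \<Otimes>\<^sub>M claim_law D)
    (\<lambda>p. ennreal (if fst p \<in> {0..TT} then intensity D (fst p) \<omega> else 0))"
  unfolding compensator_def by (intro arg_cong[where f="density _"]) (auto simp: fun_eq_iff split: split_indicator)

lemma sets_lborel_claim: "sets (lborel \<Otimes>\<^sub>M claim_law D) = sets (borel \<Otimes>\<^sub>M borel)"
  by (intro sets_pair_measure_cong) auto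

lemma nn_integral_Lb: "(\<integral>\<^sup>+s. f s \<partial>Lb) = (\<integral>\<^sup>+s. f s * indicator {0<..TT} s \<partial>lborel)"
  unfolding Lb_def by (rule nn_integral_restrict_space) simp

lemma nn_integral_compensator:
  assumes \<omega>: "\<omega> \<in> \<Omega>" and H: "H \<in> borel_measurable PF" and t: "t \<le> TT"
  shows "(\<integral>\<^sup>+p\<in>{0<..t} \<times> {0<..}. H ((fst p, \<omega>), snd p) \<partial>compensator D \<omega>) =
    (\<integral>\<^sup>+s. (if s \<le> t then (\<integral>\<^sup>+z. H ((s, \<omega>), z) * ennreal (lam (s, \<omega>)) \<partial>claim_law D) else 0) \<partial>Lb)"
proof -
  define f where "f p = H ((clip (fst p), \<omega>), snd p) * (indicator {0<..t} (fst p) * indicator {0<..} (snd p))"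
    for p :: "real \<times> real"
  define d where "d p = ennreal (if fst p \<in> {0..TT} then intensity D (fst p) \<omega> else 0)" for p :: "real \<times> real"
  have f: "f \<in> borel_measurable (lborel \<Otimes>\<^sub>M claim_law D)"
    unfolding f_def[abs_def] measurable_cong_sets[OF sets_lborel_claim refl]
    by (intro borel_measurable_times_ennreal section_measurable[OF \<omega> H]) measurable
  have d: "d \<in> borel_measurable (lborel \<Otimes>\<^sub>M claim_law D)"
    unfolding d_def[abs_def] measurable_cong_sets[OF sets_lborel_claim refl]
    using compensator_density_measurable[OF \<omega>] by (rule measurable_compose) simp
  have comp: "compensator D \<omega> = density (lborel \<Otimes>\<^sub>M claim_law D) d"
    unfolding compensator_eq d_def ..
  have fd: "(\<lambda>p. d p * f p) \<in> borel_measurable (lborel \<Otimes>\<^sub>M claim_law D)"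
    by (rule borel_measurable_times_ennreal[OF d f])
  have pos: "AE z in claim_law D. 0 < z" by (rule claim_law_pos)
  have "(\<integral>\<^sup>+p\<in>{0<..t} \<times> {0<..}. H ((fst p, \<omega>), snd p) \<partial>compensator D \<omega>) = (\<integral>\<^sup>+p. f p \<partial>compensator D \<omega>)"
    using t by (intro nn_integral_cong) (auto simp: f_def clip_eq split: split_indicator)
  moreover have "(\<integral>\<^sup>+p. f p \<partial>compensator D \<omega>) = (\<integral>\<^sup>+p. d p * f p \<partial>(lborel \<Otimes>\<^sub>M claim_law D))"
    unfolding comp by (rule nn_integral_density[OF d f])
  moreover have "(\<integral>\<^sup>+p. d p * f p \<partial>(lborel \<Otimes>\<^sub>M claim_law D)) =
      (\<integral>\<^sup>+s. (\<integral>\<^sup>+z. d (s, z) * f (s, z) \<partial>claim_law D) \<partial>lborel)"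
    using FL.nn_integral_fst[OF fd] by simp
  moreover have "(\<integral>\<^sup>+z. d (s, z) * f (s, z) \<partial>claim_law D) =
      (if s \<le> t then (\<integral>\<^sup>+z. H ((s, \<omega>), z) * ennreal (lam (s, \<omega>)) \<partial>claim_law D) else 0) * indicator {0<..TT} s" for s
  proof (cases "s \<in> {0<..t}")
    case True
    then have "(\<integral>\<^sup>+z. d (s, z) * f (s, z) \<partial>claim_law D) = (\<integral>\<^sup>+z. H ((s, \<omega>), z) * ennreal (lam (s, \<omega>)) \<partial>claim_law D)"
      using t pos by (intro nn_integral_cong_AE) (auto simp: d_def f_def clip_eq lam_def mult.commute)
    with True t show ?thesis by simp
  next
    case False
    then show ?thesis by (auto simp: f_def)
  qed
  ultimately show ?thesis unfolding nn_integral_Lb by (simp only:)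
qed

abbreviation NU :: "('a \<times> real \<times> real) measure" where
  "NU \<equiv> P0 D \<Otimes>\<^sub>M (Lb \<Otimes>\<^sub>M claim_law D)"

lemma LF_finite: "finite_measure (Lb \<Otimes>\<^sub>M claim_law D)"
  by (rule finite_measure_pair_measure) unfold_locales

lemma LF_sigma_finite: "sigma_finite_measure (Lb \<Otimes>\<^sub>M claim_law D)"
  using LF_finite by (simp add: finite_measure_def)

lemma pairs_sigma_finite:
  "pair_sigma_finite (P0 D) (Lb \<Otimes>\<^sub>M claim_law D)" "pair_sigma_finite Lb (claim_law D)"
  "pair_sigma_finite (P0 D) Lb" "pair_sigma_finite Lb (P0 D)"
  by (auto simp: pair_sigma_finite_def LF_sigma_finite intro: sigma_finite_measure_axioms
      FL.sigma_finite_measure_axioms Lb.sigma_finite_measure_axioms)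

lemma process_NU: "(\<lambda>x. (fst (snd x), fst x)) \<in> NU \<rightarrow>\<^sub>M PS"
  by measurable

lemma field_NU: "(\<lambda>x. ((fst (snd x), fst x), snd (snd x))) \<in> NU \<rightarrow>\<^sub>M PF"
  by (intro measurable_Pair process_NU measurable_compose[OF measurable_snd measurable_compose[OF measurable_snd claim_law_id]])

lemma space_NU: "space NU = \<Omega> \<times> {0<..TT} \<times> UNIV"
  by (simp add: space_pair_measure)

lemma compensatorD:
  fixes H :: "real \<Rightarrow> real \<Rightarrow> 'a \<Rightarrow> ennreal"
  assumes "predictable_field FF TT H"
  shows "predictable FF TT (\<lambda>t \<omega>. \<integral>\<^sup>+p\<in>{0<..t} \<times> {0<..}. H (fst p) (snd p) \<omega> \<partial>compensator D \<omega>)"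
    and "(\<integral>\<^sup>+\<omega>. (\<integral>\<^sup>+p\<in>{0<..TT} \<times> {0<..}. H (fst p) (snd p) \<omega> \<partial>jump_measure D \<omega>) \<partial>P0 D) =
      (\<integral>\<^sup>+\<omega>. (\<integral>\<^sup>+p\<in>{0<..TT} \<times> {0<..}. H (fst p) (snd p) \<omega> \<partial>compensator D \<omega>) \<partial>P0 D)"
  using compensator[unfolded dual_predictable_projection_def, rule_format, OF assms] by blast+

text \<open>The defining property of the compensator, for nonnegative fields.\<close>

lemma compensation_nn:
  assumes H: "H \<in> borel_measurable PF"
  shows "(\<integral>\<^sup>+\<omega>. (\<integral>\<^sup>+i. H (mark i \<omega>) \<partial>count_space (jumps \<omega>)) \<partial>P0 D) =
    (\<integral>\<^sup>+x. H ((fst (snd x), fst x), snd (snd x)) * ennreal (lam (fst (snd x), fst x)) \<partial>NU)"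
proof -
  let ?g = "\<lambda>x. H ((fst (snd x), fst x), snd (snd x)) * ennreal (lam (fst (snd x), fst x))"
  have m: "?g \<in> borel_measurable NU"
    by (intro borel_measurable_times_ennreal measurable_compose[OF field_NU H]
      measurable_compose[OF measurable_compose[OF process_NU lam_predictable] measurable_ennreal])
  have "(\<integral>\<^sup>+\<omega>. (\<integral>\<^sup>+i. H (mark i \<omega>) \<partial>count_space (jumps \<omega>)) \<partial>P0 D) =
      (\<integral>\<^sup>+\<omega>. (\<integral>\<^sup>+p\<in>{0<..TT} \<times> {0<..}. H ((fst p, \<omega>), snd p) \<partial>jump_measure D \<omega>) \<partial>P0 D)"
    by (intro nn_integral_cong nn_integral_jump_measure[symmetric] H)
  also have "\<dots> = (\<integral>\<^sup>+\<omega>. (\<integral>\<^sup>+p\<in>{0<..TT} \<times> {0<..}. H ((fst p, \<omega>), snd p) \<partial>compensator D \<omega>) \<partial>P0 D)"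
    by (rule compensatorD(2)[OF predictable_fieldI[OF H]])
  also have "\<dots> = (\<integral>\<^sup>+\<omega>. (\<integral>\<^sup>+s. (\<integral>\<^sup>+z. ?g (\<omega>, s, z) \<partial>claim_law D) \<partial>Lb) \<partial>P0 D)"
  proof (rule nn_integral_cong)
    fix \<omega> assume "\<omega> \<in> \<Omega>"
    then show "(\<integral>\<^sup>+p\<in>{0<..TT} \<times> {0<..}. H ((fst p, \<omega>), snd p) \<partial>compensator D \<omega>) =
        (\<integral>\<^sup>+s. (\<integral>\<^sup>+z. ?g (\<omega>, s, z) \<partial>claim_law D) \<partial>Lb)"
      unfolding nn_integral_compensator[OF \<open>\<omega> \<in> \<Omega>\<close> H order_refl] by (intro nn_integral_cong) simp
  qed
  also have "\<dots> = (\<integral>\<^sup>+\<omega>. (\<integral>\<^sup>+y. ?g (\<omega>, y) \<partial>(Lb \<Otimes>\<^sub>M claim_law D)) \<partial>P0 D)"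
  proof (intro nn_integral_cong)
    fix \<omega> assume "\<omega> \<in> \<Omega>"
    then have "(\<lambda>y. ?g (\<omega>, y)) \<in> borel_measurable (Lb \<Otimes>\<^sub>M claim_law D)"
      using m by (rule measurable_compose_Pair1)
    from FL.nn_integral_fst[OF this]
    show "(\<integral>\<^sup>+s. (\<integral>\<^sup>+z. ?g (\<omega>, s, z) \<partial>claim_law D) \<partial>Lb) = (\<integral>\<^sup>+y. ?g (\<omega>, y) \<partial>(Lb \<Otimes>\<^sub>M claim_law D))"
      by simp
  qed
  also have "\<dots> = (\<integral>\<^sup>+x. ?g x \<partial>NU)"
    using sigma_finite_measure.nn_integral_fst[OF LF_sigma_finite m] by simp
  finally show ?thesis .
qed

text \<open>Since \<open>\<lambda>\<^sup>0 > 0\<close>, every density is a density with respect to \<open>\<lambda>\<^sup>0\<close>, so predictability of time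
  integrals is part of what it means to be the compensator.\<close>

lemma time_integral_predictable:
  assumes \<phi>: "\<phi> \<in> borel_measurable PS"
  shows "(\<lambda>p. \<integral>\<^sup>+s. (if s \<le> fst p then \<phi> (s, snd p) else 0) \<partial>Lb) \<in> borel_measurable PS"
proof -
  let ?H = "\<lambda>x :: (real \<times> 'a) \<times> real. \<phi> (fst x) / ennreal (lam (fst x))"
  have H: "?H \<in> borel_measurable PF" using \<phi> by measurable
  have "(\<lambda>p. \<integral>\<^sup>+q\<in>{0<..fst p} \<times> {0<..}. ?H ((fst q, snd p), snd q) \<partial>compensator D (snd p)) \<in> borel_measurable PS"
    using compensatorD(1)[OF predictable_fieldI[OF H]] unfolding predictable_def case_prod_beta .
  moreover have "(\<integral>\<^sup>+q\<in>{0<..fst p} \<times> {0<..}. ?H ((fst q, snd p), snd q) \<partial>compensator D (snd p)) =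
      (\<integral>\<^sup>+s. (if s \<le> fst p then \<phi> (s, snd p) else 0) \<partial>Lb)" if p: "p \<in> space PS" for p
  proof -
    have "(\<integral>\<^sup>+z. ?H ((s, snd p), z) * ennreal (lam (s, snd p)) \<partial>claim_law D) = \<phi> (s, snd p)" if "s \<in> {0<..TT}" for s
    proof -
      have "0 < lam (s, snd p)" using p that by (intro lam_pos) (auto simp: space_PS)
      then have "\<phi> (s, snd p) / ennreal (lam (s, snd p)) * ennreal (lam (s, snd p)) = \<phi> (s, snd p)"
        by (simp add: ennreal_times_divide ennreal_divide_times mult_divide_eq_ennreal)
      then show ?thesis using FL.emeasure_space_1 by simp
    qed
    then show ?thesis
      using p by (subst nn_integral_compensator[OF _ H]) (auto simp: space_PS intro!: nn_integral_cong)
  qed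
  ultimately show ?thesis by (rule measurable_cong[THEN iffD1, rotated])
qed

end

context loss_model
begin

lemma time_integral_predictable_real:
  fixes \<phi> :: "real \<times> 'a \<Rightarrow> real"
  assumes \<phi>: "\<phi> \<in> borel_measurable PS"
  shows "(\<lambda>p. Lb.cumul (\<lambda>s. \<phi> (s, snd p)) (fst p)) \<in> borel_measurable PS"
proof -
  have e: "ennreal \<bar>indicator {..t} s * x\<bar> = (if s \<le> t then ennreal \<bar>x\<bar> else 0)"
    "ennreal (indicator {..t} s * x) = (if s \<le> t then ennreal x else 0)"
    "ennreal (- (indicator {..t} s * x)) = (if s \<le> t then ennreal (- x) else 0)" for x s t :: real
    by auto
  define A where "A f p = (\<integral>\<^sup>+s. (if s \<le> fst p then ennreal (f (\<phi> (s, snd p))) else 0) \<partial>Lb)"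
    for f :: "real \<Rightarrow> real" and p :: "real \<times> 'a"
  have A: "A f \<in> borel_measurable PS" if f: "f \<in> borel_measurable borel" for f
    unfolding A_def[abs_def]
    by (rule time_integral_predictable[OF measurable_compose[OF measurable_compose[OF \<phi> f] measurable_ennreal]])
  have [measurable]: "A abs \<in> borel_measurable PS" "A (\<lambda>x. x) \<in> borel_measurable PS" "A uminus \<in> borel_measurable PS"
    by (rule A, simp)+
  let ?g = "\<lambda>p. if A abs p < \<infinity> then enn2real (A (\<lambda>x. x) p) - enn2real (A uminus p) else 0"
  have "Lb.cumul (\<lambda>s. \<phi> (s, snd p)) (fst p) = ?g p" if p: "p \<in> space PS" for p
  proof -
    obtain r \<omega> where p': "p = (r, \<omega>)" "\<omega> \<in> \<Omega>" using p by (auto simp: space_PS)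
    then have "(\<lambda>s. (s, \<omega>)) \<in> Lb \<rightarrow>\<^sub>M PS" by measurable
    from measurable_compose[OF this \<phi>]
    have m: "(\<lambda>s. indicator {..r} s * \<phi> (s, \<omega>)) \<in> borel_measurable Lb"
      by (rule borel_measurable_times[rotated])
        (rule measurable_compose[OF Lb_id_measurable], simp)
    show ?thesis
      unfolding Lb.cumul_def A_def p' fst_conv snd_conv real_integral_by_parts_of_sign[OF m] e ..
  qed
  moreover have "?g \<in> borel_measurable PS" by measurable
  ultimately show ?thesis by (subst measurable_cong)
qed

lemma NU_measurable:
  assumes "H \<in> PF \<rightarrow>\<^sub>M N"
  shows "(\<lambda>x. H ((fst (snd x), fst x), snd (snd x))) \<in> NU \<rightarrow>\<^sub>M N"
  by (rule measurable_compose[OF field_NU assms])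

lemma NU_process_measurable:
  assumes "X \<in> PS \<rightarrow>\<^sub>M N"
  shows "(\<lambda>x. X (fst (snd x), fst x)) \<in> NU \<rightarrow>\<^sub>M N"
  by (rule measurable_compose[OF process_NU assms])

lemma process_field: "X \<in> PS \<rightarrow>\<^sub>M N \<Longrightarrow> (\<lambda>x. X (fst x)) \<in> PF \<rightarrow>\<^sub>M N"
  by (rule measurable_compose[OF measurable_fst])

lemma NU_lam_pos: "x \<in> space NU \<Longrightarrow> 0 < lam (fst (snd x), fst x)"
  using lam_pos by (auto simp: space_NU)

lemma compensation:
  fixes H :: "(real \<times> 'a) \<times> real \<Rightarrow> real"
  assumes H: "H \<in> borel_measurable PF"
    and int: "integrable NU (\<lambda>x. H ((fst (snd x), fst x), snd (snd x)) * lam (fst (snd x), fst x))"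
  shows "AE \<omega> in P0 D. integrable (count_space (jumps \<omega>)) (\<lambda>i. H (mark i \<omega>))"
    and "integrable (P0 D) (\<lambda>\<omega>. \<integral>i. H (mark i \<omega>) \<partial>count_space (jumps \<omega>))"
    and "(\<integral>\<omega>. (\<integral>i. H (mark i \<omega>) \<partial>count_space (jumps \<omega>)) \<partial>P0 D) =
      (\<integral>x. H ((fst (snd x), fst x), snd (snd x)) * lam (fst (snd x), fst x) \<partial>NU)"
proof -
  let ?h = "\<lambda>x. H ((fst (snd x), fst x), snd (snd x)) * lam (fst (snd x), fst x)"
  define P where "P f \<omega> = (\<integral>\<^sup>+i. ennreal (f (H (mark i \<omega>))) \<partial>count_space (jumps \<omega>))" for f :: "real \<Rightarrow> real" and \<omega>
  have Hf: "(\<lambda>x. ennreal (f (H x))) \<in> borel_measurable PF" if "f \<in> borel_measurable borel" for f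
    by (rule measurable_compose[OF measurable_compose[OF H that] measurable_ennreal])
  have Pm: "P f \<in> borel_measurable (P0 D)" if "f \<in> borel_measurable borel" for f
    unfolding P_def[abs_def] using horizon_pos
    by (intro from_F_measurable[of TT] jump_sum_adapted[OF Hf[OF that]]) simp
  have EP: "(\<integral>\<^sup>+\<omega>. P f \<omega> \<partial>P0 D) = (\<integral>\<^sup>+x. ennreal (f (?h x)) \<partial>NU)"
    if f: "f \<in> borel_measurable borel" and hom: "\<And>x y. 0 < y \<Longrightarrow> ennreal (f (x * y)) = ennreal (f x) * ennreal y" for f
    unfolding P_def compensation_nn[OF Hf[OF f]]
    by (intro nn_integral_cong) (simp only: hom[OF NU_lam_pos])
  have fin: "(\<integral>\<^sup>+x. ennreal \<bar>?h x\<bar> \<partial>NU) < \<infinity>"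
    using int by (simp add: integrable_iff_bounded)
  have Eabs: "(\<integral>\<^sup>+\<omega>. P abs \<omega> \<partial>P0 D) = (\<integral>\<^sup>+x. ennreal \<bar>?h x\<bar> \<partial>NU)"
    by (rule EP) (simp_all add: abs_mult ennreal_mult)
  have Eid: "(\<integral>\<^sup>+\<omega>. P (\<lambda>x. x) \<omega> \<partial>P0 D) = (\<integral>\<^sup>+x. ennreal (?h x) \<partial>NU)"
    by (rule EP) (simp_all add: ennreal_mult'')
  have Emi: "(\<integral>\<^sup>+\<omega>. P uminus \<omega> \<partial>P0 D) = (\<integral>\<^sup>+x. ennreal (- ?h x) \<partial>NU)"
  proof (rule EP)
    fix x y :: real assume "0 < y"
    then show "ennreal (- (x * y)) = ennreal (- x) * ennreal y"
      using ennreal_mult''[of y "- x"] by simp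
  qed simp
  have AEfin: "AE \<omega> in P0 D. P abs \<omega> < \<infinity>"
    using nn_integral_PInf_AE[OF Pm[of abs]] fin Eabs by (simp add: less_top)
  have le: "P (\<lambda>x. x) \<omega> \<le> P abs \<omega>" "P uminus \<omega> \<le> P abs \<omega>" for \<omega>
    unfolding P_def by (intro nn_integral_mono ennreal_leI; simp)+
  show 1: "AE \<omega> in P0 D. integrable (count_space (jumps \<omega>)) (\<lambda>i. H (mark i \<omega>))"
    using AEfin by eventually_elim (simp add: integrable_iff_bounded P_def)
  have hbi: "has_bochner_integral (P0 D) (\<lambda>\<omega>. enn2real (P f \<omega>)) (enn2real (\<integral>\<^sup>+\<omega>. P f \<omega> \<partial>P0 D))"
    if f: "f \<in> borel_measurable borel" and lef: "\<And>\<omega>. P f \<omega> \<le> P abs \<omega>" for f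
  proof (rule has_bochner_integral_nn_integral)
    show "(\<lambda>\<omega>. enn2real (P f \<omega>)) \<in> borel_measurable (P0 D)"
      using Pm[OF f] by (rule measurable_compose) simp
    have "(\<integral>\<^sup>+\<omega>. P f \<omega> \<partial>P0 D) \<le> (\<integral>\<^sup>+\<omega>. P abs \<omega> \<partial>P0 D)"
      by (intro nn_integral_mono lef)
    then have lt: "(\<integral>\<^sup>+\<omega>. P f \<omega> \<partial>P0 D) < \<infinity>" using fin Eabs by simp
    have "(\<integral>\<^sup>+\<omega>. ennreal (enn2real (P f \<omega>)) \<partial>P0 D) = (\<integral>\<^sup>+\<omega>. P f \<omega> \<partial>P0 D)"
    proof (rule nn_integral_cong_AE)
      show "AE \<omega> in P0 D. ennreal (enn2real (P f \<omega>)) = P f \<omega>"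
        using AEfin by eventually_elim (use lef in \<open>auto intro: ennreal_enn2real le_less_trans\<close>)
    qed
    then show "(\<integral>\<^sup>+\<omega>. ennreal (enn2real (P f \<omega>)) \<partial>P0 D) = ennreal (enn2real (\<integral>\<^sup>+\<omega>. P f \<omega> \<partial>P0 D))"
      using lt by simp
  qed simp_all
  have "has_bochner_integral (P0 D) (\<lambda>\<omega>. enn2real (P (\<lambda>x. x) \<omega>) - enn2real (P uminus \<omega>))
      (enn2real (\<integral>\<^sup>+\<omega>. P (\<lambda>x. x) \<omega> \<partial>P0 D) - enn2real (\<integral>\<^sup>+\<omega>. P uminus \<omega> \<partial>P0 D))"
    by (intro has_bochner_integral_diff hbi le) simp_all
  moreover have "enn2real (\<integral>\<^sup>+\<omega>. P (\<lambda>x. x) \<omega> \<partial>P0 D) - enn2real (\<integral>\<^sup>+\<omega>. P uminus \<omega> \<partial>P0 D) = (\<integral>x. ?h x \<partial>NU)"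
    unfolding Eid Emi real_lebesgue_integral_def[OF int] ..
  moreover have ptw: "(\<integral>i. H (mark i \<omega>) \<partial>count_space (jumps \<omega>)) =
      (if P abs \<omega> < \<infinity> then enn2real (P (\<lambda>x. x) \<omega>) - enn2real (P uminus \<omega>) else 0)" for \<omega>
    unfolding P_def by (rule real_integral_by_parts_of_sign) simp
  moreover have "(\<lambda>\<omega>. if P abs \<omega> < \<infinity> then enn2real (P (\<lambda>x. x) \<omega>) - enn2real (P uminus \<omega>) else 0) \<in> borel_measurable (P0 D)"
  proof -
    have [measurable]: "P abs \<in> borel_measurable (P0 D)" "P (\<lambda>x. x) \<in> borel_measurable (P0 D)" "P uminus \<in> borel_measurable (P0 D)"
      by (intro Pm; simp)+
    show ?thesis by measurable
  qed
  ultimately have "has_bochner_integral (P0 D) (\<lambda>\<omega>. \<integral>i. H (mark i \<omega>) \<partial>count_space (jumps \<omega>)) (\<integral>x. ?h x \<partial>NU)"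
    unfolding ptw using AEfin
    by (subst has_bochner_integral_cong_AE[where g="\<lambda>\<omega>. enn2real (P (\<lambda>x. x) \<omega>) - enn2real (P uminus \<omega>)"])
      (auto simp: has_bochner_integral_iff elim!: eventually_mono)
  then show "integrable (P0 D) (\<lambda>\<omega>. \<integral>i. H (mark i \<omega>) \<partial>count_space (jumps \<omega>))"
    and "(\<integral>\<omega>. (\<integral>i. H (mark i \<omega>) \<partial>count_space (jumps \<omega>)) \<partial>P0 D) = (\<integral>x. ?h x \<partial>NU)"
    by (simp_all add: has_bochner_integral_iff)
qed

lemma jump_integral_finite: "finite (jumps \<omega>) \<Longrightarrow>
  (\<integral>i. f i \<partial>count_space (jumps \<omega>)) = (\<Sum>i\<in>jumps \<omega>. f i)" for f :: "nat \<Rightarrow> real"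
  by (rule lebesgue_integral_count_space_finite)

lemma jump_integral_measurable:
  fixes H :: "(real \<times> 'a) \<times> real \<Rightarrow> real"
  assumes H: "H \<in> borel_measurable PF"
  shows "(\<lambda>\<omega>. \<integral>i. H (mark i \<omega>) \<partial>count_space (jumps \<omega>)) \<in> borel_measurable (FF TT)"
proof -
  define P where "P f \<omega> = (\<integral>\<^sup>+i. ennreal (f (H (mark i \<omega>))) \<partial>count_space (jumps \<omega>))" for f :: "real \<Rightarrow> real" and \<omega>
  have "P f \<in> borel_measurable (FF TT)" if "f \<in> borel_measurable borel" for f
    unfolding P_def[abs_def]
    by (rule jump_sum_adapted[OF measurable_compose[OF measurable_compose[OF H that] measurable_ennreal]])
  then have [measurable]: "P abs \<in> borel_measurable (FF TT)" "P (\<lambda>x. x) \<in> borel_measurable (FF TT)" "P uminus \<in> borel_measurable (FF TT)"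
    by simp_all
  have ptw: "(\<integral>i. H (mark i \<omega>) \<partial>count_space (jumps \<omega>)) =
      (if P abs \<omega> < \<infinity> then enn2real (P (\<lambda>x. x) \<omega>) - enn2real (P uminus \<omega>) else 0)" for \<omega>
    unfolding P_def by (rule real_integral_by_parts_of_sign) simp
  show ?thesis unfolding ptw by measurable
qed

subsection \<open>Translation of pathwise integrals\<close>

lemma set_integral_Lb:
  fixes f :: "real \<Rightarrow> real"
  assumes f: "f \<in> borel_measurable Lb" and a: "0 \<le> a"
  shows "(LINT s:{a..TT}|lborel. f s) = (\<integral>s. indicator {a<..} s * f s \<partial>Lb)"
proof -
  have m: "(\<lambda>s. indicator {0<..TT} s *\<^sub>R f s) \<in> borel_measurable lborel"
  proof -
    have "{0<..TT} \<inter> space lborel \<in> sets lborel" by simp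
    from borel_measurable_restrict_space_iff[OF this, of f] f show ?thesis unfolding Lb_def by blast
  qed
  have m1: "(\<lambda>s. indicator {a<..} s * (indicator {0<..TT} s *\<^sub>R f s)) \<in> borel_measurable lborel"
    by (intro borel_measurable_times[OF _ m]) measurable
  have "(\<integral>s. indicator {a<..} s * f s \<partial>Lb) = (\<integral>s. indicator {a<..} s * (indicator {0<..TT} s *\<^sub>R f s) \<partial>lborel)"
    unfolding Lb_def by (subst integral_restrict_space) (auto intro!: Bochner_Integration.integral_cong)
  also have "\<dots> = (\<integral>s. indicator {a..TT} s *\<^sub>R f s \<partial>lborel)"
  proof (rule integral_cong_AE[OF m1])
    have eq: "indicator {a..TT} s *\<^sub>R f s = indicator {a<..} s * (indicator {0<..TT} s *\<^sub>R f s) + (if a \<le> TT then f a else 0) * indicator {a} s" for s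
      using a by (auto split: split_indicator)
    show "(\<lambda>s. indicator {a..TT} s *\<^sub>R f s) \<in> borel_measurable lborel"
      unfolding eq by (intro borel_measurable_add[OF m1]) measurable
    show "AE s in lborel. indicator {a<..} s * (indicator {0<..TT} s *\<^sub>R f s) = indicator {a..TT} s *\<^sub>R f s"
      using AE_lborel_singleton[of a] by eventually_elim (simp only: eq, simp)
  qed
  finally show ?thesis by (simp add: set_lebesgue_integral_def)
qed

lemma measure_int_jump:
  fixes H :: "(real \<times> 'a) \<times> real \<Rightarrow> real"
  assumes \<omega>: "\<omega> \<in> \<Omega>" and H: "H \<in> borel_measurable PF" and ab: "0 \<le> a" "b \<le> TT"
  shows "measure_int (jump_measure D \<omega>) a b (\<lambda>s z. H ((s, \<omega>), z)) =
    (\<integral>i. (if a < tau i \<omega> \<and> tau i \<omega> \<le> b then H (mark i \<omega>) else 0) \<partial>count_space (jumps \<omega>))"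
proof -
  define f where "f p = (indicator {a<..b} (fst p) * indicator {0<..} (snd p)) * H ((clip (fst p), \<omega>), snd p)"
    for p :: "real \<times> real"
  let ?T = "\<lambda>i. (real_of_ereal (claim_time D i \<omega>), claim_size D i \<omega>)"
  let ?C = "{i. claim_time D i \<omega> < \<infinity>}"
  have T: "?T \<in> count_space ?C \<rightarrow>\<^sub>M borel \<Otimes>\<^sub>M borel"
    by (simp add: space_pair_measure)
  have f: "f \<in> borel_measurable (borel \<Otimes>\<^sub>M borel)"
    unfolding f_def[abs_def]
    by (intro borel_measurable_times section_measurable[OF \<omega> H]) measurable
  have "measure_int (jump_measure D \<omega>) a b (\<lambda>s z. H ((s, \<omega>), z)) = (\<integral>p. f p \<partial>jump_measure D \<omega>)"
    unfolding measure_int_def set_lebesgue_integral_def using ab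
    by (intro Bochner_Integration.integral_cong) (auto simp: f_def clip_eq split: split_indicator)
  also have "\<dots> = (\<integral>i. f (?T i) \<partial>count_space ?C)"
    unfolding jump_measure_def by (rule integral_distr[OF T f])
  also have "\<dots> = (\<integral>i. indicator ?C i *\<^sub>R f (?T i) \<partial>count_space UNIV)"
    by (subst integral_restrict_space[symmetric]) (simp_all add: restrict_count_space)
  also have "\<dots> = (\<integral>i. indicator (jumps \<omega>) i *\<^sub>R (if a < tau i \<omega> \<and> tau i \<omega> \<le> b then H (mark i \<omega>) else 0) \<partial>count_space UNIV)"
  proof (rule Bochner_Integration.integral_cong[OF refl])
    fix i
    have "claim_time D i \<omega> < \<infinity> \<Longrightarrow> claim_time D i \<omega> = ereal (tau i \<omega>)"
      using claim_time_pos[OF \<omega>, of i] by (cases "claim_time D i \<omega>") (auto simp: tau_def)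
    then show "indicator ?C i *\<^sub>R f (?T i) = indicator (jumps \<omega>) i *\<^sub>R (if a < tau i \<omega> \<and> tau i \<omega> \<le> b then H (mark i \<omega>) else 0)"
      using tau[OF \<omega>, of i TT] ab
      by (auto simp: f_def jumps_def mark_def clip_eq tau_def[symmetric] split: split_indicator)
  qed
  also have "\<dots> = (\<integral>i. (if a < tau i \<omega> \<and> tau i \<omega> \<le> b then H (mark i \<omega>) else 0) \<partial>count_space (jumps \<omega>))"
    by (subst integral_restrict_space[symmetric]) (simp_all add: restrict_count_space)
  finally show ?thesis .
qed

lemma nn_integral_LF:
  assumes "f \<in> borel_measurable (borel \<Otimes>\<^sub>M borel)"
  shows "(\<integral>\<^sup>+p. f p \<partial>(Lb \<Otimes>\<^sub>M claim_law D)) = (\<integral>\<^sup>+p. f p * indicator {0<..TT} (fst p) \<partial>(lborel \<Otimes>\<^sub>M claim_law D))"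
proof -
  have 1: "f \<in> borel_measurable (lborel \<Otimes>\<^sub>M claim_law D)"
    using assms unfolding measurable_cong_sets[OF sets_lborel_claim refl] .
  have id: "(\<lambda>p. (fst p, snd p)) \<in> Lb \<Otimes>\<^sub>M claim_law D \<rightarrow>\<^sub>M borel \<Otimes>\<^sub>M borel"
    by (intro measurable_Pair measurable_compose[OF measurable_fst Lb_id_measurable]
      measurable_compose[OF measurable_snd claim_law_id])
  have 2: "f \<in> borel_measurable (Lb \<Otimes>\<^sub>M claim_law D)"
    using measurable_compose[OF id assms] by simp
  have 3: "(\<lambda>p. f p * indicator {0<..TT} (fst p)) \<in> borel_measurable (lborel \<Otimes>\<^sub>M claim_law D)"
    by (intro borel_measurable_times_ennreal[OF 1]) measurable
  have "(\<integral>\<^sup>+p. f p \<partial>(Lb \<Otimes>\<^sub>M claim_law D)) = (\<integral>\<^sup>+s. (\<integral>\<^sup>+z. f (s, z) \<partial>claim_law D) * indicator {0<..TT} s \<partial>lborel)"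
    unfolding FL.nn_integral_fst[OF 2, symmetric] nn_integral_Lb ..
  also have "\<dots> = (\<integral>\<^sup>+s. (\<integral>\<^sup>+z. f (s, z) * indicator {0<..TT} s \<partial>claim_law D) \<partial>lborel)"
    by (intro nn_integral_cong) (auto split: split_indicator)
  also have "\<dots> = (\<integral>\<^sup>+p. f p * indicator {0<..TT} (fst p) \<partial>(lborel \<Otimes>\<^sub>M claim_law D))"
    using FL.nn_integral_fst[OF 3] by simp
  finally show ?thesis .
qed

lemma measure_int_compensator:
  fixes H :: "(real \<times> 'a) \<times> real \<Rightarrow> real"
  assumes \<omega>: "\<omega> \<in> \<Omega>" and H: "H \<in> borel_measurable PF" and ab: "0 \<le> a" "b \<le> TT"
  shows "measure_int (compensator D \<omega>) a b (\<lambda>s z. H ((s, \<omega>), z)) =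
    (\<integral>p. indicator {a<..b} (fst p) * (H ((fst p, \<omega>), snd p) * lam (fst p, \<omega>)) \<partial>(Lb \<Otimes>\<^sub>M claim_law D))"
proof -
  define f where "f p = (indicator {a<..b} (fst p) * indicator {0<..} (snd p)) * H ((clip (fst p), \<omega>), snd p)"
    for p :: "real \<times> real"
  define d where "d p = (if fst p \<in> {0..TT} then intensity D (fst p) \<omega> else 0)" for p :: "real \<times> real"
  let ?L = "lborel \<Otimes>\<^sub>M claim_law D"
  have fb: "f \<in> borel_measurable (borel \<Otimes>\<^sub>M borel)"
    unfolding f_def[abs_def]
    by (intro borel_measurable_times section_measurable[OF \<omega> H]) measurable
  have db: "d \<in> borel_measurable (borel \<Otimes>\<^sub>M borel)"
    unfolding d_def[abs_def] by (rule compensator_density_measurable[OF \<omega>])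
  have dfb: "(\<lambda>p. d p * f p) \<in> borel_measurable (borel \<Otimes>\<^sub>M borel)"
    by (rule borel_measurable_times[OF db fb])
  note toL = measurable_cong_sets[OF sets_lborel_claim refl]
  have df: "(\<lambda>p. d p * f p) \<in> borel_measurable ?L" "f \<in> borel_measurable ?L" "d \<in> borel_measurable ?L"
    unfolding toL by (rule dfb fb db)+
  have d0: "0 \<le> d p" for p unfolding d_def using intensity_pos[OF _ \<omega>, of "fst p"] by (simp add: less_imp_le)
  have id: "(\<lambda>p. (fst p, snd p)) \<in> Lb \<Otimes>\<^sub>M claim_law D \<rightarrow>\<^sub>M borel \<Otimes>\<^sub>M borel"
    by (intro measurable_Pair measurable_compose[OF measurable_fst Lb_id_measurable]
      measurable_compose[OF measurable_snd claim_law_id])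
  have dfL: "(\<lambda>p. d p * f p) \<in> borel_measurable (Lb \<Otimes>\<^sub>M claim_law D)"
    using measurable_compose[OF id dfb] by simp
  have f0: "f p = 0" if "fst p \<notin> {0<..TT}" for p using that ab by (auto simp: f_def split: split_indicator)
  have eqn: "(\<integral>\<^sup>+p. ennreal (g (d p * f p)) \<partial>?L) = (\<integral>\<^sup>+p. ennreal (g (d p * f p)) \<partial>(Lb \<Otimes>\<^sub>M claim_law D))"
    if g: "g \<in> borel_measurable borel" "g 0 = 0" for g :: "real \<Rightarrow> real"
  proof -
    have "(\<lambda>p. ennreal (g (d p * f p))) \<in> borel_measurable (borel \<Otimes>\<^sub>M borel)"
      by (rule measurable_compose[OF measurable_compose[OF dfb g(1)] measurable_ennreal])
    from nn_integral_LF[OF this] show ?thesis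
      by (auto intro!: nn_integral_cong simp: g(2) f0 split: split_indicator)
  qed
  have "measure_int (compensator D \<omega>) a b (\<lambda>s z. H ((s, \<omega>), z)) = (\<integral>p. f p \<partial>compensator D \<omega>)"
    unfolding measure_int_def set_lebesgue_integral_def using ab
    by (intro Bochner_Integration.integral_cong) (auto simp: f_def clip_eq split: split_indicator)
  also have "\<dots> = (\<integral>p. d p * f p \<partial>?L)"
    unfolding compensator_eq d_def[symmetric]
    by (subst integral_density[OF df(2,3)]) (simp_all add: d0)
  also have "\<dots> = (\<integral>p. d p * f p \<partial>(Lb \<Otimes>\<^sub>M claim_law D))"
    unfolding real_integral_by_parts_of_sign[OF df(1)] real_integral_by_parts_of_sign[OF dfL]
    using eqn[of abs] eqn[of "\<lambda>x. x"] eqn[of uminus] by simp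
  also have "\<dots> = (\<integral>p. indicator {a<..b} (fst p) * (H ((fst p, \<omega>), snd p) * lam (fst p, \<omega>)) \<partial>(Lb \<Otimes>\<^sub>M claim_law D))"
  proof (rule integral_cong_AE[OF dfL])
    have "(\<lambda>p. (fst p, \<omega>)) \<in> Lb \<Otimes>\<^sub>M claim_law D \<rightarrow>\<^sub>M PS" using \<omega> by measurable
    then have "(\<lambda>p. ((fst p, \<omega>), snd p)) \<in> Lb \<Otimes>\<^sub>M claim_law D \<rightarrow>\<^sub>M PF"
      by (intro measurable_Pair measurable_compose[OF measurable_snd claim_law_id])
    from measurable_compose[OF this H] measurable_compose[OF this process_field[OF lam_predictable]]
    show m2: "(\<lambda>p. indicator {a<..b} (fst p) * (H ((fst p, \<omega>), snd p) * lam (fst p, \<omega>))) \<in> borel_measurable (Lb \<Otimes>\<^sub>M claim_law D)"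
      by (intro borel_measurable_times measurable_compose[OF measurable_compose[OF measurable_fst Lb_id_measurable]
          borel_measurable_indicator]) simp_all
    have "AE z in claim_law D. d (s, z) * f (s, z) = indicator {a<..b} s * (H ((s, \<omega>), z) * lam (s, \<omega>))" if "s \<in> space Lb" for s
      using claim_law_pos by eventually_elim (use that in \<open>auto simp: d_def f_def clip_eq lam_def split: split_indicator\<close>)
    then have ae: "AE s in Lb. AE z in claim_law D. d (s, z) * f (s, z) = indicator {a<..b} s * (H ((s, \<omega>), z) * lam (s, \<omega>))"
      by (rule AE_I2)
    show "AE p in Lb \<Otimes>\<^sub>M claim_law D. d p * f p = indicator {a<..b} (fst p) * (H ((fst p, \<omega>), snd p) * lam (fst p, \<omega>))"
    proof (rule pair_sigma_finite.AE_pair_measure[OF pairs_sigma_finite(2)])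
      show "AE s in Lb. AE z in claim_law D. d (s, z) * f (s, z) =
          indicator {a<..b} (fst (s, z)) * (H ((fst (s, z), \<omega>), snd (s, z)) * lam (fst (s, z), \<omega>))"
        using ae by (simp only: fst_conv snd_conv)
    qed (rule borel_measurable_eq[OF dfL m2])
  qed
  finally show ?thesis .
qed

end

section \<open>Moments\<close>

lemma jumps_with_few_predecessors:
  fixes \<tau> :: "nat \<Rightarrow> real" and k :: nat
  assumes J: "finite J" "inj_on \<tau> J"
  defines "c \<equiv> \<lambda>s. card {j\<in>J. \<tau> j < s}"
  defines "J' \<equiv> {i\<in>J. c (\<tau> i) < k}"
  shows "(\<Sum>i\<in>J'. 2 * c (\<tau> i) + 1) = (card J')\<^sup>2"
    and "c s < k \<Longrightarrow> c s \<le> card J'"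
    and "card J' \<le> k"
    and "card J < k \<Longrightarrow> J' = J"
proof -
  have fin: "finite J'" using J by (simp add: J'_def)
  have inj: "inj_on \<tau> J'" using J by (auto simp: J'_def intro: inj_on_subset)
  have c_mono: "c r \<le> c s" if "r \<le> s" for r s
    unfolding c_def using J that by (intro card_mono) auto
  have sub: "{j\<in>J. \<tau> j < s} \<subseteq> J'" if "c s < k" for s
  proof
    fix j assume j: "j \<in> {j\<in>J. \<tau> j < s}"
    then have "c (\<tau> j) \<le> c s" by (intro c_mono) simp
    then show "j \<in> J'" using j that by (simp add: J'_def)
  qed
  have eq: "{j\<in>J'. \<tau> j < \<tau> i} = {j\<in>J. \<tau> j < \<tau> i}" if "i \<in> J'" for i
    using sub[of "\<tau> i"] that by (auto simp: J'_def)
  have "(\<Sum>i\<in>J'. (1::real)) * (\<Sum>i\<in>J'. 1) =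
      (\<Sum>i\<in>J'. 1 * (\<Sum>j\<in>{j\<in>J'. \<tau> j < \<tau> i}. 1) + (\<Sum>j\<in>{j\<in>J'. \<tau> j < \<tau> i}. 1) * 1 + 1 * 1)"
  proof -
    interpret diffuse_time lborel by unfold_locales (auto intro: AE_lborel_singleton)
    show ?thesis by (rule product_of_sums[OF fin inj])
  qed
  also have "\<dots> = (\<Sum>i\<in>J'. 2 * real (c (\<tau> i)) + 1)"
    by (intro sum.cong refl) (simp add: eq c_def)
  finally have "real (\<Sum>i\<in>J'. 2 * c (\<tau> i) + 1) = real ((card J')\<^sup>2)"
    by (simp add: power2_eq_square add.commute)
  then show "(\<Sum>i\<in>J'. 2 * c (\<tau> i) + 1) = (card J')\<^sup>2" by linarith
  show "c s \<le> card J'" if "c s < k" unfolding c_def using sub[OF that] fin by (rule card_mono[rotated])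
  show "card J' \<le> k"
  proof (cases "J' = {}")
    case False
    have "Max (\<tau> ` J') \<in> \<tau> ` J'" using fin False by (intro Max_in) auto
    then obtain m where m: "m \<in> J'" "\<tau> m = Max (\<tau> ` J')" by auto
    have "J' - {m} \<subseteq> {j\<in>J. \<tau> j < \<tau> m}"
    proof
      fix j assume j: "j \<in> J' - {m}"
      then have "\<tau> j \<le> \<tau> m" using m fin by simp
      moreover have "\<tau> j \<noteq> \<tau> m" using inj_onD[OF inj, of j m] j m(1) by auto
      ultimately show "j \<in> {j\<in>J. \<tau> j < \<tau> m}" using j by (auto simp: J'_def)
    qed
    then have "card (J' - {m}) \<le> c (\<tau> m)" unfolding c_def using J by (intro card_mono) auto
    moreover have "c (\<tau> m) < k" using m(1) by (simp add: J'_def)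
    moreover have "card (J' - {m}) = card J' - 1" using m(1) by simp
    ultimately show ?thesis by linarith
  qed simp
  show "J' = J" if "card J < k"
  proof -
    have "c (\<tau> i) \<le> card J" for i unfolding c_def using J by (intro card_mono) auto
    then show ?thesis using that by (auto simp: J'_def intro: le_less_trans)
  qed
qed

locale regular_loss_model = loss_model +
  assumes loss_moment: "integrable (P0 D)
      (\<lambda>\<omega>. exp (2 * risk_av D * exp (rate D * horizon D) * loss D (horizon D) \<omega>))"
    and intensity_exp_moment:
      "integrable (P0 D) (\<lambda>\<omega>. exp (4 * (LINT s:{0..horizon D}|lborel. intensity D s \<omega>)))"
    and intensity_square:
      "(\<integral>\<^sup>+\<omega>. (\<integral>\<^sup>+t\<in>{0..horizon D}. ennreal ((intensity D t \<omega>)\<^sup>2) \<partial>lborel) \<partial>P0 D) < \<infinity>"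

context loss_model
begin

definition Lam :: "'a \<Rightarrow> real" where "Lam \<omega> = (\<integral>s. lam (s, \<omega>) \<partial>Lb)"

definition regular :: "'a \<Rightarrow> bool" where
  "regular \<omega> \<longleftrightarrow> \<omega> \<in> \<Omega> \<and> finite (jumps \<omega>) \<and> integrable Lb (\<lambda>s. lam (s, \<omega>))"

lemma process_section: "X \<in> PS \<rightarrow>\<^sub>M N \<Longrightarrow> \<omega> \<in> \<Omega> \<Longrightarrow> (\<lambda>s. X (s, \<omega>)) \<in> Lb \<rightarrow>\<^sub>M N"
proof -
  assume X: "X \<in> PS \<rightarrow>\<^sub>M N" and "\<omega> \<in> \<Omega>"
  then have "(\<lambda>s. (s, \<omega>)) \<in> Lb \<rightarrow>\<^sub>M PS" by measurable
  from measurable_compose[OF this X] show ?thesis .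
qed

lemma PL_process: "X \<in> PS \<rightarrow>\<^sub>M N \<Longrightarrow> (\<lambda>q. X (snd q, fst q)) \<in> P0 D \<Otimes>\<^sub>M Lb \<rightarrow>\<^sub>M N"
proof -
  assume X: "X \<in> PS \<rightarrow>\<^sub>M N"
  have "(\<lambda>q. (snd q, fst q)) \<in> P0 D \<Otimes>\<^sub>M Lb \<rightarrow>\<^sub>M PS" by measurable
  from measurable_compose[OF this X] show ?thesis .
qed

lemma nn_integral_NU:
  assumes m: "g \<in> borel_measurable NU"
  shows "(\<integral>\<^sup>+x. g x \<partial>NU) = (\<integral>\<^sup>+\<omega>. (\<integral>\<^sup>+s. (\<integral>\<^sup>+z. g (\<omega>, s, z) \<partial>claim_law D) \<partial>Lb) \<partial>P0 D)"
proof -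
  have "(\<integral>\<^sup>+s. (\<integral>\<^sup>+z. g (\<omega>, s, z) \<partial>claim_law D) \<partial>Lb) = (\<integral>\<^sup>+y. g (\<omega>, y) \<partial>(Lb \<Otimes>\<^sub>M claim_law D))"
    if "\<omega> \<in> \<Omega>" for \<omega>
    using FL.nn_integral_fst[OF measurable_compose_Pair1[OF that m]] by simp
  then show ?thesis
    using sigma_finite_measure.nn_integral_fst[OF LF_sigma_finite m] by (simp cong: nn_integral_cong)
qed

lemma nn_integral_NU_weight:
  assumes W: "W \<in> borel_measurable (P0 D)" and X: "X \<in> borel_measurable PS"
  shows "(\<integral>\<^sup>+x. W (fst x) * X (fst (snd x), fst x) \<partial>NU) = (\<integral>\<^sup>+\<omega>. W \<omega> * (\<integral>\<^sup>+s. X (s, \<omega>) \<partial>Lb) \<partial>P0 D)"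
proof -
  have "(\<lambda>x. W (fst x) * X (fst (snd x), fst x)) \<in> borel_measurable NU"
    by (intro borel_measurable_times_ennreal measurable_compose[OF measurable_fst W] NU_process_measurable X)
  from nn_integral_NU[OF this] show ?thesis
    by (simp add: FL.emeasure_space_1[simplified] nn_integral_cmult process_section[OF X] cong: nn_integral_cong)
qed

lemma Lam_measurable[measurable]: "Lam \<in> borel_measurable (P0 D)"
proof -
  have "(\<lambda>(\<omega>, s). lam (s, \<omega>)) \<in> borel_measurable (P0 D \<Otimes>\<^sub>M Lb)"
    using PL_process[OF lam_predictable] by (simp add: split_beta')
  from Lb.borel_measurable_lebesgue_integral[OF this]
  show ?thesis by (simp add: Lam_def[abs_def])
qed

lemma Lam_nonneg: "\<omega> \<in> \<Omega> \<Longrightarrow> 0 \<le> Lam \<omega>"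
  unfolding Lam_def by (intro integral_nonneg_AE AE_I2 less_imp_le lam_pos) auto

lemma regular_nn_Lam:
  assumes "regular \<omega>" shows "(\<integral>\<^sup>+s. ennreal (lam (s, \<omega>)) \<partial>Lb) = ennreal (Lam \<omega>)"
  unfolding Lam_def using assms
  by (intro nn_integral_eq_integral AE_I2) (auto simp: regular_def intro!: less_imp_le lam_pos)

lemma Lam_eq: "\<omega> \<in> \<Omega> \<Longrightarrow> (LINT s:{0..TT}|lborel. intensity D s \<omega>) = Lam \<omega>"
  using set_integral_Lb[OF process_section[OF lam_predictable], of \<omega> 0]
  by (auto simp: lam_def Lam_def intro!: Bochner_Integration.integral_cong)

end

context regular_loss_model
begin

lemma exp_Lam_integrable: "integrable (P0 D) (\<lambda>\<omega>. exp (4 * Lam \<omega>))"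
  using intensity_exp_moment by (rule Bochner_Integration.integrable_cong[THEN iffD1, rotated 2]) (simp_all add: Lam_eq)

lemma exp_Lam_nn: "(\<integral>\<^sup>+\<omega>. ennreal (exp (4 * Lam \<omega>)) \<partial>P0 D) < \<infinity>"
  using exp_Lam_integrable by (simp add: integrable_iff_bounded)

lemma lam_integrable_AE: "AE \<omega> in P0 D. integrable Lb (\<lambda>s. lam (s, \<omega>))"
proof -
  define q where "q p = ennreal ((lam p)\<^sup>2)" for p
  have q: "q \<in> borel_measurable PS" unfolding q_def[abs_def] using lam_predictable by simp
  have qm: "(\<lambda>\<omega>. \<integral>\<^sup>+s. q (s, \<omega>) \<partial>Lb) \<in> borel_measurable (P0 D)"
    using Lb.borel_measurable_nn_integral[of "\<lambda>\<omega> s. q (s, \<omega>)" "P0 D"] PL_process[OF q]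
    by (simp add: split_beta')
  have "(\<integral>\<^sup>+\<omega>. (\<integral>\<^sup>+s. q (s, \<omega>) \<partial>Lb) \<partial>P0 D) \<le>
      (\<integral>\<^sup>+\<omega>. (\<integral>\<^sup>+t\<in>{0..TT}. ennreal ((intensity D t \<omega>)\<^sup>2) \<partial>lborel) \<partial>P0 D)"
    unfolding nn_integral_Lb q_def lam_def
    by (intro nn_integral_mono) (auto split: split_indicator)
  with intensity_square have "(\<integral>\<^sup>+\<omega>. (\<integral>\<^sup>+s. q (s, \<omega>) \<partial>Lb) \<partial>P0 D) \<noteq> \<infinity>" by auto
  from nn_integral_PInf_AE[OF qm this]
  have "AE \<omega> in P0 D. \<omega> \<in> \<Omega> \<and> (\<integral>\<^sup>+s. q (s, \<omega>) \<partial>Lb) \<noteq> \<infinity>" by auto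
  then show ?thesis
  proof eventually_elim
    case (elim \<omega>)
    note ms = process_section[OF q, of \<omega>] process_section[OF lam_predictable, of \<omega>]
    have "(\<integral>\<^sup>+s. ennreal (norm (lam (s, \<omega>))) \<partial>Lb) \<le> (\<integral>\<^sup>+s. 1 + q (s, \<omega>) \<partial>Lb)"
    proof (rule nn_integral_mono)
      fix s assume "s \<in> space Lb"
      have "\<bar>lam (s, \<omega>)\<bar> \<le> 1 + (lam (s, \<omega>))\<^sup>2"
      proof -
        have "0 \<le> (\<bar>lam (s, \<omega>)\<bar> - 1/2)\<^sup>2" by simp
        then show ?thesis by (simp add: power2_eq_square algebra_simps)
      qed
      then show "ennreal (norm (lam (s, \<omega>))) \<le> 1 + q (s, \<omega>)"
        using ennreal_leI[of "\<bar>lam (s, \<omega>)\<bar>" "1 + (lam (s, \<omega>))\<^sup>2"] by (simp add: q_def ennreal_plus)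
    qed
    also have "\<dots> = emeasure Lb (space Lb) + (\<integral>\<^sup>+s. q (s, \<omega>) \<partial>Lb)"
      using ms elim by (subst nn_integral_add) auto
    also have "\<dots> < \<infinity>" using elim emeasure_Lb by (simp add: less_top)
    finally show ?case using ms elim by (intro integrableI_bounded) auto
  qed
qed

lemma finite_jumps_AE: "AE \<omega> in P0 D. finite (jumps \<omega>)"
proof -
  have "(\<integral>\<^sup>+\<omega>. (\<integral>\<^sup>+i. 1 \<partial>count_space (jumps \<omega>)) \<partial>P0 D) = (\<integral>\<^sup>+x. 1 * ennreal (lam (fst (snd x), fst x)) \<partial>NU)"
    using compensation_nn[of "\<lambda>_. 1"] by simp
  also have "\<dots> = (\<integral>\<^sup>+\<omega>. 1 * (\<integral>\<^sup>+s. ennreal (lam (s, \<omega>)) \<partial>Lb) \<partial>P0 D)"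
    by (rule nn_integral_NU_weight) (simp_all add: lam_predictable)
  also have "\<dots> \<le> (\<integral>\<^sup>+\<omega>. ennreal (exp (4 * Lam \<omega>)) \<partial>P0 D)"
  proof (rule nn_integral_mono_AE)
    show "AE \<omega> in P0 D. 1 * (\<integral>\<^sup>+s. ennreal (lam (s, \<omega>)) \<partial>Lb) \<le> ennreal (exp (4 * Lam \<omega>))"
      using lam_integrable_AE AE_space
    proof eventually_elim
      case (elim \<omega>)
      have "(\<integral>\<^sup>+s. ennreal (lam (s, \<omega>)) \<partial>Lb) = ennreal (Lam \<omega>)"
        unfolding Lam_def using elim
        by (intro nn_integral_eq_integral AE_I2) (auto intro!: less_imp_le lam_pos)
      moreover have "Lam \<omega> \<le> exp (4 * Lam \<omega>)"
        using exp_ge_add_one_self[of "4 * Lam \<omega>"] Lam_nonneg[OF elim(2)] by linarith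
      ultimately show ?case by (simp add: ennreal_leI)
    qed
  qed
  also have "\<dots> < \<infinity>" by (rule exp_Lam_nn)
  finally have fin: "(\<integral>\<^sup>+\<omega>. (\<integral>\<^sup>+i. 1 \<partial>count_space (jumps \<omega>)) \<partial>P0 D) \<noteq> \<infinity>" by simp
  have "(\<lambda>\<omega>. \<integral>\<^sup>+i. 1 \<partial>count_space (jumps \<omega>)) \<in> borel_measurable (P0 D)"
    using jump_sum_adapted[of "\<lambda>_. 1"] horizon_pos by (intro from_F_measurable[of TT]) auto
  from nn_integral_PInf_AE[OF this fin] show ?thesis
    by eventually_elim (simp add: nn_integral_count_space_eq emeasure_count_space split: if_splits)
qed

lemma regular_AE: "AE \<omega> in P0 D. regular \<omega>"
  using finite_jumps_AE lam_integrable_AE AE_space by eventually_elim (simp add: regular_def)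

text \<open>The number of claims is square integrable. In \<open>N\<^sup>2 = \<Sum>\<^sub>i (2 i + 1)\<close> every summand is a predictable
  function of the past, so \<open>E N\<^sup>2 = E \<integral> (2 N\<^sub>- + 1) \<lambda> dt \<le> E ((2 N + 1) \<Lambda>)\<close>; the truncation at \<open>k\<close>
  makes it possible to absorb the first summand.\<close>

lemma card_jumps_square: "(\<integral>\<^sup>+\<omega>. ennreal ((real (card (jumps \<omega>)))\<^sup>2) \<partial>P0 D) < \<infinity>"
proof -
  define cnt where "cnt p = (\<integral>\<^sup>+i. (if tau i (snd p) < fst p then 1 else 0) \<partial>count_space (jumps (snd p)))"
    for p :: "real \<times> 'a"
  have cntm: "cnt \<in> borel_measurable PS"
    unfolding cnt_def[abs_def] using jump_sum_before_predictable[of "\<lambda>_. 1"] by simp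
  have cnt: "cnt (s, \<omega>) = of_nat (card {j\<in>jumps \<omega>. tau j \<omega> < s})" if "finite (jumps \<omega>)" for s \<omega>
    using that by (simp add: cnt_def nn_integral_count_space_finite sum.If_cases Int_def)
  define Hk where "Hk k p = (if cnt p < of_nat k then 2 * cnt p + 1 else 0)" for k :: nat and p
  have Hk: "Hk k \<in> borel_measurable PS" for k unfolding Hk_def[abs_def] using cntm by measurable
  note HkF = process_field[OF Hk]
  define Xk where "Xk k \<omega> = (\<integral>\<^sup>+i. Hk k (fst (mark i \<omega>)) \<partial>count_space (jumps \<omega>))" for k \<omega>
  have Xkm: "Xk k \<in> borel_measurable (P0 D)" for k
    unfolding Xk_def[abs_def] using jump_sum_adapted[OF HkF] horizon_pos by (intro from_F_measurable[of TT]) auto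
  define y where "y k \<omega> = card {i\<in>jumps \<omega>. card {j\<in>jumps \<omega>. tau j \<omega> < tau i \<omega>} < k}" for k \<omega>
  have Xk: "Xk k \<omega> = of_nat ((y k \<omega>)\<^sup>2)" if "regular \<omega>" for k \<omega>
  proof -
    have f: "finite (jumps \<omega>)" "inj_on (\<lambda>i. tau i \<omega>) (jumps \<omega>)" using that inj_tau by (auto simp: regular_def)
    have "Xk k \<omega> = (\<Sum>i\<in>jumps \<omega>. if card {j\<in>jumps \<omega>. tau j \<omega> < tau i \<omega>} < k
        then of_nat (2 * card {j\<in>jumps \<omega>. tau j \<omega> < tau i \<omega>} + 1) else 0)"
      unfolding Xk_def nn_integral_count_space_finite[OF f(1)]
      by (intro sum.cong refl) (simp add: Hk_def mark_def cnt[OF f(1)])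
    also have "\<dots> = of_nat (\<Sum>i\<in>{i\<in>jumps \<omega>. card {j\<in>jumps \<omega>. tau j \<omega> < tau i \<omega>} < k}.
        2 * card {j\<in>jumps \<omega>. tau j \<omega> < tau i \<omega>} + 1)"
      using f(1) by (simp only: sum.inter_filter of_nat_sum) (intro sum.cong refl, simp)
    finally show ?thesis unfolding jumps_with_few_predecessors(1)[OF f] y_def .
  qed
  have Hle: "Hk k (s, \<omega>) \<le> of_nat (2 * y k \<omega> + 1)" if "regular \<omega>" for k s \<omega>
  proof -
    have f: "finite (jumps \<omega>)" "inj_on (\<lambda>i. tau i \<omega>) (jumps \<omega>)" using that inj_tau by (auto simp: regular_def)
    show ?thesis
    proof (cases "card {j\<in>jumps \<omega>. tau j \<omega> < s} < k")
      case True
      then have "card {j\<in>jumps \<omega>. tau j \<omega> < s} \<le> y k \<omega>"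
        unfolding y_def by (rule jumps_with_few_predecessors(2)[OF f])
      then have "of_nat (2 * card {j\<in>jumps \<omega>. tau j \<omega> < s} + 1) \<le> (of_nat (2 * y k \<omega> + 1) :: ennreal)"
        by (intro of_nat_mono) simp
      then show ?thesis using True by (simp add: Hk_def cnt[OF f(1)])
    qed (simp add: Hk_def cnt[OF f(1)])
  qed
  let ?C = "\<integral>\<^sup>+\<omega>. ennreal (exp (4 * Lam \<omega>)) \<partial>P0 D"
  have bound: "(\<integral>\<^sup>+\<omega>. Xk k \<omega> \<partial>P0 D) \<le> 2 * ?C" for k
  proof -
    have "(\<integral>\<^sup>+\<omega>. Xk k \<omega> \<partial>P0 D) = (\<integral>\<^sup>+x. Hk k (fst (snd x), fst x) * ennreal (lam (fst (snd x), fst x)) \<partial>NU)"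
      unfolding Xk_def using compensation_nn[OF HkF] by simp
    also have "\<dots> = (\<integral>\<^sup>+\<omega>. (\<integral>\<^sup>+s. Hk k (s, \<omega>) * ennreal (lam (s, \<omega>)) \<partial>Lb) \<partial>P0 D)"
      using nn_integral_NU_weight[of "\<lambda>_. 1" "\<lambda>p. Hk k p * ennreal (lam p)"] Hk lam_predictable by simp
    also have "\<dots> \<le> (\<integral>\<^sup>+\<omega>. ennreal (1/2) * Xk k \<omega> + ennreal (exp (4 * Lam \<omega>)) \<partial>P0 D)"
    proof (rule nn_integral_mono_AE)
      show "AE \<omega> in P0 D. (\<integral>\<^sup>+s. Hk k (s, \<omega>) * ennreal (lam (s, \<omega>)) \<partial>Lb) \<le> ennreal (1/2) * Xk k \<omega> + ennreal (exp (4 * Lam \<omega>))"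
        using regular_AE
      proof eventually_elim
        case (elim \<omega>)
        then have \<omega>: "\<omega> \<in> \<Omega>" by (simp add: regular_def)
        let ?y = "real (y k \<omega>)"
        have "(\<integral>\<^sup>+s. Hk k (s, \<omega>) * ennreal (lam (s, \<omega>)) \<partial>Lb) \<le> (\<integral>\<^sup>+s. of_nat (2 * y k \<omega> + 1) * ennreal (lam (s, \<omega>)) \<partial>Lb)"
          by (intro nn_integral_mono mult_right_mono Hle[OF elim]) simp
        also have "\<dots> = of_nat (2 * y k \<omega> + 1) * ennreal (Lam \<omega>)"
          unfolding regular_nn_Lam[OF elim, symmetric]
          by (rule nn_integral_cmult) (rule measurable_compose[OF process_section[OF lam_predictable \<omega>] measurable_ennreal])
        also have "\<dots> = ennreal ((2 * ?y + 1) * Lam \<omega>)"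
        proof -
          have "(of_nat (2 * y k \<omega> + 1) :: ennreal) = ennreal (2 * ?y + 1)"
            unfolding ennreal_of_nat_eq_real_of_nat by (rule arg_cong[where f=ennreal]) simp
          then show ?thesis using Lam_nonneg[OF \<omega>] by (simp only: ennreal_mult[symmetric])
        qed
        also have "\<dots> \<le> ennreal (1/2 * ?y\<^sup>2 + exp (4 * Lam \<omega>))"
        proof (rule ennreal_leI)
          have "1 + 4 * Lam \<omega> + (4 * Lam \<omega>)\<^sup>2 / 2 \<le> exp (4 * Lam \<omega>)"
            using Lam_nonneg[OF \<omega>] by (intro exp_lower_Taylor_quadratic) simp
          moreover have "(4 * Lam \<omega>)\<^sup>2 = 16 * (Lam \<omega>)\<^sup>2" by (simp add: power2_eq_square)
          moreover have "0 \<le> (?y - 2 * Lam \<omega>)\<^sup>2" by simp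
          moreover have "(?y - 2 * Lam \<omega>)\<^sup>2 = ?y\<^sup>2 - 4 * (?y * Lam \<omega>) + 4 * (Lam \<omega>)\<^sup>2"
            by (simp add: power2_eq_square algebra_simps)
          moreover have "(2 * ?y + 1) * Lam \<omega> = 2 * (?y * Lam \<omega>) + Lam \<omega>" by (simp add: algebra_simps)
          ultimately show "(2 * ?y + 1) * Lam \<omega> \<le> 1/2 * ?y\<^sup>2 + exp (4 * Lam \<omega>)"
            using Lam_nonneg[OF \<omega>] zero_le_power2[of "Lam \<omega>"] by linarith
        qed
        also have "\<dots> = ennreal (1/2) * Xk k \<omega> + ennreal (exp (4 * Lam \<omega>))"
          unfolding Xk[OF elim] ennreal_of_nat_eq_real_of_nat
          by (subst ennreal_mult[symmetric]) (simp_all add: ennreal_plus)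
        finally show ?case .
      qed
    qed
    also have "\<dots> = ennreal (1/2) * (\<integral>\<^sup>+\<omega>. Xk k \<omega> \<partial>P0 D) + ?C"
      using Xkm[of k] by (subst nn_integral_add) (simp_all add: nn_integral_cmult)
    finally have le: "(\<integral>\<^sup>+\<omega>. Xk k \<omega> \<partial>P0 D) \<le> ennreal (1/2) * (\<integral>\<^sup>+\<omega>. Xk k \<omega> \<partial>P0 D) + ?C" .
    have "(\<integral>\<^sup>+\<omega>. Xk k \<omega> \<partial>P0 D) \<le> (\<integral>\<^sup>+\<omega>. of_nat (k\<^sup>2) \<partial>P0 D)"
    proof (rule nn_integral_mono_AE)
      show "AE \<omega> in P0 D. Xk k \<omega> \<le> of_nat (k\<^sup>2)"
        using regular_AE
      proof eventually_elim
        case (elim \<omega>)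
        then have "y k \<omega> \<le> k" unfolding y_def
          by (intro jumps_with_few_predecessors(3) inj_tau) (auto simp: regular_def)
        then show ?case unfolding Xk[OF elim] by (intro of_nat_mono power_mono) auto
      qed
    qed
    also have "\<dots> < \<infinity>" using of_nat_less_top[of "k\<^sup>2"] by (simp add: emeasure_space_1 del: of_nat_power)
    finally obtain e where e: "(\<integral>\<^sup>+\<omega>. Xk k \<omega> \<partial>P0 D) = ennreal e" "0 \<le> e"
      by (cases "\<integral>\<^sup>+\<omega>. Xk k \<omega> \<partial>P0 D") auto
    obtain c where c: "?C = ennreal c" "0 \<le> c" using exp_Lam_nn by (cases ?C) auto
    have "ennreal e \<le> ennreal (1/2 * e + c)"
    proof -
      have "ennreal (1/2) * ennreal e + ennreal c = ennreal (1/2 * e + c)"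
        using e(2) c(2) by (simp only: ennreal_mult[symmetric] ennreal_plus[symmetric] mult_nonneg_nonneg zero_le_divide_1_iff zero_le_numeral)
      then show ?thesis using le unfolding e(1) c(1) by simp
    qed
    then have "e \<le> 1/2 * e + c" using e(2) c(2) by (subst (asm) ennreal_le_iff) auto
    then have "ennreal e \<le> ennreal (2 * c)" by (intro ennreal_leI) simp
    then show ?thesis unfolding e(1) c(1) using c(2) by (simp add: ennreal_mult)
  qed
  have "(\<integral>\<^sup>+\<omega>. ennreal ((real (card (jumps \<omega>)))\<^sup>2) \<partial>P0 D) \<le> (\<integral>\<^sup>+\<omega>. liminf (\<lambda>k. Xk k \<omega>) \<partial>P0 D)"
  proof (rule nn_integral_mono_AE)
    show "AE \<omega> in P0 D. ennreal ((real (card (jumps \<omega>)))\<^sup>2) \<le> liminf (\<lambda>k. Xk k \<omega>)"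
      using regular_AE
    proof eventually_elim
      case (elim \<omega>)
      have f: "finite (jumps \<omega>)" "inj_on (\<lambda>i. tau i \<omega>) (jumps \<omega>)" using elim inj_tau by (auto simp: regular_def)
      have "Xk k \<omega> = ennreal ((real (card (jumps \<omega>)))\<^sup>2)" if "card (jumps \<omega>) < k" for k
        unfolding Xk[OF elim] y_def jumps_with_few_predecessors(4)[OF f that] by (simp add: ennreal_of_nat_eq_real_of_nat)
      then have "eventually (\<lambda>k. ennreal ((real (card (jumps \<omega>)))\<^sup>2) \<le> Xk k \<omega>) sequentially"
        by (intro eventually_mono[OF eventually_gt_at_top[of "card (jumps \<omega>)"]]) simp
      then show ?case by (rule Liminf_bounded)
    qed
  qed
  also have "\<dots> \<le> liminf (\<lambda>k. \<integral>\<^sup>+\<omega>. Xk k \<omega> \<partial>P0 D)"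
    by (rule nn_integral_liminf) (rule Xkm)
  also have "\<dots> \<le> 2 * ?C"
    using bound by (intro Liminf_le always_eventually) auto
  also have "\<dots> < \<infinity>" using exp_Lam_nn by (simp add: ennreal_mult_less_top)
  finally show ?thesis .
qed

end

context regular_loss_model
begin

lemma Lam_moments: "0 \<le> x \<Longrightarrow> exp (2 * x) * x \<le> exp (4 * x)" for x :: real
proof -
  assume "0 \<le> x"
  then have "x \<le> exp (2 * x)" using exp_ge_add_one_self[of "2 * x"] by linarith
  then have "exp (2 * x) * x \<le> exp (2 * x) * exp (2 * x)" by (intro mult_left_mono) simp_all
  then show ?thesis by (simp add: exp_add[symmetric])
qed

lemma square_weight_finite: "(\<integral>\<^sup>+x. ennreal ((exp (Lam (fst x)))\<^sup>2 * lam (fst (snd x), fst x)) \<partial>NU) < \<infinity>"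
proof -
  have "(\<integral>\<^sup>+x. ennreal ((exp (Lam (fst x)))\<^sup>2 * lam (fst (snd x), fst x)) \<partial>NU) =
      (\<integral>\<^sup>+x. ennreal ((exp (Lam (fst x)))\<^sup>2) * ennreal (lam (fst (snd x), fst x)) \<partial>NU)"
    by (intro nn_integral_cong ennreal_mult) (auto intro!: less_imp_le NU_lam_pos)
  also have "\<dots> = (\<integral>\<^sup>+\<omega>. ennreal ((exp (Lam \<omega>))\<^sup>2) * (\<integral>\<^sup>+s. ennreal (lam (s, \<omega>)) \<partial>Lb) \<partial>P0 D)"
    by (rule nn_integral_NU_weight[where W="\<lambda>\<omega>. ennreal ((exp (Lam \<omega>))\<^sup>2)" and X="\<lambda>p. ennreal (lam p)"])
      (use Lam_measurable lam_predictable in simp_all)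
  also have "\<dots> \<le> (\<integral>\<^sup>+\<omega>. ennreal (exp (4 * Lam \<omega>)) \<partial>P0 D)"
  proof (rule nn_integral_mono_AE)
    show "AE \<omega> in P0 D. ennreal ((exp (Lam \<omega>))\<^sup>2) * (\<integral>\<^sup>+s. ennreal (lam (s, \<omega>)) \<partial>Lb) \<le> ennreal (exp (4 * Lam \<omega>))"
      using regular_AE
    proof eventually_elim
      case (elim \<omega>)
      then have "0 \<le> Lam \<omega>" using Lam_nonneg by (simp add: regular_def)
      then show ?case
        unfolding regular_nn_Lam[OF elim]
        using Lam_moments[of "Lam \<omega>"] by (simp add: ennreal_mult[symmetric] exp_double ennreal_leI)
    qed
  qed
  finally show ?thesis using exp_Lam_nn by (rule le_less_trans)
qed

text \<open>Square integrability of a field beats the weight \<open>exp \<Lambda>\<close>: \<open>2 w h \<le> w\<^sup>2 + h\<^sup>2\<close>.\<close>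

lemma weighted_field_finite:
  fixes H :: "(real \<times> 'a) \<times> real \<Rightarrow> real"
  assumes H: "H \<in> borel_measurable PF"
    and fin: "(\<integral>\<^sup>+x. ennreal ((H ((fst (snd x), fst x), snd (snd x)))\<^sup>2 * lam (fst (snd x), fst x)) \<partial>NU) < \<infinity>"
  shows "(\<integral>\<^sup>+x. ennreal (exp (Lam (fst x)) * \<bar>H ((fst (snd x), fst x), snd (snd x))\<bar> * lam (fst (snd x), fst x)) \<partial>NU) < \<infinity>"
    and "(\<integral>\<^sup>+\<omega>. ennreal (exp (Lam \<omega>) * (\<Sum>i\<in>jumps \<omega>. \<bar>H (mark i \<omega>)\<bar>)) \<partial>P0 D) < \<infinity>"
proof -
  have am: "x * \<bar>y\<bar> \<le> x\<^sup>2 + y\<^sup>2" if "0 \<le> x" for x y :: real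
  proof -
    have "0 \<le> (x - \<bar>y\<bar>)\<^sup>2" by simp
    then have "2 * (x * \<bar>y\<bar>) \<le> x\<^sup>2 + y\<^sup>2" by (simp add: power2_diff)
    moreover have "0 \<le> x * \<bar>y\<bar>" using that by simp
    ultimately show ?thesis by linarith
  qed
  let ?h = "\<lambda>x. H ((fst (snd x), fst x), snd (snd x))" and ?l = "\<lambda>x. lam (fst (snd x), fst x)"
  have Hm: "?h \<in> borel_measurable NU" by (rule NU_measurable[OF H])
  have lm: "?l \<in> borel_measurable NU" by (rule NU_process_measurable[OF lam_predictable])
  have Lm: "(\<lambda>x. Lam (fst x)) \<in> borel_measurable NU" by (rule measurable_compose[OF measurable_fst Lam_measurable])
  have "(\<integral>\<^sup>+x. ennreal (exp (Lam (fst x)) * \<bar>?h x\<bar> * ?l x) \<partial>NU) \<le>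
      (\<integral>\<^sup>+x. ennreal ((exp (Lam (fst x)))\<^sup>2 * ?l x) + ennreal ((?h x)\<^sup>2 * ?l x) \<partial>NU)"
  proof (rule nn_integral_mono)
    fix x assume "x \<in> space NU"
    from NU_lam_pos[OF this] have "exp (Lam (fst x)) * \<bar>?h x\<bar> * ?l x \<le> ((exp (Lam (fst x)))\<^sup>2 + (?h x)\<^sup>2) * ?l x"
      by (intro mult_right_mono am) auto
    with NU_lam_pos[OF \<open>x \<in> space NU\<close>] show "ennreal (exp (Lam (fst x)) * \<bar>?h x\<bar> * ?l x) \<le>
        ennreal ((exp (Lam (fst x)))\<^sup>2 * ?l x) + ennreal ((?h x)\<^sup>2 * ?l x)"
      using ennreal_leI[of "exp (Lam (fst x)) * \<bar>?h x\<bar> * ?l x" "(exp (Lam (fst x)))\<^sup>2 * ?l x + (?h x)\<^sup>2 * ?l x"]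
      by (simp add: ennreal_plus distrib_right)
  qed
  also have "\<dots> = (\<integral>\<^sup>+x. ennreal ((exp (Lam (fst x)))\<^sup>2 * ?l x) \<partial>NU) + (\<integral>\<^sup>+x. ennreal ((?h x)\<^sup>2 * ?l x) \<partial>NU)"
    by (rule nn_integral_add) (use Hm lm Lm in measurable)
  also have "\<dots> < \<infinity>" using square_weight_finite fin by simp
  finally show "(\<integral>\<^sup>+x. ennreal (exp (Lam (fst x)) * \<bar>?h x\<bar> * ?l x) \<partial>NU) < \<infinity>" .
  let ?S = "\<lambda>\<omega>. \<integral>\<^sup>+i. ennreal ((H (mark i \<omega>))\<^sup>2) \<partial>count_space (jumps \<omega>)"
  have H2: "(\<lambda>x. ennreal ((H x)\<^sup>2)) \<in> borel_measurable PF" using H by simp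
  have Sm: "?S \<in> borel_measurable (P0 D)"
    using jump_sum_adapted[OF H2] horizon_pos by (intro from_F_measurable[of TT]) auto
  have "(\<integral>\<^sup>+\<omega>. ?S \<omega> \<partial>P0 D) = (\<integral>\<^sup>+x. ennreal ((?h x)\<^sup>2) * ennreal (?l x) \<partial>NU)"
    by (rule compensation_nn[OF H2])
  also have "\<dots> = (\<integral>\<^sup>+x. ennreal ((?h x)\<^sup>2 * ?l x) \<partial>NU)"
    by (intro nn_integral_cong ennreal_mult[symmetric]) (auto intro!: less_imp_le NU_lam_pos)
  finally have S: "(\<integral>\<^sup>+\<omega>. ?S \<omega> \<partial>P0 D) < \<infinity>" using fin by simp
  define N2 where "N2 \<omega> = ennreal ((enn2real (\<integral>\<^sup>+i. 1 \<partial>count_space (jumps \<omega>)))\<^sup>2)" for \<omega>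
  have "(\<lambda>\<omega>. \<integral>\<^sup>+i. 1 \<partial>count_space (jumps \<omega>)) \<in> borel_measurable (P0 D)"
    using jump_sum_adapted[of "\<lambda>_. 1"] horizon_pos by (intro from_F_measurable[of TT]) auto
  then have N2m: "N2 \<in> borel_measurable (P0 D)" unfolding N2_def[abs_def] by simp
  have N2: "N2 \<omega> = ennreal ((real (card (jumps \<omega>)))\<^sup>2)" if "regular \<omega>" for \<omega>
    using that by (simp add: N2_def regular_def nn_integral_count_space_finite enn2real_of_nat)
  have "(\<integral>\<^sup>+\<omega>. N2 \<omega> \<partial>P0 D) = (\<integral>\<^sup>+\<omega>. ennreal ((real (card (jumps \<omega>)))\<^sup>2) \<partial>P0 D)"
    by (rule nn_integral_cong_AE) (use regular_AE N2 in \<open>auto elim!: eventually_mono\<close>)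
  then have N2fin: "(\<integral>\<^sup>+\<omega>. N2 \<omega> \<partial>P0 D) < \<infinity>" using card_jumps_square by simp
  have "(\<integral>\<^sup>+\<omega>. ennreal (exp (Lam \<omega>) * (\<Sum>i\<in>jumps \<omega>. \<bar>H (mark i \<omega>)\<bar>)) \<partial>P0 D) \<le>
      (\<integral>\<^sup>+\<omega>. (ennreal (exp (4 * Lam \<omega>)) + N2 \<omega>) + ?S \<omega> \<partial>P0 D)"
  proof (rule nn_integral_mono_AE)
    show "AE \<omega> in P0 D. ennreal (exp (Lam \<omega>) * (\<Sum>i\<in>jumps \<omega>. \<bar>H (mark i \<omega>)\<bar>)) \<le>
        (ennreal (exp (4 * Lam \<omega>)) + N2 \<omega>) + ?S \<omega>"
      using regular_AE
    proof eventually_elim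
      case (elim \<omega>)
      then have f: "finite (jumps \<omega>)" by (simp add: regular_def)
      have "exp (Lam \<omega>) * (\<Sum>i\<in>jumps \<omega>. \<bar>H (mark i \<omega>)\<bar>) \<le> (\<Sum>i\<in>jumps \<omega>. (exp (Lam \<omega>))\<^sup>2 + (H (mark i \<omega>))\<^sup>2)"
        unfolding sum_distrib_left by (intro sum_mono am) simp
      also have "\<dots> = (exp (Lam \<omega>))\<^sup>2 * \<bar>real (card (jumps \<omega>))\<bar> + (\<Sum>i\<in>jumps \<omega>. (H (mark i \<omega>))\<^sup>2)"
        by (simp add: sum.distrib)
      also have "\<dots> \<le> ((exp (Lam \<omega>))\<^sup>2)\<^sup>2 + (real (card (jumps \<omega>)))\<^sup>2 + (\<Sum>i\<in>jumps \<omega>. (H (mark i \<omega>))\<^sup>2)"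
        by (intro add_right_mono am) simp
      also have "((exp (Lam \<omega>))\<^sup>2)\<^sup>2 = exp (4 * Lam \<omega>)"
        by (simp add: exp_double[symmetric])
      finally have "ennreal (exp (Lam \<omega>) * (\<Sum>i\<in>jumps \<omega>. \<bar>H (mark i \<omega>)\<bar>)) \<le>
          ennreal (exp (4 * Lam \<omega>) + (real (card (jumps \<omega>)))\<^sup>2 + (\<Sum>i\<in>jumps \<omega>. (H (mark i \<omega>))\<^sup>2))"
        by (rule ennreal_leI)
      also have "\<dots> = (ennreal (exp (4 * Lam \<omega>)) + N2 \<omega>) + ?S \<omega>"
        unfolding N2[OF elim] nn_integral_count_space_finite[OF f]
        by (simp add: sum_ennreal ennreal_plus sum_nonneg)
      finally show ?case .
    qed
  qed
  also have "\<dots> = ((\<integral>\<^sup>+\<omega>. ennreal (exp (4 * Lam \<omega>)) \<partial>P0 D) + (\<integral>\<^sup>+\<omega>. N2 \<omega> \<partial>P0 D)) + (\<integral>\<^sup>+\<omega>. ?S \<omega> \<partial>P0 D)"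
    using N2m Sm by (subst nn_integral_add, simp, simp, subst nn_integral_add) simp_all
  also have "\<dots> < \<infinity>" using exp_Lam_nn N2fin S by simp
  finally show "(\<integral>\<^sup>+\<omega>. ennreal (exp (Lam \<omega>) * (\<Sum>i\<in>jumps \<omega>. \<bar>H (mark i \<omega>)\<bar>)) \<partial>P0 D) < \<infinity>" .
qed

end

section \<open>Multiplicative functionals\<close>

text \<open>The process \<open>K = exp (\<integral> a ds) \<Prod> exp (- ell)\<close> covers the densities \<open>L\<^sup>u\<close> as well as the products of
  \<open>L\<^sup>u\<close> with the ratio of the controlled and the uncontrolled exponential loss.\<close>

locale multiplicative = regular_loss_model +
  fixes a :: "real \<times> 'a \<Rightarrow> real" and ell :: "(real \<times> 'a) \<times> real \<Rightarrow> real" and C :: real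
  assumes a_predictable: "a \<in> borel_measurable PS"
    and ell_predictable: "ell \<in> borel_measurable PF"
    and C_nonneg: "0 \<le> C"
    and a_bounds: "\<And>p. p \<in> space PS \<Longrightarrow> 0 \<le> a p" "\<And>p. p \<in> space PS \<Longrightarrow> a p \<le> lam p + C"
    and ell_nonneg: "\<And>p z. p \<in> space PS \<Longrightarrow> 0 < z \<Longrightarrow> 0 \<le> ell (p, z)"
begin

definition kap :: "(real \<times> 'a) \<times> real \<Rightarrow> real" where "kap x = exp (- ell x)"

definition Km :: "real \<times> 'a \<Rightarrow> real" where
  "Km p = exp (Lb.cumul (\<lambda>s. a (s, snd p)) (fst p)
    - (\<integral>i. (if tau i (snd p) < fst p then ell (mark i (snd p)) else 0) \<partial>count_space (jumps (snd p))))"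

definition KT :: "'a \<Rightarrow> real" where
  "KT \<omega> = exp ((\<integral>s. a (s, \<omega>) \<partial>Lb) - (\<integral>i. ell (mark i \<omega>) \<partial>count_space (jumps \<omega>)))"

definition bnd :: "'a \<Rightarrow> real" where "bnd \<omega> = exp (C * TT) * exp (Lam \<omega>)"

lemma Km_predictable: "Km \<in> borel_measurable PS"
  unfolding Km_def[abs_def]
  by (rule measurable_compose[OF borel_measurable_diff[OF time_integral_predictable_real[OF a_predictable]
      jump_sum_before_predictable_real[OF ell_predictable]]]) simp

lemma kap_predictable: "kap \<in> borel_measurable PF"
  unfolding kap_def[abs_def] using ell_predictable by simp

lemma mark_in:
  assumes "\<omega> \<in> \<Omega>" "i \<in> jumps \<omega>"
  shows "fst (mark i \<omega>) \<in> space PS" "0 < snd (mark i \<omega>)" "fst (mark i \<omega>) = (tau i \<omega>, \<omega>)"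
  using assms jumps_tau[OF assms] by (auto simp: mark_def space_PS jumps_def)

lemma kap_bounds: "p \<in> space PS \<Longrightarrow> 0 < z \<Longrightarrow> 0 < kap (p, z) \<and> kap (p, z) \<le> 1"
  using ell_nonneg by (simp add: kap_def)

lemma kap_mark: "\<omega> \<in> \<Omega> \<Longrightarrow> i \<in> jumps \<omega> \<Longrightarrow> 0 < kap (mark i \<omega>) \<and> kap (mark i \<omega>) \<le> 1"
  using kap_bounds[OF mark_in(1)[of \<omega> i] mark_in(2)[of \<omega> i]] by simp

lemma time_in_PS: "\<omega> \<in> \<Omega> \<Longrightarrow> s \<in> space Lb \<Longrightarrow> (s, \<omega>) \<in> space PS"
  by (auto simp: space_PS)

lemma a_integrable:
  assumes "regular \<omega>" shows "integrable Lb (\<lambda>s. a (s, \<omega>))"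
proof (rule Bochner_Integration.integrable_bound)
  show "integrable Lb (\<lambda>s. lam (s, \<omega>) + C)" using assms by (simp add: regular_def)
  show "(\<lambda>s. a (s, \<omega>)) \<in> borel_measurable Lb"
    using process_section[OF a_predictable] assms by (simp add: regular_def)
  show "AE s in Lb. norm (a (s, \<omega>)) \<le> norm (lam (s, \<omega>) + C)"
  proof (rule AE_I2)
    fix s assume "s \<in> space Lb"
    then have "(s, \<omega>) \<in> space PS" using assms time_in_PS by (auto simp: regular_def)
    from a_bounds[OF this] show "norm (a (s, \<omega>)) \<le> norm (lam (s, \<omega>) + C)" by simp
  qed
qed

lemma a_nonneg: "regular \<omega> \<Longrightarrow> s \<in> space Lb \<Longrightarrow> 0 \<le> a (s, \<omega>)"
  using a_bounds(1) time_in_PS by (simp add: regular_def)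

lemma exp_minus_sum: "finite J \<Longrightarrow> exp (- (\<Sum>j\<in>J. f j)) = (\<Prod>j\<in>J. exp (- f j))" for f :: "nat \<Rightarrow> real"
  by (simp add: sum_negf[symmetric] exp_sum)

lemma Km_eq:
  assumes "regular \<omega>"
  shows "Km (s, \<omega>) = exp (Lb.cumul (\<lambda>s. a (s, \<omega>)) s) * (\<Prod>j\<in>{j\<in>jumps \<omega>. tau j \<omega> < s}. kap (mark j \<omega>))"
proof -
  have f: "finite (jumps \<omega>)" using assms by (simp add: regular_def)
  show ?thesis
    using f exp_minus_sum[of "{j\<in>jumps \<omega>. tau j \<omega> < s}" "\<lambda>j. ell (mark j \<omega>)"]
    by (simp add: Km_def kap_def jump_integral_finite[OF f] sum.inter_filter[symmetric] exp_diff divide_inverse exp_minus)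
qed

lemma KT_eq:
  assumes "regular \<omega>"
  shows "KT \<omega> = exp (\<integral>s. a (s, \<omega>) \<partial>Lb) * (\<Prod>j\<in>jumps \<omega>. kap (mark j \<omega>))"
proof -
  have f: "finite (jumps \<omega>)" using assms by (simp add: regular_def)
  show ?thesis
    using exp_minus_sum[OF f, of "\<lambda>j. ell (mark j \<omega>)"]
    by (simp add: KT_def kap_def jump_integral_finite[OF f] exp_diff divide_inverse exp_minus)
qed

lemma K_doleans:
  assumes r: "regular \<omega>"
  shows "KT \<omega> = 1 + (\<integral>s. a (s, \<omega>) * Km (s, \<omega>) \<partial>Lb) +
      (\<Sum>i\<in>jumps \<omega>. Km (tau i \<omega>, \<omega>) * (kap (mark i \<omega>) - 1))"
    and "Km (s, \<omega>) = 1 + Lb.cumul (\<lambda>v. a (v, \<omega>) * Km (v, \<omega>)) s +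
      (\<Sum>i\<in>{i\<in>jumps \<omega>. tau i \<omega> < s}. Km (tau i \<omega>, \<omega>) * (kap (mark i \<omega>) - 1))"
proof -
  have f: "finite (jumps \<omega>)" "inj_on (\<lambda>i. tau i \<omega>) (jumps \<omega>)" using r inj_tau by (auto simp: regular_def)
  note dd = Lb.doleans_dade[OF a_integrable[OF r] a_nonneg[OF r] f, where \<kappa>="\<lambda>i. kap (mark i \<omega>)"]
  show "KT \<omega> = 1 + (\<integral>s. a (s, \<omega>) * Km (s, \<omega>) \<partial>Lb) +
      (\<Sum>i\<in>jumps \<omega>. Km (tau i \<omega>, \<omega>) * (kap (mark i \<omega>) - 1))"
    unfolding KT_eq[OF r] Km_eq[OF r] by (rule dd(1))
  show "Km (s, \<omega>) = 1 + Lb.cumul (\<lambda>v. a (v, \<omega>) * Km (v, \<omega>)) s +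
      (\<Sum>i\<in>{i\<in>jumps \<omega>. tau i \<omega> < s}. Km (tau i \<omega>, \<omega>) * (kap (mark i \<omega>) - 1))"
    unfolding Km_eq[OF r] by (rule dd(2))
qed

lemma Km_pos: "0 < Km p" by (simp add: Km_def)

lemma KT_pos: "0 < KT \<omega>" by (simp add: KT_def)

lemma Km_le:
  assumes r: "regular \<omega>" shows "Km (s, \<omega>) \<le> exp (Lb.cumul (\<lambda>s. a (s, \<omega>)) s)"
proof -
  have "(\<Prod>j\<in>{j\<in>jumps \<omega>. tau j \<omega> < s}. kap (mark j \<omega>)) \<le> 1"
    using kap_mark r by (intro prod_le_1) (auto simp: regular_def less_imp_le)
  then show ?thesis unfolding Km_eq[OF r] by (simp add: mult_le_cancel_left1)
qed

lemma cumul_a_le: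
  assumes r: "regular \<omega>"
  shows "Lb.cumul (\<lambda>s. a (s, \<omega>)) s \<le> C * TT + Lb.cumul (\<lambda>s. lam (s, \<omega>)) s"
    and "(\<integral>s. a (s, \<omega>) \<partial>Lb) \<le> C * TT + Lam \<omega>"
proof -
  have \<omega>: "\<omega> \<in> \<Omega>" and li: "integrable Lb (\<lambda>s. lam (s, \<omega>))" using r by (auto simp: regular_def)
  have mT: "measure Lb (space Lb) = TT" using emeasure_Lb horizon_pos by (simp add: measure_def)
  have ci: "integrable Lb (\<lambda>_. C)" by simp
  have "Lb.cumul (\<lambda>s. a (s, \<omega>)) s \<le> (\<integral>v. indicator {..s} v * lam (v, \<omega>) + C \<partial>Lb)"
    unfolding Lb.cumul_def
  proof (rule integral_mono)
    fix v assume "v \<in> space Lb"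
    then have "(v, \<omega>) \<in> space PS" by (rule time_in_PS[OF \<omega>])
    from a_bounds[OF this] C_nonneg show "indicator {..s} v * a (v, \<omega>) \<le> indicator {..s} v * lam (v, \<omega>) + C"
      by (auto split: split_indicator)
  qed (intro Lb.integrable_upto a_integrable[OF r] Bochner_Integration.integrable_add li ci)+
  also have "\<dots> = Lb.cumul (\<lambda>s. lam (s, \<omega>)) s + C * TT"
    unfolding Lb.cumul_def using mT
    by (subst Bochner_Integration.integral_add) (simp_all add: Lb.integrable_upto li mult.commute)
  finally show "Lb.cumul (\<lambda>s. a (s, \<omega>)) s \<le> C * TT + Lb.cumul (\<lambda>s. lam (s, \<omega>)) s" by simp
  have "(\<integral>s. a (s, \<omega>) \<partial>Lb) \<le> (\<integral>v. lam (v, \<omega>) + C \<partial>Lb)"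
    by (rule integral_mono) (use a_bounds time_in_PS[OF \<omega>] a_integrable[OF r] li ci in auto)
  then show "(\<integral>s. a (s, \<omega>) \<partial>Lb) \<le> C * TT + Lam \<omega>"
    using li mT by (simp add: Lam_def mult.commute)
qed

lemma Km_bound: "regular \<omega> \<Longrightarrow> Km (s, \<omega>) \<le> bnd \<omega>"
proof -
  assume r: "regular \<omega>"
  have "Km (s, \<omega>) \<le> exp (C * TT + Lb.cumul (\<lambda>s. lam (s, \<omega>)) s)"
    using Km_le[OF r, of s] cumul_a_le(1)[OF r, of s] by (simp add: order_trans)
  also have "\<dots> \<le> exp (C * TT + Lam \<omega>)"
    using Lb.cumul_le_integral[of "\<lambda>s. lam (s, \<omega>)" s] r lam_pos
    by (simp add: Lam_def regular_def less_imp_le)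
  finally show ?thesis by (simp add: bnd_def exp_add)
qed

lemma KT_bound: "regular \<omega> \<Longrightarrow> KT \<omega> \<le> bnd \<omega>"
proof -
  assume r: "regular \<omega>"
  have "(\<Prod>j\<in>jumps \<omega>. kap (mark j \<omega>)) \<le> 1"
    using kap_mark r by (intro prod_le_1) (auto simp: regular_def less_imp_le)
  then have "KT \<omega> \<le> exp (\<integral>s. a (s, \<omega>) \<partial>Lb)" unfolding KT_eq[OF r] by (simp add: mult_le_cancel_left1)
  also have "\<dots> \<le> exp (C * TT + Lam \<omega>)" using cumul_a_le(2)[OF r] by simp
  finally show ?thesis by (simp add: bnd_def exp_add)
qed

lemma bnd_measurable[measurable]: "bnd \<in> borel_measurable (P0 D)"
  unfolding bnd_def[abs_def] by measurable

lemma bnd_pos: "0 < bnd \<omega>" by (simp add: bnd_def)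

text \<open>Although \<open>K\<^sub>-\<close> and \<open>\<lambda>\<^sup>0\<close> are only bounded by exponential moments separately, \<open>\<integral> K\<^sub>- (a + \<lambda>\<^sup>0) ds\<close> does not
  cost more than \<open>K\<close>, because \<open>\<integral> \<lambda>\<^sup>0 exp (\<integral>\<^sub>0 \<lambda>\<^sup>0) ds\<close> is again an exponential.\<close>

lemma Km_intensity_bound:
  assumes r: "regular \<omega>"
  shows "(\<integral>\<^sup>+s. ennreal (Km (s, \<omega>) * (a (s, \<omega>) + lam (s, \<omega>))) \<partial>Lb) \<le> ennreal (2 * bnd \<omega>)"
proof -
  have \<omega>: "\<omega> \<in> \<Omega>" and li: "integrable Lb (\<lambda>s. lam (s, \<omega>))" using r by (auto simp: regular_def)
  let ?ea = "\<lambda>s. a (s, \<omega>) * exp (Lb.cumul (\<lambda>s. a (s, \<omega>)) s)"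
  let ?el = "\<lambda>s. lam (s, \<omega>) * exp (Lb.cumul (\<lambda>s. lam (s, \<omega>)) s)"
  have l0: "s \<in> space Lb \<Longrightarrow> 0 \<le> lam (s, \<omega>)" for s using lam_pos[of s \<omega>] \<omega> by (simp add: less_imp_le)
  note ea = Lb.exp_of_integral[OF a_integrable[OF r] a_nonneg[OF r]]
  note el = Lb.exp_of_integral[OF li l0]
  have int: "integrable Lb (\<lambda>s. ?ea s + exp (C * TT) * ?el s)" using ea(1) el(1) by simp
  have "(\<integral>\<^sup>+s. ennreal (Km (s, \<omega>) * (a (s, \<omega>) + lam (s, \<omega>))) \<partial>Lb) \<le>
      (\<integral>\<^sup>+s. ennreal (?ea s + exp (C * TT) * ?el s) \<partial>Lb)"
  proof (intro nn_integral_mono ennreal_leI)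
    fix s assume s: "s \<in> space Lb"
    have "Km (s, \<omega>) * a (s, \<omega>) \<le> exp (Lb.cumul (\<lambda>s. a (s, \<omega>)) s) * a (s, \<omega>)"
      by (intro mult_right_mono Km_le[OF r] a_nonneg[OF r s])
    moreover have "Km (s, \<omega>) * lam (s, \<omega>) \<le> exp (C * TT + Lb.cumul (\<lambda>s. lam (s, \<omega>)) s) * lam (s, \<omega>)"
      using Km_le[OF r, of s] cumul_a_le(1)[OF r, of s] by (intro mult_right_mono l0[OF s]) (simp add: order_trans)
    ultimately show "Km (s, \<omega>) * (a (s, \<omega>) + lam (s, \<omega>)) \<le> ?ea s + exp (C * TT) * ?el s"
      by (simp add: algebra_simps exp_add)
  qed
  also have "\<dots> = ennreal (\<integral>s. ?ea s + exp (C * TT) * ?el s \<partial>Lb)"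
    by (rule nn_integral_eq_integral[OF int]) (intro AE_I2 add_nonneg_nonneg mult_nonneg_nonneg; simp add: a_nonneg[OF r] l0)
  also have "(\<integral>s. ?ea s + exp (C * TT) * ?el s \<partial>Lb) = (exp (\<integral>s. a (s, \<omega>) \<partial>Lb) - 1) + exp (C * TT) * (exp (Lam \<omega>) - 1)"
    using ea el by (simp add: Lam_def)
  also have "\<dots> \<le> 2 * bnd \<omega>"
  proof -
    have "exp (\<integral>s. a (s, \<omega>) \<partial>Lb) \<le> bnd \<omega>" using cumul_a_le(2)[OF r] by (simp add: bnd_def exp_add[symmetric])
    moreover have "exp (C * TT) * (exp (Lam \<omega>) - 1) \<le> bnd \<omega>" by (simp add: bnd_def algebra_simps)
    ultimately show ?thesis by linarith
  qed
  finally show ?thesis by (simp add: ennreal_leI)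
qed

end

context loss_model
begin

lemmas NU_Fubini = pair_sigma_finite.integral_fst'[OF pairs_sigma_finite(1)]
lemmas NU_AE_section = pair_sigma_finite.AE_integrable_fst'[OF pairs_sigma_finite(1)]
lemmas NU_integrable_fst = pair_sigma_finite.integrable_fst'[OF pairs_sigma_finite(1)]
lemmas LF_Fubini = pair_sigma_finite.integral_fst'[OF pairs_sigma_finite(2)]
lemmas LF_integrable_fst = pair_sigma_finite.integrable_fst'[OF pairs_sigma_finite(2)]

lemma NU_AE_claim_pos: "AE x in NU. 0 < snd (snd x)"
proof -
  have m: "(\<lambda>x. snd (snd x)) \<in> borel_measurable NU"
    by (intro measurable_compose[OF measurable_snd measurable_compose[OF measurable_snd claim_law_id]])
  have "(\<lambda>p. snd p) \<in> borel_measurable (Lb \<Otimes>\<^sub>M claim_law D)"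
    by (rule measurable_compose[OF measurable_snd claim_law_id])
  then have "AE p in Lb \<Otimes>\<^sub>M claim_law D. 0 < snd p"
    by (intro pair_sigma_finite.AE_pair_measure[OF pairs_sigma_finite(2)] borel_measurable_less)
      (use claim_law_pos in auto)
  then show ?thesis
    by (intro pair_sigma_finite.AE_pair_measure[OF pairs_sigma_finite(1)] borel_measurable_less m) auto
qed

lemma NU_fst_PS: "x \<in> space NU \<Longrightarrow> (fst (snd x), fst x) \<in> space PS"
  by (auto simp: space_NU space_PS)

lemma finite_imp_integrable_NU:
  assumes "f \<in> borel_measurable NU" "g \<in> borel_measurable NU" "(\<integral>\<^sup>+x. ennreal (g x) \<partial>NU) < \<infinity>"
    and "AE x in NU. \<bar>f x\<bar> \<le> c * g x" "0 \<le> c" and "AE x in NU. 0 \<le> g x"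
  shows "integrable NU f"
proof -
  have "integrable NU g"
    using assms(2,3,6) by (intro integrableI_nonneg) auto
  then have "integrable NU (\<lambda>x. c * g x)" by simp
  then show ?thesis
    by (rule Bochner_Integration.integrable_bound[OF _ assms(1)]) (use assms(4) in \<open>auto elim!: eventually_mono\<close>)
qed

end

locale weighted_multiplicative = multiplicative +
  fixes t :: real and W :: "'a \<Rightarrow> real"
  assumes t: "t \<in> {0..TT}"
    and W_measurable: "W \<in> borel_measurable (FF t)"
    and W_values: "\<And>\<omega>. \<omega> \<in> \<Omega> \<Longrightarrow> W \<omega> = 0 \<or> W \<omega> = 1"
    and a_before: "\<And>s \<omega>. s \<le> t \<Longrightarrow> a (s, \<omega>) = 0"
    and ell_before: "\<And>s \<omega> z. s \<le> t \<Longrightarrow> ell ((s, \<omega>), z) = 0"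
begin

definition Wp :: "real \<times> 'a \<Rightarrow> real" where "Wp p = (if t < fst p then W (snd p) else 0)"

lemma Wp_predictable: "Wp \<in> borel_measurable PS"
  unfolding Wp_def[abs_def] by (rule PS_after[OF t W_measurable]) simp

lemma W_P0: "W \<in> borel_measurable (P0 D)"
  by (rule from_F_measurable[OF t W_measurable])

lemma W_abs: "\<omega> \<in> \<Omega> \<Longrightarrow> \<bar>W \<omega>\<bar> \<le> 1" using W_values[of \<omega>] by auto

lemma Wp_abs: "p \<in> space PS \<Longrightarrow> \<bar>Wp p\<bar> \<le> 1"
  using W_abs[of "snd p"] by (auto simp: Wp_def space_PS)

lemma kap_before: "s \<le> t \<Longrightarrow> kap ((s, \<omega>), z) = 1" by (simp add: kap_def ell_before)

text \<open>The predictable compensator density of \<open>K\<close> relative to \<open>K\<^sub>-\<close>, as a function of time and mark.\<close>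

definition drift :: "(real \<times> 'a) \<times> real \<Rightarrow> real" where
  "drift x = a (fst x) + lam (fst x) * (kap x - 1)"

lemma drift_measurable: "drift \<in> borel_measurable PF"
  unfolding drift_def[abs_def]
  by (intro borel_measurable_add borel_measurable_times borel_measurable_diff process_field[OF a_predictable]
      process_field[OF lam_predictable] kap_predictable borel_measurable_const)

lemma drift_bound: "p \<in> space PS \<Longrightarrow> 0 < z \<Longrightarrow> \<bar>drift (p, z)\<bar> \<le> a p + lam p"
proof -
  assume p: "p \<in> space PS" "0 < z"
  have l: "0 \<le> lam p" using lam_pos[of "fst p" "snd p"] p by (auto simp: space_PS less_imp_le)
  have "lam p * (1 - kap (p, z)) \<le> lam p * 1" using kap_bounds[OF p] l by (intro mult_left_mono) auto
  moreover have "0 \<le> lam p * (1 - kap (p, z))" using kap_bounds[OF p] l by (intro mult_nonneg_nonneg) auto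
  ultimately show ?thesis using a_bounds(1)[OF p(1)] l unfolding drift_def by (simp add: algebra_simps abs_le_iff)
qed

lemma bnd_moment: "(\<integral>\<^sup>+\<omega>. ennreal ((bnd \<omega>)\<^sup>2) \<partial>P0 D) < \<infinity>"
proof -
  have "(\<integral>\<^sup>+\<omega>. ennreal ((bnd \<omega>)\<^sup>2) \<partial>P0 D) \<le> (\<integral>\<^sup>+\<omega>. ennreal ((exp (C * TT))\<^sup>2) * ennreal (exp (4 * Lam \<omega>)) \<partial>P0 D)"
  proof (rule nn_integral_mono)
    fix \<omega> assume "\<omega> \<in> \<Omega>"
    then have "(exp (Lam \<omega>))\<^sup>2 \<le> exp (4 * Lam \<omega>)"
      using Lam_nonneg by (simp add: exp_double[symmetric])
    then show "ennreal ((bnd \<omega>)\<^sup>2) \<le> ennreal ((exp (C * TT))\<^sup>2) * ennreal (exp (4 * Lam \<omega>))"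
      by (subst ennreal_mult[symmetric]) (auto simp: bnd_def power_mult_distrib intro!: ennreal_leI)
  qed
  also have "\<dots> < \<infinity>" using exp_Lam_nn by (simp add: nn_integral_cmult ennreal_mult_less_top)
  finally show ?thesis .
qed

lemma KT_measurable: "KT \<in> borel_measurable (P0 D)"
proof -
  have "(\<lambda>(\<omega>, s). a (s, \<omega>)) \<in> borel_measurable (P0 D \<Otimes>\<^sub>M Lb)"
    using PL_process[OF a_predictable] by (simp add: split_beta')
  from Lb.borel_measurable_lebesgue_integral[OF this]
  have "(\<lambda>\<omega>. \<integral>s. a (s, \<omega>) \<partial>Lb) \<in> borel_measurable (P0 D)" by simp
  moreover have "(\<lambda>\<omega>. \<integral>i. ell (mark i \<omega>) \<partial>count_space (jumps \<omega>)) \<in> borel_measurable (P0 D)"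
    using jump_integral_measurable[OF ell_predictable] horizon_pos by (intro from_F_measurable[of TT]) auto
  ultimately show ?thesis unfolding KT_def[abs_def] by measurable
qed

text \<open>A random variable that is integrable against the bound of \<open>K\<close> may be integrated against \<open>K\<^sub>- (a + \<lambda>\<^sup>0)\<close>.\<close>

lemma Km_weight_finite:
  assumes V: "V \<in> borel_measurable (P0 D)" and fin: "(\<integral>\<^sup>+\<omega>. V \<omega> * ennreal (bnd \<omega>) \<partial>P0 D) < \<infinity>"
  shows "(\<integral>\<^sup>+x. V (fst x) * ennreal (Km (fst (snd x), fst x) * (a (fst (snd x), fst x) + lam (fst (snd x), fst x))) \<partial>NU) < \<infinity>"
proof -
  have X: "(\<lambda>p. ennreal (Km p * (a p + lam p))) \<in> borel_measurable PS"
    using Km_predictable a_predictable lam_predictable by simp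
  have "(\<integral>\<^sup>+x. V (fst x) * ennreal (Km (fst (snd x), fst x) * (a (fst (snd x), fst x) + lam (fst (snd x), fst x))) \<partial>NU)
      = (\<integral>\<^sup>+\<omega>. V \<omega> * (\<integral>\<^sup>+s. ennreal (Km (s, \<omega>) * (a (s, \<omega>) + lam (s, \<omega>))) \<partial>Lb) \<partial>P0 D)"
    by (rule nn_integral_NU_weight[OF V X])
  also have "\<dots> \<le> (\<integral>\<^sup>+\<omega>. 2 * (V \<omega> * ennreal (bnd \<omega>)) \<partial>P0 D)"
  proof (rule nn_integral_mono_AE)
    show "AE \<omega> in P0 D. V \<omega> * (\<integral>\<^sup>+s. ennreal (Km (s, \<omega>) * (a (s, \<omega>) + lam (s, \<omega>))) \<partial>Lb) \<le> 2 * (V \<omega> * ennreal (bnd \<omega>))"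
      using regular_AE
    proof eventually_elim
      case (elim \<omega>)
      have "V \<omega> * (\<integral>\<^sup>+s. ennreal (Km (s, \<omega>) * (a (s, \<omega>) + lam (s, \<omega>))) \<partial>Lb) \<le> V \<omega> * ennreal (2 * bnd \<omega>)"
        by (intro mult_left_mono Km_intensity_bound[OF elim]) simp
      also have "\<dots> = 2 * (V \<omega> * ennreal (bnd \<omega>))"
        using bnd_pos[of \<omega>] by (simp add: ennreal_mult mult.left_commute)
      finally show ?case .
    qed
  qed
  also have "\<dots> < \<infinity>" using fin V by (subst nn_integral_cmult) (auto simp: ennreal_mult_less_top)
  finally show ?thesis .
qed

text \<open>Integration by parts for \<open>K\<close> and a martingale \<open>X\<close> orthogonal to the compensated claims: the
  covariation of \<open>X\<close> and \<open>K\<close> vanishes in mean, and \<open>X\<^sub>T\<close> may be replaced by \<open>X\<^sub>s\<close> against the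
  adapted density of the finite variation part of \<open>K\<close>.\<close>

lemma orthogonal_martingale_expectation:
  assumes M: "X \<in> L_perp D"
  shows "integrable (P0 D) (\<lambda>\<omega>. W \<omega> * (X TT \<omega> * KT \<omega>))"
    and "integrable NU (\<lambda>x. Wp (fst (snd x), fst x) * Km (fst (snd x), fst x) * (X (fst (snd x)) (fst x) * drift ((fst (snd x), fst x), snd (snd x))))"
    and "(\<integral>\<omega>. W \<omega> * (X TT \<omega> * KT \<omega>) \<partial>P0 D) = (\<integral>\<omega>. W \<omega> * X TT \<omega> \<partial>P0 D) +
      (\<integral>x. Wp (fst (snd x), fst x) * Km (fst (snd x), fst x) * (X (fst (snd x)) (fst x) * drift ((fst (snd x), fst x), snd (snd x))) \<partial>NU)"
proof -
  define \<phi> where "\<phi> x = Wp (fst x) * Km (fst x) * drift x" for x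
  define \<Theta> where "\<Theta> x = Wp (fst x) * Km (fst x) * (kap x - 1)" for x
  have \<phi>m: "\<phi> \<in> borel_measurable PF" and \<Theta>m: "\<Theta> \<in> borel_measurable PF"
    unfolding \<phi>_def[abs_def] \<Theta>_def[abs_def]
    by (intro borel_measurable_times borel_measurable_diff process_field[OF Wp_predictable] process_field[OF Km_predictable]
        drift_measurable kap_predictable borel_measurable_const)+
  let ?n = "\<lambda>x :: 'a \<times> real \<times> real. ((fst (snd x), fst x), snd (snd x))"
  note \<phi>NU = NU_measurable[OF \<phi>m] and \<Theta>NU = NU_measurable[OF \<Theta>m]
  have mart: "martingale (P0 D) FF TT X" and cad: "cadlag (P0 D) TT X"
    and sq: "integrable (P0 D) (\<lambda>\<omega>. (X TT \<omega>)\<^sup>2)"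
    and orth: "\<And>\<Theta>. \<Theta> \<in> L_hat D \<Longrightarrow> martingale (P0 D) FF TT (\<lambda>t \<omega>. X t \<omega> * compensated_int D \<Theta> 0 t \<omega>)"
    using M horizon_pos by (auto simp: L_perp_def)
  have Xm: "X s \<in> borel_measurable (FF s)" "X s \<in> borel_measurable (P0 D)" "integrable (P0 D) (X s)" if "s \<in> {0..TT}" for s
    using mart that from_F_measurable[OF that] by (auto simp: martingale_def adapted_def)
  have XT: "X TT \<in> borel_measurable (P0 D)" using Xm(2)[of TT] horizon_pos by simp
  have pos: "AE x in NU. x \<in> space NU \<and> 0 < snd (snd x)" using NU_AE_claim_pos AE_space by eventually_elim simp
  have \<phi>b: "\<bar>\<phi> (p, z)\<bar> \<le> Km p * (a p + lam p)" if "p \<in> space PS" "0 < z" for p z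
  proof -
    have "\<bar>\<phi> (p, z)\<bar> \<le> 1 * Km p * (a p + lam p)"
      unfolding \<phi>_def abs_mult fst_conv using Wp_abs[OF that(1)] drift_bound[OF that] Km_pos[of p]
      by (intro mult_mono) auto
    then show ?thesis by simp
  qed
  \<comment> \<open>\<open>\<bar>X\<^sub>T\<bar> b \<le> X\<^sub>T\<^sup>2 + b\<^sup>2\<close> for the bound \<open>b\<close> of \<open>K\<close>\<close>
  have XTb: "(\<integral>\<^sup>+\<omega>. ennreal \<bar>X TT \<omega>\<bar> * ennreal (bnd \<omega>) \<partial>P0 D) < \<infinity>"
  proof -
    have "(\<integral>\<^sup>+\<omega>. ennreal \<bar>X TT \<omega>\<bar> * ennreal (bnd \<omega>) \<partial>P0 D) \<le> (\<integral>\<^sup>+\<omega>. ennreal ((X TT \<omega>)\<^sup>2) + ennreal ((bnd \<omega>)\<^sup>2) \<partial>P0 D)"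
    proof (rule nn_integral_mono)
      fix \<omega>
      have "0 \<le> (\<bar>X TT \<omega>\<bar> - bnd \<omega>)\<^sup>2" by simp
      then have "2 * (\<bar>X TT \<omega>\<bar> * bnd \<omega>) \<le> (X TT \<omega>)\<^sup>2 + (bnd \<omega>)\<^sup>2" by (simp add: power2_diff)
      moreover have "0 \<le> \<bar>X TT \<omega>\<bar> * bnd \<omega>" using bnd_pos[of \<omega>] by simp
      ultimately have "\<bar>X TT \<omega>\<bar> * bnd \<omega> \<le> (X TT \<omega>)\<^sup>2 + (bnd \<omega>)\<^sup>2" by linarith
      from ennreal_leI[OF this] show "ennreal \<bar>X TT \<omega>\<bar> * ennreal (bnd \<omega>) \<le> ennreal ((X TT \<omega>)\<^sup>2) + ennreal ((bnd \<omega>)\<^sup>2)"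
        using bnd_pos[of \<omega>] by (simp add: ennreal_mult ennreal_plus)
    qed
    also have "\<dots> = (\<integral>\<^sup>+\<omega>. ennreal ((X TT \<omega>)\<^sup>2) \<partial>P0 D) + (\<integral>\<^sup>+\<omega>. ennreal ((bnd \<omega>)\<^sup>2) \<partial>P0 D)"
      using XT bnd_measurable by (intro nn_integral_add) auto
    also have "\<dots> < \<infinity>" using sq bnd_moment by (simp add: integrable_iff_bounded)
    finally show ?thesis .
  qed
  have XTK: "integrable (P0 D) (\<lambda>\<omega>. X TT \<omega> * V \<omega>)"
    if V: "V \<in> borel_measurable (P0 D)" "AE \<omega> in P0 D. \<bar>V \<omega>\<bar> \<le> c * bnd \<omega>" "0 \<le> c" for V c
  proof (rule Bochner_Integration.integrable_bound)
    have "integrable (P0 D) (\<lambda>\<omega>. \<bar>X TT \<omega>\<bar> * bnd \<omega>)"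
      using XTb XT bnd_measurable by (intro integrableI_nonneg) (auto simp: ennreal_mult bnd_pos less_imp_le)
    then show "integrable (P0 D) (\<lambda>\<omega>. c * (\<bar>X TT \<omega>\<bar> * bnd \<omega>))" by simp
    show "AE \<omega> in P0 D. norm (X TT \<omega> * V \<omega>) \<le> norm (c * (\<bar>X TT \<omega>\<bar> * bnd \<omega>))"
      using V(2)
    proof eventually_elim
      case (elim \<omega>)
      have "\<bar>X TT \<omega>\<bar> * \<bar>V \<omega>\<bar> \<le> \<bar>X TT \<omega>\<bar> * (c * bnd \<omega>)" by (intro mult_left_mono elim) simp
      then show ?case using V(3) bnd_pos[of \<omega>] by (simp add: abs_mult mult.left_commute)
    qed
  qed (use XT V in measurable)
  note KTm = KT_measurable
  have WKT: "AE \<omega> in P0 D. \<bar>W \<omega> * KT \<omega>\<bar> \<le> 1 * bnd \<omega>"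
    using regular_AE
  proof eventually_elim
    case (elim \<omega>)
    then have "\<bar>W \<omega>\<bar> * KT \<omega> \<le> 1 * bnd \<omega>"
      using W_abs[of \<omega>] KT_bound[OF elim] KT_pos[of \<omega>] by (intro mult_mono) (auto simp: regular_def less_imp_le)
    then show ?case using KT_pos[of \<omega>] by (simp add: abs_mult)
  qed
  have iWK: "integrable (P0 D) (\<lambda>\<omega>. X TT \<omega> * (W \<omega> * KT \<omega>))"
    by (rule XTK[OF _ WKT]) (use W_P0 KTm in simp_all)
  then show "integrable (P0 D) (\<lambda>\<omega>. W \<omega> * (X TT \<omega> * KT \<omega>))" by (simp add: mult.left_commute)
  have iW: "integrable (P0 D) (\<lambda>\<omega>. X TT \<omega> * W \<omega>)"
  proof (rule XTK[OF W_P0])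
    show "AE \<omega> in P0 D. \<bar>W \<omega>\<bar> \<le> 1 * bnd \<omega>"
      using AE_space
    proof eventually_elim
      case (elim \<omega>)
      have "1 \<le> bnd \<omega>" using Lam_nonneg[OF elim] C_nonneg horizon_pos by (simp add: bnd_def exp_add[symmetric])
      then show ?case using W_abs[OF elim] by simp
    qed
  qed simp
  \<comment> \<open>integrability over time and marks\<close>
  have fin: "(\<integral>\<^sup>+x. ennreal (\<bar>X TT (fst x)\<bar> * (Km (fst (snd x), fst x) * (a (fst (snd x), fst x) + lam (fst (snd x), fst x)))) \<partial>NU) < \<infinity>"
  proof -
    have "(\<integral>\<^sup>+x. ennreal (\<bar>X TT (fst x)\<bar> * (Km (fst (snd x), fst x) * (a (fst (snd x), fst x) + lam (fst (snd x), fst x)))) \<partial>NU)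
      = (\<integral>\<^sup>+x. ennreal \<bar>X TT (fst x)\<bar> * ennreal (Km (fst (snd x), fst x) * (a (fst (snd x), fst x) + lam (fst (snd x), fst x))) \<partial>NU)"
      by (intro nn_integral_cong ennreal_mult mult_nonneg_nonneg add_nonneg_nonneg)
        (auto intro!: less_imp_le[OF Km_pos] less_imp_le[OF NU_lam_pos] a_bounds(1) NU_fst_PS)
    also have "\<dots> < \<infinity>"
      by (rule Km_weight_finite[where V="\<lambda>\<omega>. ennreal \<bar>X TT \<omega>\<bar>", OF _ XTb]) (use XT in simp)
    finally show ?thesis .
  qed
  have gm: "(\<lambda>x. \<bar>X TT (fst x)\<bar> * (Km (fst (snd x), fst x) * (a (fst (snd x), fst x) + lam (fst (snd x), fst x)))) \<in> borel_measurable NU"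
    by (intro borel_measurable_times borel_measurable_add borel_measurable_abs NU_process_measurable[OF Km_predictable]
        NU_process_measurable[OF a_predictable] NU_process_measurable[OF lam_predictable] measurable_compose[OF measurable_fst XT])
  have iMT: "integrable NU (\<lambda>x. X TT (fst x) * \<phi> (?n x))"
  proof (rule finite_imp_integrable_NU[where c=1, OF _ gm fin])
    show "(\<lambda>x. X TT (fst x) * \<phi> (?n x)) \<in> borel_measurable NU"
      by (intro borel_measurable_times \<phi>NU measurable_compose[OF measurable_fst XT])
    show "AE x in NU. \<bar>X TT (fst x) * \<phi> (?n x)\<bar> \<le> 1 * (\<bar>X TT (fst x)\<bar> * (Km (fst (snd x), fst x) * (a (fst (snd x), fst x) + lam (fst (snd x), fst x))))"
      using pos
    proof eventually_elim
      case (elim x)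
      then show ?case using \<phi>b[OF NU_fst_PS[of x], of "snd (snd x)"]
        by (auto simp: abs_mult intro!: mult_left_mono)
    qed
    show "AE x in NU. 0 \<le> \<bar>X TT (fst x)\<bar> * (Km (fst (snd x), fst x) * (a (fst (snd x), fst x) + lam (fst (snd x), fst x)))"
      by (intro AE_I2 mult_nonneg_nonneg add_nonneg_nonneg)
        (auto intro!: less_imp_le[OF Km_pos] less_imp_le[OF NU_lam_pos] a_bounds(1) NU_fst_PS)
  qed simp
  \<comment> \<open>\<open>X\<^sub>T\<close> is replaced by \<open>X\<^sub>s\<close>\<close>
  have sec: "(\<lambda>\<omega>. f ((s, \<omega>), z)) \<in> borel_measurable (FF s)" if "f \<in> borel_measurable PF" "s \<in> {0<..TT}" for f :: "_ \<Rightarrow> real" and s z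
  proof -
    have "(\<lambda>\<omega>. (s, \<omega>)) \<in> FF s \<rightarrow>\<^sub>M PS" using that(2) by (intro PS_section_F) auto
    then have "(\<lambda>\<omega>. ((s, \<omega>), z)) \<in> FF s \<rightarrow>\<^sub>M PF" by (intro measurable_Pair measurable_const) simp_all
    from measurable_compose[OF this that(1)] show ?thesis .
  qed
  have cond: "integrable (P0 D) (\<lambda>\<omega>. f \<omega> * X s \<omega>) \<and> (\<integral>\<omega>. f \<omega> * X s \<omega> \<partial>P0 D) = (\<integral>\<omega>. f \<omega> * X TT \<omega> \<partial>P0 D)"
    if s: "s \<in> {0..TT}" and f: "f \<in> borel_measurable (FF s)" and int: "integrable (P0 D) (\<lambda>\<omega>. f \<omega> * X TT \<omega>)" for f s
  proof -
    interpret fms: finite_measure_subalgebra "P0 D" "FF s"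
      by unfold_locales (rule subalg[OF s])
    note ig = fms.real_cond_exp_intg[OF int f XT]
    have ae: "AE \<omega> in P0 D. real_cond_exp (P0 D) (FF s) (X TT) \<omega> = X s \<omega>"
      using mart s horizon_pos by (auto simp: martingale_def)
    have fP: "f \<in> borel_measurable (P0 D)" by (rule from_F_measurable[OF s f])
    have e: "integrable (P0 D) (\<lambda>\<omega>. f \<omega> * real_cond_exp (P0 D) (FF s) (X TT) \<omega>) = integrable (P0 D) (\<lambda>\<omega>. f \<omega> * X s \<omega>)"
      by (rule integrable_cong_AE) (use fP Xm(2)[OF s] ae in \<open>auto elim!: eventually_mono\<close>)
    have e2: "(\<integral>\<omega>. f \<omega> * real_cond_exp (P0 D) (FF s) (X TT) \<omega> \<partial>P0 D) = (\<integral>\<omega>. f \<omega> * X s \<omega> \<partial>P0 D)"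
      by (rule integral_cong_AE) (use fP Xm(2)[OF s] ae in \<open>auto elim!: eventually_mono\<close>)
    show ?thesis using ig e e2 by simp
  qed
  have XsNU: "(\<lambda>x. X (fst (snd x)) (fst x)) \<in> borel_measurable NU"
  proof -
    have "(\<lambda>x. (fst (snd x), fst x)) \<in> NU \<rightarrow>\<^sub>M Lb \<Otimes>\<^sub>M P0 D" by measurable
    from measurable_compose[OF this cadlag_jointly_measurable[OF cad Xm(2)]] show ?thesis by simp
  qed
  have secint: "AE y in Lb \<Otimes>\<^sub>M claim_law D. integrable (P0 D) (\<lambda>\<omega>. X TT \<omega> * \<phi> ((fst y, \<omega>), snd y))"
    using pair_sigma_finite.AE_integrable_snd[OF pairs_sigma_finite(1), of "\<lambda>\<omega> y. X TT \<omega> * \<phi> ((fst y, \<omega>), snd y)"] iMT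
    by (simp add: split_beta')
  have Xsabs: "AE y in Lb \<Otimes>\<^sub>M claim_law D. integrable (P0 D) (\<lambda>\<omega>. X (fst y) \<omega> * \<phi> ((fst y, \<omega>), snd y)) \<and>
      (\<integral>\<omega>. X (fst y) \<omega> * \<phi> ((fst y, \<omega>), snd y) \<partial>P0 D) = (\<integral>\<omega>. X TT \<omega> * \<phi> ((fst y, \<omega>), snd y) \<partial>P0 D) \<and>
      (\<integral>\<omega>. \<bar>X (fst y) \<omega> * \<phi> ((fst y, \<omega>), snd y)\<bar> \<partial>P0 D) \<le> (\<integral>\<omega>. \<bar>X TT \<omega> * \<phi> ((fst y, \<omega>), snd y)\<bar> \<partial>P0 D)"
    using secint AE_space
  proof eventually_elim
    case (elim y)
    let ?s = "fst y" and ?f = "\<lambda>\<omega>. \<phi> ((fst y, \<omega>), snd y)"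
    have s: "?s \<in> {0..TT}" "?s \<in> {0<..TT}" using elim(2) by (auto simp: space_pair_measure)
    have f: "?f \<in> borel_measurable (FF ?s)" by (rule sec[OF \<phi>m s(2)])
    have 1: "integrable (P0 D) (\<lambda>\<omega>. ?f \<omega> * X ?s \<omega>) \<and> (\<integral>\<omega>. ?f \<omega> * X ?s \<omega> \<partial>P0 D) = (\<integral>\<omega>. ?f \<omega> * X TT \<omega> \<partial>P0 D)"
      using elim(1) by (intro cond[OF s(1) f]) (simp add: mult.commute)
    \<comment> \<open>the sign of \<open>X\<^sub>s\<close> turns the identity into the conditional Jensen inequality\<close>
    let ?g = "\<lambda>\<omega>. sgn (X ?s \<omega>) * \<bar>?f \<omega>\<bar>"
    have fP: "?f \<in> borel_measurable (P0 D)" by (rule from_F_measurable[OF s(1) f])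
    have g: "?g \<in> borel_measurable (FF ?s)" using f Xm(1)[OF s(1)] by simp
    have gi: "integrable (P0 D) (\<lambda>\<omega>. ?g \<omega> * X TT \<omega>)"
    proof (rule Bochner_Integration.integrable_bound[OF elim(1)])
      show "AE \<omega> in P0 D. norm (?g \<omega> * X TT \<omega>) \<le> norm (X TT \<omega> * ?f \<omega>)"
        by (rule AE_I2) (auto simp: abs_mult abs_sgn_eq)
    qed (use from_F_measurable[OF s(1) g] XT in simp)
    have "(\<integral>\<omega>. \<bar>X ?s \<omega> * ?f \<omega>\<bar> \<partial>P0 D) = (\<integral>\<omega>. ?g \<omega> * X ?s \<omega> \<partial>P0 D)"
      by (intro Bochner_Integration.integral_cong refl) (auto simp: abs_mult sgn_if)
    also have "\<dots> = (\<integral>\<omega>. ?g \<omega> * X TT \<omega> \<partial>P0 D)" using cond[OF s(1) g gi] by simp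
    also have "\<dots> \<le> (\<integral>\<omega>. \<bar>X TT \<omega> * ?f \<omega>\<bar> \<partial>P0 D)"
    proof (rule integral_mono[OF gi integrable_abs[OF elim(1)]])
      fix \<omega>
      have "\<bar>?g \<omega> * X TT \<omega>\<bar> \<le> \<bar>X TT \<omega> * ?f \<omega>\<bar>" by (auto simp: abs_mult abs_sgn_eq)
      then show "?g \<omega> * X TT \<omega> \<le> \<bar>X TT \<omega> * ?f \<omega>\<bar>" by linarith
    qed
    finally show ?case using 1 by (simp add: mult.commute)
  qed
  have i1: "integrable (Lb \<Otimes>\<^sub>M claim_law D) (\<lambda>y. \<integral>\<omega>. \<bar>X TT \<omega> * \<phi> ((fst y, \<omega>), snd y)\<bar> \<partial>P0 D)"
    using pair_sigma_finite.integrable_snd[OF pairs_sigma_finite(1), of "\<lambda>\<omega> y. \<bar>X TT \<omega> * \<phi> ((fst y, \<omega>), snd y)\<bar>"]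
      integrable_abs[OF iMT] by (simp add: split_beta')
  have NUswap: "pair_sigma_finite (Lb \<Otimes>\<^sub>M claim_law D) (P0 D)"
    using pairs_sigma_finite(1) by (simp add: pair_sigma_finite_def)
  have Xm2: "(\<lambda>x. X (fst (snd x)) (fst x) * \<phi> (?n x)) \<in> borel_measurable NU"
    by (intro borel_measurable_times XsNU \<phi>NU)
  have iMs: "integrable NU (\<lambda>x. X (fst (snd x)) (fst x) * \<phi> (?n x))"
  proof -
    let ?F = "\<lambda>q. X (fst (fst q)) (snd q) * \<phi> ((fst (fst q), snd q), snd (fst q))"
    have sw: "(\<lambda>q. (snd q, fst q)) \<in> (Lb \<Otimes>\<^sub>M claim_law D) \<Otimes>\<^sub>M P0 D \<rightarrow>\<^sub>M NU" by measurable
    have Fm: "?F \<in> borel_measurable ((Lb \<Otimes>\<^sub>M claim_law D) \<Otimes>\<^sub>M P0 D)"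
      using measurable_compose[OF sw Xm2] by simp
    have "integrable ((Lb \<Otimes>\<^sub>M claim_law D) \<Otimes>\<^sub>M P0 D) ?F"
    proof (rule pair_sigma_finite.Fubini_integrable[OF NUswap Fm])
      have nm: "(\<lambda>y. \<integral>\<omega>. norm (?F (y, \<omega>)) \<partial>P0 D) \<in> borel_measurable (Lb \<Otimes>\<^sub>M claim_law D)"
        using borel_measurable_lebesgue_integral[of "\<lambda>y \<omega>. norm (?F (y, \<omega>))"] Fm by simp
      show "integrable (Lb \<Otimes>\<^sub>M claim_law D) (\<lambda>y. \<integral>\<omega>. norm (?F (y, \<omega>)) \<partial>P0 D)"
      proof (rule Bochner_Integration.integrable_bound[OF i1 nm])
        show "AE y in Lb \<Otimes>\<^sub>M claim_law D. norm (\<integral>\<omega>. norm (?F (y, \<omega>)) \<partial>P0 D) \<le>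
            norm (\<integral>\<omega>. \<bar>X TT \<omega> * \<phi> ((fst y, \<omega>), snd y)\<bar> \<partial>P0 D)"
          using Xsabs by eventually_elim (simp add: integral_nonneg_AE)
      qed
      show "AE y in Lb \<Otimes>\<^sub>M claim_law D. integrable (P0 D) (\<lambda>\<omega>. ?F (y, \<omega>))"
        using Xsabs by eventually_elim simp
    qed
    from pair_sigma_finite.integrable_product_swap[OF NUswap this]
    show ?thesis by (simp add: split_beta')
  qed
  have eqM: "(\<integral>x. X TT (fst x) * \<phi> (?n x) \<partial>NU) = (\<integral>x. X (fst (snd x)) (fst x) * \<phi> (?n x) \<partial>NU)"
  proof -
    have "(\<integral>x. X TT (fst x) * \<phi> (?n x) \<partial>NU) = (\<integral>y. (\<integral>\<omega>. X TT \<omega> * \<phi> ((fst y, \<omega>), snd y) \<partial>P0 D) \<partial>(Lb \<Otimes>\<^sub>M claim_law D))"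
      using pair_sigma_finite.integral_snd[OF pairs_sigma_finite(1), of "\<lambda>\<omega> y. X TT \<omega> * \<phi> ((fst y, \<omega>), snd y)"] iMT
      by (simp add: split_beta')
    also have "\<dots> = (\<integral>y. (\<integral>\<omega>. X (fst y) \<omega> * \<phi> ((fst y, \<omega>), snd y) \<partial>P0 D) \<partial>(Lb \<Otimes>\<^sub>M claim_law D))"
    proof (rule integral_cong_AE)
      have "integrable (Lb \<Otimes>\<^sub>M claim_law D) (\<lambda>y. \<integral>\<omega>. X TT \<omega> * \<phi> ((fst y, \<omega>), snd y) \<partial>P0 D)"
        using pair_sigma_finite.integrable_snd[OF pairs_sigma_finite(1), of "\<lambda>\<omega> y. X TT \<omega> * \<phi> ((fst y, \<omega>), snd y)"] iMT
        by (simp add: split_beta')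
      then show "(\<lambda>y. \<integral>\<omega>. X TT \<omega> * \<phi> ((fst y, \<omega>), snd y) \<partial>P0 D) \<in> borel_measurable (Lb \<Otimes>\<^sub>M claim_law D)" by simp
      have "integrable (Lb \<Otimes>\<^sub>M claim_law D) (\<lambda>y. \<integral>\<omega>. X (fst y) \<omega> * \<phi> ((fst y, \<omega>), snd y) \<partial>P0 D)"
        using pair_sigma_finite.integrable_snd[OF pairs_sigma_finite(1), of "\<lambda>\<omega> y. X (fst y) \<omega> * \<phi> ((fst y, \<omega>), snd y)"] iMs
        by (simp add: split_beta')
      then show "(\<lambda>y. \<integral>\<omega>. X (fst y) \<omega> * \<phi> ((fst y, \<omega>), snd y) \<partial>P0 D) \<in> borel_measurable (Lb \<Otimes>\<^sub>M claim_law D)" by simp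
      show "AE y in Lb \<Otimes>\<^sub>M claim_law D. (\<integral>\<omega>. X TT \<omega> * \<phi> ((fst y, \<omega>), snd y) \<partial>P0 D) = (\<integral>\<omega>. X (fst y) \<omega> * \<phi> ((fst y, \<omega>), snd y) \<partial>P0 D)"
        using Xsabs by eventually_elim simp
    qed
    also have "\<dots> = (\<integral>x. X (fst (snd x)) (fst x) * \<phi> (?n x) \<partial>NU)"
      using pair_sigma_finite.integral_snd[OF pairs_sigma_finite(1), of "\<lambda>\<omega> y. X (fst y) \<omega> * \<phi> ((fst y, \<omega>), snd y)"] iMs
      by (simp add: split_beta')
    finally show ?thesis .
  qed
  show "integrable NU (\<lambda>x. Wp (fst (snd x), fst x) * Km (fst (snd x), fst x) * (X (fst (snd x)) (fst x) * drift (?n x)))"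
    using iMs by (simp add: \<phi>_def mult_ac)
  \<comment> \<open>orthogonality\<close>
  have \<Theta>b: "(\<Theta> (p, z))\<^sup>2 \<le> (Km p)\<^sup>2" if "p \<in> space PS" "0 < z" for p z
  proof -
    have "\<bar>\<Theta> (p, z)\<bar> \<le> 1 * Km p * 1"
      unfolding \<Theta>_def abs_mult fst_conv using Wp_abs[OF that(1)] kap_bounds[OF that] Km_pos[of p]
      by (intro mult_mono) auto
    then show ?thesis by (metis abs_le_square_iff abs_of_pos Km_pos mult_1 mult_1_right)
  qed
  let ?\<Theta> = "\<lambda>s z \<omega>. \<Theta> ((s, \<omega>), z)"
  have hat: "?\<Theta> \<in> L_hat D"
  proof -
    have "(\<integral>\<^sup>+t\<in>{0..TT}. (\<integral>\<^sup>+z\<in>{0<..}. ennreal (\<bar>\<Theta> ((t, \<omega>), z)\<bar>\<^sup>2 * intensity D t \<omega>) \<partial>claim_law D) \<partial>lborel) \<le>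
        ennreal ((bnd \<omega>)\<^sup>2) * (\<integral>\<^sup>+s. ennreal (lam (s, \<omega>)) \<partial>Lb)" if r: "regular \<omega>" for \<omega>
    proof -
      have \<omega>: "\<omega> \<in> \<Omega>" using r by (simp add: regular_def)
      have "(\<integral>\<^sup>+t\<in>{0..TT}. (\<integral>\<^sup>+z\<in>{0<..}. ennreal (\<bar>\<Theta> ((t, \<omega>), z)\<bar>\<^sup>2 * intensity D t \<omega>) \<partial>claim_law D) \<partial>lborel) \<le>
          (\<integral>\<^sup>+s. (ennreal ((bnd \<omega>)\<^sup>2) * ennreal (lam (s, \<omega>))) * indicator {0<..TT} s \<partial>lborel)"
      proof (rule nn_integral_mono_AE)
        show "AE s in lborel. (\<integral>\<^sup>+z\<in>{0<..}. ennreal (\<bar>\<Theta> ((s, \<omega>), z)\<bar>\<^sup>2 * intensity D s \<omega>) \<partial>claim_law D) * indicator {0..TT} s \<le>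
            (ennreal ((bnd \<omega>)\<^sup>2) * ennreal (lam (s, \<omega>))) * indicator {0<..TT} s"
          using AE_lborel_singleton[of 0]
        proof eventually_elim
          case (elim s)
          show ?case
          proof (cases "s \<in> {0<..TT}")
            case True
            then have p: "(s, \<omega>) \<in> space PS" using \<omega> by (auto simp: space_PS)
            have l: "0 \<le> lam (s, \<omega>)" using lam_pos[of s \<omega>] True \<omega> by simp
            have "(\<integral>\<^sup>+z\<in>{0<..}. ennreal (\<bar>\<Theta> ((s, \<omega>), z)\<bar>\<^sup>2 * intensity D s \<omega>) \<partial>claim_law D) \<le> (\<integral>\<^sup>+z. ennreal ((bnd \<omega>)\<^sup>2 * lam (s, \<omega>)) \<partial>claim_law D)"
            proof (rule nn_integral_mono)
              fix z
              show "ennreal (\<bar>\<Theta> ((s, \<omega>), z)\<bar>\<^sup>2 * intensity D s \<omega>) * indicator {0<..} z \<le> ennreal ((bnd \<omega>)\<^sup>2 * lam (s, \<omega>))"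
              proof (cases "0 < z")
                case True
                have "(Km (s, \<omega>))\<^sup>2 \<le> (bnd \<omega>)\<^sup>2" using Km_bound[OF r] Km_pos[of "(s, \<omega>)"] by (intro power_mono) auto
                then have "(\<Theta> ((s, \<omega>), z))\<^sup>2 * lam (s, \<omega>) \<le> (bnd \<omega>)\<^sup>2 * lam (s, \<omega>)"
                  using \<Theta>b[OF p True] l by (intro mult_right_mono) auto
                then show ?thesis using True by (simp add: lam_def ennreal_leI)
              qed simp
            qed
            also have "\<dots> = ennreal ((bnd \<omega>)\<^sup>2) * ennreal (lam (s, \<omega>))"
              using l FL.emeasure_space_1 by (simp add: ennreal_mult)
            finally show ?thesis using True by simp
          next
            case False
            with elim show ?thesis by (auto simp: indicator_def)
          qed
        qed
      qed
      also have "\<dots> = ennreal ((bnd \<omega>)\<^sup>2) * (\<integral>\<^sup>+s. ennreal (lam (s, \<omega>)) \<partial>Lb)"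
        unfolding nn_integral_Lb[symmetric]
        by (rule nn_integral_cmult) (rule measurable_compose[OF process_section[OF lam_predictable \<omega>] measurable_ennreal])
      finally show ?thesis .
    qed
    then have "(\<integral>\<^sup>+\<omega>. (\<integral>\<^sup>+t\<in>{0..TT}. (\<integral>\<^sup>+z\<in>{0<..}. ennreal (\<bar>\<Theta> ((t, \<omega>), z)\<bar>\<^sup>2 * intensity D t \<omega>) \<partial>claim_law D) \<partial>lborel) \<partial>P0 D) \<le>
        (\<integral>\<^sup>+\<omega>. ennreal ((bnd \<omega>)\<^sup>2) * (\<integral>\<^sup>+s. ennreal (lam (s, \<omega>)) \<partial>Lb) \<partial>P0 D)"
      using regular_AE by (intro nn_integral_mono_AE) (auto elim!: eventually_mono)
    also have "\<dots> \<le> (\<integral>\<^sup>+\<omega>. ennreal ((exp (C * TT))\<^sup>2) * ennreal (exp (4 * Lam \<omega>)) \<partial>P0 D)"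
    proof (rule nn_integral_mono_AE)
      show "AE \<omega> in P0 D. ennreal ((bnd \<omega>)\<^sup>2) * (\<integral>\<^sup>+s. ennreal (lam (s, \<omega>)) \<partial>Lb) \<le> ennreal ((exp (C * TT))\<^sup>2) * ennreal (exp (4 * Lam \<omega>))"
        using regular_AE
      proof eventually_elim
        case (elim \<omega>)
        then have "0 \<le> Lam \<omega>" using Lam_nonneg by (simp add: regular_def)
        from Lam_moments[OF this] this show ?case
          unfolding regular_nn_Lam[OF elim] bnd_def power_mult_distrib
          by (simp add: ennreal_mult[symmetric] exp_double[symmetric] mult.assoc ennreal_leI)
      qed
    qed
    also have "\<dots> < \<infinity>" using exp_Lam_nn by (simp add: nn_integral_cmult ennreal_mult_less_top)
    finally show ?thesis using predictable_fieldI[OF \<Theta>m] by (simp add: L_hat_def)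
  qed
  have zero: "(\<integral>\<omega>. X TT \<omega> * compensated_int D ?\<Theta> 0 TT \<omega> \<partial>P0 D) = 0"
    and iN: "integrable (P0 D) (\<lambda>\<omega>. X TT \<omega> * compensated_int D ?\<Theta> 0 TT \<omega>)"
  proof -
    note mN = orth[OF hat]
    show iN: "integrable (P0 D) (\<lambda>\<omega>. X TT \<omega> * compensated_int D ?\<Theta> 0 TT \<omega>)"
      using mN horizon_pos by (simp add: martingale_def)
    have "0 \<in> {0..TT}" using horizon_pos by simp
    interpret fms: finite_measure_subalgebra "P0 D" "FF 0"
      by unfold_locales (rule subalg[OF \<open>0 \<in> {0..TT}\<close>])
    have "AE \<omega> in P0 D. real_cond_exp (P0 D) (FF 0) (\<lambda>\<omega>. X TT \<omega> * compensated_int D ?\<Theta> 0 TT \<omega>) \<omega> = 0"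
      using mN horizon_pos unfolding martingale_def
      by (auto simp: compensated_int_def measure_int_def set_lebesgue_integral_def)
    then have "(\<integral>\<omega>. real_cond_exp (P0 D) (FF 0) (\<lambda>\<omega>. X TT \<omega> * compensated_int D ?\<Theta> 0 TT \<omega>) \<omega> \<partial>P0 D) = 0"
      by (intro integral_eq_zero_AE)
    then show "(\<integral>\<omega>. X TT \<omega> * compensated_int D ?\<Theta> 0 TT \<omega> \<partial>P0 D) = 0"
      using fms.real_cond_exp_int(2)[OF iN] by simp
  qed
  have LFint: "AE \<omega> in P0 D. integrable (Lb \<Otimes>\<^sub>M claim_law D) (\<lambda>y. \<phi> ((fst y, \<omega>), snd y)) \<and>
      integrable (Lb \<Otimes>\<^sub>M claim_law D) (\<lambda>y. \<Theta> ((fst y, \<omega>), snd y) * lam (fst y, \<omega>))"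
  proof -
    have fin1: "(\<integral>\<^sup>+x. ennreal (Km (fst (snd x), fst x) * (a (fst (snd x), fst x) + lam (fst (snd x), fst x))) \<partial>NU) < \<infinity>"
    proof -
      have "(\<integral>\<^sup>+\<omega>. 1 * ennreal (bnd \<omega>) \<partial>P0 D) \<le> (\<integral>\<^sup>+\<omega>. 1 + ennreal ((bnd \<omega>)\<^sup>2) \<partial>P0 D)"
      proof (rule nn_integral_mono)
        fix \<omega>
        have "0 \<le> (bnd \<omega> - 1)\<^sup>2" by simp
        then have "bnd \<omega> \<le> 1 + (bnd \<omega>)\<^sup>2" using bnd_pos[of \<omega>] by (simp add: power2_diff)
        from ennreal_leI[OF this] show "1 * ennreal (bnd \<omega>) \<le> 1 + ennreal ((bnd \<omega>)\<^sup>2)" by (simp add: ennreal_plus)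
      qed
      also have "\<dots> = 1 + (\<integral>\<^sup>+\<omega>. ennreal ((bnd \<omega>)\<^sup>2) \<partial>P0 D)"
        using bnd_measurable emeasure_space_1 by (subst nn_integral_add) auto
      also have "\<dots> < \<infinity>" using bnd_moment by simp
      finally show ?thesis using Km_weight_finite[of "\<lambda>_. 1"] by simp
    qed
    have gm1: "(\<lambda>x. Km (fst (snd x), fst x) * (a (fst (snd x), fst x) + lam (fst (snd x), fst x))) \<in> borel_measurable NU"
      by (intro borel_measurable_times borel_measurable_add NU_process_measurable[OF Km_predictable]
          NU_process_measurable[OF a_predictable] NU_process_measurable[OF lam_predictable])
    have g0: "AE x in NU. 0 \<le> Km (fst (snd x), fst x) * (a (fst (snd x), fst x) + lam (fst (snd x), fst x))"
      by (intro AE_I2 mult_nonneg_nonneg add_nonneg_nonneg)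
        (auto intro!: less_imp_le[OF Km_pos] less_imp_le[OF NU_lam_pos] a_bounds(1) NU_fst_PS)
    have "integrable NU (\<lambda>x. \<phi> (?n x))"
    proof (rule finite_imp_integrable_NU[where c=1, OF \<phi>NU gm1 fin1 _ _ g0])
      show "AE x in NU. \<bar>\<phi> (?n x)\<bar> \<le> 1 * (Km (fst (snd x), fst x) * (a (fst (snd x), fst x) + lam (fst (snd x), fst x)))"
        using pos
      proof eventually_elim
        case (elim x)
        show ?case using \<phi>b[OF NU_fst_PS[of x], of "snd (snd x)"] elim by simp
      qed
    qed simp
    moreover have "integrable NU (\<lambda>x. \<Theta> (?n x) * lam (fst (snd x), fst x))"
    proof (rule finite_imp_integrable_NU[where c=1, OF _ gm1 fin1 _ _ g0])
      show "(\<lambda>x. \<Theta> (?n x) * lam (fst (snd x), fst x)) \<in> borel_measurable NU"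
        by (intro borel_measurable_times \<Theta>NU NU_process_measurable[OF lam_predictable])
      show "AE x in NU. \<bar>\<Theta> (?n x) * lam (fst (snd x), fst x)\<bar> \<le> 1 * (Km (fst (snd x), fst x) * (a (fst (snd x), fst x) + lam (fst (snd x), fst x)))"
        using pos
      proof eventually_elim
        case (elim x)
        let ?p = "(fst (snd x), fst x)"
        have "\<bar>\<Theta> (?n x)\<bar> \<le> Km ?p"
          using \<Theta>b[OF NU_fst_PS[of x], of "snd (snd x)"] elim Km_pos[of ?p] by (simp add: abs_le_square_iff[symmetric])
        then have "\<bar>\<Theta> (?n x)\<bar> * lam ?p \<le> Km ?p * (a ?p + lam ?p)"
          using elim a_bounds(1)[OF NU_fst_PS[of x]] NU_lam_pos[of x] Km_pos[of ?p] by (intro mult_mono) auto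
        then show ?case using NU_lam_pos[of x] elim by (simp add: abs_mult)
      qed
    qed simp
    ultimately show ?thesis using NU_AE_section[of "\<lambda>x. \<phi> (?n x)"] NU_AE_section[of "\<lambda>x. \<Theta> (?n x) * lam (fst (snd x), fst x)"]
      by (simp add: eventually_conj_iff)
  qed
  have N_eq: "AE \<omega> in P0 D. compensated_int D ?\<Theta> 0 TT \<omega> =
      W \<omega> * KT \<omega> - W \<omega> - (\<integral>y. \<phi> ((fst y, \<omega>), snd y) \<partial>(Lb \<Otimes>\<^sub>M claim_law D))"
    using regular_AE LFint
  proof eventually_elim
    case (elim \<omega>)
    then have \<omega>: "\<omega> \<in> \<Omega>" and f: "finite (jumps \<omega>)" by (auto simp: regular_def)
    let ?LF = "Lb \<Otimes>\<^sub>M claim_law D"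
    have j: "measure_int (jump_measure D \<omega>) 0 TT (\<lambda>s z. \<Theta> ((s, \<omega>), z)) = (\<Sum>i\<in>jumps \<omega>. \<Theta> (mark i \<omega>))"
      using jumps_tau[OF \<omega>] horizon_pos by (subst measure_int_jump[OF \<omega> \<Theta>m]) (auto simp: jump_integral_finite[OF f] intro!: sum.cong)
    have c: "measure_int (compensator D \<omega>) 0 TT (\<lambda>s z. \<Theta> ((s, \<omega>), z)) = (\<integral>y. \<Theta> ((fst y, \<omega>), snd y) * lam (fst y, \<omega>) \<partial>?LF)"
      using horizon_pos by (subst measure_int_compensator[OF \<omega> \<Theta>m]) (auto intro!: Bochner_Integration.integral_cong simp: space_pair_measure)
    have \<phi>eq: "\<phi> ((s, \<omega>), z) - \<Theta> ((s, \<omega>), z) * lam (s, \<omega>) = Wp (s, \<omega>) * Km (s, \<omega>) * a (s, \<omega>)" for s z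
      by (simp add: \<phi>_def \<Theta>_def drift_def algebra_simps)
    have int3: "integrable ?LF (\<lambda>y. Wp (fst y, \<omega>) * Km (fst y, \<omega>) * a (fst y, \<omega>))"
      using Bochner_Integration.integrable_diff[of ?LF "\<lambda>y. \<phi> ((fst y, \<omega>), snd y)" "\<lambda>y. \<Theta> ((fst y, \<omega>), snd y) * lam (fst y, \<omega>)"] elim(2)
      by (simp add: \<phi>eq)
    have "(\<integral>y. \<phi> ((fst y, \<omega>), snd y) \<partial>?LF) - (\<integral>y. \<Theta> ((fst y, \<omega>), snd y) * lam (fst y, \<omega>) \<partial>?LF)
        = (\<integral>y. Wp (fst y, \<omega>) * Km (fst y, \<omega>) * a (fst y, \<omega>) \<partial>?LF)"
      using elim(2) by (subst Bochner_Integration.integral_diff[symmetric]) (simp_all add: \<phi>eq)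
    also have "\<dots> = (\<integral>s. Wp (s, \<omega>) * Km (s, \<omega>) * a (s, \<omega>) \<partial>Lb)"
      using LF_Fubini[OF int3] FL.prob_space by simp
    also have "\<dots> = W \<omega> * (\<integral>s. a (s, \<omega>) * Km (s, \<omega>) \<partial>Lb)"
      unfolding integral_mult_right_zero[symmetric]
      by (intro Bochner_Integration.integral_cong refl) (auto simp: Wp_def a_before)
    finally have 1: "(\<integral>y. \<phi> ((fst y, \<omega>), snd y) \<partial>?LF) - (\<integral>y. \<Theta> ((fst y, \<omega>), snd y) * lam (fst y, \<omega>) \<partial>?LF) =
        W \<omega> * (\<integral>s. a (s, \<omega>) * Km (s, \<omega>) \<partial>Lb)" .
    have 2: "(\<Sum>i\<in>jumps \<omega>. \<Theta> (mark i \<omega>)) = W \<omega> * (\<Sum>i\<in>jumps \<omega>. Km (tau i \<omega>, \<omega>) * (kap (mark i \<omega>) - 1))"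
      unfolding sum_distrib_left
      by (intro sum.cong refl) (auto simp: \<Theta>_def mark_def Wp_def kap_before)
    have 3: "W \<omega> * KT \<omega> = W \<omega> + W \<omega> * (\<integral>s. a (s, \<omega>) * Km (s, \<omega>) \<partial>Lb) + W \<omega> * (\<Sum>i\<in>jumps \<omega>. Km (tau i \<omega>, \<omega>) * (kap (mark i \<omega>) - 1))"
      unfolding K_doleans(1)[OF elim(1)] by (simp add: algebra_simps)
    show ?case unfolding compensated_int_def j c using 1 2 3 by linarith
  qed
  have iL: "integrable (P0 D) (\<lambda>\<omega>. X TT \<omega> * (\<integral>y. \<phi> ((fst y, \<omega>), snd y) \<partial>(Lb \<Otimes>\<^sub>M claim_law D)))"
    and eL: "(\<integral>\<omega>. X TT \<omega> * (\<integral>y. \<phi> ((fst y, \<omega>), snd y) \<partial>(Lb \<Otimes>\<^sub>M claim_law D)) \<partial>P0 D) = (\<integral>x. X TT (fst x) * \<phi> (?n x) \<partial>NU)"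
    using NU_integrable_fst[OF iMT] NU_Fubini[OF iMT] by simp_all
  have "(\<integral>\<omega>. X TT \<omega> * compensated_int D ?\<Theta> 0 TT \<omega> \<partial>P0 D) =
      (\<integral>\<omega>. X TT \<omega> * (W \<omega> * KT \<omega>) - X TT \<omega> * W \<omega> - X TT \<omega> * (\<integral>y. \<phi> ((fst y, \<omega>), snd y) \<partial>(Lb \<Otimes>\<^sub>M claim_law D)) \<partial>P0 D)"
  proof (rule integral_cong_AE[OF borel_measurable_integrable[OF iN]])
    show "AE \<omega> in P0 D. X TT \<omega> * compensated_int D ?\<Theta> 0 TT \<omega> = X TT \<omega> * (W \<omega> * KT \<omega>) - X TT \<omega> * W \<omega>
        - X TT \<omega> * (\<integral>y. \<phi> ((fst y, \<omega>), snd y) \<partial>(Lb \<Otimes>\<^sub>M claim_law D))"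
      using N_eq by eventually_elim (simp only: right_diff_distrib)
  qed (intro borel_measurable_diff borel_measurable_integrable[OF iWK] borel_measurable_integrable[OF iW]
      borel_measurable_integrable[OF iL])
  also have "\<dots> = (\<integral>\<omega>. X TT \<omega> * (W \<omega> * KT \<omega>) \<partial>P0 D) - (\<integral>\<omega>. X TT \<omega> * W \<omega> \<partial>P0 D) - (\<integral>x. X TT (fst x) * \<phi> (?n x) \<partial>NU)"
    using iWK iW iL eL by simp
  finally show "(\<integral>\<omega>. W \<omega> * (X TT \<omega> * KT \<omega>) \<partial>P0 D) = (\<integral>\<omega>. W \<omega> * X TT \<omega> \<partial>P0 D) +
      (\<integral>x. Wp (fst (snd x), fst x) * Km (fst (snd x), fst x) * (X (fst (snd x)) (fst x) * drift (?n x)) \<partial>NU)"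
    using zero eqM by (simp add: \<phi>_def mult_ac)
qed

end

context loss_model
begin

lemma dominated_NU:
  assumes "f \<in> borel_measurable NU" "(\<integral>\<^sup>+x. h x \<partial>NU) < \<infinity>" "AE x in NU. ennreal \<bar>f x\<bar> \<le> h x"
  shows "integrable NU f"
proof (rule integrableI_bounded[OF assms(1)])
  have "(\<integral>\<^sup>+x. ennreal (norm (f x)) \<partial>NU) \<le> (\<integral>\<^sup>+x. h x \<partial>NU)"
    by (rule nn_integral_mono_AE) (use assms(3) in simp)
  then show "(\<integral>\<^sup>+x. ennreal (norm (f x)) \<partial>NU) < \<infinity>" using assms(2) by (rule le_less_trans)
qed

lemma NU_AE_fst:
  assumes "AE \<omega> in P0 D. Q \<omega>"
  shows "AE x in NU. Q (fst x)"
proof -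
  from assms obtain N where N: "{\<omega>\<in>space (P0 D). \<not> Q \<omega>} \<subseteq> N" "emeasure (P0 D) N = 0" "N \<in> sets (P0 D)"
    by (rule AE_E)
  let ?N = "N \<times> space (Lb \<Otimes>\<^sub>M claim_law D)"
  have "emeasure NU ?N = 0"
    using sigma_finite_measure.emeasure_pair_measure_Times[OF LF_sigma_finite N(3) sets.top] N(2) by simp
  moreover have "?N \<in> sets NU" by (intro pair_measureI N(3) sets.top)
  ultimately show ?thesis
    using N(1) by (intro AE_I[of _ _ ?N]) (auto simp: space_pair_measure)
qed

lemma PSF_id: "(\<lambda>q. q) \<in> PS \<Otimes>\<^sub>M claim_law D \<rightarrow>\<^sub>M PF"
proof -
  have "(\<lambda>q. (fst q, snd q)) \<in> PS \<Otimes>\<^sub>M claim_law D \<rightarrow>\<^sub>M PF"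
    by (intro measurable_Pair measurable_fst measurable_compose[OF measurable_snd claim_law_id])
  then show ?thesis by simp
qed

lemma mark_integral_predictable:
  assumes H: "H \<in> borel_measurable PF"
  shows "(\<lambda>p. \<integral>z. H (p, z) \<partial>claim_law D :: real) \<in> borel_measurable PS"
proof -
  have "(\<lambda>(p, z). H (p, z)) \<in> borel_measurable (PS \<Otimes>\<^sub>M claim_law D)"
    using measurable_compose[OF PSF_id H] by (simp add: split_beta')
  from FL.borel_measurable_lebesgue_integral[OF this] show ?thesis .
qed

lemma time_integral_measurable:
  assumes X: "X \<in> borel_measurable PS"
  shows "(\<lambda>\<omega>. \<integral>s. X (s, \<omega>) \<partial>Lb :: real) \<in> borel_measurable (P0 D)"
proof -
  have "(\<lambda>(\<omega>, s). X (s, \<omega>)) \<in> borel_measurable (P0 D \<Otimes>\<^sub>M Lb)"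
    using PL_process[OF X] by (simp add: split_beta')
  from Lb.borel_measurable_lebesgue_integral[OF this] show ?thesis by simp
qed

end

context weighted_multiplicative
begin

text \<open>Integration by parts for \<open>K\<close> and a process of finite variation with jumps \<open>\<Theta>\<close>: the pathwise
  product formula is integrated, and the sums over the claims are replaced by their compensators.\<close>

lemma finite_variation_expectation:
  fixes \<Theta> :: "(real \<times> 'a) \<times> real \<Rightarrow> real" and g :: "real \<times> 'a \<Rightarrow> real" and b :: "'a \<Rightarrow> real" and k :: real
  assumes \<Theta>: "\<Theta> \<in> borel_measurable PF" and g: "g \<in> borel_measurable PS" and b: "b \<in> borel_measurable (FF t)"
    and \<Theta>0: "\<And>s \<omega> z. s \<le> t \<Longrightarrow> \<Theta> ((s, \<omega>), z) = 0" and g0: "\<And>s \<omega>. s \<le> t \<Longrightarrow> g (s, \<omega>) = 0"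
    and bk: "\<And>\<omega>. \<omega> \<in> \<Omega> \<Longrightarrow> \<bar>W \<omega> * b \<omega>\<bar> \<le> k"
    and \<Theta>fin: "(\<integral>\<^sup>+x. ennreal ((\<Theta> ((fst (snd x), fst x), snd (snd x)))\<^sup>2 * lam (fst (snd x), fst x)) \<partial>NU) < \<infinity>"
    and gfin: "(\<integral>\<^sup>+x. ennreal (exp (Lam (fst x))) * ennreal \<bar>Wp (fst (snd x), fst x) * g (fst (snd x), fst x)\<bar> \<partial>NU) < \<infinity>"
  defines "thet \<equiv> \<lambda>p. \<integral>z. \<Theta> (p, z) * lam p \<partial>claim_law D"
  defines "Bm \<equiv> \<lambda>p. Wp p * b (snd p) + Lb.cumul (\<lambda>s. g (s, snd p) - thet (s, snd p)) (fst p)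
    + (\<integral>i. (if tau i (snd p) < fst p then \<Theta> (mark i (snd p)) else 0) \<partial>count_space (jumps (snd p)))"
  defines "BT \<equiv> \<lambda>\<omega>. b \<omega> + (\<integral>s. g (s, \<omega>) - thet (s, \<omega>) \<partial>Lb) + (\<integral>i. \<Theta> (mark i \<omega>) \<partial>count_space (jumps \<omega>))"
  shows "integrable (P0 D) (\<lambda>\<omega>. W \<omega> * (BT \<omega> * KT \<omega>))"
    and "integrable NU (\<lambda>x. Wp (fst (snd x), fst x) * Km (fst (snd x), fst x) * (g (fst (snd x), fst x)
      + \<Theta> ((fst (snd x), fst x), snd (snd x)) * lam (fst (snd x), fst x) * (kap ((fst (snd x), fst x), snd (snd x)) - 1)
      + Bm (fst (snd x), fst x) * drift ((fst (snd x), fst x), snd (snd x))))"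
    and "(\<integral>\<omega>. W \<omega> * (BT \<omega> * KT \<omega>) \<partial>P0 D) = (\<integral>\<omega>. W \<omega> * b \<omega> \<partial>P0 D) +
      (\<integral>x. Wp (fst (snd x), fst x) * Km (fst (snd x), fst x) * (g (fst (snd x), fst x)
      + \<Theta> ((fst (snd x), fst x), snd (snd x)) * lam (fst (snd x), fst x) * (kap ((fst (snd x), fst x), snd (snd x)) - 1)
      + Bm (fst (snd x), fst x) * drift ((fst (snd x), fst x), snd (snd x))) \<partial>NU)"
    and "AE \<omega> in P0 D. W \<omega> = 1 \<longrightarrow> integrable Lb (\<lambda>s. g (s, \<omega>) - thet (s, \<omega>))"
proof -
  let ?LF = "Lb \<Otimes>\<^sub>M claim_law D"
  let ?n = "\<lambda>x :: 'a \<times> real \<times> real. ((fst (snd x), fst x), snd (snd x))" and ?p = "\<lambda>x :: 'a \<times> real \<times> real. (fst (snd x), fst x)"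
  have thetm: "thet \<in> borel_measurable PS"
  proof -
    have "(\<lambda>x. \<Theta> x * lam (fst x)) \<in> borel_measurable PF"
      by (intro borel_measurable_times \<Theta> process_field[OF lam_predictable])
    from mark_integral_predictable[OF this] show ?thesis by (simp add: thet_def)
  qed
  have gt: "(\<lambda>p. g p - thet p) \<in> borel_measurable PS" by (intro borel_measurable_diff g thetm)
  have Wb: "(\<lambda>p. Wp p * b (snd p)) \<in> borel_measurable PS"
  proof -
    have "(\<lambda>p. if t < fst p then (\<lambda>\<omega>. W \<omega> * b \<omega>) (snd p) else 0) \<in> borel_measurable PS"
      by (rule PS_after[OF t]) (intro borel_measurable_times W_measurable b, simp)
    also have "(\<lambda>p. if t < fst p then (\<lambda>\<omega>. W \<omega> * b \<omega>) (snd p) else 0) = (\<lambda>p. Wp p * b (snd p))"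
      by (auto simp: Wp_def fun_eq_iff)
    finally show ?thesis .
  qed
  have Bmm: "Bm \<in> borel_measurable PS"
    unfolding Bm_def
    by (intro borel_measurable_add Wb time_integral_predictable_real[OF gt] jump_sum_before_predictable_real[OF \<Theta>])
  have bP: "b \<in> borel_measurable (P0 D)" by (rule from_F_measurable[OF t b])
  note nm = NU_process_measurable[OF Wp_predictable] NU_process_measurable[OF Km_predictable] NU_process_measurable[OF g]
    NU_process_measurable[OF lam_predictable] NU_process_measurable[OF a_predictable] NU_process_measurable[OF Bmm]
    NU_measurable[OF \<Theta>] NU_measurable[OF kap_predictable]
  \<comment> \<open>a random bound for the finite variation process\<close>
  define V where "V \<omega> = ennreal k + (\<integral>\<^sup>+s. ennreal \<bar>Wp (s, \<omega>) * g (s, \<omega>)\<bar> \<partial>Lb)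
    + (\<integral>\<^sup>+y. ennreal (\<bar>\<Theta> ((fst y, \<omega>), snd y)\<bar> * lam (fst y, \<omega>)) \<partial>?LF) + (\<integral>\<^sup>+i. ennreal \<bar>\<Theta> (mark i \<omega>)\<bar> \<partial>count_space (jumps \<omega>))" for \<omega>
  have k0: "0 \<le> k" using bk not_empty abs_ge_zero order_trans by blast
  have X2: "(\<lambda>p. ennreal \<bar>Wp p * g p\<bar>) \<in> borel_measurable PS" using Wp_predictable g by simp
  have X3: "(\<lambda>x. ennreal (\<bar>\<Theta> (?n x)\<bar> * lam (?p x))) \<in> borel_measurable NU"
    by (intro measurable_compose[OF _ measurable_ennreal] borel_measurable_times borel_measurable_abs nm)
  have X4: "(\<lambda>x. ennreal \<bar>\<Theta> x\<bar>) \<in> borel_measurable PF" using \<Theta> by simp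
  have V2m: "(\<lambda>\<omega>. \<integral>\<^sup>+s. ennreal \<bar>Wp (s, \<omega>) * g (s, \<omega>)\<bar> \<partial>Lb) \<in> borel_measurable (P0 D)"
    using Lb.borel_measurable_nn_integral[of "\<lambda>\<omega> s. ennreal \<bar>Wp (s, \<omega>) * g (s, \<omega>)\<bar>" "P0 D"] PL_process[OF X2] by (simp add: split_beta')
  have V3m: "(\<lambda>\<omega>. \<integral>\<^sup>+y. ennreal (\<bar>\<Theta> ((fst y, \<omega>), snd y)\<bar> * lam (fst y, \<omega>)) \<partial>?LF) \<in> borel_measurable (P0 D)"
    using sigma_finite_measure.borel_measurable_nn_integral[OF LF_sigma_finite, of "\<lambda>\<omega> y. ennreal (\<bar>\<Theta> ((fst y, \<omega>), snd y)\<bar> * lam (fst y, \<omega>))" "P0 D"] X3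
    by (simp add: split_beta')
  have V4m: "(\<lambda>\<omega>. \<integral>\<^sup>+i. ennreal \<bar>\<Theta> (mark i \<omega>)\<bar> \<partial>count_space (jumps \<omega>)) \<in> borel_measurable (P0 D)"
    using jump_sum_adapted[OF X4] horizon_pos by (intro from_F_measurable[of TT]) auto
  have Vm: "V \<in> borel_measurable (P0 D)"
    unfolding V_def[abs_def] by (intro borel_measurable_add V2m V3m V4m borel_measurable_const)
  let ?c = "ennreal (exp (C * TT))"
  have bndE: "ennreal (bnd \<omega>) = ?c * ennreal (exp (Lam \<omega>))" for \<omega>
    unfolding bnd_def by (rule ennreal_mult) simp_all
  have F1: "(\<integral>\<^sup>+\<omega>. ennreal k * ennreal (bnd \<omega>) \<partial>P0 D) < \<infinity>"
  proof -
    have "(\<integral>\<^sup>+\<omega>. ennreal (bnd \<omega>) \<partial>P0 D) \<le> (\<integral>\<^sup>+\<omega>. 1 + ennreal ((bnd \<omega>)\<^sup>2) \<partial>P0 D)"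
    proof (rule nn_integral_mono)
      fix \<omega>
      have "0 \<le> (bnd \<omega> - 1)\<^sup>2" by simp
      then have "bnd \<omega> \<le> 1 + (bnd \<omega>)\<^sup>2" using bnd_pos[of \<omega>] by (simp add: power2_diff)
      from ennreal_leI[OF this] show "ennreal (bnd \<omega>) \<le> 1 + ennreal ((bnd \<omega>)\<^sup>2)" by (simp add: ennreal_plus)
    qed
    also have "\<dots> = 1 + (\<integral>\<^sup>+\<omega>. ennreal ((bnd \<omega>)\<^sup>2) \<partial>P0 D)"
      using bnd_measurable emeasure_space_1 by (subst nn_integral_add) auto
    also have "\<dots> < \<infinity>" using bnd_moment by simp
    finally show ?thesis using bnd_measurable by (simp add: nn_integral_cmult ennreal_mult_less_top)
  qed
  have F2: "(\<integral>\<^sup>+\<omega>. (\<integral>\<^sup>+s. ennreal \<bar>Wp (s, \<omega>) * g (s, \<omega>)\<bar> \<partial>Lb) * ennreal (bnd \<omega>) \<partial>P0 D) < \<infinity>"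
  proof -
    have e: "(\<integral>\<^sup>+\<omega>. ennreal (exp (Lam \<omega>)) * (\<integral>\<^sup>+s. ennreal \<bar>Wp (s, \<omega>) * g (s, \<omega>)\<bar> \<partial>Lb) \<partial>P0 D) < \<infinity>"
      using gfin nn_integral_NU_weight[where W="\<lambda>\<omega>. ennreal (exp (Lam \<omega>))", OF _ X2] Lam_measurable by simp
    have "(\<integral>\<^sup>+\<omega>. (\<integral>\<^sup>+s. ennreal \<bar>Wp (s, \<omega>) * g (s, \<omega>)\<bar> \<partial>Lb) * ennreal (bnd \<omega>) \<partial>P0 D) =
        (\<integral>\<^sup>+\<omega>. ?c * (ennreal (exp (Lam \<omega>)) * (\<integral>\<^sup>+s. ennreal \<bar>Wp (s, \<omega>) * g (s, \<omega>)\<bar> \<partial>Lb)) \<partial>P0 D)"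
      unfolding bndE by (simp only: mult_ac)
    also have "\<dots> = ?c * (\<integral>\<^sup>+\<omega>. ennreal (exp (Lam \<omega>)) * (\<integral>\<^sup>+s. ennreal \<bar>Wp (s, \<omega>) * g (s, \<omega>)\<bar> \<partial>Lb) \<partial>P0 D)"
      by (rule nn_integral_cmult) (intro borel_measurable_times_ennreal V2m, use Lam_measurable in simp)
    finally show ?thesis using e by (simp add: ennreal_mult_less_top)
  qed
  note W1 = weighted_field_finite(1)[OF \<Theta> \<Theta>fin] and W2 = weighted_field_finite(2)[OF \<Theta> \<Theta>fin]
  have F3: "(\<integral>\<^sup>+\<omega>. (\<integral>\<^sup>+y. ennreal (\<bar>\<Theta> ((fst y, \<omega>), snd y)\<bar> * lam (fst y, \<omega>)) \<partial>?LF) * ennreal (bnd \<omega>) \<partial>P0 D) < \<infinity>"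
  proof -
    let ?f = "\<lambda>x. ennreal (exp (Lam (fst x))) * ennreal (\<bar>\<Theta> (?n x)\<bar> * lam (?p x))"
    have Lm: "(\<lambda>x. ennreal (exp (Lam (fst x)))) \<in> borel_measurable NU"
      using measurable_compose[OF measurable_fst Lam_measurable] by simp
    have fm: "?f \<in> borel_measurable NU" by (intro borel_measurable_times_ennreal Lm X3)
    have "(\<integral>\<^sup>+x. ?f x \<partial>NU) = (\<integral>\<^sup>+x. ennreal (exp (Lam (fst x)) * \<bar>\<Theta> (?n x)\<bar> * lam (?p x)) \<partial>NU)"
      by (intro nn_integral_cong) (simp add: ennreal_mult[symmetric] less_imp_le[OF NU_lam_pos] mult.assoc)
    then have f: "(\<integral>\<^sup>+x. ?f x \<partial>NU) < \<infinity>" using W1 by simp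
    have "(\<integral>\<^sup>+\<omega>. (\<integral>\<^sup>+y. ennreal (\<bar>\<Theta> ((fst y, \<omega>), snd y)\<bar> * lam (fst y, \<omega>)) \<partial>?LF) * ennreal (bnd \<omega>) \<partial>P0 D) =
        (\<integral>\<^sup>+\<omega>. ?c * (\<integral>\<^sup>+y. ?f (\<omega>, y) \<partial>?LF) \<partial>P0 D)"
    proof (rule nn_integral_cong)
      fix \<omega> assume \<omega>: "\<omega> \<in> \<Omega>"
      have "(\<lambda>y. ennreal (\<bar>\<Theta> (?n (\<omega>, y))\<bar> * lam (?p (\<omega>, y)))) \<in> borel_measurable ?LF"
        by (rule measurable_compose_Pair1[OF \<omega> X3])
      then show "(\<integral>\<^sup>+y. ennreal (\<bar>\<Theta> ((fst y, \<omega>), snd y)\<bar> * lam (fst y, \<omega>)) \<partial>?LF) * ennreal (bnd \<omega>) = ?c * (\<integral>\<^sup>+y. ?f (\<omega>, y) \<partial>?LF)"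
        unfolding bndE by (simp add: nn_integral_cmult mult_ac)
    qed
    also have "\<dots> = ?c * (\<integral>\<^sup>+x. ?f x \<partial>NU)"
      unfolding sigma_finite_measure.nn_integral_fst[OF LF_sigma_finite fm, symmetric]
      by (rule nn_integral_cmult) (rule sigma_finite_measure.borel_measurable_nn_integral_fst[OF LF_sigma_finite fm])
    finally show ?thesis using f by (simp add: ennreal_mult_less_top)
  qed
  have F4: "(\<integral>\<^sup>+\<omega>. (\<integral>\<^sup>+i. ennreal \<bar>\<Theta> (mark i \<omega>)\<bar> \<partial>count_space (jumps \<omega>)) * ennreal (bnd \<omega>) \<partial>P0 D) < \<infinity>"
  proof -
    have "(\<integral>\<^sup>+\<omega>. (\<integral>\<^sup>+i. ennreal \<bar>\<Theta> (mark i \<omega>)\<bar> \<partial>count_space (jumps \<omega>)) * ennreal (bnd \<omega>) \<partial>P0 D) \<le>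
        (\<integral>\<^sup>+\<omega>. ?c * (ennreal (exp (Lam \<omega>)) * (\<integral>\<^sup>+i. ennreal \<bar>\<Theta> (mark i \<omega>)\<bar> \<partial>count_space (jumps \<omega>))) \<partial>P0 D)"
      unfolding bndE by (simp add: mult_ac)
    also have "\<dots> = ?c * (\<integral>\<^sup>+\<omega>. ennreal (exp (Lam \<omega>)) * (\<integral>\<^sup>+i. ennreal \<bar>\<Theta> (mark i \<omega>)\<bar> \<partial>count_space (jumps \<omega>)) \<partial>P0 D)"
      by (rule nn_integral_cmult) (intro borel_measurable_times_ennreal V4m, use Lam_measurable in simp)
    also have "(\<integral>\<^sup>+\<omega>. ennreal (exp (Lam \<omega>)) * (\<integral>\<^sup>+i. ennreal \<bar>\<Theta> (mark i \<omega>)\<bar> \<partial>count_space (jumps \<omega>)) \<partial>P0 D) =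
        (\<integral>\<^sup>+\<omega>. ennreal (exp (Lam \<omega>) * (\<Sum>i\<in>jumps \<omega>. \<bar>\<Theta> (mark i \<omega>)\<bar>)) \<partial>P0 D)"
    proof (rule nn_integral_cong_AE)
      show "AE \<omega> in P0 D. ennreal (exp (Lam \<omega>)) * (\<integral>\<^sup>+i. ennreal \<bar>\<Theta> (mark i \<omega>)\<bar> \<partial>count_space (jumps \<omega>)) =
          ennreal (exp (Lam \<omega>) * (\<Sum>i\<in>jumps \<omega>. \<bar>\<Theta> (mark i \<omega>)\<bar>))"
        using regular_AE
      proof eventually_elim
        case (elim \<omega>)
        then have f: "finite (jumps \<omega>)" by (simp add: regular_def)
        show ?case unfolding nn_integral_count_space_finite[OF f] by (simp add: sum_ennreal ennreal_mult sum_nonneg)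
      qed
    qed
    finally show ?thesis using W2 by (auto simp: ennreal_mult_less_top intro: le_less_trans)
  qed
  have VF: "(\<integral>\<^sup>+\<omega>. V \<omega> * ennreal (bnd \<omega>) \<partial>P0 D) < \<infinity>"
  proof -
    have bm: "(\<lambda>\<omega>. ennreal (bnd \<omega>)) \<in> borel_measurable (P0 D)" using bnd_measurable by simp
    show ?thesis
      unfolding V_def distrib_right
      by (subst nn_integral_add nn_integral_add; (intro borel_measurable_add borel_measurable_times_ennreal borel_measurable_const V2m V3m V4m bm)?)+
        (use F1 F2 F3 F4 in simp)
  qed
  note KF = Km_weight_finite[OF Vm VF]
  \<comment> \<open>the exceptional null sets\<close>
  define tame where "tame \<omega> \<longleftrightarrow> regular \<omega> \<and> integrable ?LF (\<lambda>y. \<Theta> ((fst y, \<omega>), snd y) * lam (fst y, \<omega>)) \<and>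
    integrable Lb (\<lambda>s. Wp (s, \<omega>) * g (s, \<omega>))" for \<omega>
  have tameAE: "AE \<omega> in P0 D. tame \<omega>"
  proof -
    have "AE \<omega> in P0 D. V \<omega> * ennreal (bnd \<omega>) \<noteq> \<infinity>"
      by (rule nn_integral_PInf_AE) (use VF Vm bnd_measurable in auto)
    with regular_AE show ?thesis
    proof eventually_elim
      case (elim \<omega>)
      then have \<omega>: "\<omega> \<in> \<Omega>" by (simp add: regular_def)
      have "V \<omega> < \<infinity>" using elim(2) bnd_pos[of \<omega>] by (auto simp: ennreal_mult_eq_top_iff less_top)
      then have fin: "(\<integral>\<^sup>+s. ennreal \<bar>Wp (s, \<omega>) * g (s, \<omega>)\<bar> \<partial>Lb) < \<infinity>"
        "(\<integral>\<^sup>+y. ennreal (\<bar>\<Theta> ((fst y, \<omega>), snd y)\<bar> * lam (fst y, \<omega>)) \<partial>?LF) < \<infinity>"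
        unfolding V_def by (auto simp: less_top[symmetric])
      have "integrable Lb (\<lambda>s. Wp (s, \<omega>) * g (s, \<omega>))"
        by (rule integrableI_bounded)
          (use fin(1) process_section[OF Wp_predictable \<omega>] process_section[OF g \<omega>] in auto)
      moreover have "integrable ?LF (\<lambda>y. \<Theta> ((fst y, \<omega>), snd y) * lam (fst y, \<omega>))"
      proof (rule integrableI_bounded)
        have "(\<lambda>x. \<Theta> (?n x) * lam (?p x)) \<in> borel_measurable NU" by (intro borel_measurable_times nm)
        from measurable_compose_Pair1[OF \<omega> this]
        show "(\<lambda>y. \<Theta> ((fst y, \<omega>), snd y) * lam (fst y, \<omega>)) \<in> borel_measurable ?LF" by simp
        have "(\<integral>\<^sup>+y. ennreal (norm (\<Theta> ((fst y, \<omega>), snd y) * lam (fst y, \<omega>))) \<partial>?LF) =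
            (\<integral>\<^sup>+y. ennreal (\<bar>\<Theta> ((fst y, \<omega>), snd y)\<bar> * lam (fst y, \<omega>)) \<partial>?LF)"
          using lam_pos \<omega> by (intro nn_integral_cong) (auto simp: abs_mult space_pair_measure less_imp_le abs_of_pos)
        then show "(\<integral>\<^sup>+y. ennreal (norm (\<Theta> ((fst y, \<omega>), snd y) * lam (fst y, \<omega>))) \<partial>?LF) < \<infinity>" using fin(2) by simp
      qed
      ultimately show ?case using elim(1) by (simp add: tame_def)
    qed
  qed
  have thet_int: "integrable Lb (\<lambda>s. thet (s, \<omega>))" and thet_abs: "ennreal (\<integral>s. \<bar>thet (s, \<omega>)\<bar> \<partial>Lb) \<le>
      (\<integral>\<^sup>+y. ennreal (\<bar>\<Theta> ((fst y, \<omega>), snd y)\<bar> * lam (fst y, \<omega>)) \<partial>?LF)" if "tame \<omega>" for \<omega>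
  proof -
    have i: "integrable ?LF (\<lambda>y. \<Theta> ((fst y, \<omega>), snd y) * lam (fst y, \<omega>))" and \<omega>: "\<omega> \<in> \<Omega>"
      using that by (auto simp: tame_def regular_def)
    show ti: "integrable Lb (\<lambda>s. thet (s, \<omega>))" using LF_integrable_fst[OF i] by (simp add: thet_def)
    have i2: "integrable ?LF (\<lambda>y. \<bar>\<Theta> ((fst y, \<omega>), snd y) * lam (fst y, \<omega>)\<bar>)" using i by simp
    have "(\<integral>s. \<bar>thet (s, \<omega>)\<bar> \<partial>Lb) \<le> (\<integral>s. (\<integral>z. \<bar>\<Theta> ((s, \<omega>), z) * lam (s, \<omega>)\<bar> \<partial>claim_law D) \<partial>Lb)"
    proof (rule integral_mono)
      show "integrable Lb (\<lambda>s. \<bar>thet (s, \<omega>)\<bar>)" using ti by simp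
      show "integrable Lb (\<lambda>s. \<integral>z. \<bar>\<Theta> ((s, \<omega>), z) * lam (s, \<omega>)\<bar> \<partial>claim_law D)"
        using LF_integrable_fst[OF i2] by simp
      show "\<bar>thet (s, \<omega>)\<bar> \<le> (\<integral>z. \<bar>\<Theta> ((s, \<omega>), z) * lam (s, \<omega>)\<bar> \<partial>claim_law D)" for s
        unfolding thet_def by (rule integral_abs_bound)
    qed
    also have "\<dots> = (\<integral>y. \<bar>\<Theta> ((fst y, \<omega>), snd y) * lam (fst y, \<omega>)\<bar> \<partial>?LF)"
      using LF_Fubini[OF i2] by simp
    finally have "ennreal (\<integral>s. \<bar>thet (s, \<omega>)\<bar> \<partial>Lb) \<le> ennreal (\<integral>y. \<bar>\<Theta> ((fst y, \<omega>), snd y) * lam (fst y, \<omega>)\<bar> \<partial>?LF)"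
      by (rule ennreal_leI)
    also have "\<dots> = (\<integral>\<^sup>+y. ennreal \<bar>\<Theta> ((fst y, \<omega>), snd y) * lam (fst y, \<omega>)\<bar> \<partial>?LF)"
      by (rule nn_integral_eq_integral[symmetric, OF i2]) simp
    also have "\<dots> = (\<integral>\<^sup>+y. ennreal (\<bar>\<Theta> ((fst y, \<omega>), snd y)\<bar> * lam (fst y, \<omega>)) \<partial>?LF)"
      using lam_pos \<omega> by (intro nn_integral_cong) (auto simp: abs_mult space_pair_measure less_imp_le abs_of_pos)
    finally show "ennreal (\<integral>s. \<bar>thet (s, \<omega>)\<bar> \<partial>Lb) \<le> (\<integral>\<^sup>+y. ennreal (\<bar>\<Theta> ((fst y, \<omega>), snd y)\<bar> * lam (fst y, \<omega>)) \<partial>?LF)" .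
  qed
  have g_int: "integrable Lb (\<lambda>s. g (s, \<omega>))" "\<And>s. Wp (s, \<omega>) * g (s, \<omega>) = g (s, \<omega>)" if "tame \<omega>" "W \<omega> = 1" for \<omega>
  proof -
    show e: "\<And>s. Wp (s, \<omega>) * g (s, \<omega>) = g (s, \<omega>)" using that(2) g0 by (simp add: Wp_def)
    show "integrable Lb (\<lambda>s. g (s, \<omega>))" using that(1) unfolding tame_def e by simp
  qed
  have fint: "AE \<omega> in P0 D. W \<omega> = 1 \<longrightarrow> integrable Lb (\<lambda>s. g (s, \<omega>) - thet (s, \<omega>))"
    using tameAE by eventually_elim (auto intro!: Bochner_Integration.integrable_diff g_int thet_int)
  then show "AE \<omega> in P0 D. W \<omega> = 1 \<longrightarrow> integrable Lb (\<lambda>s. g (s, \<omega>) - thet (s, \<omega>))" .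
  have BmV: "ennreal \<bar>Wp (s, \<omega>) * Bm (s, \<omega>)\<bar> \<le> V \<omega>" if fi: "tame \<omega>" for s \<omega>
  proof (cases "W \<omega> = 1 \<and> t < s")
    case True
    have \<omega>: "\<omega> \<in> \<Omega>" and f: "finite (jumps \<omega>)" using fi by (auto simp: tame_def regular_def)
    have gi: "integrable Lb (\<lambda>s. g (s, \<omega>))" using g_int(1) fi True by blast
    have ai: "integrable Lb (\<lambda>s. g (s, \<omega>) - thet (s, \<omega>))" using gi thet_int[OF fi] by simp
    have "\<bar>Lb.cumul (\<lambda>s. g (s, \<omega>) - thet (s, \<omega>)) s\<bar> \<le> (\<integral>v. \<bar>g (v, \<omega>) - thet (v, \<omega>)\<bar> \<partial>Lb)"
      by (rule Lb.cumul_bound[OF ai])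
    also have "\<dots> \<le> (\<integral>v. \<bar>g (v, \<omega>)\<bar> + \<bar>thet (v, \<omega>)\<bar> \<partial>Lb)"
      using ai gi thet_int[OF fi] by (intro integral_mono) auto
    also have "\<dots> = (\<integral>v. \<bar>g (v, \<omega>)\<bar> \<partial>Lb) + (\<integral>v. \<bar>thet (v, \<omega>)\<bar> \<partial>Lb)"
      using gi thet_int[OF fi] by simp
    finally have c: "\<bar>Lb.cumul (\<lambda>s. g (s, \<omega>) - thet (s, \<omega>)) s\<bar> \<le> (\<integral>v. \<bar>g (v, \<omega>)\<bar> \<partial>Lb) + (\<integral>v. \<bar>thet (v, \<omega>)\<bar> \<partial>Lb)" .
    have j: "\<bar>\<integral>i. (if tau i \<omega> < s then \<Theta> (mark i \<omega>) else 0) \<partial>count_space (jumps \<omega>)\<bar> \<le> (\<Sum>i\<in>jumps \<omega>. \<bar>\<Theta> (mark i \<omega>)\<bar>)"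
      unfolding jump_integral_finite[OF f] by (rule order_trans[OF sum_abs]) (auto intro!: sum_mono)
    have "\<bar>Wp (s, \<omega>) * Bm (s, \<omega>)\<bar> \<le> k + (\<integral>v. \<bar>g (v, \<omega>)\<bar> \<partial>Lb) + (\<integral>v. \<bar>thet (v, \<omega>)\<bar> \<partial>Lb) + (\<Sum>i\<in>jumps \<omega>. \<bar>\<Theta> (mark i \<omega>)\<bar>)"
    proof -
      have "Wp (s, \<omega>) * Bm (s, \<omega>) = b \<omega> + Lb.cumul (\<lambda>s. g (s, \<omega>) - thet (s, \<omega>)) s
          + (\<integral>i. (if tau i \<omega> < s then \<Theta> (mark i \<omega>) else 0) \<partial>count_space (jumps \<omega>))"
        unfolding Bm_def Wp_def fst_conv snd_conv using True by simp
      moreover have "\<bar>b \<omega>\<bar> \<le> k" using bk[OF \<omega>] True by simp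
      ultimately show ?thesis using c j by linarith
    qed
    then have "ennreal \<bar>Wp (s, \<omega>) * Bm (s, \<omega>)\<bar> \<le> ennreal (k + (\<integral>v. \<bar>g (v, \<omega>)\<bar> \<partial>Lb) + (\<integral>v. \<bar>thet (v, \<omega>)\<bar> \<partial>Lb) + (\<Sum>i\<in>jumps \<omega>. \<bar>\<Theta> (mark i \<omega>)\<bar>))"
      by (rule ennreal_leI)
    also have "\<dots> = ennreal k + ennreal (\<integral>v. \<bar>g (v, \<omega>)\<bar> \<partial>Lb) + ennreal (\<integral>v. \<bar>thet (v, \<omega>)\<bar> \<partial>Lb) + ennreal (\<Sum>i\<in>jumps \<omega>. \<bar>\<Theta> (mark i \<omega>)\<bar>)"
      using k0 by (simp add: ennreal_plus sum_nonneg)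
    also have "\<dots> \<le> V \<omega>"
    proof -
      have "ennreal (\<integral>v. \<bar>g (v, \<omega>)\<bar> \<partial>Lb) = (\<integral>\<^sup>+s. ennreal \<bar>Wp (s, \<omega>) * g (s, \<omega>)\<bar> \<partial>Lb)"
        unfolding g_int(2)[OF fi conjunct1[OF True]] using gi by (intro nn_integral_eq_integral[symmetric]) auto
      moreover have "ennreal (\<Sum>i\<in>jumps \<omega>. \<bar>\<Theta> (mark i \<omega>)\<bar>) = (\<integral>\<^sup>+i. ennreal \<bar>\<Theta> (mark i \<omega>)\<bar> \<partial>count_space (jumps \<omega>))"
        unfolding nn_integral_count_space_finite[OF f] by (simp add: sum_ennreal)
      ultimately show ?thesis
        unfolding V_def using thet_abs[OF fi] by (intro add_mono) simp_all
    qed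
    finally show ?thesis .
  next
    case False
    have "\<omega> \<in> \<Omega>" using fi by (simp add: tame_def regular_def)
    then have "Wp (s, \<omega>) = 0" using False W_values[of \<omega>] by (auto simp: Wp_def)
    then show ?thesis by simp
  qed
  \<comment> \<open>integrability of the summands\<close>
  have nice: "AE x in NU. x \<in> space NU \<and> 0 < snd (snd x) \<and> tame (fst x)"
    using NU_AE_claim_pos AE_space NU_AE_fst[OF tameAE] by eventually_elim simp
  define f1 where "f1 x = Wp (?p x) * Km (?p x) * g (?p x)" for x
  define f2 where "f2 x = Wp (?p x) * Km (?p x) * (\<Theta> (?n x) * lam (?p x))" for x
  define f2' where "f2' x = Wp (?p x) * Km (?p x) * (\<Theta> (?n x) * lam (?p x)) * kap (?n x)" for x
  define f3 where "f3 x = Wp (?p x) * Km (?p x) * Bm (?p x) * a (?p x)" for x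
  define f4 where "f4 x = Wp (?p x) * Km (?p x) * Bm (?p x) * (lam (?p x) * (kap (?n x) - 1))" for x
  have fm: "f1 \<in> borel_measurable NU" "f2 \<in> borel_measurable NU" "f2' \<in> borel_measurable NU"
    "f3 \<in> borel_measurable NU" "f4 \<in> borel_measurable NU"
    unfolding f1_def[abs_def] f2_def[abs_def] f2'_def[abs_def] f3_def[abs_def] f4_def[abs_def]
    by (intro borel_measurable_times borel_measurable_diff borel_measurable_const nm)+
  have Kle: "Km (?p x) \<le> exp (C * TT) * exp (Lam (fst x))" if "tame (fst x)" for x
    using Km_bound[of "fst x" "fst (snd x)"] that by (simp add: tame_def bnd_def)
  have i1: "integrable NU f1"
  proof (rule dominated_NU[OF fm(1)])
    show "(\<integral>\<^sup>+x. ?c * (ennreal (exp (Lam (fst x))) * ennreal \<bar>Wp (?p x) * g (?p x)\<bar>) \<partial>NU) < \<infinity>"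
    proof (subst nn_integral_cmult)
      show "(\<lambda>x. ennreal (exp (Lam (fst x))) * ennreal \<bar>Wp (?p x) * g (?p x)\<bar>) \<in> borel_measurable NU"
        using measurable_compose[OF measurable_fst Lam_measurable] NU_process_measurable[OF X2]
        by (intro borel_measurable_times_ennreal) simp_all
    qed (use gfin in \<open>simp add: ennreal_mult_less_top\<close>)
    show "AE x in NU. ennreal \<bar>f1 x\<bar> \<le> ?c * (ennreal (exp (Lam (fst x))) * ennreal \<bar>Wp (?p x) * g (?p x)\<bar>)"
      using nice
    proof eventually_elim
      case (elim x)
      have "\<bar>f1 x\<bar> = Km (?p x) * \<bar>Wp (?p x) * g (?p x)\<bar>" using Km_pos[of "?p x"] by (simp add: f1_def abs_mult)
      also have "\<dots> \<le> exp (C * TT) * exp (Lam (fst x)) * \<bar>Wp (?p x) * g (?p x)\<bar>"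
        using elim by (intro mult_right_mono Kle) auto
      finally have "ennreal \<bar>f1 x\<bar> \<le> ennreal (exp (C * TT) * exp (Lam (fst x)) * \<bar>Wp (?p x) * g (?p x)\<bar>)" by (rule ennreal_leI)
      then show ?case by (simp add: ennreal_mult mult.assoc)
    qed
  qed
  have i2: "integrable NU f2 \<and> integrable NU f2'"
  proof -
    let ?h = "\<lambda>x. ?c * ennreal (exp (Lam (fst x)) * \<bar>\<Theta> (?n x)\<bar> * lam (?p x))"
    have hf: "(\<integral>\<^sup>+x. ?h x \<partial>NU) < \<infinity>"
    proof (subst nn_integral_cmult)
      show "(\<lambda>x. ennreal (exp (Lam (fst x)) * \<bar>\<Theta> (?n x)\<bar> * lam (?p x))) \<in> borel_measurable NU"
        by (intro measurable_compose[OF _ measurable_ennreal] borel_measurable_times borel_measurable_abs nm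
            measurable_compose[OF measurable_compose[OF measurable_fst Lam_measurable] borel_measurable_exp])
    qed (use W1 in \<open>simp add: ennreal_mult_less_top\<close>)
    have both: "AE x in NU. ennreal \<bar>f2 x\<bar> \<le> ?h x \<and> ennreal \<bar>f2' x\<bar> \<le> ?h x"
      using nice
    proof eventually_elim
      case (elim x)
      have l: "0 < lam (?p x)" using elim NU_lam_pos by blast
      have kp: "0 < kap (?n x)" "kap (?n x) \<le> 1" using kap_bounds[OF NU_fst_PS, of x "snd (snd x)"] elim by auto
      have "\<bar>f2 x\<bar> = \<bar>Wp (?p x)\<bar> * (Km (?p x) * (\<bar>\<Theta> (?n x)\<bar> * lam (?p x)))"
        using Km_pos[of "?p x"] l by (simp add: f2_def abs_mult)
      also have "\<dots> \<le> 1 * (Km (?p x) * (\<bar>\<Theta> (?n x)\<bar> * lam (?p x)))"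
        using Wp_abs[OF NU_fst_PS, of x] elim Km_pos[of "?p x"] l by (intro mult_right_mono) auto
      also have "\<dots> \<le> (exp (C * TT) * exp (Lam (fst x))) * (\<bar>\<Theta> (?n x)\<bar> * lam (?p x))"
        using elim l Kle[of x] by (simp add: mult_right_mono)
      finally have b2: "\<bar>f2 x\<bar> \<le> exp (C * TT) * (exp (Lam (fst x)) * \<bar>\<Theta> (?n x)\<bar> * lam (?p x))" by (simp add: mult_ac)
      have "\<bar>f2' x\<bar> = \<bar>f2 x\<bar> * kap (?n x)" using kp by (simp add: f2'_def f2_def abs_mult)
      also have "\<dots> \<le> \<bar>f2 x\<bar>" using kp by (intro mult_left_le) auto
      finally have b2': "\<bar>f2' x\<bar> \<le> exp (C * TT) * (exp (Lam (fst x)) * \<bar>\<Theta> (?n x)\<bar> * lam (?p x))" using b2 by linarith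
      show ?case using ennreal_leI[OF b2] ennreal_leI[OF b2'] l by (simp add: ennreal_mult)
    qed
    then have "AE x in NU. ennreal \<bar>f2 x\<bar> \<le> ?h x" "AE x in NU. ennreal \<bar>f2' x\<bar> \<le> ?h x" by (auto elim: eventually_mono)
    then show ?thesis using dominated_NU[OF fm(2) hf] dominated_NU[OF fm(3) hf] by simp
  qed
  have i3: "integrable NU f3 \<and> integrable NU f4"
  proof -
    let ?h = "\<lambda>x. V (fst x) * ennreal (Km (?p x) * (a (?p x) + lam (?p x)))"
    have both: "AE x in NU. ennreal \<bar>f3 x\<bar> \<le> ?h x \<and> ennreal \<bar>f4 x\<bar> \<le> ?h x"
      using nice
    proof eventually_elim
      case (elim x)
      have l: "0 < lam (?p x)" using elim NU_lam_pos by blast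
      have a0: "0 \<le> a (?p x)" using a_bounds(1)[OF NU_fst_PS] elim by blast
      have kp: "0 < kap (?n x)" "kap (?n x) \<le> 1" using kap_bounds[OF NU_fst_PS, of x "snd (snd x)"] elim by auto
      have bV: "ennreal \<bar>Wp (?p x) * Bm (?p x)\<bar> \<le> V (fst x)" using BmV[of "fst x" "fst (snd x)"] elim by simp
      have gen: "ennreal (\<bar>Wp (?p x) * Bm (?p x)\<bar> * (Km (?p x) * y)) \<le> ?h x" if "0 \<le> y" "y \<le> a (?p x) + lam (?p x)" for y
      proof -
        have "ennreal (\<bar>Wp (?p x) * Bm (?p x)\<bar> * (Km (?p x) * y)) = ennreal \<bar>Wp (?p x) * Bm (?p x)\<bar> * ennreal (Km (?p x) * y)"
          using that Km_pos[of "?p x"] by (intro ennreal_mult) auto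
        also have "\<dots> \<le> ?h x"
          using bV that Km_pos[of "?p x"] by (intro mult_mono ennreal_leI mult_left_mono) auto
        finally show ?thesis .
      qed
      have e3: "\<bar>f3 x\<bar> = \<bar>Wp (?p x) * Bm (?p x)\<bar> * (Km (?p x) * a (?p x))"
        using a0 Km_pos[of "?p x"] by (simp add: f3_def abs_mult)
      have e4: "\<bar>f4 x\<bar> = \<bar>Wp (?p x) * Bm (?p x)\<bar> * (Km (?p x) * (lam (?p x) * (1 - kap (?n x))))"
        using l kp Km_pos[of "?p x"] by (simp add: f4_def abs_mult)
      have "lam (?p x) * (1 - kap (?n x)) \<le> lam (?p x) * 1" using l kp by (intro mult_left_mono) auto
      moreover have "0 \<le> lam (?p x) * (1 - kap (?n x))" using l kp by (intro mult_nonneg_nonneg) auto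
      ultimately show ?case unfolding e3 e4 using l kp a0 by (intro conjI gen; linarith)
    qed
    then have "AE x in NU. ennreal \<bar>f3 x\<bar> \<le> ?h x" "AE x in NU. ennreal \<bar>f4 x\<bar> \<le> ?h x" by (auto elim: eventually_mono)
    then show ?thesis using dominated_NU[OF fm(4) KF] dominated_NU[OF fm(5) KF] by simp
  qed
  have ftot: "Wp (?p x) * Km (?p x) * (g (?p x) + \<Theta> (?n x) * lam (?p x) * (kap (?n x) - 1) + Bm (?p x) * drift (?n x))
      = (f1 x + f3 x) - f2 x + (f2' x + f4 x)" for x
    by (simp add: f1_def f2_def f2'_def f3_def f4_def drift_def algebra_simps)
  show "integrable NU (\<lambda>x. Wp (?p x) * Km (?p x) * (g (?p x) + \<Theta> (?n x) * lam (?p x) * (kap (?n x) - 1) + Bm (?p x) * drift (?n x)))"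
    unfolding ftot using i1 i2 i3 by simp
  \<comment> \<open>the sum over the claims\<close>
  define H where "H x = Wp (fst x) * Km (fst x) * (\<Theta> x * kap x + Bm (fst x) * (kap x - 1))" for x
  have Hm: "H \<in> borel_measurable PF"
    unfolding H_def[abs_def]
    by (intro borel_measurable_times borel_measurable_add borel_measurable_diff process_field[OF Wp_predictable]
        process_field[OF Km_predictable] process_field[OF Bmm] \<Theta> kap_predictable borel_measurable_const)
  have Hl: "H (?n x) * lam (?p x) = f2' x + f4 x" for x
    by (simp add: H_def f2'_def f4_def algebra_simps)
  have Hi: "integrable NU (\<lambda>x. H (?n x) * lam (?p x))" unfolding Hl using i2 i3 by simp
  note comp = compensation[OF Hm Hi]
  have i13: "integrable NU (\<lambda>x. f1 x + f3 x)" using i1 i3 by simp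
  have path: "AE \<omega> in P0 D. W \<omega> * (BT \<omega> * KT \<omega>) = W \<omega> * b \<omega> + (\<integral>y. f1 (\<omega>, y) + f3 (\<omega>, y) \<partial>?LF) - (\<integral>y. f2 (\<omega>, y) \<partial>?LF)
      + (\<integral>i. H (mark i \<omega>) \<partial>count_space (jumps \<omega>))"
    using tameAE NU_AE_section[OF i13] NU_AE_section[OF conjunct1[OF i2]]
  proof eventually_elim
    case (elim \<omega>)
    have r: "regular \<omega>" and \<omega>: "\<omega> \<in> \<Omega>" and f: "finite (jumps \<omega>)" using elim(1) by (auto simp: tame_def regular_def)
    have L13: "(\<integral>y. f1 (\<omega>, y) + f3 (\<omega>, y) \<partial>?LF) = (\<integral>s. Wp (s, \<omega>) * Km (s, \<omega>) * (g (s, \<omega>) + Bm (s, \<omega>) * a (s, \<omega>)) \<partial>Lb)"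
      using LF_Fubini[OF elim(2)] FL.prob_space by (simp add: f1_def f3_def algebra_simps)
    have L2: "(\<integral>y. f2 (\<omega>, y) \<partial>?LF) = (\<integral>s. Wp (s, \<omega>) * Km (s, \<omega>) * thet (s, \<omega>) \<partial>Lb)"
      using LF_Fubini[OF elim(3)] by (simp add: f2_def thet_def)
    have iL13: "integrable Lb (\<lambda>s. Wp (s, \<omega>) * Km (s, \<omega>) * (g (s, \<omega>) + Bm (s, \<omega>) * a (s, \<omega>)))"
      using LF_integrable_fst[OF elim(2)] FL.prob_space by (simp add: f1_def f3_def algebra_simps)
    have iL2: "integrable Lb (\<lambda>s. Wp (s, \<omega>) * Km (s, \<omega>) * thet (s, \<omega>))"
      using LF_integrable_fst[OF elim(3)] by (simp add: f2_def thet_def)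
    consider "W \<omega> = 0" | "W \<omega> = 1" using W_values[OF \<omega>] by blast
    then show ?case
    proof cases
      case 1
      then have "Wp (s, \<omega>) = 0" for s by (cases "t < s") (simp_all add: Wp_def)
      then show ?thesis using 1 by (simp add: f1_def f2_def f3_def H_def mark_def)
    next
      case 2
      let ?\<alpha> = "\<lambda>s. g (s, \<omega>) - thet (s, \<omega>)" and ?\<beta> = "\<lambda>s. a (s, \<omega>) * Km (s, \<omega>)"
      let ?\<xi> = "\<lambda>i. \<Theta> (mark i \<omega>)" and ?\<upsilon> = "\<lambda>i. Km (tau i \<omega>, \<omega>) * (kap (mark i \<omega>) - 1)"
      let ?X = "\<lambda>s. b \<omega> + Lb.cumul ?\<alpha> s + (\<Sum>i\<in>{i\<in>jumps \<omega>. tau i \<omega> < s}. ?\<xi> i)"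
      have \<alpha>: "integrable Lb ?\<alpha>" using g_int(1)[OF elim(1) 2] thet_int[OF elim(1)] by simp
      have \<beta>: "integrable Lb ?\<beta>"
      proof (rule Lb.integrable_mult_bounded[OF a_integrable[OF r] process_section[OF Km_predictable \<omega>]])
        show "\<bar>Km (s, \<omega>)\<bar> \<le> bnd \<omega>" for s using Km_bound[OF r] Km_pos[of "(s, \<omega>)"] by simp
      qed
      have BmX: "Bm (s, \<omega>) = ?X s" if "t < s" for s
        unfolding Bm_def fst_conv snd_conv jump_integral_finite[OF f] using that 2 f by (simp add: Wp_def sum.inter_filter)
      have th0: "thet (s, \<omega>) = 0" if "s \<le> t" for s using \<Theta>0[OF that] by (simp add: thet_def)
      have pf: "BT \<omega> * KT \<omega> = b \<omega> * 1 + (\<integral>s. ?\<alpha> s * Km (s, \<omega>) + ?X s * ?\<beta> s \<partial>Lb)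
          + (\<Sum>i\<in>jumps \<omega>. ?\<xi> i * Km (tau i \<omega>, \<omega>) + ?X (tau i \<omega>) * ?\<upsilon> i + ?\<xi> i * ?\<upsilon> i)"
        unfolding BT_def K_doleans(1)[OF r] jump_integral_finite[OF f]
        by (rule Lb.product_formula[OF \<alpha> \<beta> f inj_tau[OF \<omega>] refl]) (rule K_doleans(2)[OF r])
      have "(\<integral>s. ?\<alpha> s * Km (s, \<omega>) + ?X s * ?\<beta> s \<partial>Lb) =
          (\<integral>s. Wp (s, \<omega>) * Km (s, \<omega>) * (g (s, \<omega>) + Bm (s, \<omega>) * a (s, \<omega>)) - Wp (s, \<omega>) * Km (s, \<omega>) * thet (s, \<omega>) \<partial>Lb)"
      proof (rule Bochner_Integration.integral_cong[OF refl])
        fix s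
        show "?\<alpha> s * Km (s, \<omega>) + ?X s * ?\<beta> s = Wp (s, \<omega>) * Km (s, \<omega>) * (g (s, \<omega>) + Bm (s, \<omega>) * a (s, \<omega>)) - Wp (s, \<omega>) * Km (s, \<omega>) * thet (s, \<omega>)"
        proof (cases "t < s")
          case True
          have "Wp (s, \<omega>) = 1" using True 2 by (simp add: Wp_def)
          then show ?thesis unfolding BmX[OF True] by (simp add: algebra_simps)
        next
          case False
          then show ?thesis using g0 th0 a_before by (simp add: Wp_def)
        qed
      qed
      also have "\<dots> = (\<integral>y. f1 (\<omega>, y) + f3 (\<omega>, y) \<partial>?LF) - (\<integral>y. f2 (\<omega>, y) \<partial>?LF)"
        unfolding L13 L2 by (rule Bochner_Integration.integral_diff[OF iL13 iL2])
      finally have e1: "(\<integral>s. ?\<alpha> s * Km (s, \<omega>) + ?X s * ?\<beta> s \<partial>Lb) = (\<integral>y. f1 (\<omega>, y) + f3 (\<omega>, y) \<partial>?LF) - (\<integral>y. f2 (\<omega>, y) \<partial>?LF)" .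
      have e2: "(\<Sum>i\<in>jumps \<omega>. ?\<xi> i * Km (tau i \<omega>, \<omega>) + ?X (tau i \<omega>) * ?\<upsilon> i + ?\<xi> i * ?\<upsilon> i) = (\<integral>i. H (mark i \<omega>) \<partial>count_space (jumps \<omega>))"
        unfolding jump_integral_finite[OF f]
      proof (rule sum.cong[OF refl])
        fix i
        show "?\<xi> i * Km (tau i \<omega>, \<omega>) + ?X (tau i \<omega>) * ?\<upsilon> i + ?\<xi> i * ?\<upsilon> i = H (mark i \<omega>)"
        proof (cases "t < tau i \<omega>")
          case True
          have "Wp (tau i \<omega>, \<omega>) = 1" using True 2 by (simp add: Wp_def)
          then show ?thesis unfolding H_def BmX[OF True, symmetric] by (simp add: mark_def BmX[OF True, symmetric] algebra_simps)
        next
          case False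
          then show ?thesis using \<Theta>0 kap_before by (simp add: H_def mark_def Wp_def)
        qed
      qed
      show ?thesis using pf e1 e2 2 by simp
    qed
  qed
  have Wbi: "integrable (P0 D) (\<lambda>\<omega>. W \<omega> * b \<omega>)"
    by (rule integrable_const_bound[where B=k]) (use bk W_P0 bP in \<open>auto intro!: AE_I2\<close>)
  have BTm: "(\<lambda>\<omega>. W \<omega> * (BT \<omega> * KT \<omega>)) \<in> borel_measurable (P0 D)"
    unfolding BT_def using horizon_pos
    by (intro borel_measurable_times borel_measurable_add W_P0 KT_measurable bP time_integral_measurable[OF gt]
        from_F_measurable[OF _ jump_integral_measurable[OF \<Theta>]]) simp
  note fst13 = NU_integrable_fst[OF i13] and fst2 = NU_integrable_fst[OF conjunct1[OF i2]]
  have ri: "integrable (P0 D) (\<lambda>\<omega>. W \<omega> * b \<omega> + (\<integral>y. f1 (\<omega>, y) + f3 (\<omega>, y) \<partial>?LF) - (\<integral>y. f2 (\<omega>, y) \<partial>?LF)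
      + (\<integral>i. H (mark i \<omega>) \<partial>count_space (jumps \<omega>)))"
    by (intro Bochner_Integration.integrable_add Bochner_Integration.integrable_diff Wbi fst13 fst2 comp(2))
  show "integrable (P0 D) (\<lambda>\<omega>. W \<omega> * (BT \<omega> * KT \<omega>))"
    by (rule integrable_cong_AE_imp[OF ri BTm]) (use path in \<open>auto elim: eventually_mono\<close>)
  have "(\<integral>\<omega>. W \<omega> * (BT \<omega> * KT \<omega>) \<partial>P0 D) = (\<integral>\<omega>. W \<omega> * b \<omega> + (\<integral>y. f1 (\<omega>, y) + f3 (\<omega>, y) \<partial>?LF) - (\<integral>y. f2 (\<omega>, y) \<partial>?LF)
      + (\<integral>i. H (mark i \<omega>) \<partial>count_space (jumps \<omega>)) \<partial>P0 D)"
    by (rule integral_cong_AE[OF BTm borel_measurable_integrable[OF ri] path])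
  also have "\<dots> = (\<integral>\<omega>. W \<omega> * b \<omega> \<partial>P0 D) + (\<integral>x. f1 x + f3 x \<partial>NU) - (\<integral>x. f2 x \<partial>NU) + (\<integral>x. f2' x + f4 x \<partial>NU)"
    using Wbi fst13 fst2 comp(2,3) NU_Fubini[OF i13] NU_Fubini[OF conjunct1[OF i2]] by (simp add: Hl)
  also have "\<dots> = (\<integral>\<omega>. W \<omega> * b \<omega> \<partial>P0 D) + (\<integral>x. (f1 x + f3 x) - f2 x + (f2' x + f4 x) \<partial>NU)"
    using i1 i2 i3 by simp
  finally show "(\<integral>\<omega>. W \<omega> * (BT \<omega> * KT \<omega>) \<partial>P0 D) = (\<integral>\<omega>. W \<omega> * b \<omega> \<partial>P0 D) +
      (\<integral>x. Wp (?p x) * Km (?p x) * (g (?p x) + \<Theta> (?n x) * lam (?p x) * (kap (?n x) - 1) + Bm (?p x) * drift (?n x)) \<partial>NU)"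
    unfolding ftot .
qed

end

section \<open>Efforts\<close>

context loss_model
begin

definition effort_set :: "(real \<times> real) set" where "effort_set = {0..\<zeta>1 D} \<times> {0..\<zeta>2 D}"

lemma zero_effort: "(0, 0) \<in> effort_set" using constants_pos by (simp add: effort_set_def)

definition effort :: "(real \<times> 'a \<Rightarrow> real \<times> real) \<Rightarrow> bool" where
  "effort v \<longleftrightarrow> v \<in> PS \<rightarrow>\<^sub>M borel \<and> (\<forall>p\<in>space PS. v p \<in> effort_set)"

lemma continuous_of_effort:
  fixes h :: "real \<Rightarrow> real"
  assumes v: "effort v"
  shows "continuous_on {0..\<zeta>1 D} h \<Longrightarrow> (\<lambda>p. h (fst (v p))) \<in> borel_measurable PS"
    and "continuous_on {0..\<zeta>2 D} h \<Longrightarrow> (\<lambda>p. h (snd (v p))) \<in> borel_measurable PS"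
proof -
  have vm: "v \<in> PS \<rightarrow>\<^sub>M (borel \<Otimes>\<^sub>M borel)" using v by (simp add: effort_def borel_prod)
  have m: "(\<lambda>x. if x \<in> {0..z} then h x else 0) \<in> borel_measurable borel" if "continuous_on {0..z} h" for z
    by (rule borel_measurable_continuous_on_if) (use that in simp_all)
  { assume c: "continuous_on {0..\<zeta>1 D} h"
    from measurable_compose[OF measurable_compose[OF vm measurable_fst] m[OF c]]
    show "(\<lambda>p. h (fst (v p))) \<in> borel_measurable PS"
      by (rule measurable_cong[THEN iffD1, rotated]) (use v in \<open>auto simp: effort_def effort_set_def mem_Times_iff\<close>) }
  { assume c: "continuous_on {0..\<zeta>2 D} h"
    from measurable_compose[OF measurable_compose[OF vm measurable_snd] m[OF c]]
    show "(\<lambda>p. h (snd (v p))) \<in> borel_measurable PS"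
      by (rule measurable_cong[THEN iffD1, rotated]) (use v in \<open>auto simp: effort_def effort_set_def mem_Times_iff\<close>) }
qed

definition eta :: "real \<Rightarrow> real" where "eta s = risk_av D * exp (rate D * (TT - s))"

definition eff_a :: "(real \<times> 'a \<Rightarrow> real \<times> real) \<Rightarrow> real \<times> 'a \<Rightarrow> real" where
  "eff_a v p = (1 - \<gamma>1 D (fst (v p))) * lam p + eta (fst p) * (cost1 D (fst (v p)) + cost2 D (snd (v p)))"

definition eff_ell :: "(real \<times> 'a \<Rightarrow> real \<times> real) \<Rightarrow> (real \<times> 'a) \<times> real \<Rightarrow> real" where
  "eff_ell v x = - ln (\<gamma>1 D (fst (v (fst x)))) + eta (fst (fst x)) * snd x * (1 - \<gamma>2 D (snd (v (fst x))))"

definition eff_C :: real where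
  "eff_C = risk_av D * exp (rate D * TT) * (cost1 D (\<zeta>1 D) + cost2 D (\<zeta>2 D))"

lemma effort_bounds:
  assumes "q \<in> effort_set"
  shows "0 < \<gamma>1 D (fst q)" "\<gamma>1 D (fst q) \<le> 1" "0 \<le> \<gamma>2 D (snd q)" "\<gamma>2 D (snd q) \<le> 1"
    and "0 \<le> cost1 D (fst q)" "cost1 D (fst q) \<le> cost1 D (\<zeta>1 D)" "0 \<le> cost2 D (snd q)" "cost2 D (snd q) \<le> cost2 D (\<zeta>2 D)"
proof -
  have q: "fst q \<in> {0..\<zeta>1 D}" "snd q \<in> {0..\<zeta>2 D}" using assms by (auto simp: effort_set_def mem_Times_iff)
  show "0 < \<gamma>1 D (fst q)" "\<gamma>1 D (fst q) \<le> 1" using \<gamma>1(1) q by (auto simp: Pi_iff)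
  show "0 \<le> \<gamma>2 D (snd q)" "\<gamma>2 D (snd q) \<le> 1" using \<gamma>2(1) q by (auto simp: Pi_iff)
  show "0 \<le> cost1 D (fst q)" "cost1 D (fst q) \<le> cost1 D (\<zeta>1 D)"
    using mono_onD[OF cost1(2), of 0 "fst q"] mono_onD[OF cost1(2), of "fst q" "\<zeta>1 D"] q cost1(3) by auto
  show "0 \<le> cost2 D (snd q)" "cost2 D (snd q) \<le> cost2 D (\<zeta>2 D)"
    using mono_onD[OF cost2(2), of 0 "snd q"] mono_onD[OF cost2(2), of "snd q" "\<zeta>2 D"] q cost2(3) by auto
qed

lemma eta_bounds: "0 < eta s" "0 \<le> s \<Longrightarrow> eta s \<le> risk_av D * exp (rate D * TT)"
  using constants_pos by (auto simp: eta_def)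

lemma eta_measurable: "(\<lambda>p. eta (fst p)) \<in> borel_measurable PS"
  unfolding eta_def by (intro borel_measurable_times borel_measurable_const measurable_compose[OF _ borel_measurable_exp]
      borel_measurable_diff PS_fst)

lemma eff_measurable:
  assumes v: "effort v"
  shows "eff_a v \<in> borel_measurable PS" "eff_ell v \<in> borel_measurable PF"
proof -
  note g1 = continuous_of_effort(1)[OF v \<gamma>1(2)] and g2 = continuous_of_effort(2)[OF v \<gamma>2(2)]
    and c1 = continuous_of_effort(1)[OF v cost1(1)] and c2 = continuous_of_effort(2)[OF v cost2(1)]
  show "eff_a v \<in> borel_measurable PS"
    unfolding eff_a_def[abs_def]
    by (intro borel_measurable_add borel_measurable_times borel_measurable_diff borel_measurable_const g1 c1 c2 lam_predictable eta_measurable)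
  have l: "(\<lambda>x. - ln (\<gamma>1 D (fst (v (fst x))))) \<in> borel_measurable PF"
    by (intro borel_measurable_uminus borel_measurable_ln process_field[OF g1])
  show "eff_ell v \<in> borel_measurable PF"
    unfolding eff_ell_def[abs_def]
    by (intro borel_measurable_add borel_measurable_times borel_measurable_diff borel_measurable_const l
        process_field[OF g2] process_field[OF eta_measurable] measurable_snd)
qed

end

context regular_loss_model
begin

lemma effort_multiplicative:
  assumes v: "effort v"
  shows "multiplicative D (eff_a v) (eff_ell v) eff_C"
proof unfold_locales
  show "eff_a v \<in> borel_measurable PS" "eff_ell v \<in> borel_measurable PF" using eff_measurable[OF v] by auto
  show "0 \<le> eff_C"
    using effort_bounds(5,6,7,8)[OF zero_effort] constants_pos unfolding eff_C_def by (intro mult_nonneg_nonneg) auto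
  fix p assume p: "p \<in> space PS"
  then have q: "v p \<in> effort_set" and s: "0 \<le> fst p" using v by (auto simp: effort_def space_PS)
  note b = effort_bounds[OF q] and l = lam_pos[of "fst p" "snd p"]
  have lp: "0 < lam p" using l p by (auto simp: space_PS)
  show "0 \<le> eff_a v p"
    unfolding eff_a_def using b lp eta_bounds(1)[of "fst p"] by (intro add_nonneg_nonneg mult_nonneg_nonneg) auto
  have "(1 - \<gamma>1 D (fst (v p))) * lam p \<le> 1 * lam p" using b lp by (intro mult_right_mono) auto
  moreover have "eta (fst p) * (cost1 D (fst (v p)) + cost2 D (snd (v p))) \<le> eff_C"
    unfolding eff_C_def using b eta_bounds[of "fst p"] s by (intro mult_mono) auto
  ultimately show "eff_a v p \<le> lam p + eff_C" unfolding eff_a_def by linarith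
  fix z :: real assume "0 < z"
  have "ln (\<gamma>1 D (fst (v p))) \<le> 0" using b by (simp add: ln_le_zero_iff)
  moreover have "0 \<le> eta (fst p) * z * (1 - \<gamma>2 D (snd (v p)))"
    using b \<open>0 < z\<close> eta_bounds(1)[of "fst p"] by (intro mult_nonneg_nonneg) auto
  ultimately show "0 \<le> eff_ell v (p, z)" unfolding eff_ell_def by simp
qed

lemma effort_weighted:
  assumes v: "effort v" and t: "t \<in> {0..TT}" and A: "A \<in> sets (FF t)" and v0: "\<And>s \<omega>. s \<le> t \<Longrightarrow> v (s, \<omega>) = (0, 0)"
  shows "weighted_multiplicative D (eff_a v) (eff_ell v) eff_C t (indicator A)"
proof -
  interpret multiplicative D "eff_a v" "eff_ell v" eff_C by (rule effort_multiplicative[OF v])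
  show ?thesis
    by unfold_locales (use t A v0 in \<open>auto simp: eff_a_def eff_ell_def \<gamma>1 \<gamma>2 cost1 cost2 split: split_indicator\<close>)
qed

end

section \<open>The driver\<close>

locale bsde_model = regular_loss_model +
  fixes R M :: "real \<Rightarrow> 'a \<Rightarrow> real" and \<Theta> :: "real \<Rightarrow> real \<Rightarrow> 'a \<Rightarrow> real"
  assumes bsde: "bsde_solution D R \<Theta> M"
begin

lemma R: "adapted FF TT R" "cadlag (P0 D) TT R"
  and M: "M \<in> L_perp D" and hat: "\<Theta> \<in> L_hat D"
  using bsde by (auto simp: bsde_solution_def L_two_def)

definition th :: "(real \<times> 'a) \<times> real \<Rightarrow> real" where
  "th x = (if 0 < snd x then \<Theta> (fst (fst x)) (snd x) (snd (fst x)) else 0)"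

definition Rm :: "real \<times> 'a \<Rightarrow> real" where "Rm p = left_limit R (fst p) (snd p)"

lemma th_measurable: "th \<in> borel_measurable PF"
  unfolding th_def[abs_def] by (rule predictable_fieldD) (use hat in \<open>simp add: L_hat_def\<close>)

lemma Rm_measurable: "Rm \<in> borel_measurable PS"
  unfolding Rm_def[abs_def] by (rule left_limit_predictable[OF R(2,1)])

lemma th_square: "(\<integral>\<^sup>+x. ennreal ((th ((fst (snd x), fst x), snd (snd x)))\<^sup>2 * lam (fst (snd x), fst x)) \<partial>NU) < \<infinity>"
proof -
  have m: "(\<lambda>x. ennreal ((th ((fst (snd x), fst x), snd (snd x)))\<^sup>2 * lam (fst (snd x), fst x))) \<in> borel_measurable NU"
    by (intro measurable_compose[OF _ measurable_ennreal] borel_measurable_times borel_measurable_power NU_measurable[OF th_measurable]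
        NU_process_measurable[OF lam_predictable])
  have "(\<integral>\<^sup>+x. ennreal ((th ((fst (snd x), fst x), snd (snd x)))\<^sup>2 * lam (fst (snd x), fst x)) \<partial>NU) =
      (\<integral>\<^sup>+\<omega>. (\<integral>\<^sup>+s. (\<integral>\<^sup>+z. ennreal ((th ((s, \<omega>), z))\<^sup>2 * lam (s, \<omega>)) \<partial>claim_law D) \<partial>Lb) \<partial>P0 D)"
    using nn_integral_NU[OF m] by simp
  also have "\<dots> \<le> (\<integral>\<^sup>+\<omega>. (\<integral>\<^sup>+t\<in>{0..TT}. (\<integral>\<^sup>+z\<in>{0<..}. ennreal (\<bar>\<Theta> t z \<omega>\<bar>\<^sup>2 * intensity D t \<omega>) \<partial>claim_law D) \<partial>lborel) \<partial>P0 D)"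
  proof (rule nn_integral_mono)
    fix \<omega>
    have "(\<integral>\<^sup>+z. ennreal ((th ((s, \<omega>), z))\<^sup>2 * lam (s, \<omega>)) \<partial>claim_law D) = (\<integral>\<^sup>+z\<in>{0<..}. ennreal (\<bar>\<Theta> s z \<omega>\<bar>\<^sup>2 * intensity D s \<omega>) \<partial>claim_law D)" for s
      by (intro nn_integral_cong) (auto simp: th_def lam_def split: split_indicator)
    then show "(\<integral>\<^sup>+s. (\<integral>\<^sup>+z. ennreal ((th ((s, \<omega>), z))\<^sup>2 * lam (s, \<omega>)) \<partial>claim_law D) \<partial>Lb) \<le>
        (\<integral>\<^sup>+t\<in>{0..TT}. (\<integral>\<^sup>+z\<in>{0<..}. ennreal (\<bar>\<Theta> t z \<omega>\<bar>\<^sup>2 * intensity D t \<omega>) \<partial>claim_law D) \<partial>lborel)"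
      unfolding nn_integral_Lb by (intro nn_integral_mono) (auto split: split_indicator)
  qed
  also have "\<dots> < \<infinity>" using hat by (simp add: L_hat_def)
  finally show ?thesis .
qed

definition drv :: "real \<times> 'a \<Rightarrow> real \<times> real \<Rightarrow> real" where
  "drv p q = driver D (fst p) (snd p) (Rm p) (\<lambda>z. th (p, z)) (fst q) (snd q)"

lemma driver_along_eq: "driver_along D R \<Theta> u s \<omega> = drv (s, \<omega>) (u s \<omega>)"
proof -
  have e: "set_lebesgue_integral (claim_law D) {0<..} f = set_lebesgue_integral (claim_law D) {0<..} g"
    if "\<And>z. 0 < z \<Longrightarrow> f z = g z" for f g :: "real \<Rightarrow> real"
    unfolding set_lebesgue_integral_def using that by (intro Bochner_Integration.integral_cong refl) (auto split: split_indicator)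
  show ?thesis
    unfolding driver_along_def drv_def driver_def Rm_def fst_conv snd_conv
    by (intro arg_cong2[where f="(-)"] arg_cong2[where f="(+)"] arg_cong2[where f="(*)"] refl e) (simp_all add: th_def)
qed

text \<open>At a time and state where \<open>\<Theta>(s,\<cdot>)\<close> is integrable, the driver takes the form in which it appears as
  the drift of \<open>K R\<close>, and it is continuous in the effort.\<close>

definition tame_at :: "real \<times> 'a \<Rightarrow> bool" where
  "tame_at p \<longleftrightarrow> integrable (claim_law D) (\<lambda>z. th (p, z))"

definition jmp :: "real \<Rightarrow> real \<times> real \<Rightarrow> real \<Rightarrow> real" where
  "jmp s q z = exp (- eta s * z * (1 - \<gamma>2 D (snd q)))"

lemma set_integral_claim: "set_lebesgue_integral (claim_law D) {0<..} f = (\<integral>z. f z \<partial>claim_law D)"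
  if "f \<in> borel_measurable borel" for f :: "real \<Rightarrow> real"
  unfolding set_lebesgue_integral_def
proof (rule integral_cong_AE)
  have m: "f \<in> borel_measurable (claim_law D)" using measurable_compose[OF claim_law_id that] by simp
  have "(\<lambda>x. indicator {0<..} x :: real) \<in> borel_measurable (claim_law D)"
    by (rule measurable_compose[OF claim_law_id]) simp
  then show "(\<lambda>x. indicator {0<..} x *\<^sub>R f x) \<in> borel_measurable (claim_law D)" using m by simp
  show "f \<in> borel_measurable (claim_law D)" by (rule m)
  show "AE x in claim_law D. indicator {0<..} x *\<^sub>R f x = f x" using claim_law_pos by eventually_elim simp
qed

lemma th_section: "p \<in> space PS \<Longrightarrow> (\<lambda>z. th (p, z)) \<in> borel_measurable borel"
  using measurable_compose[OF measurable_Pair1' th_measurable] by simp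

lemma jmp_measurable: "jmp s q \<in> borel_measurable borel"
  unfolding jmp_def[abs_def] by measurable

lemma jmp_bound: "q \<in> effort_set \<Longrightarrow> 0 < z \<Longrightarrow> 0 < jmp s q z \<and> jmp s q z \<le> 1"
  using effort_bounds(3,4)[of q] eta_bounds(1)[of s] unfolding jmp_def
  by (auto intro!: mult_nonneg_nonneg simp: mult.assoc)

lemma jmp_integrable:
  assumes p: "p \<in> space PS" "tame_at p" and q: "q \<in> effort_set"
  shows "integrable (claim_law D) (\<lambda>z. (th (p, z) + Rm p) * jmp (fst p) q z)"
proof (rule Bochner_Integration.integrable_bound)
  show "integrable (claim_law D) (\<lambda>z. \<bar>th (p, z)\<bar> + \<bar>Rm p\<bar>)" using p(2) by (simp add: tame_at_def)
  show "(\<lambda>z. (th (p, z) + Rm p) * jmp (fst p) q z) \<in> borel_measurable (claim_law D)"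
    using measurable_compose[OF claim_law_id th_section[OF p(1)]] measurable_compose[OF claim_law_id jmp_measurable] by simp
  show "AE z in claim_law D. norm ((th (p, z) + Rm p) * jmp (fst p) q z) \<le> norm (\<bar>th (p, z)\<bar> + \<bar>Rm p\<bar>)"
    using claim_law_pos
  proof eventually_elim
    case (elim z)
    have "\<bar>th (p, z) + Rm p\<bar> * \<bar>jmp (fst p) q z\<bar> \<le> (\<bar>th (p, z)\<bar> + \<bar>Rm p\<bar>) * 1"
      using jmp_bound[OF q elim, of "fst p"] by (intro mult_mono) auto
    then show ?case by (simp add: abs_mult)
  qed
qed

lemma drv_eq:
  assumes p: "p \<in> space PS" "tame_at p" and q: "q \<in> effort_set"
  shows "drv p q = - Rm p * eta (fst p) * (cost1 D (fst q) + cost2 D (snd q)) + (\<integral>z. th (p, z) \<partial>claim_law D) * lam p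
    - \<gamma>1 D (fst q) * lam p * ((\<integral>z. (th (p, z) + Rm p) * jmp (fst p) q z \<partial>claim_law D) - Rm p)"
proof -
  have thb: "(\<lambda>z. th (p, z)) \<in> borel_measurable borel" by (rule th_section[OF p(1)])
  have jb: "jmp (fst p) q \<in> borel_measurable borel" by (rule jmp_measurable)
  have "set_lebesgue_integral (claim_law D) {0<..} (\<lambda>z. th (p, z) * lam p) = (\<integral>z. th (p, z) * lam p \<partial>claim_law D)"
    by (rule set_integral_claim) (use thb in simp)
  also have "\<dots> = (\<integral>z. th (p, z) \<partial>claim_law D) * lam p" by simp
  finally have 1: "set_lebesgue_integral (claim_law D) {0<..} (\<lambda>z. th (p, z) * lam p) = (\<integral>z. th (p, z) \<partial>claim_law D) * lam p" .
  have "set_lebesgue_integral (claim_law D) {0<..} (\<lambda>z. (th (p, z) + Rm p) * (jmp (fst p) q z - 1) + th (p, z)) =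
      (\<integral>z. (th (p, z) + Rm p) * (jmp (fst p) q z - 1) + th (p, z) \<partial>claim_law D)"
    by (rule set_integral_claim) (use thb jb in simp)
  also have "\<dots> = (\<integral>z. (th (p, z) + Rm p) * jmp (fst p) q z - Rm p \<partial>claim_law D)"
    by (intro Bochner_Integration.integral_cong refl) (simp add: algebra_simps)
  also have "\<dots> = (\<integral>z. (th (p, z) + Rm p) * jmp (fst p) q z \<partial>claim_law D) - Rm p"
    using jmp_integrable[OF p q] FL.prob_space by (subst Bochner_Integration.integral_diff) auto
  finally have 2: "set_lebesgue_integral (claim_law D) {0<..} (\<lambda>z. (th (p, z) + Rm p) * (jmp (fst p) q z - 1) + th (p, z)) =
      (\<integral>z. (th (p, z) + Rm p) * jmp (fst p) q z \<partial>claim_law D) - Rm p" .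
  show ?thesis
    using 1 2 unfolding drv_def driver_def jmp_def eta_def lam_def by (simp add: mult_ac)
qed

lemma drv_zero: "p \<in> space PS \<Longrightarrow> tame_at p \<Longrightarrow> drv p (0, 0) = 0"
  using drv_eq[of p "(0, 0)", OF _ _ zero_effort] FL.prob_space
  by (simp add: \<gamma>1 \<gamma>2 cost1 cost2 jmp_def tame_at_def)

lemma drv_continuous:
  assumes p: "p \<in> space PS" "tame_at p"
  shows "continuous_on effort_set (drv p)"
proof -
  have f: "continuous_on effort_set (\<lambda>q. fst q)" "continuous_on effort_set (\<lambda>q. snd q)" by (intro continuous_intros)+
  have im: "(\<lambda>q. fst q) ` effort_set \<subseteq> {0..\<zeta>1 D}" "(\<lambda>q. snd q) ` effort_set \<subseteq> {0..\<zeta>2 D}" by (auto simp: effort_set_def)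
  note c = continuous_on_compose2[OF cost1(1) f(1) im(1)] continuous_on_compose2[OF cost2(1) f(2) im(2)]
    continuous_on_compose2[OF \<gamma>1(2) f(1) im(1)] continuous_on_compose2[OF \<gamma>2(2) f(2) im(2)]
  have "continuous_on effort_set (\<lambda>q. \<integral>z. (th (p, z) + Rm p) * jmp (fst p) q z \<partial>claim_law D)"
  proof (unfold continuous_on_sequentially o_def, intro allI ballI impI, elim conjE)
    fix x :: "nat \<Rightarrow> real \<times> real" and q assume x: "q \<in> effort_set" "\<forall>n::nat. x n \<in> effort_set" "x \<longlonglongrightarrow> q"
    show "(\<lambda>n. \<integral>z. (th (p, z) + Rm p) * jmp (fst p) (x n) z \<partial>claim_law D) \<longlonglongrightarrow> (\<integral>z. (th (p, z) + Rm p) * jmp (fst p) q z \<partial>claim_law D)"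
    proof (rule integral_dominated_convergence[where w="\<lambda>z. \<bar>th (p, z)\<bar> + \<bar>Rm p\<bar>"])
      show "(\<lambda>z. (th (p, z) + Rm p) * jmp (fst p) q z) \<in> borel_measurable (claim_law D)"
        by (rule borel_measurable_integrable[OF jmp_integrable[OF p x(1)]])
      show "(\<lambda>z. (th (p, z) + Rm p) * jmp (fst p) (x n) z) \<in> borel_measurable (claim_law D)" for n
        using x(2) by (intro borel_measurable_integrable[OF jmp_integrable[OF p]]) auto
      show "integrable (claim_law D) (\<lambda>z. \<bar>th (p, z)\<bar> + \<bar>Rm p\<bar>)" using p(2) by (simp add: tame_at_def)
      have "(\<lambda>n. \<gamma>2 D (snd (x n))) \<longlonglongrightarrow> \<gamma>2 D (snd q)"
        using continuous_on_tendsto_compose[OF c(4) x(3,1)] x(2) by simp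
      then show "AE z in claim_law D. (\<lambda>n. (th (p, z) + Rm p) * jmp (fst p) (x n) z) \<longlonglongrightarrow> (th (p, z) + Rm p) * jmp (fst p) q z"
        unfolding jmp_def by (intro AE_I2 tendsto_intros)
      show "AE z in claim_law D. norm ((th (p, z) + Rm p) * jmp (fst p) (x n) z) \<le> \<bar>th (p, z)\<bar> + \<bar>Rm p\<bar>" for n
        using claim_law_pos
      proof eventually_elim
        case (elim z)
        have "\<bar>th (p, z) + Rm p\<bar> * \<bar>jmp (fst p) (x n) z\<bar> \<le> (\<bar>th (p, z)\<bar> + \<bar>Rm p\<bar>) * 1"
          using jmp_bound[of "x n" z "fst p"] x(2) elim by (intro mult_mono) auto
        then show ?case by (simp add: abs_mult)
      qed
    qed
  qed
  note ci = this
  have "continuous_on effort_set (\<lambda>q. - Rm p * eta (fst p) * (cost1 D (fst q) + cost2 D (snd q)) + (\<integral>z. th (p, z) \<partial>claim_law D) * lam p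
    - \<gamma>1 D (fst q) * lam p * ((\<integral>z. (th (p, z) + Rm p) * jmp (fst p) q z \<partial>claim_law D) - Rm p))"
    by (intro continuous_intros c ci)
  then show ?thesis by (rule continuous_on_eq) (simp add: drv_eq[OF p])
qed

lemma drv_measurable:
  assumes v: "effort v"
  shows "(\<lambda>p. drv p (v p)) \<in> borel_measurable PS"
proof -
  note g1 = continuous_of_effort(1)[OF v \<gamma>1(2)] and g2 = continuous_of_effort(2)[OF v \<gamma>2(2)]
    and c1 = continuous_of_effort(1)[OF v cost1(1)] and c2 = continuous_of_effort(2)[OF v cost2(1)]
  have pz: "(\<lambda>x. indicator {0<..} (snd x) :: real) \<in> borel_measurable PF"
    by (rule measurable_compose[OF measurable_snd]) simp
  have i1: "(\<lambda>p. \<integral>z. (\<lambda>x. indicator {0<..} (snd x) * (th x * lam (fst x))) (p, z) \<partial>claim_law D) \<in> borel_measurable PS"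
    by (rule mark_integral_predictable) (intro borel_measurable_times pz th_measurable process_field[OF lam_predictable])
  have ex: "(\<lambda>x. exp (- eta (fst (fst x)) * snd x * (1 - \<gamma>2 D (snd (v (fst x)))))) \<in> borel_measurable PF"
    by (rule measurable_compose[OF _ borel_measurable_exp])
      (intro borel_measurable_times borel_measurable_uminus process_field[OF eta_measurable] measurable_snd borel_measurable_diff
        borel_measurable_const process_field[OF g2])
  have i2: "(\<lambda>p. \<integral>z. (\<lambda>x. indicator {0<..} (snd x) * ((th x + Rm (fst x)) * (exp (- eta (fst (fst x)) * snd x * (1 - \<gamma>2 D (snd (v (fst x))))) - 1) + th x)) (p, z) \<partial>claim_law D) \<in> borel_measurable PS"
    by (rule mark_integral_predictable)
      (intro borel_measurable_times borel_measurable_add borel_measurable_diff pz th_measurable process_field[OF Rm_measurable] ex borel_measurable_const)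
  have "(\<lambda>p. - Rm p * eta (fst p) * (cost1 D (fst (v p)) + cost2 D (snd (v p)))
      + (\<integral>z. (\<lambda>x. indicator {0<..} (snd x) * (th x * lam (fst x))) (p, z) \<partial>claim_law D)
      - \<gamma>1 D (fst (v p)) * lam p * (\<integral>z. (\<lambda>x. indicator {0<..} (snd x) * ((th x + Rm (fst x)) * (exp (- eta (fst (fst x)) * snd x * (1 - \<gamma>2 D (snd (v (fst x))))) - 1) + th x)) (p, z) \<partial>claim_law D)) \<in> borel_measurable PS"
    by (intro borel_measurable_times borel_measurable_add borel_measurable_diff borel_measurable_uminus Rm_measurable eta_measurable c1 c2 g1 lam_predictable i1 i2)
  also have "(\<lambda>p. - Rm p * eta (fst p) * (cost1 D (fst (v p)) + cost2 D (snd (v p)))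
      + (\<integral>z. (\<lambda>x. indicator {0<..} (snd x) * (th x * lam (fst x))) (p, z) \<partial>claim_law D)
      - \<gamma>1 D (fst (v p)) * lam p * (\<integral>z. (\<lambda>x. indicator {0<..} (snd x) * ((th x + Rm (fst x)) * (exp (- eta (fst (fst x)) * snd x * (1 - \<gamma>2 D (snd (v (fst x))))) - 1) + th x)) (p, z) \<partial>claim_law D))
      = (\<lambda>p. drv p (v p))"
    unfolding drv_def driver_def set_lebesgue_integral_def eta_def lam_def by (simp add: fun_eq_iff mult_ac)
  finally show ?thesis .
qed

lemma tame_AE_time: "AE \<omega> in P0 D. AE s in Lb. tame_at (s, \<omega>)"
  and tame_AE_state: "AE s in Lb. AE \<omega> in P0 D. tame_at (s, \<omega>)"
proof -
  define q where "q p = (\<integral>\<^sup>+z. ennreal ((th (p, z))\<^sup>2 * lam p) \<partial>claim_law D)" for p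
  have hm: "(\<lambda>x. ennreal ((th x)\<^sup>2 * lam (fst x))) \<in> borel_measurable PF"
    by (intro measurable_compose[OF _ measurable_ennreal] borel_measurable_times borel_measurable_power th_measurable process_field[OF lam_predictable])
  have qm: "q \<in> borel_measurable PS"
  proof -
    have "(\<lambda>(p, z). ennreal ((th (p, z))\<^sup>2 * lam p)) \<in> borel_measurable (PS \<Otimes>\<^sub>M claim_law D)"
      using measurable_compose[OF PSF_id hm] by (simp add: split_beta')
    from FL.borel_measurable_nn_integral[OF this] show ?thesis unfolding q_def[abs_def] .
  qed
  have "(\<integral>\<^sup>+x. q (fst (snd x), fst x) \<partial>NU) = (\<integral>\<^sup>+\<omega>. (\<integral>\<^sup>+s. q (s, \<omega>) \<partial>Lb) \<partial>P0 D)"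
    using nn_integral_NU_weight[of "\<lambda>_. 1", OF _ qm] by simp
  also have "\<dots> < \<infinity>" using th_square nn_integral_NU[OF NU_measurable[OF hm]] by (simp add: q_def)
  finally have fin: "(\<integral>\<^sup>+x. q (fst (snd x), fst x) \<partial>NU) \<noteq> \<infinity>" by simp
  have tame: "tame_at p" if p: "p \<in> space PS" "q p \<noteq> \<infinity>" for p
    unfolding tame_at_def
  proof (rule integrableI_bounded)
    have l: "0 < lam p" using lam_pos[of "fst p" "snd p"] p by (auto simp: space_PS)
    have tb: "(\<lambda>z. th (p, z)) \<in> borel_measurable (claim_law D)" by (rule measurable_compose[OF claim_law_id th_section[OF p(1)]])
    then show "(\<lambda>z. th (p, z)) \<in> borel_measurable (claim_law D)" .
    have "(\<integral>\<^sup>+z. ennreal (norm (th (p, z))) \<partial>claim_law D) \<le> (\<integral>\<^sup>+z. 1 + ennreal (1 / lam p) * ennreal ((th (p, z))\<^sup>2 * lam p) \<partial>claim_law D)"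
    proof (rule nn_integral_mono)
      fix z
      have "0 \<le> (\<bar>th (p, z)\<bar> - 1/2)\<^sup>2" by simp
      then have "\<bar>th (p, z)\<bar> \<le> 1 + 1 / lam p * ((th (p, z))\<^sup>2 * lam p)" using l by (simp add: power2_eq_square algebra_simps)
      from ennreal_leI[OF this] show "ennreal (norm (th (p, z))) \<le> 1 + ennreal (1 / lam p) * ennreal ((th (p, z))\<^sup>2 * lam p)"
        using l by (simp add: ennreal_plus ennreal_mult[symmetric])
    qed
    also have "\<dots> = 1 + ennreal (1 / lam p) * q p"
      unfolding q_def using tb FL.emeasure_space_1 by (subst nn_integral_add) (simp_all add: nn_integral_cmult)
    also have "\<dots> < \<infinity>" using p(2) by (simp add: ennreal_mult_less_top less_top)
    finally show "(\<integral>\<^sup>+z. ennreal (norm (th (p, z))) \<partial>claim_law D) < \<infinity>" .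
  qed
  have qPL: "(\<lambda>y. q (snd y, fst y)) \<in> borel_measurable (P0 D \<Otimes>\<^sub>M Lb)" by (rule PL_process[OF qm])
  have finPL: "(\<integral>\<^sup>+y. q (snd y, fst y) \<partial>(P0 D \<Otimes>\<^sub>M Lb)) \<noteq> \<infinity>"
    using fin Lb.nn_integral_fst[OF qPL] nn_integral_NU_weight[of "\<lambda>_. 1", OF _ qm] by simp
  have ae: "AE y in P0 D \<Otimes>\<^sub>M Lb. q (snd y, fst y) \<noteq> \<infinity>" by (rule nn_integral_PInf_AE[OF qPL finPL])
  have 1: "AE \<omega> in P0 D. AE s in Lb. q (s, \<omega>) \<noteq> \<infinity>" using pair_sigma_finite.AE_pair[OF pairs_sigma_finite(3) ae] by simp
  have "{x \<in> space (P0 D \<Otimes>\<^sub>M Lb). q (snd x, fst x) \<noteq> \<infinity>} \<in> sets (P0 D \<Otimes>\<^sub>M Lb)" using qPL by measurable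
  then have 2: "AE s in Lb. AE \<omega> in P0 D. q (s, \<omega>) \<noteq> \<infinity>"
    using pair_sigma_finite.AE_commute[OF pairs_sigma_finite(3), of "\<lambda>\<omega> s. q (s, \<omega>) \<noteq> \<infinity>"] 1 by simp
  have "AE \<omega> in P0 D. \<omega> \<in> \<Omega>" by (rule AE_space)
  with 1 show "AE \<omega> in P0 D. AE s in Lb. tame_at (s, \<omega>)"
  proof eventually_elim
    case (elim \<omega>)
    from elim(1) AE_space show ?case by eventually_elim (use tame elim(2) in \<open>auto simp: space_PS\<close>)
  qed
  from 2 AE_space show "AE s in Lb. AE \<omega> in P0 D. tame_at (s, \<omega>)"
  proof eventually_elim
    case (elim s)
    from elim(1) AE_space show ?case by eventually_elim (use tame elim(2) in \<open>auto simp: space_PS\<close>)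
  qed
qed

end

section \<open>The change of measure\<close>

context loss_model
begin

text \<open>Density and jump exponent of \<open>L\<^sup>u\<close>; those of the product \<open>K\<close> of \<open>L\<^sup>u\<close> with the cost ratio are \<open>eff_a\<close> and
  \<open>eff_ell\<close>. \<open>LTe\<close> and \<open>KTe\<close> below are the terminal values.\<close>

definition den_a :: "(real \<times> 'a \<Rightarrow> real \<times> real) \<Rightarrow> real \<times> 'a \<Rightarrow> real" where
  "den_a v p = (1 - \<gamma>1 D (fst (v p))) * lam p"

definition den_ell :: "(real \<times> 'a \<Rightarrow> real \<times> real) \<Rightarrow> (real \<times> 'a) \<times> real \<Rightarrow> real" where
  "den_ell v x = - ln (\<gamma>1 D (fst (v (fst x))))"

definition mult_exp :: "(real \<times> 'a \<Rightarrow> real) \<Rightarrow> ((real \<times> 'a) \<times> real \<Rightarrow> real) \<Rightarrow> 'a \<Rightarrow> real" where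
  "mult_exp a ell \<omega> = exp ((\<integral>s. a (s, \<omega>) \<partial>Lb) - (\<integral>i. ell (mark i \<omega>) \<partial>count_space (jumps \<omega>)))"

definition KTe :: "(real \<times> 'a \<Rightarrow> real \<times> real) \<Rightarrow> 'a \<Rightarrow> real" where "KTe v = mult_exp (eff_a v) (eff_ell v)"

definition LTe :: "(real \<times> 'a \<Rightarrow> real \<times> real) \<Rightarrow> 'a \<Rightarrow> real" where "LTe v = mult_exp (den_a v) (den_ell v)"

definition Xi :: "'a \<Rightarrow> real" where
  "Xi \<omega> = exp (\<integral>i. (\<lambda>x. eta (fst (fst x)) * snd x) (mark i \<omega>) \<partial>count_space (jumps \<omega>))"

definition unc :: "(real \<Rightarrow> 'a \<Rightarrow> real \<times> real) \<Rightarrow> real \<times> 'a \<Rightarrow> real \<times> real" where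
  "unc u p = u (fst p) (snd p)"

lemma den_measurable:
  assumes v: "effort v"
  shows "den_a v \<in> borel_measurable PS" "den_ell v \<in> borel_measurable PF"
proof -
  note g1 = continuous_of_effort(1)[OF v \<gamma>1(2)]
  show "den_a v \<in> borel_measurable PS"
    unfolding den_a_def[abs_def] by (intro borel_measurable_times borel_measurable_diff borel_measurable_const g1 lam_predictable)
  show "den_ell v \<in> borel_measurable PF"
    unfolding den_ell_def[abs_def] by (intro borel_measurable_uminus borel_measurable_ln process_field[OF g1])
qed

lemma swapped_PS: "(\<lambda>p. (snd p, fst p)) \<in> FF TT \<Otimes>\<^sub>M Lb \<rightarrow>\<^sub>M PS"
proof (rule measurable_into_PS)
  have sp: "space (FF TT \<Otimes>\<^sub>M Lb) = \<Omega> \<times> {0<..TT}" by (simp add: space_pair_measure)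
  show "(snd x, fst x) \<in> {0..TT} \<times> \<Omega>" if "x \<in> space (FF TT \<Otimes>\<^sub>M Lb)" for x
    using that unfolding sp by auto
  show "(\<lambda>p. (snd p, fst p)) -` ({0} \<times> A) \<inter> space (FF TT \<Otimes>\<^sub>M Lb) \<in> sets (FF TT \<Otimes>\<^sub>M Lb)" for A
  proof -
    have "(\<lambda>p. (snd p, fst p)) -` ({0} \<times> A) \<inter> space (FF TT \<Otimes>\<^sub>M Lb) = {}" unfolding sp by auto
    then show ?thesis by simp
  qed
  fix s t A assume s: "0 \<le> s" "s \<le> t" "t \<le> TT" and A: "A \<in> sets (FF s)"
  have "A \<in> sets (FF TT)" using sets_F_mono[of s TT] A s by auto
  moreover have "{v \<in> space Lb. s < v \<and> v \<le> t} \<in> sets Lb" using Lb_id_measurable by measurable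
  ultimately have "A \<times> {v \<in> space Lb. s < v \<and> v \<le> t} \<in> sets (FF TT \<Otimes>\<^sub>M Lb)" by (rule pair_measureI)
  moreover have "(\<lambda>p. (snd p, fst p)) -` ({s<..t} \<times> A) \<inter> space (FF TT \<Otimes>\<^sub>M Lb) = A \<times> {v \<in> space Lb. s < v \<and> v \<le> t}"
    unfolding sp using sets.sets_into_space[OF A] by auto
  ultimately show "(\<lambda>p. (snd p, fst p)) -` ({s<..t} \<times> A) \<inter> space (FF TT \<Otimes>\<^sub>M Lb) \<in> sets (FF TT \<Otimes>\<^sub>M Lb)" by simp
qed

lemma mult_exp_measurable:
  assumes a: "a \<in> borel_measurable PS" and ell: "ell \<in> borel_measurable PF"
  shows "mult_exp a ell \<in> borel_measurable (FF TT)"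
proof -
  have "(\<lambda>(\<omega>, s). a (s, \<omega>)) \<in> borel_measurable (FF TT \<Otimes>\<^sub>M Lb)"
    using measurable_compose[OF swapped_PS a] by (simp add: split_beta')
  from Lb.borel_measurable_lebesgue_integral[OF this]
  have 1: "(\<lambda>\<omega>. \<integral>s. a (s, \<omega>) \<partial>Lb) \<in> borel_measurable (FF TT)" by simp
  show ?thesis
    unfolding mult_exp_def[abs_def]
    by (intro measurable_compose[OF _ borel_measurable_exp] borel_measurable_diff 1 jump_integral_measurable[OF ell])
qed

lemma jump_mean:
  assumes \<omega>: "\<omega> \<in> \<Omega>" and H: "H \<in> borel_measurable PF" and h: "\<And>s z. h s z = H ((s, \<omega>), z)"
  shows "measure_int (jump_measure D \<omega>) 0 TT h = (\<integral>i. H (mark i \<omega>) \<partial>count_space (jumps \<omega>))"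
proof -
  have "h = (\<lambda>s z. H ((s, \<omega>), z))" using h by (simp add: fun_eq_iff)
  then have "measure_int (jump_measure D \<omega>) 0 TT h =
      (\<integral>i. (if 0 < tau i \<omega> \<and> tau i \<omega> \<le> TT then H (mark i \<omega>) else 0) \<partial>count_space (jumps \<omega>))"
    using measure_int_jump[OF \<omega> H, of 0 TT] by simp
  also have "\<dots> = (\<integral>i. H (mark i \<omega>) \<partial>count_space (jumps \<omega>))"
    by (rule Bochner_Integration.integral_cong[OF refl]) (use jumps_tau[OF \<omega>] in auto)
  finally show ?thesis .
qed

lemma time_mean:
  fixes X :: "real \<times> 'a \<Rightarrow> real"
  assumes \<omega>: "\<omega> \<in> \<Omega>" and X: "X \<in> borel_measurable PS" and h: "\<And>s. h s = X (s, \<omega>)"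
  shows "(LINT s:{0..TT}|lborel. h s) = (\<integral>s. X (s, \<omega>) \<partial>Lb)"
proof -
  have "(LINT s:{0..TT}|lborel. X (s, \<omega>)) = (\<integral>s. indicator {0<..} s * X (s, \<omega>) \<partial>Lb)"
    by (rule set_integral_Lb[OF process_section[OF X \<omega>]]) simp
  also have "\<dots> = (\<integral>s. X (s, \<omega>) \<partial>Lb)" by (rule Bochner_Integration.integral_cong[OF refl]) simp
  finally show ?thesis by (simp add: h)
qed

lemma density_process_eq:
  assumes v: "effort (unc u)" and \<omega>: "\<omega> \<in> \<Omega>"
  shows "density_process D u TT \<omega> = LTe (unc u) \<omega>"
proof -
  note m = den_measurable[OF v]
  have 1: "(LINT s:{0..TT}|lborel. (\<gamma>1 D (fst (u s \<omega>)) - 1) * intensity D s \<omega>) = (\<integral>s. - den_a (unc u) (s, \<omega>) \<partial>Lb)"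
    by (rule time_mean[OF \<omega> borel_measurable_uminus[OF m(1)]]) (simp add: den_a_def unc_def lam_def algebra_simps)
  have 2: "measure_int (jump_measure D \<omega>) 0 TT (\<lambda>s z. ln (\<gamma>1 D (fst (u s \<omega>)))) = (\<integral>i. - den_ell (unc u) (mark i \<omega>) \<partial>count_space (jumps \<omega>))"
    by (rule jump_mean[OF \<omega> borel_measurable_uminus[OF m(2)]]) (simp add: den_ell_def unc_def)
  show ?thesis unfolding density_process_def 1 2 by (simp add: LTe_def mult_exp_def)
qed

lemma final_wealth_eq:
  assumes v: "effort (unc u)" and \<omega>: "\<omega> \<in> \<Omega>"
  shows "- risk_av D * Y D u TT \<omega> =
    (\<integral>i. (\<lambda>x. \<gamma>2 D (snd (unc u (fst x))) * (eta (fst (fst x)) * snd x)) (mark i \<omega>) \<partial>count_space (jumps \<omega>))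
    + (\<integral>s. (\<lambda>p. eta (fst p) * (cost1 D (fst (unc u p)) + cost2 D (snd (unc u p)))) (s, \<omega>) \<partial>Lb)"
    and "(\<lambda>\<omega>. Y D u TT \<omega>) \<in> borel_measurable (FF TT)"
proof -
  note g2 = continuous_of_effort(2)[OF v \<gamma>2(2)] and c1 = continuous_of_effort(1)[OF v cost1(1)]
    and c2 = continuous_of_effort(2)[OF v cost2(1)]
  define H where "H x = \<gamma>2 D (snd (unc u (fst x))) * (eta (fst (fst x)) * snd x)" for x
  define X where "X p = eta (fst p) * (cost1 D (fst (unc u p)) + cost2 D (snd (unc u p)))" for p
  have H: "H \<in> borel_measurable PF"
    unfolding H_def[abs_def] by (intro borel_measurable_times process_field[OF g2] process_field[OF eta_measurable] measurable_snd)
  have X: "X \<in> borel_measurable PS"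
    unfolding X_def[abs_def] by (intro borel_measurable_times borel_measurable_add c1 c2 eta_measurable)
  have \<eta>: "risk_av D \<noteq> 0" using constants_pos by simp
  have Yeq: "Y D u TT \<omega>' = - (\<integral>i. 1 / risk_av D * H (mark i \<omega>') \<partial>count_space (jumps \<omega>')) - (\<integral>s. 1 / risk_av D * X (s, \<omega>') \<partial>Lb)"
    if w: "\<omega>' \<in> \<Omega>" for \<omega>'
  proof -
    have 1: "measure_int (jump_measure D \<omega>') 0 TT (\<lambda>s z. \<gamma>2 D (snd (u s \<omega>')) * exp (rate D * (TT - s)) * z) =
        (\<integral>i. 1 / risk_av D * H (mark i \<omega>') \<partial>count_space (jumps \<omega>'))"
      by (rule jump_mean[OF w borel_measurable_times[OF borel_measurable_const H]]) (use \<eta> in \<open>simp add: H_def unc_def eta_def\<close>)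
    have 2: "(LINT s:{0..TT}|lborel. exp (rate D * (TT - s)) * (cost1 D (fst (u s \<omega>')) + cost2 D (snd (u s \<omega>')))) =
        (\<integral>s. 1 / risk_av D * X (s, \<omega>') \<partial>Lb)"
      by (rule time_mean[OF w borel_measurable_times[OF borel_measurable_const X]]) (use \<eta> in \<open>simp add: X_def unc_def eta_def\<close>)
    show ?thesis unfolding Y_def 1 2 by simp
  qed
  show "- risk_av D * Y D u TT \<omega> =
    (\<integral>i. (\<lambda>x. \<gamma>2 D (snd (unc u (fst x))) * (eta (fst (fst x)) * snd x)) (mark i \<omega>) \<partial>count_space (jumps \<omega>))
    + (\<integral>s. (\<lambda>p. eta (fst p) * (cost1 D (fst (unc u p)) + cost2 D (snd (unc u p)))) (s, \<omega>) \<partial>Lb)"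
    unfolding Yeq[OF \<omega>] H_def[symmetric] X_def[symmetric] using \<eta> by (simp add: algebra_simps)
  have "(\<lambda>\<omega>. ln (mult_exp (\<lambda>p. - (1 / risk_av D) * X p) (\<lambda>x. 1 / risk_av D * H x) \<omega>)) \<in> borel_measurable (FF TT)"
    by (intro borel_measurable_ln mult_exp_measurable borel_measurable_times borel_measurable_const H X)
  then show "(\<lambda>\<omega>. Y D u TT \<omega>) \<in> borel_measurable (FF TT)"
    by (rule measurable_cong[THEN iffD1, rotated]) (simp add: Yeq mult_exp_def)
qed

lemma null_is_effort: "effort (unc null_effort)"
  using zero_effort by (simp add: effort_def unc_def[abs_def] null_effort_def)

lemma terminal_Xi: "\<omega> \<in> \<Omega> \<Longrightarrow> terminal D \<omega> = Xi \<omega>"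
  unfolding terminal_def final_wealth_eq(1)[OF null_is_effort] Xi_def by (simp add: unc_def null_effort_def \<gamma>2 cost1 cost2)

lemma eta_field: "(\<lambda>x. eta (fst (fst x)) * snd x) \<in> borel_measurable PF"
  by (intro borel_measurable_times process_field[OF eta_measurable] measurable_snd)

lemma Xi_measurable: "Xi \<in> borel_measurable (FF TT)"
  unfolding Xi_def[abs_def] by (intro measurable_compose[OF _ borel_measurable_exp] jump_integral_measurable[OF eta_field])

lemma Xi_pos: "0 < Xi \<omega>" by (simp add: Xi_def)

lemma TT_in: "TT \<in> {0..TT}" using horizon_pos by simp

text \<open>Almost surely all claims are positive, so the jump measure counts every claim up to \<open>T\<close>, and these are
  numbered without gaps.\<close>

lemma loss_eq_sum:
  assumes \<omega>: "\<omega> \<in> \<Omega>" and f: "finite (jumps \<omega>)" and z: "\<forall>i. 0 < claim_size D i \<omega>"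
  shows "loss D TT \<omega> = (\<Sum>i\<in>jumps \<omega>. claim_size D i \<omega>)"
proof -
  have J: "jumps \<omega> = {i. claim_time D i \<omega> \<le> ereal TT}" using z by (auto simp: jumps_def)
  obtain n where n: "n \<notin> jumps \<omega>" using f ex_new_if_finite[OF infinite_UNIV_nat] by blast
  define m where "m = (LEAST n. n \<notin> jumps \<omega>)"
  have m: "m \<notin> jumps \<omega>" unfolding m_def by (rule LeastI[of _ n]) (rule n)
  have mono: "claim_time D i \<omega> \<le> claim_time D j \<omega>" if "i \<le> j" for i j
    using that by (rule lift_Suc_mono_le[rotated]) (rule claim_time_incr(1)[OF \<omega>])
  have "jumps \<omega> = {..<m}"
  proof (intro set_eqI iffI)
    fix i assume i: "i \<in> jumps \<omega>"
    have "\<not> m \<le> i"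
    proof
      assume "m \<le> i"
      then have "claim_time D m \<omega> \<le> ereal TT" using mono[of m i] i unfolding J by auto
      then show False using m unfolding J by simp
    qed
    then show "i \<in> {..<m}" by simp
  next
    fix i assume "i \<in> {..<m}"
    then show "i \<in> jumps \<omega>" using not_less_Least[of i "\<lambda>n. n \<notin> jumps \<omega>"] unfolding m_def by auto
  qed
  then show ?thesis unfolding loss_def claim_count_def J[symmetric] by simp
qed

definition cut :: "real \<Rightarrow> (real \<times> 'a \<Rightarrow> real \<times> real) \<Rightarrow> real \<times> 'a \<Rightarrow> real \<times> real" where
  "cut t v p = (if t < fst p then v p else (0, 0))"

lemma effort_cut: "effort v \<Longrightarrow> effort (cut t v)"
  unfolding effort_def cut_def[abs_def] using zero_effort by (auto intro!: measurable_If borel_measurable_less PS_fst)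

end

context regular_loss_model
begin

text \<open>An effort that vanishes almost surely at each time up to \<open>t\<close> also vanishes at almost all claims up to \<open>t\<close>,
  because the compensator of the claims has a density in time.\<close>

lemma cut_AE:
  assumes v: "effort v" and v0: "\<And>s. s \<in> {0<..TT} \<Longrightarrow> s \<le> t \<Longrightarrow> AE \<omega> in P0 D. v (s, \<omega>) = (0, 0)"
  shows "AE \<omega> in P0 D. (AE s in Lb. cut t v (s, \<omega>) = v (s, \<omega>)) \<and>
    (\<forall>i\<in>jumps \<omega>. cut t v (tau i \<omega>, \<omega>) = v (tau i \<omega>, \<omega>))"
proof -
  define qr :: "real \<times> 'a \<Rightarrow> real" where "qr p = (if cut t v p \<noteq> v p then 1 else 0)" for p
  define q :: "real \<times> 'a \<Rightarrow> ennreal" where "q p = ennreal (qr p)" for p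
  have vm: "v \<in> PS \<rightarrow>\<^sub>M borel" "cut t v \<in> PS \<rightarrow>\<^sub>M borel" using v effort_cut[OF v] by (auto simp: effort_def)
  have qr: "qr \<in> borel_measurable PS"
  proof -
    have "{p \<in> space PS. cut t v p = v p} \<in> sets PS" using vm by (intro measurable_equality_set)
    then have "{p \<in> space PS. \<not> cut t v p = v p} \<in> sets PS" by (rule sets.sets_Collect_neg)
    then show ?thesis unfolding qr_def[abs_def] by (intro measurable_If) auto
  qed
  have q: "q \<in> borel_measurable PS" unfolding q_def[abs_def] using qr by simp
  have s0: "AE s in Lb. AE \<omega> in P0 D. q (s, \<omega>) = 0"
  proof (rule AE_I2)
    fix s assume s: "s \<in> space Lb"
    show "AE \<omega> in P0 D. q (s, \<omega>) = 0"
    proof (cases "s \<le> t")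
      case True
      from v0[OF _ True] s show ?thesis by (auto simp: q_def qr_def cut_def elim: eventually_mono)
    next
      case False
      then show ?thesis by (simp add: q_def qr_def cut_def)
    qed
  qed
  have qm: "(\<lambda>y. q (snd y, fst y)) \<in> borel_measurable (P0 D \<Otimes>\<^sub>M Lb)" by (rule PL_process[OF q])
  have "{x \<in> space (P0 D \<Otimes>\<^sub>M Lb). q (snd x, fst x) = 0} \<in> sets (P0 D \<Otimes>\<^sub>M Lb)" using qm by measurable
  then have w0: "AE \<omega> in P0 D. AE s in Lb. q (s, \<omega>) = 0"
    using pair_sigma_finite.AE_commute[OF pairs_sigma_finite(3), of "\<lambda>\<omega> s. q (s, \<omega>) = 0"] s0 by simp
  have X: "(\<lambda>p. q p * ennreal (lam p)) \<in> borel_measurable PS" using q lam_predictable by simp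
  have H: "(\<lambda>x. q (fst x)) \<in> borel_measurable PF" by (rule process_field[OF q])
  have "(\<integral>\<^sup>+\<omega>. (\<integral>\<^sup>+i. q (fst (mark i \<omega>)) \<partial>count_space (jumps \<omega>)) \<partial>P0 D) =
      (\<integral>\<^sup>+x. q (fst (snd x), fst x) * ennreal (lam (fst (snd x), fst x)) \<partial>NU)"
    using compensation_nn[OF H] by simp
  also have "\<dots> = (\<integral>\<^sup>+\<omega>. 1 * (\<integral>\<^sup>+s. q (s, \<omega>) * ennreal (lam (s, \<omega>)) \<partial>Lb) \<partial>P0 D)"
    using nn_integral_NU_weight[of "\<lambda>_. 1", OF _ X] by simp
  also have "\<dots> = (\<integral>\<^sup>+\<omega>. 0 \<partial>P0 D)"
  proof (rule nn_integral_cong_AE)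
    show "AE \<omega> in P0 D. 1 * (\<integral>\<^sup>+s. q (s, \<omega>) * ennreal (lam (s, \<omega>)) \<partial>Lb) = 0"
      using w0
    proof eventually_elim
      case (elim \<omega>)
      then have "(\<integral>\<^sup>+s. q (s, \<omega>) * ennreal (lam (s, \<omega>)) \<partial>Lb) = (\<integral>\<^sup>+s. 0 \<partial>Lb)"
        by (intro nn_integral_cong_AE) (auto elim: eventually_mono)
      then show ?case by simp
    qed
  qed
  finally have z: "(\<integral>\<^sup>+\<omega>. (\<integral>\<^sup>+i. q (fst (mark i \<omega>)) \<partial>count_space (jumps \<omega>)) \<partial>P0 D) = 0" by simp
  have "AE \<omega> in P0 D. (\<integral>\<^sup>+i. q (fst (mark i \<omega>)) \<partial>count_space (jumps \<omega>)) = 0"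
  proof -
    define J where "J \<omega> = (\<integral>i. (\<lambda>x. qr (fst x)) (mark i \<omega>) \<partial>count_space (jumps \<omega>))" for \<omega>
    have Jm: "J \<in> borel_measurable (P0 D)"
      unfolding J_def[abs_def] by (rule from_F_measurable[OF TT_in jump_integral_measurable[OF process_field[OF qr]]])
    have qr0: "0 \<le> qr p" for p by (simp add: qr_def)
    have PJ: "AE \<omega> in P0 D. (\<integral>\<^sup>+i. q (fst (mark i \<omega>)) \<partial>count_space (jumps \<omega>)) = ennreal (J \<omega>)"
      using finite_jumps_AE
    proof eventually_elim
      case (elim \<omega>)
      show ?case unfolding nn_integral_count_space_finite[OF elim] J_def jump_integral_finite[OF elim] q_def
        by (rule sum_ennreal) (rule qr0)
    qed
    have "(\<integral>\<^sup>+\<omega>. ennreal (J \<omega>) \<partial>P0 D) = 0" using z nn_integral_cong_AE[OF PJ] by simp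
    then have "AE \<omega> in P0 D. ennreal (J \<omega>) = 0" using nn_integral_0_iff_AE[of "\<lambda>\<omega>. ennreal (J \<omega>)" "P0 D"] Jm by simp
    with PJ show ?thesis by eventually_elim (simp only:)
  qed
  with w0 show ?thesis
  proof eventually_elim
    case (elim \<omega>)
    have "AE s in Lb. cut t v (s, \<omega>) = v (s, \<omega>)" using elim(1) by (auto simp: q_def qr_def elim: eventually_mono split: if_splits)
    moreover have "\<forall>i\<in>jumps \<omega>. cut t v (tau i \<omega>, \<omega>) = v (tau i \<omega>, \<omega>)"
      using elim(2) by (subst (asm) nn_integral_0_iff_AE) (auto simp: AE_count_space q_def qr_def mark_def split: if_splits)
    ultimately show ?case by blast
  qed
qed

lemma mult_exp_cut:
  assumes v: "effort v" and v0: "\<And>s. s \<in> {0<..TT} \<Longrightarrow> s \<le> t \<Longrightarrow> AE \<omega> in P0 D. v (s, \<omega>) = (0, 0)"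
  shows "AE \<omega> in P0 D. KTe (cut t v) \<omega> = KTe v \<omega> \<and> LTe (cut t v) \<omega> = LTe v \<omega>"
proof -
  have ce: "AE \<omega> in P0 D. (AE s in Lb. cut t v (s, \<omega>) = v (s, \<omega>)) \<and> (\<forall>i\<in>jumps \<omega>. cut t v (tau i \<omega>, \<omega>) = v (tau i \<omega>, \<omega>))"
    by (rule cut_AE[OF v]) (rule v0)
  then show ?thesis using AE_space
proof eventually_elim
  case (elim \<omega>)
  note c = effort_cut[OF v, of t]
  have 1: "(\<integral>s. eff_a (cut t v) (s, \<omega>) \<partial>Lb) = (\<integral>s. eff_a v (s, \<omega>) \<partial>Lb)" "(\<integral>s. den_a (cut t v) (s, \<omega>) \<partial>Lb) = (\<integral>s. den_a v (s, \<omega>) \<partial>Lb)"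
    by (intro integral_cong_AE process_section[OF eff_measurable(1)[OF v]] process_section[OF eff_measurable(1)[OF c]]
        process_section[OF den_measurable(1)[OF v]] process_section[OF den_measurable(1)[OF c]] elim(2)
        eventually_mono[OF conjunct1[OF elim(1)]]; simp add: eff_a_def den_a_def)+
  have 2: "(\<integral>i. eff_ell (cut t v) (mark i \<omega>) \<partial>count_space (jumps \<omega>)) = (\<integral>i. eff_ell v (mark i \<omega>) \<partial>count_space (jumps \<omega>))"
    "(\<integral>i. den_ell (cut t v) (mark i \<omega>) \<partial>count_space (jumps \<omega>)) = (\<integral>i. den_ell v (mark i \<omega>) \<partial>count_space (jumps \<omega>))"
    by (rule Bochner_Integration.integral_cong[OF refl]; use elim(1) in \<open>simp add: eff_ell_def den_ell_def mark_def\<close>)+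
  show ?case unfolding KTe_def LTe_def mult_exp_def 1 2 by simp
qed
qed

lemma density_multiplicative:
  assumes v: "effort v"
  shows "multiplicative D (den_a v) (den_ell v) 0"
proof unfold_locales
  show "den_a v \<in> borel_measurable PS" "den_ell v \<in> borel_measurable PF" using den_measurable[OF v] by auto
  fix p assume p: "p \<in> space PS"
  then have q: "v p \<in> effort_set" using v by (auto simp: effort_def)
  note b = effort_bounds[OF q]
  have lp: "0 < lam p" using lam_pos[of "fst p" "snd p"] p by (auto simp: space_PS)
  show "0 \<le> den_a v p" unfolding den_a_def using b lp by (intro mult_nonneg_nonneg) auto
  have "(1 - \<gamma>1 D (fst (v p))) * lam p \<le> 1 * lam p" using b lp by (intro mult_right_mono) auto
  then show "den_a v p \<le> lam p + 0" unfolding den_a_def by simp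
  fix z :: real
  show "0 \<le> den_ell v (p, z)" using b by (simp add: den_ell_def ln_le_zero_iff)
qed simp

lemma mult_exp_KT:
  "effort v \<Longrightarrow> KTe v = multiplicative.KT D (eff_a v) (eff_ell v)"
  "effort v \<Longrightarrow> LTe v = multiplicative.KT D (den_a v) (den_ell v)"
  by (simp_all add: fun_eq_iff KTe_def LTe_def mult_exp_def multiplicative.KT_def[OF effort_multiplicative]
      multiplicative.KT_def[OF density_multiplicative])

text \<open>The density process of a reduced intensity has no drift, so it is a martingale.\<close>

lemma density_expectation:
  assumes v: "effort v" and t: "t \<in> {0..TT}" and A: "A \<in> sets (FF t)"
  shows "(\<integral>\<omega>. indicator A \<omega> * LTe (cut t v) \<omega> \<partial>P0 D) = measure (P0 D) A"
    and "integrable (P0 D) (\<lambda>\<omega>. indicator A \<omega> * LTe (cut t v) \<omega>)"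
proof -
  let ?v = "cut t v"
  note c = effort_cut[OF v, of t]
  interpret multiplicative D "den_a ?v" "den_ell ?v" 0 by (rule density_multiplicative[OF c])
  interpret w: weighted_multiplicative D "den_a ?v" "den_ell ?v" 0 t "indicator A"
    by unfold_locales (use t A in \<open>auto simp: den_a_def den_ell_def cut_def \<gamma>1 split: split_indicator\<close>)
  have dr: "w.drift ((fst (snd x), fst x), snd (snd x)) = 0" if "x \<in> space NU" for x
  proof -
    have "?v (fst (snd x), fst x) \<in> effort_set" using c NU_fst_PS[OF that] by (auto simp: effort_def)
    note b = effort_bounds[OF this]
    show ?thesis using b(1) by (simp add: w.drift_def kap_def den_a_def den_ell_def algebra_simps)
  qed
  have A0: "A \<in> sets (P0 D)" by (rule subalg_sets[OF t A])
  have z1: "(\<lambda>_. 0 :: real) \<in> borel_measurable PF" "(\<lambda>_. 0 :: real) \<in> borel_measurable PS" "(\<lambda>_. 1 :: real) \<in> borel_measurable (FF t)" by simp_all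
  have z2: "\<bar>indicator A \<omega> * 1\<bar> \<le> (1 :: real)" for \<omega> :: 'a by (simp split: split_indicator)
  have z3: "(\<integral>\<^sup>+x. ennreal ((0::real)\<^sup>2 * lam (fst (snd x), fst x)) \<partial>NU) < \<infinity>" by simp
  have z4: "(\<integral>\<^sup>+x. ennreal (exp (Lam (fst x))) * ennreal \<bar>w.Wp (fst (snd x), fst x) * 0\<bar> \<partial>NU) < \<infinity>" by simp
  note fv = w.finite_variation_expectation[OF z1 refl refl z2 z3 z4]
  have Wi: "(\<lambda>\<omega>. indicator A \<omega> * ((1 + (\<integral>s. 0 - (\<integral>z. 0 * lam (s, \<omega>) \<partial>claim_law D) \<partial>Lb) + (\<integral>i. 0 \<partial>count_space (jumps \<omega>))) * KT \<omega>)) = (\<lambda>\<omega>. indicator A \<omega> * KT \<omega>)"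
    by (simp only: mult_zero_left integral_zero diff_0_right add_0_right mult_1_left)
  have "(\<integral>x. w.Wp (fst (snd x), fst x) * Km (fst (snd x), fst x) * (0
      + 0 * lam (fst (snd x), fst x) * (kap ((fst (snd x), fst x), snd (snd x)) - 1)
      + B x * w.drift ((fst (snd x), fst x), snd (snd x))) \<partial>NU) = 0" for B
    by (rule integral_eq_zero_AE, rule AE_I2) (simp only: dr mult_zero_left mult_zero_right add_0_right)
  then have "(\<integral>\<omega>. indicator A \<omega> * KT \<omega> \<partial>P0 D) = (\<integral>\<omega>. indicator A \<omega> * 1 \<partial>P0 D)"
    using fv(3) unfolding Wi by (simp only: add_0_right)
  then show "(\<integral>\<omega>. indicator A \<omega> * LTe (cut t v) \<omega> \<partial>P0 D) = measure (P0 D) A"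
    using A0 by (simp add: mult_exp_KT(2)[OF c])
  show "integrable (P0 D) (\<lambda>\<omega>. indicator A \<omega> * LTe (cut t v) \<omega>)"
    using fv(1) unfolding Wi mult_exp_KT(2)[OF c] .
qed

lemma Xi_square: "integrable (P0 D) (\<lambda>\<omega>. (Xi \<omega>)\<^sup>2)"
proof (rule Bochner_Integration.integrable_bound[OF loss_moment])
  show "(\<lambda>\<omega>. (Xi \<omega>)\<^sup>2) \<in> borel_measurable (P0 D)"
    using from_F_measurable[OF TT_in Xi_measurable] by simp
  show "AE \<omega> in P0 D. norm ((Xi \<omega>)\<^sup>2) \<le> norm (exp (2 * risk_av D * exp (rate D * TT) * loss D TT \<omega>))"
    using regular_AE claim_size_pos_AE
  proof eventually_elim
    case (elim \<omega>)
    have \<omega>: "\<omega> \<in> \<Omega>" and f: "finite (jumps \<omega>)" using elim(1) by (auto simp: regular_def)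
    have "(\<Sum>i\<in>jumps \<omega>. eta (tau i \<omega>) * claim_size D i \<omega>) \<le> (\<Sum>i\<in>jumps \<omega>. risk_av D * exp (rate D * TT) * claim_size D i \<omega>)"
      using jumps_tau[OF \<omega>] elim(2) by (intro sum_mono mult_right_mono eta_bounds(2)) (auto intro: less_imp_le)
    also have "\<dots> = risk_av D * exp (rate D * TT) * loss D TT \<omega>"
      unfolding loss_eq_sum[OF \<omega> f elim(2)] by (simp add: sum_distrib_left)
    finally have "Xi \<omega> \<le> exp (risk_av D * exp (rate D * TT) * loss D TT \<omega>)"
      unfolding Xi_def jump_integral_finite[OF f] by (simp add: mark_def)
    then have "(Xi \<omega>)\<^sup>2 \<le> (exp (risk_av D * exp (rate D * TT) * loss D TT \<omega>))\<^sup>2"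
      using Xi_pos[of \<omega>] by (intro power_mono) auto
    then show ?case by (simp add: exp_double[symmetric] mult.assoc)
  qed
qed

lemma product_moment:
  assumes X: "X \<in> borel_measurable (P0 D)" and i: "integrable (P0 D) (\<lambda>\<omega>. (X \<omega>)\<^sup>2)"
  shows "integrable (P0 D) (\<lambda>\<omega>. exp (Lam \<omega>) * X \<omega>)"
proof (rule Bochner_Integration.integrable_bound)
  show "integrable (P0 D) (\<lambda>\<omega>. exp (4 * Lam \<omega>) + (X \<omega>)\<^sup>2)" using exp_Lam_integrable i by simp
  show "(\<lambda>\<omega>. exp (Lam \<omega>) * X \<omega>) \<in> borel_measurable (P0 D)" using X by simp
  show "AE \<omega> in P0 D. norm (exp (Lam \<omega>) * X \<omega>) \<le> norm (exp (4 * Lam \<omega>) + (X \<omega>)\<^sup>2)"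
  proof (rule AE_I2)
    fix \<omega> assume "\<omega> \<in> \<Omega>"
    then have e: "(exp (Lam \<omega>))\<^sup>2 \<le> exp (4 * Lam \<omega>)" using Lam_nonneg by (simp add: exp_double[symmetric])
    have "0 \<le> (exp (Lam \<omega>) - \<bar>X \<omega>\<bar>)\<^sup>2" by simp
    then have "2 * (exp (Lam \<omega>) * \<bar>X \<omega>\<bar>) \<le> (exp (Lam \<omega>))\<^sup>2 + (X \<omega>)\<^sup>2" by (simp add: power2_diff)
    moreover have "0 \<le> exp (Lam \<omega>) * \<bar>X \<omega>\<bar>" by simp
    ultimately have "exp (Lam \<omega>) * \<bar>X \<omega>\<bar> \<le> exp (4 * Lam \<omega>) + (X \<omega>)\<^sup>2" using e by linarith
    then show "norm (exp (Lam \<omega>) * X \<omega>) \<le> norm (exp (4 * Lam \<omega>) + (X \<omega>)\<^sup>2)" by (simp add: abs_mult)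
  qed
qed

lemma KTe_props:
  assumes v: "effort v"
  shows "0 < KTe v \<omega>" "KTe v \<in> borel_measurable (P0 D)" "integrable (P0 D) (\<lambda>\<omega>. Xi \<omega> * KTe v \<omega>)"
proof -
  interpret multiplicative D "eff_a v" "eff_ell v" eff_C by (rule effort_multiplicative[OF v])
  note e = mult_exp_KT(1)[OF v]
  show "0 < KTe v \<omega>" unfolding e by (rule KT_pos)
  show m: "KTe v \<in> borel_measurable (P0 D)" unfolding KTe_def by (rule from_F_measurable[OF TT_in mult_exp_measurable[OF eff_measurable[OF v]]])
  have X: "Xi \<in> borel_measurable (P0 D)" by (rule from_F_measurable[OF TT_in Xi_measurable])
  show "integrable (P0 D) (\<lambda>\<omega>. Xi \<omega> * KTe v \<omega>)"
  proof (rule Bochner_Integration.integrable_bound)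
    show "integrable (P0 D) (\<lambda>\<omega>. exp (eff_C * TT) * (exp (Lam \<omega>) * Xi \<omega>))"
      using product_moment[OF X Xi_square] by simp
    show "(\<lambda>\<omega>. Xi \<omega> * KTe v \<omega>) \<in> borel_measurable (P0 D)" using X m by simp
    show "AE \<omega> in P0 D. norm (Xi \<omega> * KTe v \<omega>) \<le> norm (exp (eff_C * TT) * (exp (Lam \<omega>) * Xi \<omega>))"
      using regular_AE
    proof eventually_elim
      case (elim \<omega>)
      have "Xi \<omega> * KTe v \<omega> \<le> Xi \<omega> * bnd \<omega>"
        using KT_bound[OF elim] Xi_pos[of \<omega>] unfolding e by (intro mult_left_mono) auto
      then show ?case using Xi_pos[of \<omega>] KT_pos[of \<omega>] unfolding e by (simp add: bnd_def abs_mult mult_ac)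
    qed
  qed
qed

text \<open>The density of \<open>P\<^sup>u\<close> is absorbed into the cost; from here on all expectations are under \<open>P\<^sup>0\<close>.\<close>

lemma density_wealth:
  assumes v: "effort (unc u)" and r: "regular \<omega>"
  shows "density_process D u TT \<omega> * exp (- risk_av D * Y D u TT \<omega>) = Xi \<omega> * KTe (unc u) \<omega>"
proof -
  have \<omega>: "\<omega> \<in> \<Omega>" and f: "finite (jumps \<omega>)" using r by (auto simp: regular_def)
  let ?v = "unc u"
  have ia: "integrable Lb (\<lambda>s. eff_a ?v (s, \<omega>))" by (rule multiplicative.a_integrable[OF effort_multiplicative[OF v] r])
  have ib: "integrable Lb (\<lambda>s. den_a ?v (s, \<omega>))" by (rule multiplicative.a_integrable[OF density_multiplicative[OF v] r])
  have "(\<integral>s. (\<lambda>p. eta (fst p) * (cost1 D (fst (?v p)) + cost2 D (snd (?v p)))) (s, \<omega>) \<partial>Lb) =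
      (\<integral>s. eff_a ?v (s, \<omega>) - den_a ?v (s, \<omega>) \<partial>Lb)" by (simp add: eff_a_def den_a_def)
  also have "\<dots> = (\<integral>s. eff_a ?v (s, \<omega>) \<partial>Lb) - (\<integral>s. den_a ?v (s, \<omega>) \<partial>Lb)"
    by (rule Bochner_Integration.integral_diff[OF ia ib])
  finally have 1: "(\<integral>s. (\<lambda>p. eta (fst p) * (cost1 D (fst (?v p)) + cost2 D (snd (?v p)))) (s, \<omega>) \<partial>Lb) =
      (\<integral>s. eff_a ?v (s, \<omega>) \<partial>Lb) - (\<integral>s. den_a ?v (s, \<omega>) \<partial>Lb)" .
  have 2: "(\<Sum>i\<in>jumps \<omega>. (\<lambda>x. \<gamma>2 D (snd (?v (fst x))) * (eta (fst (fst x)) * snd x)) (mark i \<omega>)) =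
      (\<Sum>i\<in>jumps \<omega>. (\<lambda>x. eta (fst (fst x)) * snd x) (mark i \<omega>)) - (\<Sum>i\<in>jumps \<omega>. eff_ell ?v (mark i \<omega>)) + (\<Sum>i\<in>jumps \<omega>. den_ell ?v (mark i \<omega>))"
    unfolding sum_subtractf[symmetric] sum.distrib[symmetric]
    by (rule sum.cong[OF refl]) (simp add: eff_ell_def den_ell_def algebra_simps)
  show ?thesis
    unfolding density_process_eq[OF v \<omega>] final_wealth_eq(1)[OF v \<omega>] LTe_def KTe_def mult_exp_def Xi_def 1 jump_integral_finite[OF f] 2
    by (simp add: exp_add[symmetric])
qed

lemma Pu_integral:
  assumes v: "effort (unc u)" and f: "f \<in> borel_measurable (FF TT)"
  shows "integrable (Pu D u) f \<longleftrightarrow> integrable (P0 D) (\<lambda>\<omega>. density_process D u TT \<omega> * f \<omega>)" (is ?i)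
    and "(\<integral>\<omega>. f \<omega> \<partial>Pu D u) = (\<integral>\<omega>. density_process D u TT \<omega> * f \<omega> \<partial>P0 D)" (is ?e)
proof -
  have sb: "subalgebra (P0 D) (FF TT)" by (rule subalg[OF TT_in])
  have "LTe (unc u) \<in> borel_measurable (FF TT)" unfolding LTe_def by (rule mult_exp_measurable[OF den_measurable[OF v]])
  then have L: "density_process D u TT \<in> borel_measurable (FF TT)"
    by (rule measurable_cong[THEN iffD1, rotated]) (simp add: density_process_eq[OF v])
  have m: "f \<in> borel_measurable (restr_to_subalg (P0 D) (FF TT))" "density_process D u TT \<in> borel_measurable (restr_to_subalg (P0 D) (FF TT))"
    using f L by (auto intro: measurable_in_subalg[OF sb])
  have p: "AE \<omega> in restr_to_subalg (P0 D) (FF TT). 0 \<le> density_process D u TT \<omega>" by (simp add: density_process_def)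
  have Lf: "(\<lambda>\<omega>. density_process D u TT \<omega> * f \<omega>) \<in> borel_measurable (FF TT)" using L f by simp
  show ?i
    unfolding Pu_def integrable_density[OF m p]
    using integrable_from_subalg[OF sb] integrable_in_subalg[OF sb Lf] by auto
  show ?e
    unfolding Pu_def integral_density[OF m p] using integral_subalgebra2[OF sb Lf] by simp
qed

lemma unc_admissible: "u \<in> admissible D \<Longrightarrow> effort (unc u)"
  by (auto simp: admissible_def effort_def effort_set_def predictable_def unc_def[abs_def] space_PS split_beta')

lemma exp_wealth_measurable: "effort (unc u) \<Longrightarrow> (\<lambda>\<omega>. exp (- risk_av D * Y D u TT \<omega>)) \<in> borel_measurable (FF TT)"
proof -
  assume v: "effort (unc u)"
  have "\<Omega> \<noteq> {}" by (rule not_empty)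
  then obtain \<omega> where "\<omega> \<in> \<Omega>" by auto
  from final_wealth_eq(2)[OF v this] show ?thesis by simp
qed

lemma exp_wealth_integral:
  assumes v: "effort (unc u)"
  shows "integrable (Pu D u) (\<lambda>\<omega>. exp (- risk_av D * Y D u TT \<omega>))"
    and "A \<in> sets (FF TT) \<Longrightarrow> (\<integral>\<omega>. indicator A \<omega> * exp (- risk_av D * Y D u TT \<omega>) \<partial>Pu D u) = (\<integral>\<omega>. indicator A \<omega> * (Xi \<omega> * KTe (unc u) \<omega>) \<partial>P0 D)"
proof -
  note Ym = exp_wealth_measurable[OF v]
  have LF: "density_process D u TT \<in> borel_measurable (P0 D)"
  proof (rule measurable_cong[THEN iffD2])
    show "LTe (unc u) \<in> borel_measurable (P0 D)"
      unfolding LTe_def by (rule from_F_measurable[OF TT_in mult_exp_measurable[OF den_measurable[OF v]]])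
  qed (simp add: density_process_eq[OF v])
  note Y0 = from_F_measurable[OF TT_in Ym] and X0 = from_F_measurable[OF TT_in Xi_measurable]
  have ae: "AE \<omega> in P0 D. density_process D u TT \<omega> * exp (- risk_av D * Y D u TT \<omega>) = Xi \<omega> * KTe (unc u) \<omega>"
    using regular_AE by eventually_elim (rule density_wealth[OF v])
  show "integrable (Pu D u) (\<lambda>\<omega>. exp (- risk_av D * Y D u TT \<omega>))"
    unfolding Pu_integral(1)[OF v Ym]
    using KTe_props(3)[OF v] by (rule integrable_cong_AE[THEN iffD2, rotated 3]) (use LF Y0 X0 KTe_props(2)[OF v] ae in simp_all)
  assume A: "A \<in> sets (FF TT)"
  have m: "(\<lambda>\<omega>. indicator A \<omega> * exp (- risk_av D * Y D u TT \<omega>)) \<in> borel_measurable (FF TT)" using A Ym by simp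
  show "(\<integral>\<omega>. indicator A \<omega> * exp (- risk_av D * Y D u TT \<omega>) \<partial>Pu D u) = (\<integral>\<omega>. indicator A \<omega> * (Xi \<omega> * KTe (unc u) \<omega>) \<partial>P0 D)"
    unfolding Pu_integral(2)[OF v m]
  proof (rule integral_cong_AE)
    have A0: "A \<in> sets (P0 D)" by (rule subalg_sets[OF TT_in A])
    show "(\<lambda>\<omega>. density_process D u TT \<omega> * (indicator A \<omega> * exp (- risk_av D * Y D u TT \<omega>))) \<in> borel_measurable (P0 D)"
      using A0 LF Y0 by simp
    show "(\<lambda>\<omega>. indicator A \<omega> * (Xi \<omega> * KTe (unc u) \<omega>)) \<in> borel_measurable (P0 D)" using A0 X0 KTe_props(2)[OF v] by simp
    show "AE \<omega> in P0 D. density_process D u TT \<omega> * (indicator A \<omega> * exp (- risk_av D * Y D u TT \<omega>)) = indicator A \<omega> * (Xi \<omega> * KTe (unc u) \<omega>)"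
      using ae by eventually_elim (simp add: mult_ac)
  qed
qed

lemma exp_wealth_split: "exp (- risk_av D * wealth D u TT \<omega>) = exp (- risk_av D * (wealth0 D * exp (rate D * TT))) * exp (- risk_av D * Y D u TT \<omega>)"
  by (simp add: wealth_def exp_add[symmetric] algebra_simps)

lemma effort_admissible: "effort v \<Longrightarrow> (\<lambda>s \<omega>. v (s, \<omega>)) \<in> admissible D"
proof -
  assume v: "effort v"
  have e: "unc (\<lambda>s \<omega>. v (s, \<omega>)) = v" by (simp add: unc_def fun_eq_iff)
  show ?thesis
    using v exp_wealth_integral(1)[of "\<lambda>s \<omega>. v (s, \<omega>)"] unfolding admissible_def e exp_wealth_split
    by (auto simp: effort_def effort_set_def predictable_def space_PS)
qed

lemma objective_eq: "effort (unc u) \<Longrightarrow> objective D u = exp (- risk_av D * (wealth0 D * exp (rate D * TT))) * (\<integral>\<omega>. Xi \<omega> * KTe (unc u) \<omega> \<partial>P0 D)"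
proof -
  assume v: "effort (unc u)"
  have \<Omega>: "\<Omega> \<in> sets (FF TT)" using sets.top[of "FF TT"] by simp
  have sp: "space (Pu D u) = \<Omega>" by (simp add: Pu_def space_restr_to_subalg)
  have "(\<integral>\<omega>. exp (- risk_av D * Y D u TT \<omega>) \<partial>Pu D u) = (\<integral>\<omega>. indicator \<Omega> \<omega> * exp (- risk_av D * Y D u TT \<omega>) \<partial>Pu D u)"
    by (rule Bochner_Integration.integral_cong[OF refl]) (simp add: sp)
  also have "\<dots> = (\<integral>\<omega>. indicator \<Omega> \<omega> * (Xi \<omega> * KTe (unc u) \<omega>) \<partial>P0 D)" by (rule exp_wealth_integral(2)[OF v \<Omega>])
  also have "\<dots> = (\<integral>\<omega>. Xi \<omega> * KTe (unc u) \<omega> \<partial>P0 D)" by (rule Bochner_Integration.integral_cong[OF refl]) simp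
  finally show ?thesis unfolding objective_def exp_wealth_split by simp
qed

text \<open>Bayes' rule: on the past up to \<open>t\<close> the measures \<open>P\<^sup>u\<close> and \<open>P\<^sup>0\<close> agree, because the effort vanishes there.\<close>

lemma conditional_cost:
  fixes u t
  defines "Z \<equiv> real_cond_exp (Pu D u) (FF t) (\<lambda>\<omega>. exp (- risk_av D * Y D u TT \<omega>))"
  assumes v: "effort (unc u)" and t: "t \<in> {0..TT}" and u0: "\<And>s. s \<in> {0<..TT} \<Longrightarrow> s \<le> t \<Longrightarrow> AE \<omega> in P0 D. unc u (s, \<omega>) = (0, 0)"
  shows "Z \<in> borel_measurable (FF t)" "integrable (P0 D) Z"
    and "\<And>A. A \<in> sets (FF t) \<Longrightarrow> (\<integral>\<omega>. indicator A \<omega> * Z \<omega> \<partial>P0 D) = (\<integral>\<omega>. indicator A \<omega> * (Xi \<omega> * KTe (cut t (unc u)) \<omega>) \<partial>P0 D)"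
proof -
  have FtT: "A \<in> sets (FF TT)" if "A \<in> sets (FF t)" for A using that sets_F_mono[of t TT] t by auto
  have mc: "AE \<omega> in P0 D. KTe (cut t (unc u)) \<omega> = KTe (unc u) \<omega> \<and> LTe (cut t (unc u)) \<omega> = LTe (unc u) \<omega>"
    by (rule mult_exp_cut[OF v]) (rule u0)
  have ae: "AE \<omega> in P0 D. density_process D u TT \<omega> = LTe (cut t (unc u)) \<omega>"
    using mc AE_space by eventually_elim (simp add: density_process_eq[OF v])
  have c: "effort (cut t (unc u))" by (rule effort_cut[OF v])
  have Lm: "LTe (unc u) \<in> borel_measurable (P0 D)" "LTe (cut t (unc u)) \<in> borel_measurable (P0 D)"
    unfolding LTe_def by (rule from_F_measurable[OF TT_in mult_exp_measurable[OF den_measurable[OF v]]])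
      (rule from_F_measurable[OF TT_in mult_exp_measurable[OF den_measurable[OF c]]])
  have dm: "density_process D u TT \<in> borel_measurable (P0 D)"
    by (rule measurable_cong[THEN iffD2, OF _ Lm(1)]) (simp add: density_process_eq[OF v])
  have PA: "integrable (Pu D u) (indicator A :: 'a \<Rightarrow> real)" "(\<integral>\<omega>. indicator A \<omega> \<partial>Pu D u) = measure (P0 D) A" if A: "A \<in> sets (FF t)" for A
  proof -
    have A0: "A \<in> sets (P0 D)" by (rule subalg_sets[OF t A])
    have m: "(indicator A :: 'a \<Rightarrow> real) \<in> borel_measurable (FF TT)" using FtT[OF A] by simp
    have ae': "AE \<omega> in P0 D. density_process D u TT \<omega> * indicator A \<omega> = indicator A \<omega> * LTe (cut t (unc u)) \<omega>"
      using ae by eventually_elim simp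
    have ms: "(\<lambda>\<omega>. density_process D u TT \<omega> * indicator A \<omega>) \<in> borel_measurable (P0 D)"
      "(\<lambda>\<omega>. indicator A \<omega> * LTe (cut t (unc u)) \<omega>) \<in> borel_measurable (P0 D)" using A0 dm Lm by simp_all
    show "integrable (Pu D u) (indicator A :: 'a \<Rightarrow> real)"
      unfolding Pu_integral(1)[OF v m] integrable_cong_AE[OF ms ae'] by (rule density_expectation(2)[OF v t A])
    show "(\<integral>\<omega>. indicator A \<omega> \<partial>Pu D u) = measure (P0 D) A"
      unfolding Pu_integral(2)[OF v m] integral_cong_AE[OF ms ae'] by (rule density_expectation(1)[OF v t A])
  qed
  have sp: "space (Pu D u) = \<Omega>" "sets (Pu D u) = sets (FF TT)"
    using sets_restr_to_subalg[OF subalg[OF TT_in]] by (simp_all add: Pu_def space_restr_to_subalg)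
  have Ot: "\<Omega> \<in> sets (FF t)" using sets.top[of "FF t"] by simp
  have "integrable (Pu D u) (\<lambda>_. 1 :: real)"
    using PA(1)[OF Ot] by (rule Bochner_Integration.integrable_cong[THEN iffD1, rotated 2]) (simp_all add: sp)
  then have "emeasure (Pu D u) (space (Pu D u)) \<noteq> \<infinity>" by (simp add: integrable_iff_bounded less_top)
  then interpret Q: finite_measure "Pu D u" by (rule finite_measureI)
  have sbQ: "subalgebra (Pu D u) (FF t)" unfolding subalgebra_def sp using FtT by auto
  interpret Q: finite_measure_subalgebra "Pu D u" "FF t" by unfold_locales (rule sbQ)
  have sb0: "subalgebra (P0 D) (FF t)" by (rule subalg[OF t])
  have eqm: "restr_to_subalg (Pu D u) (FF t) = restr_to_subalg (P0 D) (FF t)"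
  proof (rule measure_eqI)
    show "sets (restr_to_subalg (Pu D u) (FF t)) = sets (restr_to_subalg (P0 D) (FF t))"
      by (simp add: sets_restr_to_subalg[OF sbQ] sets_restr_to_subalg[OF sb0])
    fix A assume "A \<in> sets (restr_to_subalg (Pu D u) (FF t))"
    then have A: "A \<in> sets (FF t)" by (simp add: sets_restr_to_subalg[OF sbQ])
    have "measure (Pu D u) A = measure (P0 D) A" using PA(2)[OF A] sets.sets_into_space[OF FtT[OF A]] sp by (simp add: Int_absorb2)
    then show "emeasure (restr_to_subalg (Pu D u) (FF t)) A = emeasure (restr_to_subalg (P0 D) (FF t)) A"
      by (simp add: emeasure_restr_to_subalg[OF sbQ A] emeasure_restr_to_subalg[OF sb0 A] Q.emeasure_eq_measure emeasure_eq_measure)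
  qed
  have tr: "integrable (P0 D) f" "(\<integral>\<omega>. f \<omega> \<partial>P0 D) = (\<integral>\<omega>. f \<omega> \<partial>Pu D u)" if "f \<in> borel_measurable (FF t)" "integrable (Pu D u) f" for f :: "'a \<Rightarrow> real"
    using integrable_in_subalg[OF sbQ that] integrable_from_subalg[OF sb0, of f] integral_subalgebra2[OF sbQ that(1)]
      integral_subalgebra2[OF sb0 that(1)] unfolding eqm by simp_all
  show Zm: "Z \<in> borel_measurable (FF t)" unfolding Z_def by (rule borel_measurable_cond_exp)
  have iY: "integrable (Pu D u) (\<lambda>\<omega>. exp (- risk_av D * Y D u TT \<omega>))" by (rule exp_wealth_integral(1)[OF v])
  have iZ: "integrable (Pu D u) Z" unfolding Z_def by (rule Q.real_cond_exp_int(1)[OF iY])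
  show "integrable (P0 D) Z" by (rule tr(1)[OF Zm iZ])
  fix A assume A: "A \<in> sets (FF t)"
  have AQ: "A \<in> sets (Pu D u)" using FtT[OF A] sp by simp
  have iAZ: "integrable (Pu D u) (\<lambda>\<omega>. indicator A \<omega> * Z \<omega>)" using integrable_mult_indicator[OF AQ iZ] by simp
  have iAY: "integrable (Pu D u) (\<lambda>\<omega>. indicator A \<omega> * exp (- risk_av D * Y D u TT \<omega>))" using integrable_mult_indicator[OF AQ iY] by simp
  have AZm: "(\<lambda>\<omega>. indicator A \<omega> * Z \<omega>) \<in> borel_measurable (FF t)" using A Zm by simp
  have "(\<integral>\<omega>. indicator A \<omega> * Z \<omega> \<partial>P0 D) = (\<integral>\<omega>. indicator A \<omega> * Z \<omega> \<partial>Pu D u)" by (rule tr(2)[OF AZm iAZ])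
  also have "\<dots> = (\<integral>\<omega>. indicator A \<omega> * exp (- risk_av D * Y D u TT \<omega>) \<partial>Pu D u)"
    unfolding Z_def by (rule Q.real_cond_exp_intg(2)[OF iAY]) (use A borel_measurable_integrable[OF iY] in simp_all)
  also have "\<dots> = (\<integral>\<omega>. indicator A \<omega> * (Xi \<omega> * KTe (unc u) \<omega>) \<partial>P0 D)" by (rule exp_wealth_integral(2)[OF v FtT[OF A]])
  also have "\<dots> = (\<integral>\<omega>. indicator A \<omega> * (Xi \<omega> * KTe (cut t (unc u)) \<omega>) \<partial>P0 D)"
  proof (rule integral_cong_AE)
    have A0: "A \<in> sets (P0 D)" by (rule subalg_sets[OF t A])
    note X0 = from_F_measurable[OF TT_in Xi_measurable]
    show "(\<lambda>\<omega>. indicator A \<omega> * (Xi \<omega> * KTe (unc u) \<omega>)) \<in> borel_measurable (P0 D)"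
      "(\<lambda>\<omega>. indicator A \<omega> * (Xi \<omega> * KTe (cut t (unc u)) \<omega>)) \<in> borel_measurable (P0 D)"
      using A0 X0 KTe_props(2)[OF v] KTe_props(2)[OF c] by simp_all
    show "AE \<omega> in P0 D. indicator A \<omega> * (Xi \<omega> * KTe (unc u) \<omega>) = indicator A \<omega> * (Xi \<omega> * KTe (cut t (unc u)) \<omega>)"
      using mc by eventually_elim simp
  qed
  finally show "(\<integral>\<omega>. indicator A \<omega> * Z \<omega> \<partial>P0 D) = (\<integral>\<omega>. indicator A \<omega> * (Xi \<omega> * KTe (cut t (unc u)) \<omega>) \<partial>P0 D)" .
qed

end

section \<open>The maximal driver\<close>

context bsde_model
begin

lemma effort_const: "q \<in> effort_set \<Longrightarrow> effort (\<lambda>_. q)" by (simp add: effort_def)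

text \<open>A dense sequence of effort levels. Suprema over it are measurable, and by continuity they are suprema
  over all effort levels.\<close>

definition qs :: "nat \<Rightarrow> real \<times> real" where
  "qs = (SOME x. (\<forall>n. x n \<in> effort_set) \<and> effort_set \<subseteq> closure (range x))"

lemma qs: "qs n \<in> effort_set" "effort_set \<subseteq> closure (range qs)"
proof -
  obtain T where T: "countable T" "T \<subseteq> effort_set" "effort_set \<subseteq> closure T" by (rule separable)
  have ne: "T \<noteq> {}" using T(3) zero_effort by auto
  have "\<exists>x. (\<forall>n::nat. x n \<in> effort_set) \<and> effort_set \<subseteq> closure (range x)"
    using T range_from_nat_into[OF ne T(1)] from_nat_into[OF ne] by (intro exI[of _ "from_nat_into T"]) auto
  from someI_ex[OF this] have "(\<forall>n. qs n \<in> effort_set) \<and> effort_set \<subseteq> closure (range qs)" unfolding qs_def .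
  then show "qs n \<in> effort_set" "effort_set \<subseteq> closure (range qs)" by auto
qed

definition Gp :: "real \<times> 'a \<Rightarrow> real" where "Gp p = real_of_ereal (SUP n. ereal (drv p (qs n)))"

lemma Gp_measurable: "Gp \<in> borel_measurable PS"
proof -
  have "(\<lambda>p. SUP n. ereal (drv p (qs n))) \<in> borel_measurable PS"
    by (intro borel_measurable_SUP borel_measurable_ereal drv_measurable[OF effort_const[OF qs(1)]]) simp
  then show ?thesis unfolding Gp_def[abs_def] by (rule borel_measurable_real_of_ereal)
qed

lemma Gp:
  assumes p: "p \<in> space PS" "tame_at p"
  shows "(SUP n. ereal (drv p (qs n))) = ereal (Gp p)" "\<And>q. q \<in> effort_set \<Longrightarrow> drv p q \<le> Gp p" "0 \<le> Gp p"
proof -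
  have "compact effort_set" unfolding effort_set_def by (intro compact_Times compact_Icc)
  from compact_continuous_image[OF drv_continuous[OF p] this]
  have "bdd_above (drv p ` effort_set)" by (intro bounded_imp_bdd_above compact_imp_bounded)
  then obtain B where B: "\<And>q. q \<in> effort_set \<Longrightarrow> drv p q \<le> B" unfolding bdd_above_def by blast
  let ?S = "SUP n. ereal (drv p (qs n))"
  have ub: "?S \<le> ereal B" by (rule SUP_least) (use B qs(1) in simp)
  have le: "ereal (drv p (qs n)) \<le> ?S" for n by (rule SUP_upper) simp
  have "\<bar>?S\<bar> \<noteq> \<infinity>" using le[of 0] ub by (cases ?S) auto
  then show S: "?S = ereal (Gp p)" by (simp add: Gp_def ereal_real)
  have n: "drv p (qs n) \<le> Gp p" for n using le[of n] unfolding S by simp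
  show G: "drv p q \<le> Gp p" if q: "q \<in> effort_set" for q
  proof -
    from closure_sequential[THEN iffD1, OF subsetD[OF qs(2) q]]
    obtain x where x: "\<forall>n. x n \<in> range qs" "x \<longlonglongrightarrow> q" by (elim exE conjE)
    have xs: "x n \<in> effort_set" and xG: "drv p (x n) \<le> Gp p" for n using spec[OF x(1), of n] qs(1) n by auto
    have "(\<lambda>n. drv p (x n)) \<longlonglongrightarrow> drv p q"
      by (rule continuous_on_tendsto_compose[OF drv_continuous[OF p] x(2) q]) (simp add: xs)
    then show ?thesis by (rule LIMSEQ_le_const2) (use xG in blast)
  qed
  show "0 \<le> Gp p" using G[OF zero_effort] drv_zero[OF p] by simp
qed

text \<open>At a fixed time the essential supremum over the admissible efforts is the pointwise supremum over a
  countable dense set of constant efforts.\<close>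

lemma driver_ess_Sup_eq: "AE s in Lb. AE \<omega> in P0 D. driver_ess_Sup D R \<Theta> s \<omega> = ereal (Gp (s, \<omega>))"
  using tame_AE_state AE_space
proof eventually_elim
  case (elim s)
  have s: "s \<in> {0..TT}" using elim(2) by simp
  let ?S = "(\<lambda>u \<omega>. ereal (driver_along D R \<Theta> u s \<omega>)) ` admissible D"
  have es: "is_ess_Sup (P0 D) ?S (\<lambda>\<omega>. ereal (Gp (s, \<omega>)))"
    unfolding is_ess_Sup_def
  proof (intro conjI ballI impI)
    show "(\<lambda>\<omega>. ereal (Gp (s, \<omega>))) \<in> borel_measurable (P0 D)"
      by (intro borel_measurable_ereal measurable_compose[OF PS_section_P0[OF s] Gp_measurable])
    fix X assume "X \<in> ?S"
    then obtain u where u: "u \<in> admissible D" and X: "X = (\<lambda>\<omega>. ereal (drv (s, \<omega>) (u s \<omega>)))"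
      by (auto simp: driver_along_eq)
    show "AE \<omega> in P0 D. X \<omega> \<le> ereal (Gp (s, \<omega>))"
      using elim(1) AE_space
    proof eventually_elim
      case (elim \<omega>)
      have "u s \<omega> \<in> effort_set" using u s elim(2) by (auto simp: admissible_def effort_set_def)
      then show ?case using Gp(2)[of "(s, \<omega>)"] s elim by (simp add: X space_PS)
    qed
  next
    fix h assume h: "\<forall>X\<in>?S. AE \<omega> in P0 D. X \<omega> \<le> h \<omega>"
    have "AE \<omega> in P0 D. ereal (drv (s, \<omega>) (qs n)) \<le> h \<omega>" for n
      using bspec[OF h imageI[OF effort_admissible[OF effort_const[OF qs(1)[of n]]]]] by (simp add: driver_along_eq)
    then have "AE \<omega> in P0 D. \<forall>n. ereal (drv (s, \<omega>) (qs n)) \<le> h \<omega>" by (simp add: AE_all_countable)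
    then show "AE \<omega> in P0 D. ereal (Gp (s, \<omega>)) \<le> h \<omega>"
      using elim(1) AE_space
    proof eventually_elim
      case (elim \<omega>)
      have "(s, \<omega>) \<in> space PS" using s elim(3) by (simp add: space_PS)
      from Gp(1)[OF this elim(2), symmetric] show ?case using elim(1) by (simp add: SUP_least)
    qed
  qed
  then have "is_ess_Sup (P0 D) ?S (ess_Sup (P0 D) ?S)" unfolding ess_Sup_def by (rule someI[of "is_ess_Sup (P0 D) ?S"])
  from is_ess_Sup_unique[OF this es] show ?case unfolding driver_ess_Sup_def .
qed

end

section \<open>The solution of the backward equation along the paths\<close>

context bsde_model
begin

definition cth :: "real \<times> 'a \<Rightarrow> real" where "cth p = (\<integral>z. th (p, z) * lam p \<partial>claim_law D)"

text \<open>The three integrals over \<open>(s,T]\<close> in the backward equation: \<open>\<Theta>\<close> against the jump measure, \<open>\<Theta>\<close> against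
  its compensator, and the maximal driver.\<close>

definition jump_part :: "real \<Rightarrow> 'a \<Rightarrow> real" where
  "jump_part s \<omega> = (\<integral>i. (if s < tau i \<omega> then th (mark i \<omega>) else 0) \<partial>count_space (jumps \<omega>))"

definition comp_part :: "real \<Rightarrow> 'a \<Rightarrow> real" where
  "comp_part s \<omega> = (\<integral>v. indicator {s<..} v * cth (v, \<omega>) \<partial>Lb)"

definition gain_part :: "real \<Rightarrow> 'a \<Rightarrow> real" where
  "gain_part s \<omega> = (\<integral>v. indicator {s<..} v * Gp (v, \<omega>) \<partial>Lb)"

definition fine_path :: "'a \<Rightarrow> bool" where
  "fine_path \<omega> \<longleftrightarrow> regular \<omega> \<and> integrable (Lb \<Otimes>\<^sub>M claim_law D) (\<lambda>y. th ((fst y, \<omega>), snd y) * lam (fst y, \<omega>)) \<and>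
    integrable Lb (\<lambda>s. cth (s, \<omega>)) \<and> integrable Lb (\<lambda>s. Gp (s, \<omega>)) \<and> (AE s in Lb. tame_at (s, \<omega>))"

lemma th_lam_measurable: "(\<lambda>x. th x * lam (fst x)) \<in> borel_measurable PF"
  by (intro borel_measurable_times th_measurable process_field[OF lam_predictable])

lemma cth_measurable: "cth \<in> borel_measurable PS"
  unfolding cth_def[abs_def] using mark_integral_predictable[OF th_lam_measurable] by simp

lemma weighted_th_integrable:
  "integrable NU (\<lambda>x. exp (Lam (fst x)) * \<bar>th ((fst (snd x), fst x), snd (snd x))\<bar> * lam (fst (snd x), fst x))"
proof (rule dominated_NU[OF _ weighted_field_finite(1)[OF th_measurable th_square]])
  show "(\<lambda>x. exp (Lam (fst x)) * \<bar>th ((fst (snd x), fst x), snd (snd x))\<bar> * lam (fst (snd x), fst x)) \<in> borel_measurable NU"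
    by (intro borel_measurable_times borel_measurable_abs NU_measurable[OF th_measurable] NU_process_measurable[OF lam_predictable]
        measurable_compose[OF measurable_compose[OF measurable_fst Lam_measurable] borel_measurable_exp])
  show "AE x in NU. ennreal \<bar>exp (Lam (fst x)) * \<bar>th ((fst (snd x), fst x), snd (snd x))\<bar> * lam (fst (snd x), fst x)\<bar>
      \<le> ennreal (exp (Lam (fst x)) * \<bar>th ((fst (snd x), fst x), snd (snd x))\<bar> * lam (fst (snd x), fst x))"
  proof (rule AE_I2)
    fix x assume "x \<in> space NU"
    from NU_lam_pos[OF this] show "ennreal \<bar>exp (Lam (fst x)) * \<bar>th ((fst (snd x), fst x), snd (snd x))\<bar> * lam (fst (snd x), fst x)\<bar>
      \<le> ennreal (exp (Lam (fst x)) * \<bar>th ((fst (snd x), fst x), snd (snd x))\<bar> * lam (fst (snd x), fst x))"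
      by (simp add: abs_mult)
  qed
qed

lemma th_lam_integrable: "integrable NU (\<lambda>x. th ((fst (snd x), fst x), snd (snd x)) * lam (fst (snd x), fst x))"
proof (rule Bochner_Integration.integrable_bound[OF weighted_th_integrable])
  show "(\<lambda>x. th ((fst (snd x), fst x), snd (snd x)) * lam (fst (snd x), fst x)) \<in> borel_measurable NU"
    by (intro borel_measurable_times NU_measurable[OF th_measurable] NU_process_measurable[OF lam_predictable])
  show "AE x in NU. norm (th ((fst (snd x), fst x), snd (snd x)) * lam (fst (snd x), fst x))
      \<le> norm (exp (Lam (fst x)) * \<bar>th ((fst (snd x), fst x), snd (snd x))\<bar> * lam (fst (snd x), fst x))"
  proof (rule AE_I2)
    fix x assume x: "x \<in> space NU"
    then have "1 \<le> exp (Lam (fst x))" using Lam_nonneg[of "fst x"] by (auto simp: space_NU)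
    then have "1 * \<bar>th ((fst (snd x), fst x), snd (snd x)) * lam (fst (snd x), fst x)\<bar>
        \<le> exp (Lam (fst x)) * \<bar>th ((fst (snd x), fst x), snd (snd x)) * lam (fst (snd x), fst x)\<bar>"
      by (intro mult_right_mono) auto
    then show "norm (th ((fst (snd x), fst x), snd (snd x)) * lam (fst (snd x), fst x))
      \<le> norm (exp (Lam (fst x)) * \<bar>th ((fst (snd x), fst x), snd (snd x))\<bar> * lam (fst (snd x), fst x))"
      by (simp add: abs_mult mult.assoc)
  qed
qed

lemma indicator_Lb: "(indicator {s<..} :: real \<Rightarrow> real) \<in> borel_measurable Lb"
proof -
  have "(indicator {s<..} :: real \<Rightarrow> real) \<in> borel_measurable borel" by simp
  from measurable_compose[OF Lb_id_measurable this] show ?thesis .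
qed

text \<open>The version \<open>G\<close> of the essential supremum in the backward equation is identified with the pointwise
  maximum: they agree almost surely at almost every time, and by Fubini almost surely at almost every time of
  the path.\<close>

lemma bsde_paths:
  shows fine_path_AE: "AE \<omega> in P0 D. fine_path \<omega>"
    and bsde_at: "\<And>s. s \<in> {0..TT} \<Longrightarrow> AE \<omega> in P0 D.
      R s \<omega> + M s \<omega> = Xi \<omega> + M TT \<omega> - jump_part s \<omega> + comp_part s \<omega> - gain_part s \<omega>"
proof -
  obtain G :: "real \<Rightarrow> 'a \<Rightarrow> real" where
    Gm: "(\<lambda>(s, \<omega>). G s \<omega>) \<in> borel_measurable (restrict_space borel {0..TT} \<Otimes>\<^sub>M P0 D)"
    and Gess: "AE s in lborel. s \<in> {0..TT} \<longrightarrow> (AE \<omega> in P0 D. ereal (G s \<omega>) = driver_ess_Sup D R \<Theta> s \<omega>)"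
    and Gint: "AE \<omega> in P0 D. set_integrable lborel {0..TT} (\<lambda>s. G s \<omega>)"
    and Geq: "\<And>s. s \<in> {0..TT} \<Longrightarrow> AE \<omega> in P0 D. R s \<omega> = terminal D \<omega> - compensated_int D \<Theta> s TT \<omega>
             - (LINT v:{s..TT}|lborel. G v \<omega>) + M TT \<omega> - M s \<omega>"
    using bsde unfolding bsde_solution_def by blast
  have "(\<lambda>s. s) \<in> Lb \<rightarrow>\<^sub>M restrict_space borel {0..TT}"
    using Lb_id_measurable by (intro measurable_restrict_space2) auto
  then have "(\<lambda>p. (fst p, snd p)) \<in> Lb \<Otimes>\<^sub>M P0 D \<rightarrow>\<^sub>M restrict_space borel {0..TT} \<Otimes>\<^sub>M P0 D"
    by (intro measurable_Pair measurable_snd measurable_compose[OF measurable_fst])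
  from measurable_compose[OF this Gm]
  have Gj: "(\<lambda>p. G (fst p) (snd p)) \<in> borel_measurable (Lb \<Otimes>\<^sub>M P0 D)" by simp
  have Gpj: "(\<lambda>p. Gp p) \<in> borel_measurable (Lb \<Otimes>\<^sub>M P0 D)" using measurable_compose[OF PS_joint Gp_measurable] by simp
  have "AE s in Lb. AE \<omega> in P0 D. ereal (G s \<omega>) = driver_ess_Sup D R \<Theta> s \<omega>"
    unfolding AE_Lb_iff using Gess by eventually_elim auto
  with driver_ess_Sup_eq have sw: "AE s in Lb. AE \<omega> in P0 D. G s \<omega> = Gp (s, \<omega>)"
  proof eventually_elim
    case (elim s)
    from elim show ?case by eventually_elim simp
  qed
  have "{x \<in> space (Lb \<Otimes>\<^sub>M P0 D). G (fst x) (snd x) = Gp x} \<in> sets (Lb \<Otimes>\<^sub>M P0 D)"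
    by (rule borel_measurable_eq[OF Gj Gpj])
  then have GG: "AE \<omega> in P0 D. AE s in Lb. G s \<omega> = Gp (s, \<omega>)"
    using pair_sigma_finite.AE_commute[OF pairs_sigma_finite(4), of "\<lambda>s \<omega>. G s \<omega> = Gp (s, \<omega>)"] sw by simp
  have Gsec: "(\<lambda>s. G s \<omega>) \<in> borel_measurable Lb" if "\<omega> \<in> \<Omega>" for \<omega>
    using measurable_compose[OF measurable_Pair2'[OF that] Gj] by simp
  note Gpsec = process_section[OF Gp_measurable]
  show ok: "AE \<omega> in P0 D. fine_path \<omega>"
    using regular_AE NU_AE_section[OF th_lam_integrable] tame_AE_time GG Gint
  proof eventually_elim
    case (elim \<omega>)
    have \<omega>: "\<omega> \<in> \<Omega>" using elim(1) by (simp add: regular_def)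
    have i1: "integrable (Lb \<Otimes>\<^sub>M claim_law D) (\<lambda>y. th ((fst y, \<omega>), snd y) * lam (fst y, \<omega>))" using elim(2) by simp
    have i2: "integrable Lb (\<lambda>s. cth (s, \<omega>))" using LF_integrable_fst[OF i1] by (simp add: cth_def)
    have "set_integrable lborel {0<..TT} (\<lambda>s. G s \<omega>)" using elim(5) by (rule set_integrable_subset) auto
    then have "integrable Lb (\<lambda>s. G s \<omega>)" unfolding Lb_def by (subst integrable_restrict_space) (simp_all add: set_integrable_def)
    then have i3: "integrable Lb (\<lambda>s. Gp (s, \<omega>))"
      by (rule integrable_cong_AE[THEN iffD1, rotated 3]) (use Gsec[OF \<omega>] Gpsec[OF \<omega>] elim(4) in simp_all)
    show ?case unfolding fine_path_def using elim(1,3) i1 i2 i3 by blast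
  qed
  fix s assume s: "s \<in> {0..TT}"
  show "AE \<omega> in P0 D. R s \<omega> + M s \<omega> = Xi \<omega> + M TT \<omega> - jump_part s \<omega> + comp_part s \<omega> - gain_part s \<omega>"
    using ok GG Geq[OF s]
  proof eventually_elim
    case (elim \<omega>)
    have r: "regular \<omega>" and \<omega>: "\<omega> \<in> \<Omega>" and i1: "integrable (Lb \<Otimes>\<^sub>M claim_law D) (\<lambda>y. th ((fst y, \<omega>), snd y) * lam (fst y, \<omega>))"
      using elim(1) by (auto simp: fine_path_def regular_def)
    have pos: "measure_int \<mu> s TT (\<lambda>s z. \<Theta> s z \<omega>) = measure_int \<mu> s TT (\<lambda>s z. th ((s, \<omega>), z))" for \<mu> :: "(real \<times> real) measure"
      unfolding measure_int_def set_lebesgue_integral_def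
      by (intro Bochner_Integration.integral_cong refl) (auto simp: th_def split: split_indicator)
    have s0: "0 \<le> s" using s by simp
    have j: "measure_int (jump_measure D \<omega>) s TT (\<lambda>s z. th ((s, \<omega>), z)) = jump_part s \<omega>"
      unfolding measure_int_jump[OF \<omega> th_measurable s0 order_refl] jump_part_def
      by (rule Bochner_Integration.integral_cong[OF refl]) (use jumps_tau[OF \<omega>] in auto)
    have c: "measure_int (compensator D \<omega>) s TT (\<lambda>s z. th ((s, \<omega>), z)) = comp_part s \<omega>"
    proof -
      let ?f = "\<lambda>p. indicator {s<..TT} (fst p) * (th ((fst p, \<omega>), snd p) * lam (fst p, \<omega>)) :: real"
      have im: "(\<lambda>p. indicator {s<..TT} (fst p) :: real) \<in> borel_measurable (Lb \<Otimes>\<^sub>M claim_law D)"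
        by (intro measurable_compose[OF measurable_compose[OF measurable_fst Lb_id_measurable]]) simp
      have "integrable (Lb \<Otimes>\<^sub>M claim_law D) ?f"
        by (rule Bochner_Integration.integrable_bound[OF i1 borel_measurable_times[OF im borel_measurable_integrable[OF i1]]])
          (auto split: split_indicator)
      from LF_Fubini[OF this, symmetric]
      have "(\<integral>p. ?f p \<partial>(Lb \<Otimes>\<^sub>M claim_law D)) = (\<integral>v. indicator {s<..TT} v * cth (v, \<omega>) \<partial>Lb)" by (simp add: cth_def)
      also have "\<dots> = comp_part s \<omega>" unfolding comp_part_def
        by (rule Bochner_Integration.integral_cong[OF refl]) (auto split: split_indicator)
      finally show ?thesis unfolding measure_int_compensator[OF \<omega> th_measurable s0 order_refl] .
    qed
    have "(LINT v:{s..TT}|lborel. G v \<omega>) = (\<integral>v. indicator {s<..} v * G v \<omega> \<partial>Lb)"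
      by (rule set_integral_Lb[OF Gsec[OF \<omega>] s0])
    also have "\<dots> = gain_part s \<omega>" unfolding gain_part_def
    proof (rule integral_cong_AE)
      have im: "(indicator {s<..} :: real \<Rightarrow> real) \<in> borel_measurable Lb" by (rule indicator_Lb)
      show "(\<lambda>v. indicator {s<..} v * G v \<omega>) \<in> borel_measurable Lb" "(\<lambda>v. indicator {s<..} v * Gp (v, \<omega>)) \<in> borel_measurable Lb"
        by (rule borel_measurable_times[OF im Gsec[OF \<omega>]], rule borel_measurable_times[OF im Gpsec[OF \<omega>]])
      show "AE v in Lb. indicator {s<..} v * G v \<omega> = indicator {s<..} v * Gp (v, \<omega>)" using elim(2) by eventually_elim simp
    qed
    finally have g: "(LINT v:{s..TT}|lborel. G v \<omega>) = gain_part s \<omega>" .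
    show ?case using elim(3) unfolding compensated_int_def pos j c g terminal_Xi[OF \<omega>] by linarith
  qed
qed

lemma RM_adapted: "s \<in> {0..TT} \<Longrightarrow> R s \<in> borel_measurable (FF s)" "s \<in> {0..TT} \<Longrightarrow> M s \<in> borel_measurable (FF s)"
  and M_cadlag: "cadlag (P0 D) TT M"
  and M_square: "s \<in> {0..TT} \<Longrightarrow> integrable (P0 D) (\<lambda>\<omega>. (M s \<omega>)\<^sup>2)"
  and M_integrable: "s \<in> {0..TT} \<Longrightarrow> integrable (P0 D) (M s)"
  using R(1) M by (auto simp: adapted_def L_perp_def martingale_def)

lemma M_test:
  assumes t: "t \<in> {0..TT}" and A: "A \<in> sets (FF t)"
  shows "(\<integral>\<omega>. indicator A \<omega> * M TT \<omega> \<partial>P0 D) = (\<integral>\<omega>. indicator A \<omega> * M t \<omega> \<partial>P0 D)"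
proof -
  interpret S: finite_measure_subalgebra "P0 D" "FF t" by unfold_locales (rule subalg[OF t])
  have A0: "A \<in> sets (P0 D)" by (rule subalg_sets[OF t A])
  have i: "integrable (P0 D) (\<lambda>\<omega>. indicator A \<omega> * M TT \<omega>)" using integrable_mult_indicator[OF A0 M_integrable[OF TT_in]] by simp
  have "(\<integral>\<omega>. indicator A \<omega> * M TT \<omega> \<partial>P0 D) = (\<integral>\<omega>. indicator A \<omega> * real_cond_exp (P0 D) (FF t) (M TT) \<omega> \<partial>P0 D)"
    by (rule S.real_cond_exp_intg(2)[OF i, symmetric]) (use A M_integrable[OF TT_in] in simp_all)
  also have "\<dots> = (\<integral>\<omega>. indicator A \<omega> * M t \<omega> \<partial>P0 D)"
  proof (rule integral_cong_AE)
    show "(\<lambda>\<omega>. indicator A \<omega> * real_cond_exp (P0 D) (FF t) (M TT) \<omega>) \<in> borel_measurable (P0 D)"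
      using A0 by (intro borel_measurable_times borel_measurable_indicator from_F_measurable[OF t borel_measurable_cond_exp])
    show "(\<lambda>\<omega>. indicator A \<omega> * M t \<omega>) \<in> borel_measurable (P0 D)" using A0 M_integrable[OF t] by simp
    have "AE \<omega> in P0 D. real_cond_exp (P0 D) (FF t) (M TT) \<omega> = M t \<omega>"
      using M t by (simp add: L_perp_def martingale_def)
    then show "AE \<omega> in P0 D. indicator A \<omega> * real_cond_exp (P0 D) (FF t) (M TT) \<omega> = indicator A \<omega> * M t \<omega>"
      by eventually_elim simp
  qed
  finally show ?thesis .
qed

definition aft :: "real \<Rightarrow> real \<Rightarrow> real" where "aft t s = (if t < s then 1 else 0)"

lemma aft_eq_indicator: "aft t = indicator {t<..}"
  by (simp add: fun_eq_iff aft_def indicator_def)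

lemma aft_measurable: "t \<in> {0..TT} \<Longrightarrow> (\<lambda>p. aft t (fst p)) \<in> borel_measurable PS"
  unfolding aft_def[abs_def] using PS_after[of t "\<lambda>_. 1 :: real" borel 0] by simp

text \<open>Between \<open>t\<close> and \<open>s\<close> the process \<open>R + M\<close> is of finite variation. A claim happens at a fixed time with
  probability zero, so the sums over the claims before \<open>s\<close> and up to \<open>s\<close> agree almost surely.\<close>

lemma RM_path:
  assumes t: "t \<in> {0..TT}"
  shows "AE \<omega> in P0 D. AE s in Lb. t < s \<longrightarrow> R s \<omega> + M s \<omega> = R t \<omega> + M t \<omega>
    + Lb.cumul (\<lambda>v. aft t v * Gp (v, \<omega>) - aft t v * cth (v, \<omega>)) s
    + (\<integral>i. (if tau i \<omega> < s then aft t (fst (fst (mark i \<omega>))) * th (mark i \<omega>) else 0) \<partial>count_space (jumps \<omega>))"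
proof -
  define Q where "Q p = (if t < fst p then R t (snd p) + M t (snd p) else 0)
    + Lb.cumul (\<lambda>v. (\<lambda>p. aft t (fst p) * Gp p - aft t (fst p) * cth p) (v, snd p)) (fst p)
    + (\<integral>i. (if tau i (snd p) < fst p then (\<lambda>x. aft t (fst (fst x)) * th x) (mark i (snd p)) else 0) \<partial>count_space (jumps (snd p)))" for p
  have am: "(\<lambda>p. aft t (fst p)) \<in> borel_measurable PS" by (rule aft_measurable[OF t])
  have RMt: "(\<lambda>\<omega>. R t \<omega> + M t \<omega>) \<in> borel_measurable (FF t)" using RM_adapted t by simp
  have Qm: "Q \<in> borel_measurable PS"
    unfolding Q_def[abs_def]
    by (intro borel_measurable_add PS_after[OF t RMt] time_integral_predictable_real jump_sum_before_predictable_real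
        borel_measurable_diff borel_measurable_times am Gp_measurable cth_measurable process_field[OF am] th_measurable) simp
  have Qj: "(\<lambda>p. Q p) \<in> borel_measurable (Lb \<Otimes>\<^sub>M P0 D)" using measurable_compose[OF PS_joint Qm] by simp
  have RP: "R s \<in> borel_measurable (P0 D)" "M s \<in> borel_measurable (P0 D)" if "s \<in> {0..TT}" for s
    using from_F_measurable[OF that RM_adapted(1)[OF that]] from_F_measurable[OF that RM_adapted(2)[OF that]] by auto
  have RMj: "(\<lambda>p. R (fst p) (snd p) + M (fst p) (snd p)) \<in> borel_measurable (Lb \<Otimes>\<^sub>M P0 D)"
    by (intro borel_measurable_add cadlag_jointly_measurable R(2) M_cadlag RP)
  have fj: "(\<lambda>p. fst p) \<in> borel_measurable (Lb \<Otimes>\<^sub>M P0 D)" by (rule measurable_compose[OF measurable_fst Lb_id_measurable])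
  have nj: "AE s in Lb. AE \<omega> in P0 D. \<forall>i. claim_time D i \<omega> \<noteq> ereal s"
  proof -
    have "AE s in Lb. \<forall>i. claim_time D i \<omega> \<noteq> ereal s" for \<omega>
    proof -
      have "countable {s. \<exists>i. claim_time D i \<omega> = ereal s}"
        by (rule countable_subset[of _ "range (\<lambda>i. real_of_ereal (claim_time D i \<omega>))"]) (auto simp: image_iff, metis real_of_ereal.simps(1))
      then show ?thesis unfolding AE_Lb_iff by (intro AE_I'[OF countable_imp_null_set_lborel]) auto
    qed
    then have 1: "AE \<omega> in P0 D. AE s in Lb. \<forall>i. claim_time D i \<omega> \<noteq> ereal s" by simp
    have "{x \<in> space (Lb \<Otimes>\<^sub>M P0 D). claim_time D i (snd x) = ereal (fst x)} \<in> sets (Lb \<Otimes>\<^sub>M P0 D)" for i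
      by (rule measurable_equality_set[OF measurable_compose[OF measurable_snd claim_time_meas] borel_measurable_ereal[OF fj]])
    then have "{x \<in> space (Lb \<Otimes>\<^sub>M P0 D). \<forall>i. claim_time D i (snd x) \<noteq> ereal (fst x)} \<in> sets (Lb \<Otimes>\<^sub>M P0 D)"
      by (intro sets.sets_Collect_countable_All sets.sets_Collect_neg)
    then show ?thesis
      using pair_sigma_finite.AE_commute[OF pairs_sigma_finite(4), of "\<lambda>s \<omega>. \<forall>i. claim_time D i \<omega> \<noteq> ereal s"] 1 by simp
  qed
  have "AE s in Lb. AE \<omega> in P0 D. t < s \<longrightarrow> R s \<omega> + M s \<omega> = Q (s, \<omega>)"
    using nj AE_space
  proof eventually_elim
    case (elim s)
    have s: "s \<in> {0..TT}" using elim(2) by simp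
    show ?case using elim(1) fine_path_AE bsde_at[OF t] bsde_at[OF s]
    proof eventually_elim
      case (elim \<omega>)
      show ?case
      proof
        assume ts: "t < s"
        have f: "finite (jumps \<omega>)" and \<omega>: "\<omega> \<in> \<Omega>" and iG: "integrable Lb (\<lambda>v. Gp (v, \<omega>))" and iC: "integrable Lb (\<lambda>v. cth (v, \<omega>))"
          using elim(2) by (auto simp: fine_path_def regular_def)
        have ne: "tau i \<omega> \<noteq> s" if "i \<in> jumps \<omega>" for i
          using tau(1)[OF \<omega>, of i TT] that elim(1) by (auto simp: jumps_def)
        have sub: "integrable Lb (\<lambda>v. indicator {q<..} v * h v)" if "integrable Lb h" for h :: "real \<Rightarrow> real" and q
        proof (rule Bochner_Integration.integrable_bound[OF that])
          have "(indicator {q<..} :: real \<Rightarrow> real) \<in> borel_measurable Lb" by (rule indicator_Lb)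
          then show "(\<lambda>v. indicator {q<..} v * h v) \<in> borel_measurable Lb" using borel_measurable_integrable[OF that] by simp
        qed (auto split: split_indicator)
        have "gain_part t \<omega> - gain_part s \<omega> - (comp_part t \<omega> - comp_part s \<omega>) =
            (\<integral>v. (indicator {t<..} v * Gp (v, \<omega>) - indicator {s<..} v * Gp (v, \<omega>)) - (indicator {t<..} v * cth (v, \<omega>) - indicator {s<..} v * cth (v, \<omega>)) \<partial>Lb)"
          unfolding gain_part_def comp_part_def using sub[OF iG] sub[OF iC] by simp
        also have "\<dots> = Lb.cumul (\<lambda>v. (\<lambda>p. aft t (fst p) * Gp p - aft t (fst p) * cth p) (v, \<omega>)) s"
          unfolding Lb.cumul_def using ts by (intro Bochner_Integration.integral_cong refl) (auto simp: aft_def split: split_indicator)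
        finally have 1: "gain_part t \<omega> - gain_part s \<omega> - (comp_part t \<omega> - comp_part s \<omega>) =
            Lb.cumul (\<lambda>v. (\<lambda>p. aft t (fst p) * Gp p - aft t (fst p) * cth p) (v, \<omega>)) s" .
        have "jump_part t \<omega> - jump_part s \<omega> =
            (\<integral>i. (if tau i \<omega> < s then (\<lambda>x. aft t (fst (fst x)) * th x) (mark i \<omega>) else 0) \<partial>count_space (jumps \<omega>))"
          unfolding jump_part_def jump_integral_finite[OF f] sum_subtractf[symmetric]
        proof (rule sum.cong[OF refl])
          fix i assume "i \<in> jumps \<omega>"
          from ne[OF this] ts show "(if t < tau i \<omega> then th (mark i \<omega>) else 0) - (if s < tau i \<omega> then th (mark i \<omega>) else 0) =
              (if tau i \<omega> < s then (\<lambda>x. aft t (fst (fst x)) * th x) (mark i \<omega>) else 0)"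
            by (simp add: aft_def mark_def)
        qed
        then show "R s \<omega> + M s \<omega> = Q (s, \<omega>)"
          using elim(3,4) 1 ts unfolding Q_def fst_conv snd_conv by simp
      qed
    qed
  qed
  moreover have "{x \<in> space (Lb \<Otimes>\<^sub>M P0 D). t < fst x \<longrightarrow> R (fst x) (snd x) + M (fst x) (snd x) = Q x} \<in> sets (Lb \<Otimes>\<^sub>M P0 D)"
    by (intro sets.sets_Collect_imp borel_measurable_eq[OF RMj Qj] borel_measurable_less[OF borel_measurable_const fj])
  ultimately have "AE \<omega> in P0 D. AE s in Lb. t < s \<longrightarrow> R s \<omega> + M s \<omega> = Q (s, \<omega>)"
    using pair_sigma_finite.AE_commute[OF pairs_sigma_finite(4), of "\<lambda>s \<omega>. t < s \<longrightarrow> R s \<omega> + M s \<omega> = Q (s, \<omega>)"] by simp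
  then show ?thesis
  proof eventually_elim
    case (elim \<omega>)
    then show ?case
    proof eventually_elim
      case (elim s)
      show ?case
      proof
        assume ts: "t < s"
        show "R s \<omega> + M s \<omega> = R t \<omega> + M t \<omega> + Lb.cumul (\<lambda>v. aft t v * Gp (v, \<omega>) - aft t v * cth (v, \<omega>)) s
          + (\<integral>i. (if tau i \<omega> < s then aft t (fst (fst (mark i \<omega>))) * th (mark i \<omega>) else 0) \<partial>count_space (jumps \<omega>))"
          using mp[OF elim ts] ts unfolding Q_def fst_conv snd_conv by simp
      qed
    qed
  qed
qed

section \<open>Verification\<close>

definition Kme :: "(real \<times> 'a \<Rightarrow> real \<times> real) \<Rightarrow> real \<times> 'a \<Rightarrow> real" where
  "Kme v = multiplicative.Km D (eff_a v) (eff_ell v)"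

text \<open>The integrated shortfall of the driver at \<open>v\<close> from its maximum, weighted with \<open>K\<close>: what is lost on \<open>A\<close>
  after \<open>t\<close> by using \<open>v\<close>.\<close>

definition gain :: "(real \<times> 'a \<Rightarrow> real \<times> real) \<Rightarrow> real \<Rightarrow> 'a set \<Rightarrow> 'a \<Rightarrow> real" where
  "gain v t A \<omega> = (\<integral>s. indicator A \<omega> * aft t s * (Kme v (s, \<omega>) * (Gp (s, \<omega>) - drv (s, \<omega>) (v (s, \<omega>)))) \<partial>Lb)"

text \<open>The drift of \<open>K R\<close>: the part that \<open>R\<close> contributes and the part that \<open>K\<close> contributes add up to the
  shortfall of the driver at \<open>v\<close> from its maximum.\<close>

lemma drift_identity:
  assumes v: "effort v" and p: "p \<in> space PS" "tame_at p"
  shows "(\<integral>z. Gp p + th (p, z) * lam p * (exp (- eff_ell v (p, z)) - 1) + Rm p * (eff_a v p + lam p * (exp (- eff_ell v (p, z)) - 1)) \<partial>claim_law D)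
    = Gp p - drv p (v p)"
proof -
  have q: "v p \<in> effort_set" using v p(1) by (simp add: effort_def)
  have k: "exp (- eff_ell v (p, z)) = \<gamma>1 D (fst (v p)) * jmp (fst p) (v p) z" for z
    using effort_bounds(1)[OF q] by (simp add: eff_ell_def jmp_def exp_diff exp_minus divide_simps)
  have e: "Gp p + th (p, z) * lam p * (exp (- eff_ell v (p, z)) - 1) + Rm p * (eff_a v p + lam p * (exp (- eff_ell v (p, z)) - 1)) =
      (Gp p + Rm p * eff_a v p - Rm p * lam p) + (\<gamma>1 D (fst (v p)) * lam p) * ((th (p, z) + Rm p) * jmp (fst p) (v p) z) - lam p * th (p, z)" for z
    unfolding k by (simp add: algebra_simps)
  have i1: "integrable (claim_law D) (\<lambda>z. (\<gamma>1 D (fst (v p)) * lam p) * ((th (p, z) + Rm p) * jmp (fst p) (v p) z))"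
    using jmp_integrable[OF p q] by simp
  have i2: "integrable (claim_law D) (\<lambda>z. lam p * th (p, z))" using p(2) by (simp add: tame_at_def)
  have "(\<integral>z. Gp p + th (p, z) * lam p * (exp (- eff_ell v (p, z)) - 1) + Rm p * (eff_a v p + lam p * (exp (- eff_ell v (p, z)) - 1)) \<partial>claim_law D) =
      (Gp p + Rm p * eff_a v p - Rm p * lam p) + (\<gamma>1 D (fst (v p)) * lam p) * (\<integral>z. (th (p, z) + Rm p) * jmp (fst p) (v p) z \<partial>claim_law D)
      - lam p * (\<integral>z. th (p, z) \<partial>claim_law D)"
    unfolding e using i1 i2 FL.prob_space
    by (subst Bochner_Integration.integral_diff, simp_all add: Bochner_Integration.integral_add)
  then show ?thesis
    unfolding drv_eq[OF p q] by (simp add: eff_a_def algebra_simps)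
qed

text \<open>The martingale part is removed by subtracting the identity for \<open>M\<close> alone from the one for \<open>R + M\<close>. The
  maximal driver is not assumed to be integrable against \<open>exp \<Lambda>\<close>. This follows from the backward equation itself: the
  driver is nonnegative, because the null effort gives it the value zero, and its pathwise integral is
  expressed by the other terms, all of which have enough moments on \<open>A\<close>.\<close>

lemma verification:
  assumes v: "effort v" and t: "t \<in> {0..TT}" and v0: "\<And>s \<omega>. s \<le> t \<Longrightarrow> v (s, \<omega>) = (0, 0)"
    and A: "A \<in> sets (FF t)" and k: "\<And>\<omega>. \<omega> \<in> A \<Longrightarrow> \<bar>R t \<omega>\<bar> \<le> k \<and> \<bar>M t \<omega>\<bar> \<le> k" and k0: "0 \<le> k"
  shows "integrable (P0 D) (gain v t A)"
    and "(\<integral>\<omega>. indicator A \<omega> * (Xi \<omega> * KTe v \<omega>) \<partial>P0 D) = (\<integral>\<omega>. indicator A \<omega> * R t \<omega> \<partial>P0 D) + (\<integral>\<omega>. gain v t A \<omega> \<partial>P0 D)"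
proof -
  let ?W = "indicator A :: 'a \<Rightarrow> real"
  let ?p = "\<lambda>x::'a \<times> real \<times> real. (fst (snd x), fst x)"
  let ?n = "\<lambda>x::'a \<times> real \<times> real. ((fst (snd x), fst x), snd (snd x))"
  interpret w: weighted_multiplicative D "eff_a v" "eff_ell v" eff_C t ?W by (rule effort_weighted[OF v t A v0])
  define \<Theta>c where "\<Theta>c x = aft t (fst (fst x)) * th x" for x
  define g where "g p = aft t (fst p) * Gp p" for p
  define b where "b \<omega> = R t \<omega> + M t \<omega>" for \<omega>
  have A0: "A \<in> sets (P0 D)" by (rule subalg_sets[OF t A])
  have am: "(\<lambda>p. aft t (fst p)) \<in> borel_measurable PS" by (rule aft_measurable[OF t])
  have \<Theta>m: "\<Theta>c \<in> borel_measurable PF" unfolding \<Theta>c_def[abs_def] by (intro borel_measurable_times process_field[OF am] th_measurable)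
  have gm: "g \<in> borel_measurable PS" unfolding g_def[abs_def] by (intro borel_measurable_times am Gp_measurable)
  have bm: "b \<in> borel_measurable (FF t)" unfolding b_def[abs_def] using RM_adapted t by simp
  have bk: "\<bar>?W \<omega> * b \<omega>\<bar> \<le> 2 * k" for \<omega> using k[of \<omega>] k0 by (auto simp: b_def split: split_indicator)
  have \<Theta>fin: "(\<integral>\<^sup>+x. ennreal ((\<Theta>c (?n x))\<^sup>2 * lam (?p x)) \<partial>NU) < \<infinity>"
  proof (rule le_less_trans[OF nn_integral_mono th_square])
    fix x assume "x \<in> space NU"
    from NU_lam_pos[OF this] show "ennreal ((\<Theta>c (?n x))\<^sup>2 * lam (?p x)) \<le> ennreal ((th (?n x))\<^sup>2 * lam (?p x))"
      by (intro ennreal_leI) (simp add: \<Theta>c_def aft_def)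
  qed
  have thc: "(\<integral>z. \<Theta>c (p, z) * lam p \<partial>claim_law D) = aft t (fst p) * cth p" for p
    by (simp add: \<Theta>c_def cth_def mult.assoc)
  have MTm: "M TT \<in> borel_measurable (P0 D)" using M_integrable[OF TT_in] by simp
  have Xm: "Xi \<in> borel_measurable (P0 D)" by (rule from_F_measurable[OF TT_in Xi_measurable])
  define J where "J \<omega> = (\<integral>i. \<bar>th (mark i \<omega>)\<bar> \<partial>count_space (jumps \<omega>))" for \<omega>
  define Cc where "Cc \<omega> = (\<integral>y. (\<lambda>x. exp (Lam (fst x)) * \<bar>th (?n x)\<bar> * lam (?p x)) (\<omega>, y) \<partial>(Lb \<Otimes>\<^sub>M claim_law D))" for \<omega>
  define V where "V \<omega> = exp (Lam \<omega>) * Xi \<omega> + exp (Lam \<omega>) * \<bar>M TT \<omega>\<bar> + exp (Lam \<omega>) * J \<omega> + Cc \<omega> + 2 * k * (exp (Lam \<omega>) * 1)" for \<omega>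
  have "integrable (P0 D) (\<lambda>\<omega>. exp (Lam \<omega>) * J \<omega>)"
  proof (rule integrableI_bounded)
    have thab: "(\<lambda>x. \<bar>th x\<bar>) \<in> borel_measurable PF" by (intro borel_measurable_abs th_measurable)
    have "J \<in> borel_measurable (P0 D)" unfolding J_def[abs_def] by (rule from_F_measurable[OF TT_in jump_integral_measurable[OF thab]])
    then show "(\<lambda>\<omega>. exp (Lam \<omega>) * J \<omega>) \<in> borel_measurable (P0 D)" by simp
    have "(\<integral>\<^sup>+\<omega>. ennreal (norm (exp (Lam \<omega>) * J \<omega>)) \<partial>P0 D) = (\<integral>\<^sup>+\<omega>. ennreal (exp (Lam \<omega>) * (\<Sum>i\<in>jumps \<omega>. \<bar>th (mark i \<omega>)\<bar>)) \<partial>P0 D)"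
    proof (rule nn_integral_cong_AE)
      show "AE \<omega> in P0 D. ennreal (norm (exp (Lam \<omega>) * J \<omega>)) = ennreal (exp (Lam \<omega>) * (\<Sum>i\<in>jumps \<omega>. \<bar>th (mark i \<omega>)\<bar>))"
        using regular_AE by eventually_elim (simp add: J_def regular_def jump_integral_finite sum_nonneg)
    qed
    also have "\<dots> < \<infinity>" by (rule weighted_field_finite(2)[OF th_measurable th_square])
    finally show "(\<integral>\<^sup>+\<omega>. ennreal (norm (exp (Lam \<omega>) * J \<omega>)) \<partial>P0 D) < \<infinity>" .
  qed
  moreover have "integrable (P0 D) Cc" unfolding Cc_def[abs_def] by (rule NU_integrable_fst[OF weighted_th_integrable])
  moreover have "integrable (P0 D) (\<lambda>\<omega>. exp (Lam \<omega>) * \<bar>M TT \<omega>\<bar>)"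
    by (rule product_moment) (use MTm M_square[OF TT_in] in simp_all)
  moreover have "integrable (P0 D) (\<lambda>\<omega>. exp (Lam \<omega>) * Xi \<omega>)" by (rule product_moment[OF Xm Xi_square])
  moreover have "integrable (P0 D) (\<lambda>\<omega>. exp (Lam \<omega>) * 1)" by (rule product_moment) simp_all
  ultimately have Vi: "integrable (P0 D) V" unfolding V_def[abs_def] by (intro Bochner_Integration.integrable_add integrable_mult_right) auto
  have gfin: "(\<integral>\<^sup>+x. ennreal (exp (Lam (fst x))) * ennreal \<bar>w.Wp (?p x) * g (?p x)\<bar> \<partial>NU) < \<infinity>"
  proof -
    have Wgm: "(\<lambda>p. ennreal \<bar>w.Wp p * g p\<bar>) \<in> borel_measurable PS" using w.Wp_predictable gm by simp
    have "(\<integral>\<^sup>+x. ennreal (exp (Lam (fst x))) * ennreal \<bar>w.Wp (?p x) * g (?p x)\<bar> \<partial>NU) =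
        (\<integral>\<^sup>+\<omega>. ennreal (exp (Lam \<omega>)) * (\<integral>\<^sup>+s. ennreal \<bar>w.Wp (s, \<omega>) * g (s, \<omega>)\<bar> \<partial>Lb) \<partial>P0 D)"
      by (rule nn_integral_NU_weight[where W="\<lambda>\<omega>. ennreal (exp (Lam \<omega>))" and X="\<lambda>p. ennreal \<bar>w.Wp p * g p\<bar>", OF _ Wgm]) simp
    also have "\<dots> \<le> (\<integral>\<^sup>+\<omega>. ennreal (norm (V \<omega>)) \<partial>P0 D)"
    proof (rule nn_integral_mono_AE)
      show "AE \<omega> in P0 D. ennreal (exp (Lam \<omega>)) * (\<integral>\<^sup>+s. ennreal \<bar>w.Wp (s, \<omega>) * g (s, \<omega>)\<bar> \<partial>Lb) \<le> ennreal (norm (V \<omega>))"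
        using fine_path_AE bsde_at[OF t]
      proof eventually_elim
        case (elim \<omega>)
        have \<omega>: "\<omega> \<in> \<Omega>" and f: "finite (jumps \<omega>)" and iG: "integrable Lb (\<lambda>s. Gp (s, \<omega>))" and iC: "integrable Lb (\<lambda>s. cth (s, \<omega>))"
          and iL: "integrable (Lb \<Otimes>\<^sub>M claim_law D) (\<lambda>y. th ((fst y, \<omega>), snd y) * lam (fst y, \<omega>))"
          and tm: "AE s in Lb. tame_at (s, \<omega>)"
          using elim(1) by (auto simp: fine_path_def regular_def)
        have G0: "AE s in Lb. 0 \<le> Gp (s, \<omega>)"
          using tm AE_space by eventually_elim (use Gp(3) \<omega> in \<open>auto simp: space_PS\<close>)
        have tm': "(indicator {t<..} :: real \<Rightarrow> real) \<in> borel_measurable Lb" by (rule indicator_Lb)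
        have itG: "integrable Lb (\<lambda>s. indicator {t<..} s * Gp (s, \<omega>))"
          by (rule Bochner_Integration.integrable_bound[OF iG borel_measurable_times[OF tm' borel_measurable_integrable[OF iG]]])
            (auto split: split_indicator)
        have "(\<integral>\<^sup>+s. ennreal \<bar>w.Wp (s, \<omega>) * g (s, \<omega>)\<bar> \<partial>Lb) \<le> (\<integral>\<^sup>+s. ennreal (?W \<omega>) * ennreal (indicator {t<..} s * Gp (s, \<omega>)) \<partial>Lb)"
          by (rule nn_integral_mono_AE, use G0 in eventually_elim)
            (simp add: w.Wp_def g_def aft_def abs_mult ennreal_mult[symmetric] split: split_indicator)
        also have "\<dots> = ennreal (?W \<omega>) * ennreal (gain_part t \<omega>)"
          unfolding gain_part_def using borel_measurable_integrable[OF itG]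
          by (subst nn_integral_cmult, simp, subst nn_integral_eq_integral[OF itG])
            (use G0 in \<open>auto elim!: eventually_mono split: split_indicator\<close>)
        finally have 1: "(\<integral>\<^sup>+s. ennreal \<bar>w.Wp (s, \<omega>) * g (s, \<omega>)\<bar> \<partial>Lb) \<le> ennreal (?W \<omega>) * ennreal (gain_part t \<omega>)" .
        have jb: "\<bar>jump_part t \<omega>\<bar> \<le> J \<omega>"
          unfolding jump_part_def J_def jump_integral_finite[OF f] by (rule order_trans[OF sum_abs]) (auto intro!: sum_mono)
        have iLa: "integrable (Lb \<Otimes>\<^sub>M claim_law D) (\<lambda>y. \<bar>th ((fst y, \<omega>), snd y) * lam (fst y, \<omega>)\<bar>)" using iL by simp
        have cb: "exp (Lam \<omega>) * \<bar>comp_part t \<omega>\<bar> \<le> Cc \<omega>"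
        proof -
          have "\<bar>comp_part t \<omega>\<bar> \<le> (\<integral>s. \<bar>indicator {t<..} s * cth (s, \<omega>)\<bar> \<partial>Lb)" unfolding comp_part_def by (rule integral_abs_bound)
          also have "\<dots> \<le> (\<integral>s. \<bar>cth (s, \<omega>)\<bar> \<partial>Lb)"
            using iC by (intro integral_mono_AE') (auto split: split_indicator)
          also have "\<dots> \<le> (\<integral>s. (\<integral>z. \<bar>th ((s, \<omega>), z) * lam (s, \<omega>)\<bar> \<partial>claim_law D) \<partial>Lb)"
            using LF_integrable_fst[OF iLa] iC unfolding cth_def by (intro integral_mono integral_abs_bound) simp_all
          also have "\<dots> = (\<integral>y. \<bar>th ((fst y, \<omega>), snd y) * lam (fst y, \<omega>)\<bar> \<partial>(Lb \<Otimes>\<^sub>M claim_law D))"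
            using LF_Fubini[OF iLa] by simp
          finally have "exp (Lam \<omega>) * \<bar>comp_part t \<omega>\<bar> \<le> exp (Lam \<omega>) * (\<integral>y. \<bar>th ((fst y, \<omega>), snd y) * lam (fst y, \<omega>)\<bar> \<partial>(Lb \<Otimes>\<^sub>M claim_law D))"
            by (intro mult_left_mono) auto
          also have "\<dots> = Cc \<omega>"
            unfolding Cc_def integral_mult_right_zero[symmetric]
            by (rule Bochner_Integration.integral_cong[OF refl])
              (use lam_pos \<omega> in \<open>auto simp: space_pair_measure abs_mult less_imp_le abs_of_pos\<close>)
          finally show ?thesis .
        qed
        have "ennreal (?W \<omega>) * ennreal (gain_part t \<omega>) \<le> ennreal (Xi \<omega> + \<bar>M TT \<omega>\<bar> + J \<omega> + \<bar>comp_part t \<omega>\<bar> + 2 * k)"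
        proof (cases "\<omega> \<in> A")
          case True
          have "gain_part t \<omega> \<le> Xi \<omega> + \<bar>M TT \<omega>\<bar> + J \<omega> + \<bar>comp_part t \<omega>\<bar> + 2 * k"
            using elim(2) k[OF True] jb by linarith
          then show ?thesis using True by (simp add: ennreal_leI)
        qed simp
        then have "ennreal (exp (Lam \<omega>)) * (\<integral>\<^sup>+s. ennreal \<bar>w.Wp (s, \<omega>) * g (s, \<omega>)\<bar> \<partial>Lb) \<le>
            ennreal (exp (Lam \<omega>)) * ennreal (Xi \<omega> + \<bar>M TT \<omega>\<bar> + J \<omega> + \<bar>comp_part t \<omega>\<bar> + 2 * k)"
          using 1 by (intro mult_left_mono) auto
        also have "\<dots> = ennreal (exp (Lam \<omega>) * (Xi \<omega> + \<bar>M TT \<omega>\<bar> + J \<omega> + \<bar>comp_part t \<omega>\<bar> + 2 * k))"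
          using jb k0 Xi_pos[of \<omega>] by (intro ennreal_mult[symmetric]) auto
        also have "\<dots> \<le> ennreal (norm (V \<omega>))"
          using cb unfolding V_def by (intro ennreal_leI) (simp add: algebra_simps)
        finally show ?case .
      qed
    qed
    also have "\<dots> < \<infinity>" using Vi by (simp add: integrable_iff_bounded)
    finally show ?thesis .
  qed
  have \<Theta>0: "\<And>s \<omega> z. s \<le> t \<Longrightarrow> \<Theta>c ((s, \<omega>), z) = 0" by (simp add: \<Theta>c_def aft_def)
  have g0: "\<And>s \<omega>. s \<le> t \<Longrightarrow> g (s, \<omega>) = 0" by (simp add: g_def aft_def)
  define Bm where "Bm p = w.Wp p * b (snd p) + Lb.cumul (\<lambda>s. g (s, snd p) - (\<integral>z. \<Theta>c ((s, snd p), z) * lam (s, snd p) \<partial>claim_law D)) (fst p)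
    + (\<integral>i. (if tau i (snd p) < fst p then \<Theta>c (mark i (snd p)) else 0) \<partial>count_space (jumps (snd p)))" for p
  define BT where "BT \<omega> = b \<omega> + (\<integral>s. g (s, \<omega>) - (\<integral>z. \<Theta>c ((s, \<omega>), z) * lam (s, \<omega>) \<partial>claim_law D) \<partial>Lb) + (\<integral>i. \<Theta>c (mark i \<omega>) \<partial>count_space (jumps \<omega>))" for \<omega>
  define f1 where "f1 x = w.Wp (?p x) * w.Km (?p x) * (g (?p x) + \<Theta>c (?n x) * lam (?p x) * (w.kap (?n x) - 1) + Bm (?p x) * w.drift (?n x))" for x
  define f2 where "f2 x = w.Wp (?p x) * w.Km (?p x) * (M (fst (snd x)) (fst x) * w.drift (?n x))" for x
  have fv: "integrable (P0 D) (\<lambda>\<omega>. ?W \<omega> * (BT \<omega> * w.KT \<omega>))" "integrable NU (\<lambda>x. f1 x)"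
    "(\<integral>\<omega>. ?W \<omega> * (BT \<omega> * w.KT \<omega>) \<partial>P0 D) = (\<integral>\<omega>. ?W \<omega> * b \<omega> \<partial>P0 D) + (\<integral>x. f1 x \<partial>NU)"
    unfolding BT_def f1_def Bm_def
    by (rule w.finite_variation_expectation[OF \<Theta>m gm bm _ _ bk \<Theta>fin gfin]; simp add: \<Theta>0 g0)+
  note om = w.orthogonal_martingale_expectation[OF M, folded f2_def]
  have KTw: "w.KT = KTe v" by (simp add: mult_exp_KT(1)[OF v])
  have BT: "AE \<omega> in P0 D. BT \<omega> = Xi \<omega> + M TT \<omega>"
    using fine_path_AE bsde_at[OF t]
  proof eventually_elim
    case (elim \<omega>)
    have iG: "integrable Lb (\<lambda>s. Gp (s, \<omega>))" and iC: "integrable Lb (\<lambda>s. cth (s, \<omega>))" using elim(1) by (auto simp: fine_path_def)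
    have tm': "(\<lambda>s. aft t s) \<in> borel_measurable Lb" unfolding aft_eq_indicator by (rule indicator_Lb)
    have i: "integrable Lb (\<lambda>s. aft t s * h s)" if "integrable Lb h" for h :: "real \<Rightarrow> real"
      by (rule Bochner_Integration.integrable_bound[OF that borel_measurable_times[OF tm' borel_measurable_integrable[OF that]]]) (simp add: aft_def)
    have "(\<integral>s. g (s, \<omega>) - (\<integral>z. \<Theta>c ((s, \<omega>), z) * lam (s, \<omega>) \<partial>claim_law D) \<partial>Lb) = gain_part t \<omega> - comp_part t \<omega>"
    proof -
      have e: "indicator {t<..} s = aft t s" for s :: real by (simp add: aft_def)
      show ?thesis unfolding thc g_def fst_conv gain_part_def comp_part_def e by (rule Bochner_Integration.integral_diff[OF i[OF iG] i[OF iC]])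
    qed
    moreover have "(\<integral>i. \<Theta>c (mark i \<omega>) \<partial>count_space (jumps \<omega>)) = jump_part t \<omega>"
      unfolding jump_part_def by (intro Bochner_Integration.integral_cong refl) (simp add: \<Theta>c_def aft_def mark_def)
    ultimately show ?case using elim(2) unfolding BT_def b_def by linarith
  qed
  have WA: "integrable (P0 D) (\<lambda>\<omega>. ?W \<omega> * (Xi \<omega> * KTe v \<omega>))"
    using integrable_mult_indicator[OF A0 KTe_props(3)[OF v]] by simp
  have "(\<integral>\<omega>. ?W \<omega> * (BT \<omega> * w.KT \<omega>) \<partial>P0 D) = (\<integral>\<omega>. ?W \<omega> * (Xi \<omega> * KTe v \<omega>) + ?W \<omega> * (M TT \<omega> * KTe v \<omega>) \<partial>P0 D)"
  proof (rule integral_cong_AE)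
    show "(\<lambda>\<omega>. ?W \<omega> * (BT \<omega> * w.KT \<omega>)) \<in> borel_measurable (P0 D)" by (rule borel_measurable_integrable[OF fv(1)])
    show "(\<lambda>\<omega>. ?W \<omega> * (Xi \<omega> * KTe v \<omega>) + ?W \<omega> * (M TT \<omega> * KTe v \<omega>)) \<in> borel_measurable (P0 D)"
      using A0 Xm MTm KTe_props(2)[OF v] by simp
    show "AE \<omega> in P0 D. ?W \<omega> * (BT \<omega> * w.KT \<omega>) = ?W \<omega> * (Xi \<omega> * KTe v \<omega>) + ?W \<omega> * (M TT \<omega> * KTe v \<omega>)"
      using BT by eventually_elim (simp add: KTw algebra_simps)
  qed
  also have "\<dots> = (\<integral>\<omega>. ?W \<omega> * (Xi \<omega> * KTe v \<omega>) \<partial>P0 D) + (\<integral>\<omega>. ?W \<omega> * (M TT \<omega> * KTe v \<omega>) \<partial>P0 D)"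
    by (rule Bochner_Integration.integral_add[OF WA om(1)[unfolded KTw]])
  finally have e1: "(\<integral>\<omega>. ?W \<omega> * (BT \<omega> * w.KT \<omega>) \<partial>P0 D) = (\<integral>\<omega>. ?W \<omega> * (Xi \<omega> * KTe v \<omega>) \<partial>P0 D) + (\<integral>\<omega>. ?W \<omega> * (M TT \<omega> * KTe v \<omega>) \<partial>P0 D)" .
  have RtM: "R t \<in> borel_measurable (P0 D)" by (rule from_F_measurable[OF t RM_adapted(1)[OF t]])
  have WR: "integrable (P0 D) (\<lambda>\<omega>. ?W \<omega> * R t \<omega>)"
    by (rule integrable_const_bound[where B=k]) (use k k0 RtM A0 in \<open>auto split: split_indicator\<close>)
  have WM: "integrable (P0 D) (\<lambda>\<omega>. ?W \<omega> * M t \<omega>)" using integrable_mult_indicator[OF A0 M_integrable[OF t]] by simp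
  have e2: "(\<integral>\<omega>. ?W \<omega> * b \<omega> \<partial>P0 D) = (\<integral>\<omega>. ?W \<omega> * R t \<omega> \<partial>P0 D) + (\<integral>\<omega>. ?W \<omega> * M t \<omega> \<partial>P0 D)"
    unfolding b_def distrib_left by (rule Bochner_Integration.integral_add[OF WR WM])
  have f12: "integrable NU (\<lambda>x. f1 x - f2 x)" using fv(2) om(2) by (rule Bochner_Integration.integrable_diff)
  have e3: "(\<integral>\<omega>. ?W \<omega> * (Xi \<omega> * KTe v \<omega>) \<partial>P0 D) = (\<integral>\<omega>. ?W \<omega> * R t \<omega> \<partial>P0 D) + (\<integral>x. f1 x - f2 x \<partial>NU)"
    using fv(3) om(3) e1 e2 M_test[OF t A] Bochner_Integration.integral_diff[OF fv(2) om(2)] by (simp add: KTw)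
  have inner: "AE \<omega> in P0 D. (\<integral>y. f1 (\<omega>, y) - f2 (\<omega>, y) \<partial>(Lb \<Otimes>\<^sub>M claim_law D)) = gain v t A \<omega>"
    using fine_path_AE RM_path[OF t] NU_AE_section[OF f12]
  proof eventually_elim
    case (elim \<omega>)
    have \<omega>: "\<omega> \<in> \<Omega>" and tm: "AE s in Lb. tame_at (s, \<omega>)" using elim(1) by (auto simp: fine_path_def regular_def)
    have "(\<integral>y. f1 (\<omega>, y) - f2 (\<omega>, y) \<partial>(Lb \<Otimes>\<^sub>M claim_law D)) = (\<integral>s. (\<integral>z. f1 (\<omega>, s, z) - f2 (\<omega>, s, z) \<partial>claim_law D) \<partial>Lb)"
      using LF_Fubini[OF elim(3)] by simp
    also have "\<dots> = gain v t A \<omega>"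
      unfolding gain_def
    proof (rule integral_cong_AE)
      show "(\<lambda>s. \<integral>z. f1 (\<omega>, s, z) - f2 (\<omega>, s, z) \<partial>claim_law D) \<in> borel_measurable Lb"
        using borel_measurable_integrable[OF LF_integrable_fst[OF elim(3)]] by simp
      have "(\<lambda>p. aft t (fst p) * (w.Km p * (Gp p - drv p (v p)))) \<in> borel_measurable PS"
        by (intro borel_measurable_times borel_measurable_diff am w.Km_predictable Gp_measurable drv_measurable[OF v])
      from process_section[OF this \<omega>]
      show "(\<lambda>s. ?W \<omega> * aft t s * (Kme v (s, \<omega>) * (Gp (s, \<omega>) - drv (s, \<omega>) (v (s, \<omega>))))) \<in> borel_measurable Lb"
        by (simp add: Kme_def mult.assoc)
      show "AE s in Lb. (\<integral>z. f1 (\<omega>, s, z) - f2 (\<omega>, s, z) \<partial>claim_law D) = ?W \<omega> * aft t s * (Kme v (s, \<omega>) * (Gp (s, \<omega>) - drv (s, \<omega>) (v (s, \<omega>))))"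
        using elim(2) tm left_limit_eq_AE[OF R(2) \<omega>] AE_space
      proof eventually_elim
        case (elim s)
        have p: "(s, \<omega>) \<in> space PS" using elim(4) \<omega> by (simp add: space_PS)
        show ?case
        proof (cases "\<omega> \<in> A \<and> t < s")
          case True
          have BmE: "Bm (s, \<omega>) = R s \<omega> + M s \<omega>"
            using elim(1) True unfolding Bm_def fst_conv snd_conv thc unfolding g_def \<Theta>c_def b_def fst_conv by (simp add: w.Wp_def)
          have Rs: "R s \<omega> = Rm (s, \<omega>)" using elim(3) by (simp add: Rm_def)
          have "f1 (\<omega>, s, z) - f2 (\<omega>, s, z) = w.Km (s, \<omega>) * (Gp (s, \<omega>) + th ((s, \<omega>), z) * lam (s, \<omega>) * (exp (- eff_ell v ((s, \<omega>), z)) - 1)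
              + Rm (s, \<omega>) * (eff_a v (s, \<omega>) + lam (s, \<omega>) * (exp (- eff_ell v ((s, \<omega>), z)) - 1)))" for z
            using True by (simp add: f1_def f2_def BmE Rs w.Wp_def g_def \<Theta>c_def aft_def w.drift_def w.kap_def algebra_simps)
          then show ?thesis using True by (simp add: drift_identity[OF v p elim(2)] Kme_def aft_def)
        next
          case False
          then have "w.Wp (s, \<omega>) = 0" "?W \<omega> * aft t s = 0" by (auto simp: w.Wp_def aft_def)
          then show ?thesis by (simp add: f1_def f2_def)
        qed
      qed
    qed
    finally show ?case .
  qed
  have gainm: "gain v t A \<in> borel_measurable (P0 D)"
  proof -
    have "(\<lambda>p. w.Wp p * (w.Km p * (Gp p - drv p (v p)))) \<in> borel_measurable PS"
      by (intro borel_measurable_times borel_measurable_diff w.Wp_predictable w.Km_predictable Gp_measurable drv_measurable[OF v])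
    from time_integral_measurable[OF this] have "(\<lambda>\<omega>. \<integral>s. w.Wp (s, \<omega>) * (w.Km (s, \<omega>) * (Gp (s, \<omega>) - drv (s, \<omega>) (v (s, \<omega>)))) \<partial>Lb) \<in> borel_measurable (P0 D)" .
    moreover have "w.Wp (s, \<omega>) = ?W \<omega> * aft t s" for s \<omega> by (simp add: w.Wp_def aft_def)
    ultimately show ?thesis unfolding gain_def[abs_def] Kme_def by simp
  qed
  note fm = borel_measurable_integrable[OF NU_integrable_fst[OF f12]]
  show "integrable (P0 D) (gain v t A)"
    using NU_integrable_fst[OF f12] integrable_cong_AE[OF fm gainm inner] by simp
  have "(\<integral>x. f1 x - f2 x \<partial>NU) = (\<integral>\<omega>. gain v t A \<omega> \<partial>P0 D)"
    using NU_Fubini[OF f12] integral_cong_AE[OF fm gainm inner] by simp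
  then show "(\<integral>\<omega>. ?W \<omega> * (Xi \<omega> * KTe v \<omega>) \<partial>P0 D) = (\<integral>\<omega>. ?W \<omega> * R t \<omega> \<partial>P0 D) + (\<integral>\<omega>. gain v t A \<omega> \<partial>P0 D)"
    using e3 by simp
qed

lemma gain_nonneg:
  assumes v: "effort v" shows "AE \<omega> in P0 D. 0 \<le> gain v t A \<omega>"
  using fine_path_AE
proof eventually_elim
  case (elim \<omega>)
  have \<omega>: "\<omega> \<in> \<Omega>" and tm: "AE s in Lb. tame_at (s, \<omega>)" using elim by (auto simp: fine_path_def regular_def)
  show ?case unfolding gain_def
  proof (rule integral_nonneg_AE)
    show "AE s in Lb. 0 \<le> indicator A \<omega> * aft t s * (Kme v (s, \<omega>) * (Gp (s, \<omega>) - drv (s, \<omega>) (v (s, \<omega>))))"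
      using tm AE_space
    proof eventually_elim
      case (elim s)
      have p: "(s, \<omega>) \<in> space PS" using elim(2) \<omega> by (simp add: space_PS)
      then have "drv (s, \<omega>) (v (s, \<omega>)) \<le> Gp (s, \<omega>)" using Gp(2)[OF p elim(1)] v by (simp add: effort_def)
      moreover have "0 < Kme v (s, \<omega>)" unfolding Kme_def by (rule multiplicative.Km_pos[OF effort_multiplicative[OF v]])
      ultimately show ?case by (simp add: aft_def)
    qed
  qed
qed

lemma gain_le:
  assumes v: "effort v" and \<epsilon>: "0 \<le> \<epsilon>" and op: "AE \<omega> in P0 D. AE s in Lb. t < s \<longrightarrow> Gp (s, \<omega>) - \<epsilon> \<le> drv (s, \<omega>) (v (s, \<omega>))"
  shows "AE \<omega> in P0 D. gain v t A \<omega> \<le> \<epsilon> * (TT * (exp (eff_C * TT) * exp (Lam \<omega>)))"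
  using regular_AE op
proof eventually_elim
  case (elim \<omega>)
  interpret m: multiplicative D "eff_a v" "eff_ell v" eff_C by (rule effort_multiplicative[OF v])
  have "gain v t A \<omega> \<le> (\<integral>s. m.bnd \<omega> * \<epsilon> \<partial>Lb)"
    unfolding gain_def
  proof (rule integral_mono_AE')
    show "integrable Lb (\<lambda>s. m.bnd \<omega> * \<epsilon>)" by simp
    have b0: "0 \<le> m.bnd \<omega> * \<epsilon>" using \<epsilon> by (simp add: m.bnd_def)
    then show "AE s in Lb. 0 \<le> m.bnd \<omega> * \<epsilon>" by simp
    show "AE s in Lb. indicator A \<omega> * aft t s * (Kme v (s, \<omega>) * (Gp (s, \<omega>) - drv (s, \<omega>) (v (s, \<omega>)))) \<le> m.bnd \<omega> * \<epsilon>"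
      using elim(2)
    proof eventually_elim
      case (elim s)
      have K: "0 \<le> Kme v (s, \<omega>)" "Kme v (s, \<omega>) \<le> m.bnd \<omega>"
        unfolding Kme_def using m.Km_pos[of "(s, \<omega>)"] m.Km_bound[OF \<open>regular \<omega>\<close>] by auto
      have "Kme v (s, \<omega>) * (Gp (s, \<omega>) - drv (s, \<omega>) (v (s, \<omega>))) \<le> m.bnd \<omega> * \<epsilon>" if "t < s"
      proof -
        have "Kme v (s, \<omega>) * (Gp (s, \<omega>) - drv (s, \<omega>) (v (s, \<omega>))) \<le> Kme v (s, \<omega>) * \<epsilon>"
          using elim that K by (intro mult_left_mono) auto
        also have "\<dots> \<le> m.bnd \<omega> * \<epsilon>" using K \<epsilon> by (intro mult_right_mono)
        finally show ?thesis .
      qed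
      then show ?case using b0 by (auto simp: aft_def split: split_indicator)
    qed
  qed
  also have "\<dots> = \<epsilon> * (TT * (exp (eff_C * TT) * exp (Lam \<omega>)))"
    using emeasure_Lb horizon_pos by (simp add: measure_def m.bnd_def)
  finally show ?case .
qed

text \<open>A predictable selection of efforts that are optimal up to \<open>\<epsilon>\<close>.\<close>

definition sel :: "real \<Rightarrow> real \<times> 'a \<Rightarrow> real \<times> real" where
  "sel \<epsilon> p = qs (LEAST n. Gp p - \<epsilon> \<le> drv p (qs n))"

lemma effort_sel: "effort (sel \<epsilon>)"
proof -
  have "(\<lambda>p. Gp p - \<epsilon> \<le> drv p (qs n)) \<in> measurable PS (count_space UNIV)" for n
  proof -
    have "{p \<in> space PS. Gp p - \<epsilon> \<le> drv p (qs n)} \<in> sets PS"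
      by (intro borel_measurable_le borel_measurable_diff borel_measurable_const Gp_measurable drv_measurable[OF effort_const[OF qs(1)]])
    then show ?thesis by (simp add: pred_def)
  qed
  then have "(\<lambda>p. LEAST n. Gp p - \<epsilon> \<le> drv p (qs n)) \<in> measurable PS (count_space UNIV)" by (rule measurable_Least)
  from measurable_compose[OF this, of qs borel] show ?thesis
    unfolding effort_def sel_def[abs_def] using qs(1) by simp
qed

lemma sel_optimal:
  assumes p: "p \<in> space PS" "tame_at p" and \<epsilon>: "0 < \<epsilon>"
  shows "Gp p - \<epsilon> \<le> drv p (sel \<epsilon> p)"
proof -
  have "ereal (Gp p - \<epsilon>) < (SUP n. ereal (drv p (qs n)))" unfolding Gp(1)[OF p] using \<epsilon> by simp
  then obtain n where "Gp p - \<epsilon> \<le> drv p (qs n)" unfolding less_SUP_iff by (auto intro: less_imp_le)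
  then show ?thesis unfolding sel_def by (rule LeastI)
qed

definition level :: "real \<Rightarrow> nat \<Rightarrow> 'a set" where
  "level t k = {\<omega> \<in> \<Omega>. \<bar>R t \<omega>\<bar> \<le> real k \<and> \<bar>M t \<omega>\<bar> \<le> real k}"

lemma level_sets: "t \<in> {0..TT} \<Longrightarrow> level t k \<in> sets (FF t)"
proof -
  assume t: "t \<in> {0..TT}"
  have "{\<omega> \<in> space (FF t). \<bar>R t \<omega>\<bar> \<le> real k \<and> \<bar>M t \<omega>\<bar> \<le> real k} \<in> sets (FF t)"
    by (intro sets.sets_Collect_conj borel_measurable_le borel_measurable_abs RM_adapted[OF t] borel_measurable_const)
  then show ?thesis by (simp add: level_def)
qed

lemma level_exhausts: "\<omega> \<in> \<Omega> \<Longrightarrow> \<exists>k0. \<forall>k\<ge>k0. \<omega> \<in> level t k"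
proof -
  assume \<omega>: "\<omega> \<in> \<Omega>"
  obtain k0 where "max \<bar>R t \<omega>\<bar> \<bar>M t \<omega>\<bar> \<le> real k0" using real_arch_simple by blast
  then show ?thesis using \<omega> by (intro exI[of _ k0]) (auto simp: level_def intro: order_trans)
qed

definition cost :: "real \<Rightarrow> (real \<Rightarrow> 'a \<Rightarrow> real \<times> real) \<Rightarrow> 'a \<Rightarrow> real" where
  "cost t u = real_cond_exp (Pu D u) (FF t) (\<lambda>\<omega>. exp (- risk_av D * Y D u TT \<omega>))"

lemma null_before:
  assumes u: "u \<in> admissible_null D t" and t: "t \<in> {0..TT}"
  shows "effort (unc u)" "\<And>s. s \<in> {0<..TT} \<Longrightarrow> s \<le> t \<Longrightarrow> AE \<omega> in P0 D. unc u (s, \<omega>) = (0, 0)"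
  using u unc_admissible by (auto simp: admissible_null_def unc_def null_effort_def)

lemma cost_props:
  assumes u: "u \<in> admissible_null D t" and t: "t \<in> {0..TT}"
  shows "cost t u \<in> borel_measurable (FF t)" "integrable (P0 D) (cost t u)"
    and "\<And>A. A \<in> sets (FF t) \<Longrightarrow> (\<integral>\<omega>. indicator A \<omega> * cost t u \<omega> \<partial>P0 D) = (\<integral>\<omega>. indicator A \<omega> * (Xi \<omega> * KTe (cut t (unc u)) \<omega>) \<partial>P0 D)"
proof -
  note nb = null_before[OF u t]
  show "cost t u \<in> borel_measurable (FF t)" "integrable (P0 D) (cost t u)"
    unfolding cost_def by (rule conditional_cost(1)[OF nb(1) t], rule nb(2), assumption+) (rule conditional_cost(2)[OF nb(1) t], rule nb(2), assumption+)
  fix A assume A: "A \<in> sets (FF t)"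
  show "(\<integral>\<omega>. indicator A \<omega> * cost t u \<omega> \<partial>P0 D) = (\<integral>\<omega>. indicator A \<omega> * (Xi \<omega> * KTe (cut t (unc u)) \<omega>) \<partial>P0 D)"
    unfolding cost_def by (rule conditional_cost(3)[OF nb(1) t _ A], rule nb(2), assumption+)
qed

lemma cost_shortfall:
  assumes u: "u \<in> admissible_null D t" and t: "t \<in> {0..TT}"
    and A: "A \<in> sets (FF t)" "A \<subseteq> level t k"
  shows "integrable (P0 D) (\<lambda>\<omega>. indicator A \<omega> * (cost t u \<omega> - R t \<omega>))"
    and "(\<integral>\<omega>. indicator A \<omega> * (cost t u \<omega> - R t \<omega>) \<partial>P0 D) = (\<integral>\<omega>. gain (cut t (unc u)) t A \<omega> \<partial>P0 D)"
proof -
  note nb = null_before[OF u t]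
  note cc = cost_props[OF u t]
  have A0: "A \<in> sets (P0 D)" by (rule subalg_sets[OF t A(1)])
  have k: "\<bar>R t \<omega>\<bar> \<le> real k \<and> \<bar>M t \<omega>\<bar> \<le> real k" if "\<omega> \<in> A" for \<omega> using A(2) that by (auto simp: level_def)
  have RtM: "R t \<in> borel_measurable (P0 D)" by (rule from_F_measurable[OF t RM_adapted(1)[OF t]])
  have WR: "integrable (P0 D) (\<lambda>\<omega>. indicator A \<omega> * R t \<omega>)"
    by (rule integrable_const_bound[where B="real k"]) (use k RtM A0 in \<open>auto split: split_indicator\<close>)
  have WZ: "integrable (P0 D) (\<lambda>\<omega>. indicator A \<omega> * cost t u \<omega>)" using integrable_mult_indicator[OF A0 cc(2)] by simp
  show "integrable (P0 D) (\<lambda>\<omega>. indicator A \<omega> * (cost t u \<omega> - R t \<omega>))"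
    unfolding right_diff_distrib by (rule Bochner_Integration.integrable_diff[OF WZ WR])
  have "(\<integral>\<omega>. indicator A \<omega> * (cost t u \<omega> - R t \<omega>) \<partial>P0 D) = (\<integral>\<omega>. indicator A \<omega> * cost t u \<omega> \<partial>P0 D) - (\<integral>\<omega>. indicator A \<omega> * R t \<omega> \<partial>P0 D)"
    unfolding right_diff_distrib by (rule Bochner_Integration.integral_diff[OF WZ WR])
  then show "(\<integral>\<omega>. indicator A \<omega> * (cost t u \<omega> - R t \<omega>) \<partial>P0 D) = (\<integral>\<omega>. gain (cut t (unc u)) t A \<omega> \<partial>P0 D)"
  proof -
    have "(\<integral>\<omega>. indicator A \<omega> * (Xi \<omega> * KTe (cut t (unc u)) \<omega>) \<partial>P0 D) =
        (\<integral>\<omega>. indicator A \<omega> * R t \<omega> \<partial>P0 D) + (\<integral>\<omega>. gain (cut t (unc u)) t A \<omega> \<partial>P0 D)"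
      by (rule verification(2)[OF effort_cut[OF nb(1)] t _ A(1), where k="real k"]) (simp_all add: cut_def k)
    then show ?thesis using \<open>(\<integral>\<omega>. indicator A \<omega> * (cost t u \<omega> - R t \<omega>) \<partial>P0 D) = (\<integral>\<omega>. indicator A \<omega> * cost t u \<omega> \<partial>P0 D) - (\<integral>\<omega>. indicator A \<omega> * R t \<omega> \<partial>P0 D)\<close> cc(3)[OF A(1)] by simp
  qed
qed

text \<open>Testing on the event where the inequality fails, localized to make \<open>R\<^sub>t\<close> and \<open>M\<^sub>t\<close> bounded.\<close>

lemma R_le_cost:
  assumes u: "u \<in> admissible_null D t" and t: "t \<in> {0..TT}"
  shows "AE \<omega> in P0 D. R t \<omega> \<le> cost t u \<omega>"
proof -
  note nb = null_before[OF u t]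
  note cc = cost_props[OF u t]
  have on_level: "AE \<omega> in P0 D. \<omega> \<in> level t k \<longrightarrow> R t \<omega> \<le> cost t u \<omega>" for k
  proof -
    define A where "A = level t k \<inter> {\<omega> \<in> \<Omega>. cost t u \<omega> < R t \<omega>}"
    have "{\<omega> \<in> space (FF t). cost t u \<omega> < R t \<omega>} \<in> sets (FF t)"
      by (intro borel_measurable_less cc(1) RM_adapted(1)[OF t])
    then have A: "A \<in> sets (FF t)" "A \<subseteq> level t k" unfolding A_def using level_sets[OF t] by auto
    let ?f = "\<lambda>\<omega>. indicator A \<omega> * (R t \<omega> - cost t u \<omega>)"
    have eq: "?f = (\<lambda>\<omega>. - (indicator A \<omega> * (cost t u \<omega> - R t \<omega>)))" by (auto simp: fun_eq_iff algebra_simps)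
    have i: "integrable (P0 D) ?f" unfolding eq using cost_shortfall(1)[OF u t A] by simp
    have "0 \<le> (\<integral>\<omega>. gain (cut t (unc u)) t A \<omega> \<partial>P0 D)" by (rule integral_nonneg_AE[OF gain_nonneg[OF effort_cut[OF nb(1)]]])
    then have "(\<integral>\<omega>. ?f \<omega> \<partial>P0 D) \<le> 0" unfolding eq using cost_shortfall(2)[OF u t A] by simp
    moreover have nn: "AE \<omega> in P0 D. 0 \<le> ?f \<omega>" by (auto simp: A_def split: split_indicator)
    ultimately have "(\<integral>\<omega>. ?f \<omega> \<partial>P0 D) = 0" using integral_nonneg_AE[OF nn] by linarith
    then have "AE \<omega> in P0 D. ?f \<omega> = 0" using integral_nonneg_eq_0_iff_AE[OF i nn] by simp
    then show ?thesis using AE_space by eventually_elim (auto simp: A_def split: split_indicator_asm)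
  qed
  have "AE \<omega> in P0 D. \<forall>k. \<omega> \<in> level t k \<longrightarrow> R t \<omega> \<le> cost t u \<omega>" unfolding AE_all_countable by (intro allI on_level)
  then show ?thesis using AE_space by eventually_elim (use level_exhausts in blast)
qed

text \<open>A lower bound \<open>h\<close> need not be known at time \<open>t\<close>, so it cannot be used to define a test event. Instead
  the costs of efforts that are optimal up to \<open>1/(n+1)\<close> are shown to converge to \<open>R\<^sub>t\<close> in mean on each level set;
  hence their pointwise infimum is \<open>R\<^sub>t\<close>.\<close>

lemma R_is_ess_Inf:
  assumes t: "t \<in> {0..TT}"
  shows "is_ess_Inf (P0 D) ((\<lambda>u \<omega>. ereal (cost t u \<omega>)) ` admissible_null D t) (\<lambda>\<omega>. ereal (R t \<omega>))"
  unfolding is_ess_Inf_def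
proof (intro conjI ballI impI)
  have RtM: "R t \<in> borel_measurable (P0 D)" by (rule from_F_measurable[OF t RM_adapted(1)[OF t]])
  then show "(\<lambda>\<omega>. ereal (R t \<omega>)) \<in> borel_measurable (P0 D)" by simp
  show "AE \<omega> in P0 D. ereal (R t \<omega>) \<le> X \<omega>" if "X \<in> (\<lambda>u \<omega>. ereal (cost t u \<omega>)) ` admissible_null D t" for X
    using that R_le_cost[OF _ t] by auto
  fix h :: "'a \<Rightarrow> ereal" assume h: "\<forall>X\<in>(\<lambda>u \<omega>. ereal (cost t u \<omega>)) ` admissible_null D t. AE \<omega> in P0 D. h \<omega> \<le> X \<omega>"
  define e where "e n = inverse (real (Suc n))" for n
  define u where "u n s \<omega> = cut t (sel (e n)) (s, \<omega>)" for n s \<omega>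
  have un: "unc (u n) = cut t (sel (e n))" for n by (simp add: unc_def u_def fun_eq_iff)
  have cs: "effort (cut t (sel (e n)))" for n by (rule effort_cut[OF effort_sel])
  have ua: "u n \<in> admissible_null D t" for n
    using effort_admissible[OF cs[of n]] unfolding admissible_null_def u_def[abs_def] by (auto simp: cut_def null_effort_def)
  have e0: "0 < e n" for n by (simp add: e_def)
  define CC where "CC = (\<integral>\<omega>. TT * (exp (eff_C * TT) * exp (Lam \<omega>)) \<partial>P0 D)"
  have iE: "integrable (P0 D) (\<lambda>\<omega>. TT * (exp (eff_C * TT) * exp (Lam \<omega>)))"
    using product_moment[of "\<lambda>_. 1"] by simp
  define f where "f \<omega> = (INF n. ennreal (cost t (u n) \<omega> - R t \<omega>))" for \<omega>
  have on_level: "AE \<omega> in P0 D. \<omega> \<in> level t k \<longrightarrow> f \<omega> = 0" for k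
  proof -
    let ?A = "level t k"
    have le: "(\<integral>\<^sup>+\<omega>. indicator ?A \<omega> * f \<omega> \<partial>P0 D) \<le> ennreal (e n * CC)" for n
    proof -
      have nn: "AE \<omega> in P0 D. 0 \<le> indicator ?A \<omega> * (cost t (u n) \<omega> - R t \<omega>)"
        using R_le_cost[OF ua t] by eventually_elim (auto split: split_indicator)
      have "(\<integral>\<^sup>+\<omega>. indicator ?A \<omega> * f \<omega> \<partial>P0 D) \<le> (\<integral>\<^sup>+\<omega>. ennreal (indicator ?A \<omega> * (cost t (u n) \<omega> - R t \<omega>)) \<partial>P0 D)"
        by (rule nn_integral_mono) (auto simp: f_def intro: INF_lower split: split_indicator)
      also have "\<dots> = ennreal (\<integral>\<omega>. indicator ?A \<omega> * (cost t (u n) \<omega> - R t \<omega>) \<partial>P0 D)"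
        by (rule nn_integral_eq_integral[OF cost_shortfall(1)[OF ua t level_sets[OF t] order_refl] nn])
      also have "\<dots> \<le> ennreal (e n * CC)"
      proof (rule ennreal_leI)
        have "AE \<omega> in P0 D. AE s in Lb. t < s \<longrightarrow> Gp (s, \<omega>) - e n \<le> drv (s, \<omega>) (cut t (sel (e n)) (s, \<omega>))"
          using fine_path_AE
        proof eventually_elim
          case (elim \<omega>)
          have \<omega>: "\<omega> \<in> \<Omega>" and tm: "AE s in Lb. tame_at (s, \<omega>)" using elim by (auto simp: fine_path_def regular_def)
          from tm AE_space show ?case
            by eventually_elim (use sel_optimal[OF _ _ e0] \<omega> in \<open>auto simp: space_PS cut_def\<close>)
        qed
        note gl = gain_le[OF cs[of n] less_imp_le[OF e0[of n]] this, of ?A]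
        have "(\<integral>\<omega>. gain (cut t (sel (e n))) t ?A \<omega> \<partial>P0 D) \<le> (\<integral>\<omega>. e n * (TT * (exp (eff_C * TT) * exp (Lam \<omega>))) \<partial>P0 D)"
          by (rule integral_mono_AE'[OF _ gl]) (use iE e0[of n] horizon_pos in \<open>auto intro!: mult_nonneg_nonneg less_imp_le\<close>)
        moreover have "cut t (cut t (sel (e n))) = cut t (sel (e n))" by (simp add: cut_def fun_eq_iff)
        ultimately show "(\<integral>\<omega>. indicator ?A \<omega> * (cost t (u n) \<omega> - R t \<omega>) \<partial>P0 D) \<le> e n * CC"
          unfolding cost_shortfall(2)[OF ua t level_sets[OF t] order_refl] un by (simp add: CC_def)
      qed
      finally show ?thesis .
    qed
    have "(\<lambda>n. e n * CC) \<longlonglongrightarrow> 0" unfolding e_def by (rule tendsto_mult_left_zero[OF LIMSEQ_inverse_real_of_nat])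
    then have "(\<lambda>n. ennreal (e n * CC)) \<longlonglongrightarrow> ennreal 0" by (rule tendsto_ennrealI)
    then have "(\<integral>\<^sup>+\<omega>. indicator ?A \<omega> * f \<omega> \<partial>P0 D) \<le> ennreal 0" by (rule LIMSEQ_le_const) (use le in blast)
    then have z: "(\<integral>\<^sup>+\<omega>. indicator ?A \<omega> * f \<omega> \<partial>P0 D) = 0" by simp
    have A0: "?A \<in> sets (P0 D)" by (rule subalg_sets[OF t level_sets[OF t]])
    have cm: "cost t (u n) \<in> borel_measurable (P0 D)" for n
      unfolding cost_def by (rule from_F_measurable[OF t borel_measurable_cond_exp])
    have "f \<in> borel_measurable (P0 D)" unfolding f_def[abs_def]
      by (intro borel_measurable_INF measurable_compose[OF _ measurable_ennreal] borel_measurable_diff cm RtM) simp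
    then have "(\<lambda>\<omega>. indicator ?A \<omega> * f \<omega>) \<in> borel_measurable (P0 D)" using A0 by simp
    from nn_integral_0_iff_AE[OF this] z have "AE \<omega> in P0 D. indicator ?A \<omega> * f \<omega> = 0" by simp
    then show ?thesis by eventually_elim (auto split: split_indicator_asm)
  qed
  have fz: "AE \<omega> in P0 D. \<forall>k. \<omega> \<in> level t k \<longrightarrow> f \<omega> = 0" unfolding AE_all_countable by (intro allI on_level)
  have "AE \<omega> in P0 D. h \<omega> \<le> ereal (cost t (u n) \<omega>)" for n
    using bspec[OF h imageI[OF ua[of n]]] by simp
  then have "AE \<omega> in P0 D. \<forall>n. h \<omega> \<le> ereal (cost t (u n) \<omega>)" by (simp add: AE_all_countable)
  then show "AE \<omega> in P0 D. h \<omega> \<le> ereal (R t \<omega>)"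
    using fz AE_space
  proof eventually_elim
    case (elim \<omega>)
    have f0: "f \<omega> = 0" using elim(2) level_exhausts[OF elim(3)] by blast
    show ?case
    proof (rule ereal_le_epsilon2; (intro allI impI)?)
      fix d :: real assume d: "0 < d"
      have "(INF n. ennreal (cost t (u n) \<omega> - R t \<omega>)) < ennreal d" using f0 d unfolding f_def by simp
      then obtain n where "ennreal (cost t (u n) \<omega> - R t \<omega>) < ennreal d" unfolding INF_less_iff by blast
      then have "cost t (u n) \<omega> - R t \<omega> < d" using d by (metis ennreal_leI not_le)
      then have "ereal (cost t (u n) \<omega>) \<le> ereal (R t \<omega>) + ereal d" by simp
      then show "h \<omega> \<le> ereal (R t \<omega>) + ereal d" using elim(1) order_trans by blast
    qed
  qed
qed

lemma R_eq_snell: "t \<in> {0..TT} \<Longrightarrow> AE \<omega> in P0 D. ereal (R t \<omega>) = snell_null D t \<omega>"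
proof -
  assume t: "t \<in> {0..TT}"
  let ?S = "(\<lambda>u \<omega>. ereal (cost t u \<omega>)) ` admissible_null D t"
  have "is_ess_Inf (P0 D) ?S (ess_Inf (P0 D) ?S)" unfolding ess_Inf_def by (rule someI[of "is_ess_Inf (P0 D) ?S", OF R_is_ess_Inf[OF t]])
  from is_ess_Inf_unique[OF R_is_ess_Inf[OF t] this] show ?thesis unfolding snell_null_def cost_def .
qed

text \<open>At time \<open>0\<close> conditioning is not needed: the expected costs are limits of the expected costs on the
  level sets of \<open>R\<^sub>0\<close> and \<open>M\<^sub>0\<close>.\<close>

lemma maximizer_optimal:
  assumes u: "u \<in> admissible D"
    and mx: "\<And>s. s \<in> {0..TT} \<Longrightarrow> AE \<omega> in P0 D. ereal (driver_along D R \<Theta> u s \<omega>) = driver_ess_Sup D R \<Theta> s \<omega>"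
  shows "optimal_effort D u"
proof -
  have t: "0 \<in> {0..TT}" using horizon_pos by simp
  have v: "effort (unc u)" by (rule unc_admissible[OF u])
  have "AE s in Lb. AE \<omega> in P0 D. drv (s, \<omega>) (unc u (s, \<omega>)) = Gp (s, \<omega>)"
    using driver_ess_Sup_eq AE_space
  proof eventually_elim
    case (elim s)
    have "s \<in> {0..TT}" using elim(2) by simp
    from elim(1) mx[OF this] show ?case by eventually_elim (simp add: driver_along_eq unc_def)
  qed
  moreover have "{x \<in> space (Lb \<Otimes>\<^sub>M P0 D). drv x (unc u x) = Gp x} \<in> sets (Lb \<Otimes>\<^sub>M P0 D)"
    by (rule borel_measurable_eq[OF measurable_compose[OF PS_joint drv_measurable[OF v]] measurable_compose[OF PS_joint Gp_measurable]])
  ultimately have mx': "AE \<omega> in P0 D. AE s in Lb. drv (s, \<omega>) (unc u (s, \<omega>)) = Gp (s, \<omega>)"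
    using pair_sigma_finite.AE_commute[OF pairs_sigma_finite(4), of "\<lambda>s \<omega>. drv (s, \<omega>) (unc u (s, \<omega>)) = Gp (s, \<omega>)"] by simp
  have op: "AE \<omega> in P0 D. AE s in Lb. 0 < s \<longrightarrow> Gp (s, \<omega>) - 0 \<le> drv (s, \<omega>) (cut 0 (unc u) (s, \<omega>))"
    using mx'
  proof eventually_elim
    case (elim \<omega>)
    then show ?case by eventually_elim (simp add: cut_def)
  qed
  have cut0: "AE \<omega> in P0 D. KTe (cut 0 w) \<omega> = KTe w \<omega>" if "effort w" for w
  proof -
    have "AE \<omega> in P0 D. KTe (cut 0 w) \<omega> = KTe w \<omega> \<and> LTe (cut 0 w) \<omega> = LTe w \<omega>" by (rule mult_exp_cut[OF that]) auto
    then show ?thesis by eventually_elim simp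
  qed
  have Xm: "Xi \<in> borel_measurable (P0 D)" by (rule from_F_measurable[OF TT_in Xi_measurable])
  have lev: "(\<integral>\<omega>. indicator (level 0 k) \<omega> * (Xi \<omega> * KTe w \<omega>) \<partial>P0 D) =
      (\<integral>\<omega>. indicator (level 0 k) \<omega> * R 0 \<omega> \<partial>P0 D) + (\<integral>\<omega>. gain (cut 0 w) 0 (level 0 k) \<omega> \<partial>P0 D)" if w: "effort w" for w k
  proof -
    have "(\<integral>\<omega>. indicator (level 0 k) \<omega> * (Xi \<omega> * KTe w \<omega>) \<partial>P0 D) = (\<integral>\<omega>. indicator (level 0 k) \<omega> * (Xi \<omega> * KTe (cut 0 w) \<omega>) \<partial>P0 D)"
    proof (rule integral_cong_AE)
      have A0: "level 0 k \<in> sets (P0 D)" by (rule subalg_sets[OF t level_sets[OF t]])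
      show "(\<lambda>\<omega>. indicator (level 0 k) \<omega> * (Xi \<omega> * KTe w \<omega>)) \<in> borel_measurable (P0 D)"
        "(\<lambda>\<omega>. indicator (level 0 k) \<omega> * (Xi \<omega> * KTe (cut 0 w) \<omega>)) \<in> borel_measurable (P0 D)"
        using A0 Xm KTe_props(2)[OF w] KTe_props(2)[OF effort_cut[OF w]] by simp_all
      show "AE \<omega> in P0 D. indicator (level 0 k) \<omega> * (Xi \<omega> * KTe w \<omega>) = indicator (level 0 k) \<omega> * (Xi \<omega> * KTe (cut 0 w) \<omega>)"
        using cut0[OF w] by eventually_elim simp
    qed
    also have "\<dots> = (\<integral>\<omega>. indicator (level 0 k) \<omega> * R 0 \<omega> \<partial>P0 D) + (\<integral>\<omega>. gain (cut 0 w) 0 (level 0 k) \<omega> \<partial>P0 D)"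
      by (rule verification(2)[OF effort_cut[OF w] t _ level_sets[OF t], where k="real k"]) (auto simp: cut_def level_def)
    finally show ?thesis .
  qed
  have lim: "(\<lambda>k. \<integral>\<omega>. indicator (level 0 k) \<omega> * (Xi \<omega> * KTe w \<omega>) \<partial>P0 D) \<longlonglongrightarrow> (\<integral>\<omega>. Xi \<omega> * KTe w \<omega> \<partial>P0 D)" if w: "effort w" for w
  proof (rule integral_dominated_convergence[where w="\<lambda>\<omega>. Xi \<omega> * KTe w \<omega>"])
    have A0: "level 0 k \<in> sets (P0 D)" for k by (rule subalg_sets[OF t level_sets[OF t]])
    show "(\<lambda>\<omega>. Xi \<omega> * KTe w \<omega>) \<in> borel_measurable (P0 D)" using Xm KTe_props(2)[OF w] by simp
    then show "(\<lambda>\<omega>. indicator (level 0 k) \<omega> * (Xi \<omega> * KTe w \<omega>)) \<in> borel_measurable (P0 D)" for k using A0[of k] by simp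
    show "integrable (P0 D) (\<lambda>\<omega>. Xi \<omega> * KTe w \<omega>)" by (rule KTe_props(3)[OF w])
    show "AE \<omega> in P0 D. (\<lambda>k. indicator (level 0 k) \<omega> * (Xi \<omega> * KTe w \<omega>)) \<longlonglongrightarrow> Xi \<omega> * KTe w \<omega>"
    proof (rule AE_I2)
      fix \<omega> assume "\<omega> \<in> \<Omega>"
      from level_exhausts[OF this, of 0] obtain k0 where "\<forall>k\<ge>k0. \<omega> \<in> level 0 k" by blast
      then have "eventually (\<lambda>k. indicator (level 0 k) \<omega> * (Xi \<omega> * KTe w \<omega>) = Xi \<omega> * KTe w \<omega>) sequentially"
        unfolding eventually_sequentially by (intro exI[of _ k0]) simp
      then show "(\<lambda>k. indicator (level 0 k) \<omega> * (Xi \<omega> * KTe w \<omega>)) \<longlonglongrightarrow> Xi \<omega> * KTe w \<omega>" by (rule tendsto_eventually)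
    qed
    show "AE \<omega> in P0 D. norm (indicator (level 0 k) \<omega> * (Xi \<omega> * KTe w \<omega>)) \<le> Xi \<omega> * KTe w \<omega>" for k
      using Xi_pos KTe_props(1)[OF w] by (intro AE_I2) (simp add: abs_mult less_imp_le split: split_indicator)
  qed
  have best: "(\<integral>\<omega>. Xi \<omega> * KTe (unc u) \<omega> \<partial>P0 D) \<le> (\<integral>\<omega>. Xi \<omega> * KTe w \<omega> \<partial>P0 D)" if w: "effort w" for w
  proof (rule LIMSEQ_le[OF lim[OF v] lim[OF w]], intro exI allI impI)
    fix k
    have "AE \<omega> in P0 D. gain (cut 0 (unc u)) 0 (level 0 k) \<omega> = 0"
      using gain_le[OF effort_cut[OF v] order_refl op, where A="level 0 k"] gain_nonneg[OF effort_cut[OF v, of 0], where A="level 0 k" and t=0]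
      by eventually_elim simp
    then have "(\<integral>\<omega>. gain (cut 0 (unc u)) 0 (level 0 k) \<omega> \<partial>P0 D) = 0" by (rule integral_eq_zero_AE)
    moreover have "0 \<le> (\<integral>\<omega>. gain (cut 0 w) 0 (level 0 k) \<omega> \<partial>P0 D)"
      by (rule integral_nonneg_AE[OF gain_nonneg[OF effort_cut[OF w]]])
    ultimately show "(\<integral>\<omega>. indicator (level 0 k) \<omega> * (Xi \<omega> * KTe (unc u) \<omega>) \<partial>P0 D) \<le> (\<integral>\<omega>. indicator (level 0 k) \<omega> * (Xi \<omega> * KTe w \<omega>) \<partial>P0 D)"
      unfolding lev[OF v] lev[OF w] by simp
  qed
  have "objective D u \<le> objective D w" if "w \<in> admissible D" for w
    unfolding objective_eq[OF v] objective_eq[OF unc_admissible[OF that]]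
    by (rule mult_left_mono[OF best[OF unc_admissible[OF that]]]) simp
  then have "(INF w\<in>admissible D. objective D w) = objective D u"
    using u by (intro cInf_eq_minimum) auto
  then show ?thesis using u by (simp add: optimal_effort_def)
qed

end

theorem theorem3p5:
  fixes D :: "'a loss_data"
    and R M :: "real \<Rightarrow> 'a \<Rightarrow> real"
    and \<Theta> :: "real \<Rightarrow> real \<Rightarrow> 'a \<Rightarrow> real"
  assumes "loss_model D"
    and "integrable (P0 D)
           (\<lambda>\<omega>. exp (2 * risk_av D * exp (rate D * horizon D) * loss D (horizon D) \<omega>))"
    and "integrable (P0 D) (\<lambda>\<omega>. exp (4 * (LINT s:{0..horizon D}|lborel. intensity D s \<omega>)))"
    and "(\<integral>\<^sup>+\<omega>. (\<integral>\<^sup>+t\<in>{0..horizon D}. ennreal ((intensity D t \<omega>)\<^sup>2) \<partial>lborel) \<partial>P0 D) < \<infinity>"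
    and "bsde_solution D R \<Theta> M"
  shows "(\<forall>t\<in>{0..horizon D}. AE \<omega> in P0 D. ereal (R t \<omega>) = snell_null D t \<omega>) \<and>
    (\<forall>u\<in>admissible D.
       (\<forall>t\<in>{0..horizon D}. AE \<omega> in P0 D.
          ereal (driver_along D R \<Theta> u t \<omega>) = driver_ess_Sup D R \<Theta> t \<omega>) \<longrightarrow>
       optimal_effort D u)"
proof -
  interpret loss_model D by (rule assms(1))
  interpret bsde_model D R M \<Theta> by unfold_locales (rule assms(2) assms(3) assms(4) assms(5))+
  show ?thesis using R_eq_snell maximizer_optimal by blast
qed

end
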